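(* Let $z\in\mathbb{C}\setminus\mathbb{R}$ and $z'=\bar z$, and let $\mathscr{P}_{z,z'}$ be the determinantal point process on $\mathbb{R}^*$ with the Whittaker kernel $\mathcal{K}_{z,z'}$. Let $n,k$ be two non-negative integers with $n\neq k$. Then for Lebesgue-almost every $\mathfrak{p}=(p_1^+,\dots,p_n^+;p_1^-,\dots,p_k^-)\in\mathbb{R}_+^n\times\mathbb{R}_-^k$ of distinct points, the reduced Palm measure $\mathscr{P}_{z,z'}^{\mathfrak{p}}$ and the measure $\mathscr{P}_{z,z'}$ are mutually singular.
   Context: $\mathbb{R}^*=\mathbb{R}\setminus\{0\}=\mathbb{R}_+\sqcup\mathbb{R}_-$ (open positive and negative semi-axes). $\mathrm{Conf}(\mathbb{R}^* )$ is the set of subsets $X\subset\mathbb{R}^*$ with $\#(X\cap B)<\infty$ for every compact $B\subset\mathbb{R}^*$, with the Borel structure generated by the maps $X\mapsto\#(X\cap B)$, $B$ relatively compact Borel. A point process is a Borel probability measure on $\mathrm{Conf}(\mathbb{R}^* )$. It is determinantal with correlation kernel $K$ if for all $k\ge1$ its $k$-th correlation measure is $\rho_k(dx_1\cdots dx_k)=\det(K(x_i,x_j))_{1\le i,j\le k}\,dx_1\cdots dx_k$, where $\rho_k$ is characterized by $\mathbb{E}\prod_{i=1}^k\#(X\cap D_i)=\rho_k(D_1\times\cdots\times D_k)$ for disjoint relatively compact Borel $D_i$. Reduced Palm measures. For a point process $\mathbb{P}$ with correlation measures $\rho_k$, the reduced Palm measures $\mathbb{P}^{\mathfrak{q}}$,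 defined for $\rho_k$-almost every $k$-tuple $\mathfrak{q}=(q_1,\dots,q_k)$ of distinct points, are point processes determined by $$\int\sum^{*}_{q_1,\dots,q_k\in X}u(X;\mathfrak{q})\,\mathbb{P}(dX)=\int\rho_k(d\mathfrak{q})\int u(X\cup\{q_1,\dots,q_k\};\mathfrak{q})\,\mathbb{P}^{\mathfrak{q}}(dX)$$ for all non-negative Borel $u$, where $\sum^*$ is over $k$-tuples of distinct points of $X$. Whittaker kernels. Let $z,z'\in\mathbb{C}$ satisfy either $z'=\bar z$, $z\in\mathbb{C}\setminus\mathbb{Z}$; or $z,z'\in\mathbb{R}$ and $m<z,z'<m+1$ for some $m\in\mathbb{Z}$. For $x>0$ set $$\mathcal{P}_\pm(x)=\frac{(zz')^{1/4}}{(\Gamma(1\pm z)\Gamma(1\pm z')x)^{1/2}}W_{\frac{\pm(z+z')+1}{2},\frac{z-z'}{2}}(x),\quad \mathcal{Q}_\pm(x)=\frac{(zz')^{3/4}}{(\Gamma(1\pm z)\Gamma(1\pm z')x)^{1/2}}W_{\frac{\pm(z+z')-1}{2},\frac{z-z'}{2}}(x),$$ where $\Gamma$ is the Euler Gamma function and $W_{a,b}$ the Whittaker function. The Whittaker kernel $\mathcal{K}_{z,z'}(x,y)$ is $\frac{\mathcal{P}_+(x)\mathcal{Q}_+(y)-\mathcal{Q}_+(x)\mathcal{P}_+(y)}{x-y}$ for $x,y>0$; $\frac{\mathcal{P}_+(x)\mathcal{P}_-(-y)+\mathcal{Q}_+(x)\mathcal{Q}_-(-y)}{x-y}$ for $x>0,y<0$;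 $\frac{\mathcal{P}_-(-x)\mathcal{P}_+(y)+\mathcal{Q}_-(-x)\mathcal{Q}_+(y)}{x-y}$ for $x<0,y>0$; $\frac{\mathcal{P}_-(-x)\mathcal{Q}_-(-y)-\mathcal{Q}_-(-x)\mathcal{P}_-(-y)}{y-x}$ for $x,y<0$ (extended by continuity to the diagonal). By Borodin and Olshanski, it is the correlation kernel of a determinantal point process on $\mathbb{R}^*$, denoted $\mathscr{P}_{z,z'}$. *)

theory Defs
  imports "HOL-Probability.Probability" "Jordan_Normal_Form.Determinant"
begin

abbreviation Rstar :: "real set" where
  "Rstar \<equiv> - {0}"

definition Conf :: "real set set" where
  "Conf = {X. X \<subseteq> Rstar \<and> (\<forall>B. compact B \<and> B \<subseteq> Rstar \<longrightarrow> finite (X \<inter> B))}"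

text \<open>Relative compactness is meant in the punctured line, so the sets stay away from 0.\<close>

definition relcompact_borel :: "real set set" where
  "relcompact_borel = {B \<in> sets borel. compact (closure B) \<and> closure B \<subseteq> Rstar}"

definition conf_algebra :: "real set measure" where
  "conf_algebra = sigma Conf
     {(\<lambda>X. card (X \<inter> B)) -` {j} \<inter> Conf | B j. B \<in> relcompact_borel}"

definition point_process :: "real set measure \<Rightarrow> bool" where
  "point_process P \<longleftrightarrow> prob_space P \<and> sets P = sets conf_algebra"

text \<open>An \<open>m\<close>-tuple of points is an extensional function on \<open>{..<m}\<close>.\<close>

abbreviation tuples :: "nat \<Rightarrow> (nat \<Rightarrow> real) measure" where
  "tuples m \<equiv> Pi\<^sub>M {..<m} (\<lambda>_. restrict_space borel Rstar)"

abbreviation lebesgue_tuples :: "nat \<Rightarrow> (nat \<Rightarrow> real) measure" where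
  "lebesgue_tuples m \<equiv> Pi\<^sub>M {..<m} (\<lambda>_. restrict_space lborel Rstar)"

text \<open>
  Products of disjoint sets determine a measure only off the diagonals. Correlation measures
  count tuples of distinct points, so they do not charge the diagonals; this is the
  last clause.
\<close>

definition correlation_measure ::
    "real set measure \<Rightarrow> nat \<Rightarrow> (nat \<Rightarrow> real) measure \<Rightarrow> bool" where
  "correlation_measure P m \<rho> \<longleftrightarrow>
     sets \<rho> = sets (tuples m) \<and>
     (\<forall>D. (\<forall>i<m. D i \<in> relcompact_borel) \<and> disjoint_family_on D {..<m} \<longrightarrow>
        (\<integral>\<^sup>+X. (\<Prod>i<m. of_nat (card (X \<inter> D i))) \<partial>P) = emeasure \<rho> (Pi\<^sub>E {..<m} D)) \<and>
     (AE q in \<rho>. inj_on q {..<m})"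

definition kernel_det :: "(real \<Rightarrow> real \<Rightarrow> complex) \<Rightarrow> nat \<Rightarrow> (nat \<Rightarrow> real) \<Rightarrow> complex" where
  "kernel_det K m x = Determinant.det (Matrix.mat m m (\<lambda>(i, j). K (x i) (x j)))"

definition determinantal ::
    "real set measure \<Rightarrow> (real \<Rightarrow> real \<Rightarrow> complex) \<Rightarrow> bool" where
  "determinantal P K \<longleftrightarrow> point_process P \<and>
     (\<forall>m\<ge>1. (AE x in lebesgue_tuples m. kernel_det K m x \<in> \<real>\<^sub>\<ge>\<^sub>0) \<and>
        correlation_measure P m
          (density (lebesgue_tuples m) (\<lambda>x. ennreal (Re (kernel_det K m x)))))"

text \<open>
  The family of reduced Palm measures is only defined almost everywhere: \<open>Q\<close> agrees
  with a probability kernel off a null set and is arbitrary on that null set.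
  The inner integral on the left is the sum over \<open>m\<close>-tuples of distinct points of \<open>X\<close>.
\<close>

definition reduced_palm ::
    "real set measure \<Rightarrow> nat \<Rightarrow> ((nat \<Rightarrow> real) \<Rightarrow> real set measure) \<Rightarrow> bool" where
  "reduced_palm P m Q \<longleftrightarrow>
     (\<exists>\<rho>. correlation_measure P m \<rho> \<and>
        (\<exists>Q' \<in> tuples m \<rightarrow>\<^sub>M prob_algebra conf_algebra. AE q in \<rho>. Q q = Q' q) \<and>
        (\<forall>u \<in> borel_measurable (conf_algebra \<Otimes>\<^sub>M tuples m).
           (\<integral>\<^sup>+X. (\<integral>\<^sup>+q. u (X, q) \<partial>count_space {q \<in> {..<m} \<rightarrow>\<^sub>E X. inj_on q {..<m}}) \<partial>P) =
           (\<integral>\<^sup>+q. (\<integral>\<^sup>+X. (u (X \<union> q ` {..<m}, q) :: ennreal) \<partial>Q q) \<partial>\<rho>)))"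

definition mutually_singular :: "'a measure \<Rightarrow> 'a measure \<Rightarrow> bool" where
  "mutually_singular M N \<longleftrightarrow> sets M = sets N \<and>
     (\<exists>A \<in> sets M. emeasure M A = 0 \<and> emeasure N (space N - A) = 0)"

text \<open>Whittaker's functions on the positive half-line (DLMF 13.14.2 and 13.14.33).\<close>

definition whittaker_M :: "complex \<Rightarrow> complex \<Rightarrow> real \<Rightarrow> complex" where
  "whittaker_M a b x = exp (- of_real x / 2) * of_real x powr (b + 1/2) *
     eval_fps (fps_hypergeo [1/2 + b - a] [1 + 2 * b] 1) (of_real x)"

definition whittaker_W_generic :: "complex \<Rightarrow> complex \<Rightarrow> real \<Rightarrow> complex" where
  "whittaker_W_generic a b x =
     Gamma (- 2 * b) * rGamma (1/2 - b - a) * whittaker_M a b x +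
     Gamma (2 * b) * rGamma (1/2 + b - a) * whittaker_M a (- b) x"

text \<open>The connection formula breaks down for integral \<open>2b\<close>, where one takes the limit in \<open>b\<close>.\<close>

definition whittaker_W :: "complex \<Rightarrow> complex \<Rightarrow> real \<Rightarrow> complex" where
  "whittaker_W a b x =
     (if 2 * b \<in> \<int> then Lim (at b) (\<lambda>c. whittaker_W_generic a c x)
      else whittaker_W_generic a b x)"

text \<open>
  The sign in \<open>\<P>\<^sub>\<plusminus>\<close> and \<open>\<Q>\<^sub>\<plusminus>\<close> is the argument \<open>s\<close>, equal to 1 or -1. For admissible
  parameters the bases of the fractional powers are positive reals, so the principal branches
  are the positive roots.
\<close>

definition whittaker_P :: "complex \<Rightarrow> complex \<Rightarrow> complex \<Rightarrow> real \<Rightarrow> complex" where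
  "whittaker_P s z z' x =
     (z * z') powr (1/4) / (Gamma (1 + s * z) * Gamma (1 + s * z') * of_real x) powr (1/2) *
     whittaker_W ((s * (z + z') + 1) / 2) ((z - z') / 2) x"

definition whittaker_Q :: "complex \<Rightarrow> complex \<Rightarrow> complex \<Rightarrow> real \<Rightarrow> complex" where
  "whittaker_Q s z z' x =
     (z * z') powr (3/4) / (Gamma (1 + s * z) * Gamma (1 + s * z') * of_real x) powr (1/2) *
     whittaker_W ((s * (z + z') - 1) / 2) ((z - z') / 2) x"

definition whittaker_kernel_offdiag ::
    "complex \<Rightarrow> complex \<Rightarrow> real \<Rightarrow> real \<Rightarrow> complex" where
  "whittaker_kernel_offdiag z z' x y =
     (let Pp = whittaker_P 1 z z'; Pm = whittaker_P (-1) z z';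
          Qp = whittaker_Q 1 z z'; Qm = whittaker_Q (-1) z z'
      in if x > 0 \<and> y > 0 then (Pp x * Qp y - Qp x * Pp y) / of_real (x - y)
         else if x > 0 \<and> y < 0 then (Pp x * Pm (- y) + Qp x * Qm (- y)) / of_real (x - y)
         else if x < 0 \<and> y > 0 then (Pm (- x) * Pp y + Qm (- x) * Qp y) / of_real (x - y)
         else if x < 0 \<and> y < 0 then (Pm (- x) * Qm (- y) - Qm (- x) * Pm (- y)) / of_real (y - x)
         else 0)"

definition whittaker_kernel :: "complex \<Rightarrow> complex \<Rightarrow> real \<Rightarrow> real \<Rightarrow> complex" where
  "whittaker_kernel z z' x y =
     (if x = y then Lim (at x) (\<lambda>t. whittaker_kernel_offdiag z z' t x)
      else whittaker_kernel_offdiag z z' x y)"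

end

theory Submission
  imports Defs "HOL-Real_Asymp.Real_Asymp"
begin

text \<open>
  A configuration carries the charge +1 at each positive and -1 at each negative point. The process is
  rigid for the charge: in a growing annulus the total charge has bounded variance, so suitable averages
  of it, minus their means, tend to 0 almost surely (\<open>AE_limit_event\<close>). Inserting points shifts the
  limit by their total charge \<open>n - k\<close> (\<open>avg_insert_points\<close>). By the defining identity of reduced Palm
  measures, adding the points of \<open>p\<close> to a typical configuration of the Palm measure restores the
  limit 0. So the Palm measure is carried by the configurations with limit \<open>k - n\<close>, the process by
  those with limit 0, and \<open>n \<noteq> k\<close> separates the two (\<open>palm_singular\<close>).

  The variance bound rests on the form of the kernel: \<open>K(x,y) = sgn y * k(x,y)\<close> with \<open>k\<close> real,
  symmetric, bounded by \<open>C / max |x| |y|\<close>, and with \<open>\<integral> k(x,s)\<^sup>2 ds = K(x,x)\<close>. The signs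
  of \<open>K(x,y) K(y,x)\<close> cancel against those of the charges, and for nested sets \<open>D \<subseteq> E\<close> the covariance
  of the charges is at most the integral of \<open>k\<^sup>2\<close> over \<open>D\<close> times the complement of \<open>E\<close>
  (\<open>charge_cov\<close>). For annuli the bound on \<open>k\<close> makes this decay geometrically in the ratio of scales,
  so averages over scales have variance of order one over their number (\<open>avg_variance\<close>).

  The analytic part supplies these properties of the Whittaker kernel. The four functions
  \<open>P\<^sub>\<plusminus>\<close>, \<open>Q\<^sub>\<plusminus>\<close> are glued to one pair on the punctured line, solving one linear system with regular
  singularity at 0; decay at infinity, boundedness at 0, and the connection coefficients at 0 are
  computed from the confluent hypergeometric series. Differentiating \<open>t k(tx,ts)\<close> in the scale \<open>t\<close>
  turns the integral identity for \<open>k\<close> into an ordinary differential equation. This gives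
  \<open>\<integral> k(x,s) k(y,s) ds = \<tau> k(x,y)\<close> on a half-line with an unknown constant, and the
  limit \<open>t \<rightarrow> 0\<close>, an integral of \<open>sin\<^sup>2\<close> of a logarithm, shows \<open>\<tau> = 1\<close> (\<open>reproducing\<close>).

  The Palm measures are given only up to null sets of a correlation measure, the claim is about Lebesgue
  null sets. Hence the correlation density must not vanish at distinct points
  (\<open>kernel_det_nonzero\<close>): on each half-line \<open>k\<close> is a Gram kernel of linearly independent
  functions, and the opposite signs of the half-lines make the cross terms cancel.
\<close>

abbreviation lint :: "(real => 'a :: {banach, second_countable_topology}) => 'a" where "lint \<equiv> integral\<^sup>L lborel"

section \<open>The Whittaker system and its confluent hypergeometric solutions\<close>

definition kummer :: "complex => complex => complex => complex" where
 "kummer al ga = eval_fps (fps_hypergeo [al] [ga] 1)"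

lemma pochhammer_Re_one_nonzero:
 fixes ga :: complex
 assumes "Re ga = 1"
 shows "pochhammer ga n \<noteq> 0"
proof
 assume "pochhammer ga n = 0"
 then obtain k where "ga = - of_nat k" by (auto simp: pochhammer_eq_0_iff)
 then show False using assms by simp
qed

lemma summable_kummer:
 assumes "Re ga = 1"
 shows "summable (\<lambda>n. fps_nth (fps_hypergeo [al] [ga] 1) n * x ^ n)"
proof -
 define f where "f n = fps_nth (fps_hypergeo [al] [ga] 1) n * x ^ n" for n
 define N where "N = nat \<lceil>2 * (norm al + 1) * norm x\<rceil>"
 have "norm (f (Suc n)) \<le> 1/2 * norm (f n)" if n: "n \<ge> N" for n
 proof -
  have g: "norm (ga + of_nat n) \<ge> real n + 1"
   using abs_Re_le_cmod[of "ga + of_nat n"] assms by simp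
  have a: "norm (al + of_nat n) \<le> (norm al + 1) * (real n + 1)"
  proof -
   have "norm (al + of_nat n) \<le> norm al + real n"
    using norm_triangle_ineq[of al "of_nat n"] by simp
   moreover have "norm al + real n \<le> norm al * real n + 1 * real n + (norm al * 1 + 1 * 1)"
    using mult_nonneg_nonneg[of "norm al" "real n"] by simp
   ultimately show ?thesis unfolding distrib_right distrib_left by linarith
  qed
  have x: "(norm al + 1) * norm x \<le> (real n + 1) / 2"
  proof -
   have "2 * (norm al + 1) * norm x \<le> real N"
    unfolding N_def by (rule real_nat_ceiling_ge)
   moreover have "t \<le> (real n + 1) / 2" if "2 * t \<le> real N" for t using that n by simp
   ultimately show ?thesis by (simp only: mult.assoc)
  qed
  have eq: "f (Suc n) = ((al + of_nat n) * x / ((ga + of_nat n) * (of_nat n + 1))) * f n"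
   using pochhammer_Re_one_nonzero[OF assms, of n] g
   by (auto simp: f_def pochhammer_Suc field_simps)
  have "norm ((al + of_nat n) * x / ((ga + of_nat n) * (of_nat n + 1)))
    \<le> ((norm al + 1) * (real n + 1)) * norm x / ((real n + 1) * (real n + 1))"
   unfolding norm_divide norm_mult
   using a g norm_of_nat[of "Suc n", where 'a = complex]
   by (intro frac_le mult_mono) (auto simp: add.commute)
  also have "\<dots> = ((norm al + 1) * norm x) / (real n + 1)"
  proof -
   have "a * c * b / (c * c) = a * b / c" if "c \<noteq> 0" for a b c :: real
    using that by (simp add: field_simps)
   then show ?thesis by simp
  qed
  also have "\<dots> \<le> 1/2" using x by (simp add: field_simps)
  finally show ?thesis unfolding eq norm_mult by (intro mult_right_mono) auto
 qed
 then show ?thesis unfolding f_def[symmetric]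
  by (intro summable_ratio_test[of "1/2" N]) auto
qed

lemma conv_radius_kummer:
 assumes "Re ga = 1"
 shows "fps_conv_radius (fps_hypergeo [al] [ga] 1) = \<infinity>"
 unfolding fps_conv_radius_def
 by (intro conv_radius_inftyI'' summable_kummer assms)

lemma kummer_0: "kummer al ga 0 = 1"
 by (simp add: kummer_def eval_fps_at_0)

lemma kummer_coeff_shift:
 assumes "Re ga = 1"
 defines "c \<equiv> \<lambda>al n. fps_nth (fps_hypergeo [al] [ga] 1) n"
 shows "al * c (al + 1) n = (al + of_nat n) * c al n"
proof -
 have "al * pochhammer (al + 1) n = pochhammer al n * (al + of_nat n)"
  by (simp add: pochhammer_rec[symmetric] pochhammer_Suc)
 then show ?thesis
  using pochhammer_Re_one_nonzero[OF assms(1), of n] by (simp add: c_def field_simps)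
qed

lemma kummer_deriv:
 assumes "Re ga = 1"
 obtains d where "(kummer al ga has_field_derivative d) (at x)"
  "x * d = al * (kummer (al + 1) ga x - kummer al ga x)"
proof -
 define h where "h al = fps_hypergeo [al] [ga] 1" for al :: complex
 have cr: "fps_conv_radius (h al) = \<infinity>" for al
  unfolding h_def by (rule conv_radius_kummer[OF assms])
 have crd: "fps_conv_radius (fps_deriv (h al)) = \<infinity>" for al
  using fps_conv_radius_deriv[of "h al"] cr by simp
 have fps: "fps_X * fps_deriv (h al) = fps_const al * (h (al + 1) - h al)"
 proof (rule fps_ext)
  fix n
  show "fps_nth (fps_X * fps_deriv (h al)) n = fps_nth (fps_const al * (h (al + 1) - h al)) n"
  proof (cases n)
   case 0
   then show ?thesis by (simp add: h_def)
  next
   case (Suc k)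
   then have "fps_nth (fps_X * fps_deriv (h al)) n = of_nat n * fps_nth (h al) n"
    by (simp add: fps_X_mult_nth)
   also have "\<dots> = al * (fps_nth (h (al + 1)) n - fps_nth (h al) n)"
    using kummer_coeff_shift[OF assms, of al n] unfolding h_def
    by (simp only: right_diff_distrib distrib_right) simp
   finally show ?thesis by simp
  qed
 qed
 have crs: "fps_conv_radius (h (al + 1) - h al) = \<infinity>"
  using fps_conv_radius_diff[of "h (al+1)" "h al"] cr by simp
 have 1: "(kummer al ga has_field_derivative eval_fps (fps_deriv (h al)) x) (at x)"
  unfolding kummer_def h_def[symmetric]
  by (rule has_field_derivative_eval_fps) (simp add: cr)
 have "x * eval_fps (fps_deriv (h al)) x = eval_fps (fps_X * fps_deriv (h al)) x"
  by (subst eval_fps_mult) (simp_all add: crd)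
 also have "\<dots> = al * (kummer (al + 1) ga x - kummer al ga x)"
  unfolding fps by (subst eval_fps_mult) (simp_all add: crs eval_fps_diff cr kummer_def h_def[symmetric])
 finally show ?thesis using 1 that by blast
qed

text \<open>Raising the first parameter is a first-order differential operator. Together with the derivative formula it
  gives the two equations of the Whittaker system without a second-order equation.\<close>

lemma kummer_deriv_up:
 assumes "Re ga = 1"
 obtains d where "(kummer (al + 1) ga has_field_derivative d) (at x)"
  "x * d = (ga - al - 1) * kummer al ga x - (ga - al - 1 - x) * kummer (al + 1) ga x"
proof -
 define h where "h al = fps_hypergeo [al] [ga] 1" for al :: complex
 have cr: "fps_conv_radius (h al) = \<infinity>" for al
  unfolding h_def by (rule conv_radius_kummer[OF assms])
 have crd: "fps_conv_radius (fps_deriv (h al)) = \<infinity>" for al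
  using fps_conv_radius_deriv[of "h al"] cr by simp
 have fps: "fps_X * fps_deriv (h (al+1)) =
   fps_const (ga - al - 1) * (h al - h (al + 1)) + fps_X * h (al + 1)"
 proof (rule fps_ext)
  fix n
  show "fps_nth (fps_X * fps_deriv (h (al+1))) n =
   fps_nth (fps_const (ga - al - 1) * (h al - h (al + 1)) + fps_X * h (al + 1)) n"
  proof (cases n)
   case 0
   then show ?thesis by (simp add: h_def)
  next
   case (Suc m)
   let ?p = "pochhammer (al + 1) m" and ?g = "pochhammer ga m"
   have nz: "?g \<noteq> 0" "ga + of_nat m \<noteq> 0" "pochhammer ga (Suc m) \<noteq> 0"
    using pochhammer_Re_one_nonzero[OF assms, of m] pochhammer_Re_one_nonzero[OF assms, of "Suc m"]
    by (auto simp: pochhammer_Suc)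
   have e1: "fps_nth (h al) n = al * ?p / (?g * (ga + of_nat m) * fact (Suc m))"
    by (simp add: h_def Suc pochhammer_rec[of al m] pochhammer_Suc[of ga] del: fact_Suc)
   have e2: "fps_nth (h (al+1)) n = (al + 1 + of_nat m) * ?p / (?g * (ga + of_nat m) * fact (Suc m))"
    by (simp add: h_def Suc pochhammer_Suc[of ga] pochhammer_Suc[of "al+1"] del: fact_Suc)
   have e3: "fps_nth (h (al+1)) m = ?p / (?g * fact m)" by (simp add: h_def)
   have "fps_nth (fps_X * fps_deriv (h (al+1))) n = of_nat (Suc m) * fps_nth (h (al+1)) n"
    using Suc by (simp add: fps_X_mult_nth)
   also have "\<dots> = (ga - al - 1) * (fps_nth (h al) n - fps_nth (h (al+1)) n) + fps_nth (h (al+1)) m"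
    unfolding e1 e2 e3 using nz by (simp add: divide_simps del: of_nat_Suc) (simp add: algebra_simps)
   finally show ?thesis using Suc by (simp add: fps_X_mult_nth)
  qed
 qed
 have crs: "fps_conv_radius (h al - h (al + 1)) = \<infinity>"
  using fps_conv_radius_diff[of "h al" "h (al+1)"] cr by simp
 have crs2: "fps_conv_radius (fps_const (ga - al - 1) * (h al - h (al + 1))) = \<infinity>"
  using fps_conv_radius_mult[of "fps_const (ga - al - 1)" "h al - h (al + 1)"] crs by simp
 have crs3: "fps_conv_radius (fps_X * h (al + 1)) = \<infinity>"
  using fps_conv_radius_mult[of fps_X "h (al + 1)"] cr by simp
 have 1: "(kummer (al+1) ga has_field_derivative eval_fps (fps_deriv (h (al+1))) x) (at x)"
  unfolding kummer_def h_def[symmetric]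
  by (rule has_field_derivative_eval_fps) (simp add: cr)
 have "x * eval_fps (fps_deriv (h (al+1))) x = eval_fps (fps_X * fps_deriv (h (al+1))) x"
  by (subst eval_fps_mult) (simp_all add: crd)
 also have "\<dots> = (ga - al - 1) * (kummer al ga x - kummer (al + 1) ga x) + x * kummer (al+1) ga x"
  unfolding fps using crs crs2 crs3 cr
  by (simp add: eval_fps_add eval_fps_mult eval_fps_diff kummer_def h_def[symmetric])
 also have "\<dots> = (ga - al - 1) * kummer al ga x - (ga - al - 1 - x) * kummer (al + 1) ga x"
  by (simp add: algebra_simps)
 finally show ?thesis using 1 that by blast
qed

text \<open>The complex solution \<open>x powr (-1/2) * M\<close> of the Whittaker system, with \<open>M\<close> the
  Whittaker function of index \<open>\<i> m\<close>.\<close>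

definition uw :: "real => real => complex => complex" where
 "uw m \<kappa> x = exp (- x / 2) * x powr (\<i> * m) * kummer (1/2 + \<i> * m - \<kappa>) (1 + 2 * \<i> * m) x"

lemma uw_deriv:
 fixes r m :: real and x :: complex
 assumes "x \<notin> \<real>\<^sub>\<le>\<^sub>0"
 defines "z \<equiv> Complex r m"
 shows "(uw m (r + 1/2) has_field_derivative
   (((of_real r - x / 2) * uw m (r + 1/2) x - cnj z * uw m (r - 1/2) x) / x)) (at x)"
  and "(uw m (r - 1/2) has_field_derivative
   (((x / 2 - of_real r) * uw m (r - 1/2) x + z * uw m (r + 1/2) x) / x)) (at x)"
proof -
 have x0: "x \<noteq> 0" using assms by auto
 define al where "al = - cnj z"
 define ga where "ga = (1 + 2 * \<i> * m :: complex)"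
 have g: "Re ga = 1" by (simp add: ga_def)
 have u1: "uw m (r + 1/2) = (\<lambda>x. exp (- x / 2) * x powr (\<i> * m) * kummer al ga x)"
 proof -
  have "1/2 + \<i> * m - complex_of_real (r + 1/2) = al"
   by (simp add: al_def z_def complex_eq_iff)
  then show ?thesis unfolding uw_def ga_def by (intro ext) simp
 qed
 have u2: "uw m (r - 1/2) = (\<lambda>x. exp (- x / 2) * x powr (\<i> * m) * kummer (al + 1) ga x)"
 proof -
  have "1/2 + \<i> * m - complex_of_real (r - 1/2) = al + 1"
   by (simp add: al_def z_def complex_eq_iff)
  then show ?thesis unfolding uw_def ga_def by (simp only:)
 qed
 define e where "e = exp (- x / 2) * x powr (\<i> * m)"
 have pw: "x powr (\<i> * m - 1) = x powr (\<i> * m) / x"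
  using x0 by (simp add: powr_diff)
 obtain d where d: "(kummer al ga has_field_derivative d) (at x)"
  "x * d = al * (kummer (al + 1) ga x - kummer al ga x)" by (rule kummer_deriv[OF g])
 obtain d' where d': "(kummer (al + 1) ga has_field_derivative d') (at x)"
  "x * d' = (ga - al - 1) * kummer al ga x - (ga - al - 1 - x) * kummer (al + 1) ga x"
  by (rule kummer_deriv_up[OF g])
 have D: "((\<lambda>x. exp (- x / 2) * x powr (\<i> * m) * f x) has_field_derivative
   (e * ((\<i> * m - x / 2) * f x + x * f') / x)) (at x)"
  if "(f has_field_derivative f') (at x)" for f f'
 proof -
  have "((\<lambda>x. exp (- x / 2)) has_field_derivative (- exp (- x / 2) / 2)) (at x)"
   by (auto intro!: derivative_eq_intros)
  from DERIV_mult[OF DERIV_mult[OF this has_field_derivative_powr[OF assms(1)]] that]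
  show ?thesis by (rule DERIV_cong) (use x0 in \<open>simp add: e_def pw field_simps\<close>)
 qed
 have i: "\<i> * of_real m = of_real r - cnj z" "2 * (\<i> * of_real m) = z - cnj z"
   by (simp_all add: z_def complex_eq_iff)
 show "(uw m (r + 1/2) has_field_derivative
   (((of_real r - x / 2) * uw m (r + 1/2) x - cnj z * uw m (r - 1/2) x) / x)) (at x)"
  unfolding u1 u2 by (rule DERIV_cong[OF D[OF d(1)]], unfold d(2) e_def)
   (use x0 in \<open>simp add: i field_simps al_def\<close>)
 have "2 * of_real r = z + cnj z" by (simp add: z_def complex_eq_iff)
 then have r: "of_real r = (z + cnj z) / 2" by (simp add: field_simps)
 have ii: "\<i> * of_real m = (z - cnj z) / 2" using i(2) by (simp add: field_simps)
 show "(uw m (r - 1/2) has_field_derivative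
   (((x / 2 - of_real r) * uw m (r - 1/2) x + z * uw m (r + 1/2) x) / x)) (at x)"
  unfolding u1 u2
  by (rule DERIV_cong[OF D[OF d'(1)]], unfold d'(2) e_def)
   (use x0 in \<open>simp add: r ii al_def ga_def mult.assoc\<close>, simp add: field_simps)
qed

section \<open>Growth dichotomy at infinity\<close>

text \<open>An inverse-square bound on the derivative is integrable, so the Cauchy criterion holds at infinity.\<close>

lemma convergent_of_deriv_bound:
 fixes h h' :: "real => real"
 assumes "a > 0" and d: "\<And>x. x \<ge> a ==> (h has_real_derivative h' x) (at x)"
  and b: "\<And>x. x \<ge> a ==> \<bar>h' x\<bar> \<le> B / x^2"
 shows "\<exists>L. (h \<longlongrightarrow> L) at_top"
proof -
 have B: "B \<ge> 0"
 proof -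
  have "0 \<le> B / a^2" using b[of a] by (auto intro: order_trans[OF abs_ge_zero])
  then show ?thesis using assms(1) by (simp add: zero_le_divide_iff)
 qed
 have key: "\<bar>h y - h x\<bar> \<le> B / x" if "a \<le> x" "x \<le> y" for x y
 proof -
  have "h x - B / x \<le> h y - B / y"
  proof (rule DERIV_nonneg_imp_nondecreasing[OF that(2)])
   fix u assume u: "x \<le> u" "u \<le> y"
   have "((\<lambda>x. h x - B / x) has_real_derivative (h' u + B / u^2)) (at u)"
    using u that assms(1)
    by (auto intro!: derivative_eq_intros d simp: power2_eq_square)
   moreover have "h' u + B / u^2 \<ge> 0" using b[of u] u that by linarith
   ultimately show "\<exists>y. ((\<lambda>x. h x - B / x) has_real_derivative y) (at u) \<and> 0 \<le> y" by blast
  qed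
  moreover have "h y + B / y \<le> h x + B / x"
  proof (rule DERIV_nonpos_imp_nonincreasing[OF that(2)])
   fix u assume u: "x \<le> u" "u \<le> y"
   have "((\<lambda>x. h x + B / x) has_real_derivative (h' u - B / u^2)) (at u)"
    using u that assms(1)
    by (auto intro!: derivative_eq_intros d simp: power2_eq_square)
   moreover have "h' u - B / u^2 \<le> 0" using b[of u] u that by linarith
   ultimately show "\<exists>y. ((\<lambda>x. h x + B / x) has_real_derivative y) (at u) \<and> y \<le> 0" by blast
  qed
  moreover have "0 \<le> B / y" using B that assms(1) by simp
  ultimately show ?thesis by linarith
 qed
 have "Cauchy (\<lambda>n. h (real n))"
 proof (rule metric_CauchyI)
  fix e :: real assume "e > 0"
  define M where "M = nat \<lceil>a + 2 * B / e\<rceil> + 1"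
  have "real M \<ge> a + 2 * B / e + 1" unfolding M_def
   using real_nat_ceiling_ge[of "a + 2 * B / e"] by simp
  moreover have "2 * B / e \<ge> 0" using B \<open>e > 0\<close> by simp
  ultimately have M: "real M \<ge> a" "real M > 2 * B / e" "real M > 0" using assms(1) by auto
  have B2: "B / real M < e / 2" using M \<open>e > 0\<close> by (simp add: field_simps)
  show "\<exists>M. \<forall>m\<ge>M. \<forall>n\<ge>M. dist (h (real m)) (h (real n)) < e"
  proof (intro exI[of _ M] allI impI)
   fix m n assume "m \<ge> M" "n \<ge> M"
   then have "\<bar>h (real m) - h (real M)\<bar> \<le> B / real M" "\<bar>h (real n) - h (real M)\<bar> \<le> B / real M"
    using key[of "real M"] M by auto
   then show "dist (h (real m)) (h (real n)) < e" using B2 unfolding dist_real_def by linarith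
  qed
 qed
 then obtain L where L: "(\<lambda>n. h (real n)) \<longlonglongrightarrow> L"
  using Cauchy_convergent_iff convergent_def by blast
 have le: "\<bar>L - h x\<bar> \<le> B / x" if "x \<ge> a" for x
 proof (rule tendsto_upperbound)
  show "(\<lambda>n. \<bar>h (real n) - h x\<bar>) \<longlonglongrightarrow> \<bar>L - h x\<bar>" by (intro tendsto_intros L)
  show "\<forall>\<^sub>F n in sequentially. \<bar>h (real n) - h x\<bar> \<le> B / x"
   using eventually_ge_at_top[of "nat \<lceil>x\<rceil>"]
   by eventually_elim (rule key[OF that], linarith)
 qed simp
 have "((\<lambda>x. h x - L) \<longlongrightarrow> 0) at_top"
 proof (rule Lim_null_comparison)
  show "\<forall>\<^sub>F x in at_top. norm (h x - L) \<le> B / x"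
   using eventually_ge_at_top[of a] by eventually_elim (use le in \<open>auto simp: abs_minus_commute\<close>)
  show "((\<lambda>x. B / x) \<longlongrightarrow> 0) at_top"
   by (intro tendsto_divide_0[OF tendsto_const] filterlim_at_top_imp_at_infinity filterlim_ident)
 qed
 then have "(h \<longlongrightarrow> L) at_top" by (simp add: LIM_zero_iff)
 then show ?thesis by blast
qed

text \<open>Asymptotically \<open>q\<close> grows and \<open>p\<close> decays. The difference \<open>q\<^sup>2 -
  p\<^sup>2\<close> is eventually monotone: if it never becomes positive, \<open>p\<close> dominates and both
  functions decay; otherwise \<open>q\<close> dominates, and the logarithm of the normalized \<open>q\<close>
 has an integrable derivative after subtracting a term that tends to 0.\<close>

lemma system_dichotomy:
 fixes p q :: "real => real"
 assumes "w > 0" "X > 0"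
  and p: "\<And>x. x \<ge> X ==> (p has_real_derivative (((r - x / 2) * p x + w * q x) / x)) (at x)"
  and q: "\<And>x. x \<ge> X ==> (q has_real_derivative (((x / 2 - r) * q x - w * p x) / x)) (at x)"
 shows "(\<exists>C Y. \<forall>x\<ge>Y. \<bar>p x\<bar> \<le> C * exp (- x / 4) \<and> \<bar>q x\<bar> \<le> C * exp (- x / 4))
   \<or> (\<exists>l. l \<noteq> 0 \<and> ((\<lambda>x. q x * exp (- x / 2) * x powr r) \<longlongrightarrow> l) at_top)"
proof -
 define Y where "Y = max X (4 * \<bar>r\<bar> + 4 * w + 4)"
 have Y: "Y > 0" "Y \<ge> X" "\<And>x. x \<ge> Y ==> x \<ge> 4 * \<bar>r\<bar> + 4 * w + 4"
  using assms(1,2) by (auto simp: Y_def)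
 have pq: "2 * \<bar>p x * q x\<bar> \<le> (p x)^2 + (q x)^2" for x
  using sum_squares_bound[of "\<bar>p x\<bar>" "\<bar>q x\<bar>"] by (simp add: abs_mult)
 define D where "D x = (q x)^2 - (p x)^2" for x
 have D: "(D has_real_derivative ((x - 2 * r) * ((p x)^2 + (q x)^2) - 4 * w * (p x * q x)) / x) (at x)"
  if "x \<ge> Y" for x
  unfolding D_def using that Y(1,2)
  by (auto intro!: derivative_eq_intros p q) (simp add: field_simps power2_eq_square)
 have Dpos: "((x - 2 * r) * ((p x)^2 + (q x)^2) - 4 * w * (p x * q x)) / x \<ge> 0" if "x \<ge> Y" for x
 proof -
  have "4 * w * (p x * q x) \<le> 2 * w * ((p x)^2 + (q x)^2)"
  proof -
   have "2 * (p x * q x) \<le> (p x)^2 + (q x)^2"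
    using pq[of x] abs_ge_self[of "p x * q x"] by linarith
   from mult_left_mono[OF this, of "2 * w"] show ?thesis using assms(1) by (simp add: mult.assoc)
  qed
  also have "\<dots> \<le> (x - 2 * r) * ((p x)^2 + (q x)^2)"
   using Y(3)[OF that] assms(1) by (intro mult_right_mono) auto
  finally show ?thesis using that Y(1) by simp
 qed
 have Dmono: "D x \<le> D y" if "Y \<le> x" "x \<le> y" for x y
 proof (rule DERIV_nonneg_imp_nondecreasing[OF that(2)])
  fix u assume "x \<le> u" "u \<le> y"
  then show "\<exists>y. (D has_real_derivative y) (at u) \<and> 0 \<le> y"
   using D[of u] Dpos[of u] that by auto
 qed
 show ?thesis
 proof (cases "\<forall>x\<ge>Y. D x \<le> 0")
  case True
  have le: "\<bar>q x\<bar> \<le> \<bar>p x\<bar>" if "x \<ge> Y" for x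
   using True that by (auto simp: D_def abs_le_square_iff)
  define g where "g x = (p x)^2 * exp (x / 2)" for x
  have gd: "(g has_real_derivative ((2 * r / x - 1/2) * (p x)^2 + 2 * w * (p x * q x) / x) * exp (x / 2)) (at x)"
   if "x \<ge> Y" for x
   unfolding g_def using that Y(1,2)
   by (auto intro!: derivative_eq_intros p) (simp add: field_simps power2_eq_square)
  have gneg: "((2 * r / x - 1/2) * (p x)^2 + 2 * w * (p x * q x) / x) * exp (x / 2) \<le> 0" if "x \<ge> Y" for x
  proof -
   have x: "x > 0" using that Y(1) by simp
   have "p x * q x \<le> (p x)^2"
    using mult_left_mono[OF le[OF that], of "\<bar>p x\<bar>"] abs_ge_self[of "p x * q x"]
    by (simp add: abs_mult power2_eq_square)
   then have "2 * w * (p x * q x) / x \<le> 2 * w / x * (p x)^2"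
    using x assms(1) by (simp add: divide_simps)
   moreover have "(2 * r / x - 1/2) + 2 * w / x \<le> 0"
    using Y(3)[OF that] x by (simp add: field_simps)
   then have "((2 * r / x - 1/2) + 2 * w / x) * (p x)^2 \<le> 0" by (intro mult_nonpos_nonneg) auto
   ultimately have "(2 * r / x - 1/2) * (p x)^2 + 2 * w * (p x * q x) / x \<le> 0"
    by (simp add: distrib_right)
   then show ?thesis by (intro mult_nonpos_nonneg) auto
  qed
  have gmono: "g x \<le> g Y" if "Y \<le> x" for x
  proof (rule DERIV_nonpos_imp_nonincreasing[OF that])
   fix u assume "Y \<le> u" "u \<le> x"
   then show "\<exists>y. (g has_real_derivative y) (at u) \<and> y \<le> 0"
    using gd[of u] gneg[of u] by blast
  qed
  define C where "C = \<bar>p Y\<bar> * exp (Y / 4)"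
  have "\<bar>p x\<bar> \<le> C * exp (- x / 4)" if "x \<ge> Y" for x
  proof -
   have "(p x * exp (x / 4))^2 \<le> C^2"
    using gmono[OF that] by (simp add: g_def C_def power_mult_distrib exp_double[symmetric])
   then have "\<bar>p x * exp (x / 4)\<bar> \<le> \<bar>C\<bar>" by (simp add: abs_le_square_iff)
   then have "\<bar>p x\<bar> * exp (x / 4) \<le> C" by (simp add: abs_mult C_def)
   then show ?thesis by (simp add: exp_minus field_simps)
  qed
  moreover then have "\<bar>q x\<bar> \<le> C * exp (- x / 4)" if "x \<ge> Y" for x
   using le[OF that] that by (meson order_trans)
  ultimately show ?thesis by (intro disjI1 exI[of _ C] exI[of _ Y]) simp
 next
  case False
  then obtain a where a: "a \<ge> Y" "D a > 0" by force
  have Da: "D x > 0" if "x \<ge> a" for x using Dmono[of a x] a that by linarith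
  have q0: "q x \<noteq> 0" if "x \<ge> a" for x
   using Da[OF that] by (auto simp: D_def)
  define \<rho> where "\<rho> x = p x / q x" for x
  have rho: "\<bar>\<rho> x\<bar> \<le> 1" if "x \<ge> a" for x
  proof -
   have "\<bar>p x\<bar> \<le> \<bar>q x\<bar>" using Da[OF that] by (simp add: D_def abs_le_square_iff)
   then show ?thesis using q0[OF that] by (simp add: \<rho>_def)
  qed
  define h where "h x = ln ((q x)^2) / 2 - x / 2 + r * ln x - w * \<rho> x / (x - 2 * r)" for x
  define h' where "h' x = - w\<^sup>2 * (1 + (\<rho> x)^2) / (x * (x - 2 * r)) + w * \<rho> x / (x - 2 * r)^2" for x
  have rd: "(\<rho> has_real_derivative ((2 * r - x) * \<rho> x + w * (1 + (\<rho> x)^2)) / x) (at x)" if "x \<ge> a" for x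
  proof -
   have x: "x > 0" "x \<ge> X" using that a Y by auto
   show ?thesis unfolding \<rho>_def
    using q0[OF that] x by (auto intro!: derivative_eq_intros p q)
     (simp add: field_simps power2_eq_square)
  qed
  have hd: "(h has_real_derivative h' x) (at x)" if "x \<ge> a" for x
  proof -
   have x: "x > 0" "x \<ge> X" "x - 2 * r > 0" using that a Y(1,2) Y(3)[of x] assms(1) by auto
   have 1: "((\<lambda>x. ln ((q x)^2) / 2 - x / 2 + r * ln x) has_real_derivative (- w * \<rho> x / x)) (at x)"
    using q0[OF that] x by (auto intro!: derivative_eq_intros q simp: \<rho>_def)
     (simp add: field_simps power2_eq_square)
   have 2: "((\<lambda>x. w * \<rho> x / (x - 2 * r)) has_real_derivative
     (- w * \<rho> x / x + w^2 * (1 + (\<rho> x)^2) / (x * (x - 2 * r)) - w * \<rho> x / (x - 2 * r)^2)) (at x)"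
   proof -
    have "w * (((2 * r - x) * R + w * (1 + R^2)) / x) / (x - 2 * r) - w * R / (x - 2 * r)^2
      = - w * R / x + w^2 * (1 + R^2) / (x * (x - 2 * r)) - w * R / (x - 2 * r)^2" for R
    proof -
     have "w * (((2 * r - x) * R + w * (1 + R^2)) / x) / (x - 2 * r)
      = - w * R / x + w^2 * (1 + R^2) / (x * (x - 2 * r))"
     proof -
      define y where "y = x - 2 * r"
      have e: "2 * r - x = - y" "x - 2 * r = y" "y \<noteq> 0" using x by (auto simp: y_def)
      show ?thesis unfolding e using e(3) x(1) by (simp add: field_simps power2_eq_square)
     qed
     then show ?thesis by simp
    qed
    moreover have "((\<lambda>x. w * \<rho> x / (x - 2 * r)) has_real_derivative
      (w * (((2 * r - x) * \<rho> x + w * (1 + (\<rho> x)^2)) / x) / (x - 2 * r) - w * \<rho> x / (x - 2 * r)^2)) (at x)"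
    proof (rule DERIV_cong[OF DERIV_divide[OF DERIV_cmult[OF rd[OF that]]
       DERIV_diff[OF DERIV_ident DERIV_const]]])
     have *: "(A * y - B * (1 - 0)) / (y * y) = A / y - B / y^2" if "y \<noteq> 0" for A B y :: real
      using that by (simp add: field_simps power2_eq_square)
     show "(w * (((2 * r - x) * \<rho> x + w * (1 + (\<rho> x)^2)) / x) * (x - 2 * r) - w * \<rho> x * (1 - 0)) / ((x - 2 * r) * (x - 2 * r)) =
      w * (((2 * r - x) * \<rho> x + w * (1 + (\<rho> x)^2)) / x) / (x - 2 * r) - w * \<rho> x / (x - 2 * r)^2"
      by (rule *) (use x(3) in simp)
    qed (use x in auto)
    ultimately show ?thesis by simp
   qed
   show ?thesis unfolding h_def
    by (rule DERIV_cong[OF DERIV_diff[OF 1 2]]) (simp add: h'_def)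
  qed
  have hb: "\<bar>h' x\<bar> \<le> (4 * w^2 + 4 * w) / x^2" if "x \<ge> a" for x
  proof -
   have x: "x > 0" "x - 2 * r \<ge> x / 2" using that a Y(1,2) Y(3)[of x] assms(1) by auto
   have r2: "(\<rho> x)^2 \<le> 1" using rho[OF that] by (simp add: abs_square_le_1)
   have "\<bar>- w\<^sup>2 * (1 + (\<rho> x)^2) / (x * (x - 2 * r))\<bar> = w^2 * (1 + (\<rho> x)^2) / (x * (x - 2 * r))"
    using x by (simp add: abs_mult)
   also have "\<dots> \<le> w^2 * 2 / (x * (x / 2))"
    using x r2 by (intro frac_le mult_mono mult_pos_pos) auto
   also have "\<dots> = 4 * w^2 / x^2" using x by (simp add: field_simps power2_eq_square)
   finally have 1: "\<bar>- w\<^sup>2 * (1 + (\<rho> x)^2) / (x * (x - 2 * r))\<bar> \<le> 4 * w^2 / x^2" .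
   have "\<bar>w * \<rho> x / (x - 2 * r)^2\<bar> = w * \<bar>\<rho> x\<bar> / (x - 2 * r)^2"
    using assms(1) by (simp add: abs_mult)
   also have "\<dots> \<le> w * 1 / (x / 2)^2"
    using x rho[OF that] assms(1) by (intro frac_le mult_mono power_mono) auto
   also have "\<dots> = 4 * w / x^2" using x by (simp add: field_simps power2_eq_square)
   finally have 2: "\<bar>w * \<rho> x / (x - 2 * r)^2\<bar> \<le> 4 * w / x^2" .
   show ?thesis unfolding h'_def add_divide_distrib using 1 2 by linarith
  qed
  have "a > 0" using a Y by simp
  then obtain L where L: "(h \<longlongrightarrow> L) at_top"
   using convergent_of_deriv_bound[OF _ hd hb] by blast
  have r0: "((\<lambda>x. w * \<rho> x / (x - 2 * r)) \<longlongrightarrow> 0) at_top"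
  proof (rule Lim_null_comparison)
   show "\<forall>\<^sub>F x in at_top. norm (w * \<rho> x / (x - 2 * r)) \<le> w / (x - 2 * r)"
    using eventually_ge_at_top[of a]
   proof eventually_elim
    case (elim x)
    have "x - 2 * r > 0" using elim a Y(3)[of x] assms(1) by auto
    then show ?case using rho[OF elim] assms(1)
     by (simp add: abs_mult divide_right_mono mult_left_le)
   qed
   have "filterlim (\<lambda>x. - (2 * r) + x) at_top at_top"
    by (rule filterlim_tendsto_add_at_top[OF tendsto_const filterlim_ident])
   then have "filterlim (\<lambda>x. x - 2 * r) at_infinity at_top"
    by (simp add: filterlim_at_top_imp_at_infinity)
   then show "((\<lambda>x. w / (x - 2 * r)) \<longlongrightarrow> 0) at_top"
    by (rule tendsto_divide_0[OF tendsto_const])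
  qed
  have "((\<lambda>x. exp (h x + w * \<rho> x / (x - 2 * r))) \<longlongrightarrow> exp L) at_top"
   using tendsto_exp[OF tendsto_add[OF L r0]] by simp
  moreover have "\<forall>\<^sub>F x in at_top. exp (h x + w * \<rho> x / (x - 2 * r)) = \<bar>q x\<bar> * exp (- x / 2) * x powr r"
   using eventually_ge_at_top[of a]
  proof eventually_elim
   case (elim x)
   have x: "x > 0" "q x \<noteq> 0" using elim a Y q0 by auto
   have "ln ((q x)^2) / 2 = ln \<bar>q x\<bar>"
    using x(2) ln_realpow[of "\<bar>q x\<bar>" 2] by simp
   then have "h x + w * \<rho> x / (x - 2 * r) = ln \<bar>q x\<bar> + (- x / 2) + r * ln x"
    by (simp add: h_def)
   then show ?case using x
    by (simp only: exp_add) (simp add: powr_def)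
  qed
  ultimately have lim: "((\<lambda>x. \<bar>q x\<bar> * exp (- x / 2) * x powr r) \<longlongrightarrow> exp L) at_top"
   by (rule Lim_transform_eventually[where f = "\<lambda>x. exp (h x + w * \<rho> x / (x - 2 * r))"])
  have sgn: "(\<forall>x\<ge>a. q x > 0) \<or> (\<forall>x\<ge>a. q x < 0)"
  proof -
   have c: "continuous_on {a..} q"
   proof (rule continuous_at_imp_continuous_on, rule ballI)
    fix x assume "x \<in> {a..}"
    then show "isCont q x" using q[of x] a(1) Y(2) by (intro DERIV_isCont[OF q]) auto
   qed
   have "connected (q ` {a..})" by (rule connected_continuous_image[OF c]) simp
   then have sub: "{q x..q y} \<subseteq> q ` {a..}" if "x \<ge> a" "y \<ge> a" for x y
    by (rule connected_contains_Icc) (use that in auto)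
   have nz: "0 \<notin> q ` {a..}" using q0 by force
   have *: "\<not> (q x \<le> 0 \<and> 0 \<le> q y)" if "x \<ge> a" "y \<ge> a" for x y
   proof
    assume "q x \<le> 0 \<and> 0 \<le> q y"
    then have "0 \<in> {q x..q y}" by simp
    then have "0 \<in> q ` {a..}" using sub[OF that] by (rule rev_subsetD)
    then show False using nz by contradiction
   qed
   show ?thesis
   proof (cases "q a > 0")
    case True
    have "q x > 0" if "x \<ge> a" for x
     using *[OF that order_refl] True by linarith
    then show ?thesis by (intro disjI1 allI impI)
   next
    case False
    have "q x < 0" if "x \<ge> a" for x
     using *[OF order_refl that] False by linarith
    then show ?thesis by (intro disjI2 allI impI)
   qed
  qed
  show ?thesis
  proof (rule disjI2, cases "\<forall>x\<ge>a. q x > 0")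
   case True
   have "((\<lambda>x. q x * exp (- x / 2) * x powr r) \<longlongrightarrow> exp L) at_top"
   proof (rule Lim_transform_eventually[OF lim])
    show "\<forall>\<^sub>F x in at_top. \<bar>q x\<bar> * exp (- x / 2) * x powr r = q x * exp (- x / 2) * x powr r"
     using eventually_ge_at_top[of a] by eventually_elim (simp add: True less_imp_le abs_of_pos)
   qed
   then show "\<exists>l. l \<noteq> 0 \<and> ((\<lambda>x. q x * exp (- x / 2) * x powr r) \<longlongrightarrow> l) at_top"
    using exp_not_eq_zero by blast
  next
   case False
   then have neg: "\<forall>x\<ge>a. q x < 0" using sgn by blast
   have "((\<lambda>x. q x * exp (- x / 2) * x powr r) \<longlongrightarrow> - exp L) at_top"
   proof (rule Lim_transform_eventually[OF tendsto_minus[OF lim]])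
    show "\<forall>\<^sub>F x in at_top. - (\<bar>q x\<bar> * exp (- x / 2) * x powr r) = q x * exp (- x / 2) * x powr r"
     using eventually_ge_at_top[of a] by eventually_elim (simp add: neg abs_of_neg)
   qed
   moreover have "- exp L \<noteq> 0" by simp
   ultimately show "\<exists>l. l \<noteq> 0 \<and> ((\<lambda>x. q x * exp (- x / 2) * x powr r) \<longlongrightarrow> l) at_top"
    by blast
  qed
 qed
qed

section \<open>Limits at infinity and a Laplace transform\<close>

lemma exp_powr_tendsto_0:
 fixes r c :: real assumes "c > 0"
 shows "((\<lambda>x. exp (- c * x) * x powr r) \<longlongrightarrow> 0) at_top"
 using assms by real_asymp

text \<open>The decaying alternative has limit 0. So a vanishing limit excludes the growing alternative and is a
  criterion for decay.\<close>

lemma system_limit: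
 fixes p q :: "real => real"
 assumes "w > 0" "X > 0"
  and "\<And>x. x \<ge> X ==> (p has_real_derivative (((r - x / 2) * p x + w * q x) / x)) (at x)"
  and "\<And>x. x \<ge> X ==> (q has_real_derivative (((x / 2 - r) * q x - w * p x) / x)) (at x)"
 shows "\<exists>l. ((\<lambda>x. q x * exp (- x / 2) * x powr r) \<longlongrightarrow> l) at_top"
  and "((\<lambda>x. q x * exp (- x / 2) * x powr r) \<longlongrightarrow> 0) at_top ==>
   \<exists>C Y. \<forall>x\<ge>Y. \<bar>p x\<bar> \<le> C * exp (- x / 4) \<and> \<bar>q x\<bar> \<le> C * exp (- x / 4)"
proof -
 have dich: "(\<exists>C Y. \<forall>x\<ge>Y. \<bar>p x\<bar> \<le> C * exp (- x / 4) \<and> \<bar>q x\<bar> \<le> C * exp (- x / 4))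
   \<or> (\<exists>l. l \<noteq> 0 \<and> ((\<lambda>x. q x * exp (- x / 2) * x powr r) \<longlongrightarrow> l) at_top)"
  by (rule system_dichotomy[OF assms(1,2)]) (rule assms(3,4), assumption)+
 have 0: "((\<lambda>x. q x * exp (- x / 2) * x powr r) \<longlongrightarrow> 0) at_top"
  if b: "\<forall>x\<ge>Y. \<bar>p x\<bar> \<le> C * exp (- x / 4) \<and> \<bar>q x\<bar> \<le> C * exp (- x / 4)" for C Y
 proof (rule Lim_null_comparison)
  have "((\<lambda>x. C * (exp (- (3/4) * x) * x powr r)) \<longlongrightarrow> C * 0) at_top"
   by (intro tendsto_intros exp_powr_tendsto_0) simp
  then show "((\<lambda>x. C * (exp (- (3/4) * x) * x powr r)) \<longlongrightarrow> 0) at_top" by simp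
  show "\<forall>\<^sub>F x in at_top. norm (q x * exp (- x / 2) * x powr r) \<le> C * (exp (- (3/4) * x) * x powr r)"
   using eventually_ge_at_top[of Y]
  proof eventually_elim
   case (elim x)
   have "norm (q x * exp (- x / 2) * x powr r) = \<bar>q x\<bar> * (exp (- x / 2) * x powr r)"
    by (simp add: abs_mult)
   also have "\<dots> \<le> C * exp (- x / 4) * (exp (- x / 2) * x powr r)"
    using b elim by (intro mult_right_mono) auto
   also have "\<dots> = C * ((exp (- x / 4) * exp (- x / 2)) * x powr r)" by simp
   also have "exp (- x / 4) * exp (- x / 2) = exp (- (3/4) * x)"
    by (simp flip: exp_add)
   finally show ?case .
  qed
 qed
 show "\<exists>l. ((\<lambda>x. q x * exp (- x / 2) * x powr r) \<longlongrightarrow> l) at_top"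
  using dich
 proof (elim disjE exE conjE)
  fix C Y assume "\<forall>x\<ge>Y. \<bar>p x\<bar> \<le> C * exp (- x / 4) \<and> \<bar>q x\<bar> \<le> C * exp (- x / 4)"
  then show ?thesis by (intro exI[of _ 0]) (rule 0)
 next
  fix l assume "((\<lambda>x. q x * exp (- x / 2) * x powr r) \<longlongrightarrow> l) at_top"
  then show ?thesis by (rule exI)
 qed
 assume l0: "((\<lambda>x. q x * exp (- x / 2) * x powr r) \<longlongrightarrow> 0) at_top"
 have neg: "\<not> (\<exists>l. l \<noteq> 0 \<and> ((\<lambda>x. q x * exp (- x / 2) * x powr r) \<longlongrightarrow> l) at_top)"
  using tendsto_unique[OF _ l0] by auto
 show "\<exists>C Y. \<forall>x\<ge>Y. \<bar>p x\<bar> \<le> C * exp (- x / 4) \<and> \<bar>q x\<bar> \<le> C * exp (- x / 4)"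
  by (rule disjE[OF dich]) (assumption | erule notE[OF neg])+
qed

lemma has_real_derivative_Re:
 assumes "(f has_field_derivative f') (at (complex_of_real x))"
 shows "((\<lambda>x. Re (c * f (complex_of_real x))) has_real_derivative Re (c * f')) (at x)"
proof -
 have "((\<lambda>x. c * f x) has_field_derivative (c * f')) (at (complex_of_real x))"
  by (rule DERIV_cmult[OF assms])
 then have "((\<lambda>x. c * f (complex_of_real x)) has_vector_derivative (c * f')) (at x)"
  by (rule has_vector_derivative_real_field)
 from bounded_linear.has_vector_derivative[OF bounded_linear_Re this]
 show ?thesis by (simp add: has_real_derivative_iff_has_vector_derivative o_def)
qed

lemma Re_lincomb:
 assumes "X = (complex_of_real a * A + complex_of_real b * B) / of_real x"
 shows "Re X = (a * Re A + b * Re B) / x"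
 using assms by simp

lemma Re_lincomb':
 assumes "X = (complex_of_real a * A - complex_of_real b * B) / of_real x"
 shows "Re X = (a * Re A - b * Re B) / x"
 using assms by simp

lemma uw_limit_exists:
 fixes m r :: real
 assumes "m \<noteq> 0"
 shows "\<exists>l. ((\<lambda>x. uw m (r - 1/2) (complex_of_real x) * of_real (exp (- x / 2) * x powr r)) \<longlongrightarrow> l) at_top"
proof -
 define z where "z = Complex r m"
 have z0: "z \<noteq> 0" using assms by (auto simp: z_def complex_eq_iff)
 define w where "w = norm z"
 have w: "w > 0" using z0 by (simp add: w_def)
 have zz: "z * cnj z = of_real w * of_real w"
  using complex_norm_square[of z] by (simp add: w_def power2_eq_square)
 have nn: "complex_of_real x \<notin> \<real>\<^sub>\<le>\<^sub>0" if "x \<ge> 1" for x :: real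
  using that complex_nonpos_Reals_iff by auto
 have lim: "\<exists>l. ((\<lambda>x. Re (c * uw m (r - 1/2) (complex_of_real x)) * exp (- x / 2) * x powr r) \<longlongrightarrow> l) at_top" for c
 proof (rule system_limit(1)[OF w, of 1 "\<lambda>x. Re (- c * z / of_real w * uw m (r + 1/2) (complex_of_real x))"])
  fix x :: real assume x: "1 \<le> x"
  let ?U = "uw m (r + 1/2) (of_real x)" and ?V = "uw m (r - 1/2) (of_real x)"
  note d = uw_deriv[OF nn[OF x], where r = r and m = m, folded z_def]
  have "- c * z / of_real w * (((of_real r - of_real x / 2) * ?U - cnj z * ?V) / of_real x)
   = (of_real (r - x / 2) * (- c * z / of_real w * ?U) + of_real w * (c * ?V)) / of_real x"
   using x w zz by (simp add: field_simps) (simp add: mult.assoc[symmetric] zz)?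
  note Re_lincomb[OF this]
  with has_real_derivative_Re[OF d(1), of "- c * z / of_real w"]
  show "((\<lambda>x. Re (- c * z / of_real w * uw m (r + 1/2) (complex_of_real x))) has_real_derivative
   ((r - x / 2) * Re (- c * z / of_real w * ?U) + w * Re (c * ?V)) / x) (at x)"
   by (simp only:)
  have "c * (((of_real x / 2 - of_real r) * ?V + z * ?U) / of_real x)
   = (of_real (x / 2 - r) * (c * ?V) - of_real w * (- c * z / of_real w * ?U)) / of_real x"
   using x w by (simp add: field_simps)
  note Re_lincomb'[OF this]
  with has_real_derivative_Re[OF d(2), of c]
  show "((\<lambda>x. Re (c * uw m (r - 1/2) (complex_of_real x))) has_real_derivative
   ((x / 2 - r) * Re (c * ?V) - w * Re (- c * z / of_real w * ?U)) / x) (at x)"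
   by (simp only:)
 qed simp
 obtain l1 where l1: "((\<lambda>x. Re (1 * uw m (r - 1/2) (complex_of_real x)) * exp (- x / 2) * x powr r) \<longlongrightarrow> l1) at_top"
  using lim by blast
 obtain l2 where l2: "((\<lambda>x. Re (- \<i> * uw m (r - 1/2) (complex_of_real x)) * exp (- x / 2) * x powr r) \<longlongrightarrow> l2) at_top"
  using lim by blast
 from tendsto_Complex[OF l1 l2]
 have "((\<lambda>x. uw m (r - 1/2) (complex_of_real x) * of_real (exp (- x / 2) * x powr r)) \<longlongrightarrow> Complex l1 l2) at_top"
  by (rule Lim_transform_eventually) (auto simp: complex_eq_iff intro!: always_eventually)
 then show ?thesis by blast
qed

lemma kummer_sums:
 assumes "Re ga = 1"
 shows "(\<lambda>n. pochhammer al n / (pochhammer ga n * fact n) * x ^ n) sums kummer al ga x"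
 using sums_eval_fps[of x "fps_hypergeo [al] [ga] 1"] conv_radius_kummer[OF assms]
 by (simp add: kummer_def)

lemma pochhammer_Re_one_ge_fact:
 assumes "Re ga = 1"
 shows "norm (pochhammer ga n) \<ge> fact n"
proof (induction n)
 case (Suc n)
 have "norm (ga + of_nat n) \<ge> real n + 1"
  using abs_Re_le_cmod[of "ga + of_nat n"] assms by simp
 then have "fact n * (real n + 1) \<le> norm (pochhammer ga n) * norm (ga + of_nat n)"
  using Suc by (intro mult_mono) auto
 moreover have "fact (Suc n) = (fact n * (real n + 1) :: real)" by (simp add: algebra_simps)
 ultimately show ?case by (simp only: pochhammer_Suc norm_mult)
qed simp

lemma Gamma_integral_lborel:
 assumes "Re z > 0"
 defines "f \<equiv> \<lambda>t. indicator {0<..} t *\<^sub>R (complex_of_real t powr (z - 1) * of_real (exp (- t)))"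
 shows "integrable lborel f" "lint f = Gamma z"
proof -
 have eq: "complex_of_real t powr (z - 1) / of_real (exp t) = complex_of_real t powr (z - 1) * of_real (exp (- t))" for t
  by (simp add: exp_minus field_simps)
 have m: "f \<in> borel_measurable borel"
 proof -
  have "f = (\<lambda>t. indicator {0<..} t *\<^sub>R (exp ((z - 1) * of_real (ln t)) * of_real (exp (- t))))"
   by (rule ext) (auto simp: f_def powr_def indicator_def Ln_of_real)
  then show ?thesis by simp
 qed
 have ai: "set_integrable lebesgue {0<..} (\<lambda>t. complex_of_real t powr (z - 1) * of_real (exp (- t)))"
  using absolutely_integrable_Gamma_integral'[OF assms(1)] unfolding eq .
 then have il: "integrable lebesgue f" unfolding set_integrable_def f_def .
 then show int: "integrable lborel f" using m by (simp add: integrable_completion)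
 have "((\<lambda>t. complex_of_real t powr (z - 1) * of_real (exp (- t))) has_integral Gamma z) {0<..}"
  using Gamma_integral_complex'[OF assms(1)] unfolding eq .
 moreover have "((\<lambda>t. complex_of_real t powr (z - 1) * of_real (exp (- t))) has_integral
   (LINT t:{0<..}|lebesgue. complex_of_real t powr (z - 1) * of_real (exp (- t)))) {0<..}"
  by (rule has_integral_set_lebesgue[OF ai])
 ultimately have "(LINT t:{0<..}|lebesgue. complex_of_real t powr (z - 1) * of_real (exp (- t))) = Gamma z"
  by (rule has_integral_unique[rotated])
 then show "lint f = Gamma z"
  using m unfolding set_lebesgue_integral_def f_def[symmetric]
  by (simp add: integral_completion)
qed

lemma powr_of_real_nat_add:
 fixes y :: real assumes "y > 0"
 shows "complex_of_real y powr (s + of_nat n) = complex_of_real y powr s * of_real (y ^ n)"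
 using assms by (simp add: powr_add powr_nat)

text \<open>The Laplace transform of the confluent series is a binomial series. Its behaviour as \<open>t \<rightarrow>
  1\<close> is governed by the growth of the series at infinity, which is how the growth coefficient is found.\<close>

lemma kummer_laplace:
 fixes m t :: real and al :: complex
 assumes "0 < t" "t < 1"
 defines "ga \<equiv> 1 + 2 * \<i> * of_real m"
 shows "lint (\<lambda>y. indicator {0<..} y *\<^sub>R
   (of_real y powr (ga - 1) * of_real (exp (- y)) * kummer al ga (of_real (t * y))))
  = Gamma ga * of_real (1 - t) powr (- al)"
proof -
 have g: "Re ga = 1" by (simp add: ga_def)
 define c where "c n = pochhammer al n / (pochhammer ga n * fact n) * of_real t ^ n" for n
 define e where "e n y = indicator {0<..} y *\<^sub>R (complex_of_real y powr (ga + of_nat n - 1) * of_real (exp (- y)))" for n y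
 have e: "integrable lborel (e n)" "lint (e n) = Gamma (ga + of_nat n)" for n
  unfolding e_def by (rule Gamma_integral_lborel; simp add: g)+
 have ne: "lint (\<lambda>y. norm (e n y)) = fact n" for n
 proof -
  have "lint (\<lambda>y. indicator {0<..} y *\<^sub>R (complex_of_real y powr (of_nat n + 1 - 1) * of_real (exp (- y))))
    = Gamma (of_nat n + 1)"
   by (rule Gamma_integral_lborel) simp
  also have "(\<lambda>y. indicator {0<..} y *\<^sub>R (complex_of_real y powr (of_nat n + 1 - 1) * of_real (exp (- y))))
   = (\<lambda>y. of_real (norm (e n y)))"
   by (rule ext) (auto simp: e_def indicator_def norm_mult norm_powr_real_powr g powr_nat powr_realpow)
  finally have "complex_of_real (lint (\<lambda>y. norm (e n y))) = of_real (fact n)"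
   by (simp add: Gamma_fact add.commute)
  then show ?thesis using of_real_eq_iff by blast
 qed
 have cf: "norm (c n) * fact n \<le> norm ((- al gchoose n) * (- of_real t) ^ n)" for n
 proof -
  have "(- al gchoose n) * (- of_real t) ^ n = pochhammer al n / fact n * of_real t ^ n"
   by (simp add: gbinomial_pochhammer field_simps flip: power_mult_distrib)
  then have "norm ((- al gchoose n) * (- of_real t) ^ n) = norm (pochhammer al n) / fact n * \<bar>t\<bar> ^ n"
   by (simp add: norm_mult norm_divide norm_power)
  moreover have "norm (c n) * fact n = norm (pochhammer al n) / norm (pochhammer ga n) * \<bar>t\<bar> ^ n"
   by (simp add: c_def norm_mult norm_divide norm_power)
  moreover have "norm (pochhammer al n) / norm (pochhammer ga n) \<le> norm (pochhammer al n) / fact n"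
   by (intro divide_left_mono pochhammer_Re_one_ge_fact[OF g] mult_pos_pos)
    (auto simp: pochhammer_Re_one_nonzero[OF g])
  ultimately show ?thesis by (simp only: mult_right_mono zero_le_power abs_ge_zero)
 qed
 have "summable (\<lambda>n. norm ((- al gchoose n) * (- of_real t) ^ n))"
 proof (rule abs_summable_in_conv_radius)
  show "ereal (norm (- complex_of_real t)) < conv_radius (\<lambda>n. - al gchoose n)"
   using conv_radius_gchoose[of "- al"] assms(1,2) by (auto split: if_splits)
 qed
 then have summ: "summable (\<lambda>n. norm (c n) * fact n)"
  by (rule summable_comparison_test[rotated]) (use cf in auto)
 have S: "(\<lambda>n. lint (\<lambda>y. c n * e n y)) sums lint (\<lambda>y. \<Sum>n. c n * e n y)"
 proof (rule sums_integral)
  show "integrable lborel (\<lambda>y. c n * e n y)" for n using e(1) by simp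
  show "summable (\<lambda>n. lint (\<lambda>y. norm (c n * e n y)))"
   using summ by (simp add: norm_mult ne)
  show "AE y in lborel. summable (\<lambda>n. norm (c n * e n y))"
  proof (rule AE_I2)
   fix y :: real
   show "summable (\<lambda>n. norm (c n * e n y))"
   proof (cases "y > 0")
    case True
    have "ereal (norm (complex_of_real (t * y))) < fps_conv_radius (fps_hypergeo [al] [ga] 1)"
     by (simp add: conv_radius_kummer[OF g])
    from norm_summable_fps[OF this]
    have "summable (\<lambda>n. norm (pochhammer al n / (pochhammer ga n * fact n) * of_real (t * y) ^ n) * exp (- y))"
     by (intro summable_mult2) simp
    also have "(\<lambda>n. norm (pochhammer al n / (pochhammer ga n * fact n) * of_real (t * y) ^ n) * exp (- y))
      = (\<lambda>n. norm (c n * e n y))"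
     using True by (intro ext) (simp add: c_def e_def norm_mult norm_divide norm_power norm_powr_real_powr
       g powr_realpow power_mult_distrib)
    finally show ?thesis .
   qed (simp add: e_def)
  qed
 qed
 have "(\<lambda>y. \<Sum>n. c n * e n y) = (\<lambda>y. indicator {0<..} y *\<^sub>R
   (of_real y powr (ga - 1) * of_real (exp (- y)) * kummer al ga (of_real (t * y))))"
 proof
  fix y :: real
  show "(\<Sum>n. c n * e n y) = indicator {0<..} y *\<^sub>R
   (of_real y powr (ga - 1) * of_real (exp (- y)) * kummer al ga (of_real (t * y)))"
  proof (cases "y > 0")
   case True
   have "c n * e n y = of_real y powr (ga - 1) * of_real (exp (- y)) *
     (pochhammer al n / (pochhammer ga n * fact n) * of_real (t * y) ^ n)" for n
    using True powr_of_real_nat_add[of y "ga - 1" n]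
    by (simp add: c_def e_def power_mult_distrib algebra_simps)
   then show ?thesis
    using sums_mult[OF kummer_sums[OF g, of al "of_real (t * y)"],
      of "of_real y powr (ga - 1) * of_real (exp (- y))"] True
    by (simp add: sums_iff)
  qed (simp add: e_def)
 qed
 moreover have "(\<lambda>n. lint (\<lambda>y. c n * e n y)) = (\<lambda>n. Gamma ga * ((- al gchoose n) * (- of_real t) ^ n))"
 proof
  fix n
  have "Gamma (ga + of_nat n) = pochhammer ga n * Gamma ga"
   using pochhammer_Gamma[of ga n] Gamma_eq_zero_iff[of ga] g
   by (auto simp: nonpos_Ints_def)
  then show "lint (\<lambda>y. c n * e n y) = Gamma ga * ((- al gchoose n) * (- of_real t) ^ n)"
   using pochhammer_Re_one_nonzero[OF g, of n]
   by (simp add: e(2) c_def gbinomial_pochhammer field_simps flip: power_mult_distrib)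
 qed
 moreover have "(\<lambda>n. Gamma ga * ((- al gchoose n) * (- of_real t) ^ n)) sums (Gamma ga * (1 + - of_real t) powr (- al))"
  by (intro sums_mult gen_binomial_complex) (use assms in simp)
 ultimately show ?thesis using S by (simp add: sums_iff)
qed

section \<open>Real solutions that decay at infinity\<close>

lemma isCont_kummer:
 assumes "Re ga = 1"
 shows "isCont (kummer al ga) x"
 by (rule kummer_deriv[OF assms, of al x]) (rule DERIV_isCont)

text \<open>The limit exists by the dichotomy. Its value is read off by letting \<open>t \<rightarrow> 1\<close> in the
  Laplace transform, scaled so that only large arguments contribute.\<close>

lemma uw_limit:
 fixes m r :: real
 assumes m: "m \<noteq> 0" and r: "r \<le> 0"
 shows "((\<lambda>x. uw m (r - 1/2) (complex_of_real x) * of_real (exp (- x / 2) * x powr r))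
  \<longlongrightarrow> Gamma (1 + 2 * \<i> * of_real m) / Gamma (1 - Complex r (- m))) at_top"
proof -
 define ga where "ga = 1 + 2 * \<i> * complex_of_real m"
 define al where "al = 1 - Complex r (- m)"
 have g: "Re ga = 1" by (simp add: ga_def)
 have a: "Re al > 0" using r by (simp add: al_def)
 obtain l where l: "((\<lambda>x. uw m (r - 1/2) (complex_of_real x) * of_real (exp (- x / 2) * x powr r)) \<longlongrightarrow> l) at_top"
  using uw_limit_exists[OF m] by blast
 have aeq: "1/2 + \<i> * of_real m - complex_of_real (r - 1/2) = al"
  by (simp add: al_def complex_eq_iff)
 define h where "h x = uw m (r - 1/2) (complex_of_real x) * of_real (exp (- x / 2) * x powr r)" for x
 have h_eq: "h x = of_real (exp (- x)) * of_real x powr (\<i> * m + r) * kummer al ga (of_real x)" if "x > 0" for x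
 proof -
  have "exp (- complex_of_real x / 2) * of_real (exp (- x / 2)) = of_real (exp (- x / 2) * exp (- x / 2))"
   by (simp flip: exp_of_real)
  also have "exp (- x / 2) * exp (- x / 2) = exp (- x)" by (simp flip: exp_add)
  finally have e: "exp (- complex_of_real x / 2) * of_real (exp (- x / 2)) = of_real (exp (- x))" .
  have p: "of_real x powr (\<i> * m + r) = of_real x powr (\<i> * m) * complex_of_real (x powr r)"
   using that by (simp add: powr_add powr_of_real)
  have "h x = (exp (- complex_of_real x / 2) * of_real (exp (- x / 2))) *
    (of_real x powr (\<i> * m) * complex_of_real (x powr r)) * kummer al ga (of_real x)"
   unfolding h_def uw_def aeq ga_def[symmetric] by simp
  then show ?thesis unfolding e p .
 qed
 obtain B where B: "B \<ge> 0" "\<And>x. x > 0 ==> norm (h x) \<le> B * (1 + x powr r)"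
 proof -
  have "\<forall>\<^sub>F x in at_top. norm (h x) < norm l + 1"
   using l unfolding h_def[symmetric]
   by (intro order_tendstoD(2)[OF tendsto_norm]) auto
  then obtain Y where Y: "\<And>x. x \<ge> Y ==> norm (h x) < norm l + 1"
   by (auto simp: eventually_at_top_linorder)
  have cpt: "compact ((\<lambda>x. norm (kummer al ga (complex_of_real x))) ` {0..\<bar>Y\<bar>})"
  proof (intro compact_continuous_image continuous_on_norm)
   have "continuous_on UNIV (kummer al ga)"
    by (rule continuous_at_imp_continuous_on) (simp add: isCont_kummer[OF g])
   then show "continuous_on {0..\<bar>Y\<bar>} (\<lambda>x. kummer al ga (complex_of_real x))"
    by (rule continuous_on_compose2) (auto intro: continuous_intros)
  qed simp
  obtain K where K: "\<And>x. x \<in> {0..\<bar>Y\<bar>} ==> norm (kummer al ga (complex_of_real x)) \<le> K"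
  proof -
   assume a: "\<And>K. (\<And>x. x \<in> {0..\<bar>Y\<bar>} ==> norm (kummer al ga (complex_of_real x)) \<le> K) ==> thesis"
   obtain K where "\<forall>y\<in>(\<lambda>x. norm (kummer al ga (complex_of_real x))) ` {0..\<bar>Y\<bar>}. norm y \<le> K"
    using compact_imp_bounded[OF cpt] unfolding bounded_iff by blast
   then show thesis by (intro a[of K]) auto
  qed
  have K0: "K \<ge> 0" using order_trans[OF norm_ge_zero K[of 0]] by simp
  show ?thesis
  proof (rule that[of "K + norm l + 1"])
   fix x :: real assume x: "x > 0"
   show "norm (h x) \<le> (K + norm l + 1) * (1 + x powr r)"
   proof (cases "x \<ge> Y")
    case True
    have "norm (h x) \<le> (norm l + 1) * 1" using Y[OF True] by simp
    also have "\<dots> \<le> (K + norm l + 1) * (1 + x powr r)" using K0 by (intro mult_mono) auto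
    finally show ?thesis .
   next
    case False
    have "norm (h x) = exp (- x) * x powr r * norm (kummer al ga (of_real x))"
     unfolding h_eq[OF x] using x by (simp add: norm_mult norm_powr_real_powr)
    also have "\<dots> \<le> 1 * x powr r * K"
     using x False by (intro mult_mono K) auto
    also have "\<dots> \<le> (K + norm l + 1) * (1 + x powr r)"
     using K0 by (subst mult.commute, intro mult_mono) auto
    finally show ?thesis .
   qed
  qed (use K0 in simp)
 qed
 define S where "S n u = indicator {0<..} u *\<^sub>R (complex_of_real u powr (al - 1) * of_real (exp (- u)) * h ((real n + 1) * u))" for n u
 have main: "Gamma ga = of_real ((real n + 1) / (real n + 2)) powr (- (\<i> * m + r)) * lint (S n)" for n
 proof -
  define ep where "ep = 1 / (real n + 2)"
  define t where "t = (real n + 1) / (real n + 2)"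
  have t: "0 < t" "t < 1" "1 - t = ep" "ep > 0" by (auto simp: t_def ep_def field_simps)
  define f where "f y = indicator {0<..} y *\<^sub>R
   (complex_of_real y powr (ga - 1) * of_real (exp (- y)) * kummer al ga (of_real (t * y)))" for y
  have "Gamma ga * of_real ep powr (- al) = lint f"
   using kummer_laplace[OF t(1,2), of m al] unfolding ga_def[symmetric] t(3) f_def by simp
  also have "\<dots> = \<bar>1 / ep\<bar> *\<^sub>R lint (\<lambda>u. f (0 + 1 / ep * u))"
   by (rule lborel_integral_real_affine) (use t in simp)
  also have "(\<lambda>u. f (0 + 1 / ep * u)) = (\<lambda>u. (of_real ep powr (1 - al) * of_real t powr (- (\<i> * m + r))) * S n u)"
  proof
   fix u :: real
   show "f (0 + 1 / ep * u) = (of_real ep powr (1 - al) * of_real t powr (- (\<i> * m + r))) * S n u"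
   proof (cases "u > 0")
    case True
    have te: "t / ep = real n + 1" by (simp add: t_def ep_def)
    define x where "x = (real n + 1) * u"
    have x: "x > 0" using True by (simp add: x_def)
    have "t * (1 / ep * u) = (t / ep) * u" by simp
    then have xt: "t * (1 / ep * u) = x" unfolding te x_def .
    have ue: "1 / ep * u = u + x" unfolding x_def ep_def by (simp add: algebra_simps)
    have lnx: "ln x = ln t - ln ep + ln u"
     using t True by (simp add: x_def te[symmetric] ln_mult ln_div)
    have lnue: "ln (1 / ep * u) = ln u - ln ep"
     using t True by (simp add: ln_mult ln_div)
    have ee: "exp (- (1 / ep * u)) = exp (- u) * exp (- x)" unfolding ue by (simp flip: exp_add)
    have "of_real (1 / ep * u) powr (ga - 1) =
      (of_real ep powr (1 - al) * of_real t powr (- (\<i> * m + r))) * (of_real u powr (al - 1) * complex_of_real x powr (\<i> * m + r))"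
    proof -
     have P: "complex_of_real y powr s = exp (s * of_real (ln y))" if "y > 0" for y s
      using that by (simp add: powr_def Ln_of_real)
     have pos: "1 / ep * u > 0" using t True by simp
     have "(ga - 1) * of_real (ln (1 / ep * u)) = (1 - al) * of_real (ln ep) + (- (\<i> * m + r)) * of_real (ln t) +
       ((al - 1) * of_real (ln u) + (\<i> * m + r) * complex_of_real (ln x))"
      unfolding lnue lnx by (simp add: ga_def al_def complex_eq_iff algebra_simps)
     then show ?thesis
      unfolding P[OF pos] P[OF t(4)] P[OF t(1)] P[OF True] P[OF x] exp_add[symmetric] by simp
    qed
    then have "f (0 + 1 / ep * u) = (of_real ep powr (1 - al) * of_real t powr (- (\<i> * m + r))) *
      (of_real u powr (al - 1) * of_real (exp (- u)) *
       (of_real (exp (- x)) * complex_of_real x powr (\<i> * m + r) * kummer al ga (of_real x)))"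
     using True t unfolding f_def add_0 ee xt by (simp add: mult_ac)
    then show ?thesis using True by (simp add: S_def h_eq[OF x, folded x_def] x_def[symmetric])
   next
    case False
    then have "\<not> 0 + 1 / ep * u > 0" using t by (simp add: zero_less_divide_iff)
    then have "indicator {0<..} (0 + 1 / ep * u) = (0 :: real)" by (simp del: add_0)
    then show ?thesis using False unfolding f_def S_def by (simp only:) simp
   qed
  qed
  finally have "Gamma ga * of_real ep powr (- al) =
    of_real (1 / ep) * (of_real ep powr (1 - al) * of_real t powr (- (\<i> * m + r)) * lint (S n))"
   using t by (simp add: scaleR_conv_of_real)
  moreover have "complex_of_real ep powr (1 - al) = of_real ep * of_real ep powr (- al)"
   using t powr_add[of "complex_of_real ep" 1 "- al"] by simp
  ultimately have "of_real ep powr (- al) * Gamma ga = of_real ep powr (- al) * (of_real t powr (- (\<i> * m + r)) * lint (S n))"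
   using t by (simp add: mult_ac)
  moreover have "complex_of_real ep powr (- al) \<noteq> 0" using t by simp
  ultimately show ?thesis unfolding t_def using mult_left_cancel by blast
 qed
 define Slim where "Slim u = l * (indicator {0<..} u *\<^sub>R (complex_of_real u powr (al - 1) * of_real (exp (- u))))" for u
 define dom where "dom u = B * (norm (indicator {0<..} u *\<^sub>R (complex_of_real u powr (of_real (1 - r) - 1) * of_real (exp (- u))))
   + norm (indicator {0<..} u *\<^sub>R (complex_of_real u powr (1 - 1) * of_real (exp (- u)))))" for u
 have "(\<lambda>n. lint (S n)) \<longlonglongrightarrow> lint Slim"
 proof (rule integral_dominated_convergence[where w = dom])
  have hm: "(\<lambda>u. indicator {0<..} u *\<^sub>R h ((real n + 1) * u)) \<in> borel_measurable borel" for n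
  proof -
   have "(\<lambda>u. indicator {0<..} u *\<^sub>R h ((real n + 1) * u)) = (\<lambda>u. indicator {0<..} u *\<^sub>R (of_real (exp (- ((real n + 1) * u))) * exp ((\<i> * m + r) * of_real (ln ((real n + 1) * u))) * kummer al ga (of_real ((real n + 1) * u))))"
   proof
    fix u :: real
    show "indicator {0<..} u *\<^sub>R h ((real n + 1) * u) = indicator {0<..} u *\<^sub>R (of_real (exp (- ((real n + 1) * u))) * exp ((\<i> * m + r) * of_real (ln ((real n + 1) * u))) * kummer al ga (of_real ((real n + 1) * u)))"
    proof (cases "u > 0")
     case True
     define v where "v = (real n + 1) * u"
     have "v > 0" using True by (simp add: v_def)
     then show ?thesis unfolding v_def[symmetric] h_eq[OF \<open>v > 0\<close>] powr_def by (simp add: Ln_of_real)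
    qed simp
   qed
   moreover have "kummer al ga \<in> borel_measurable borel"
    by (intro borel_measurable_continuous_onI continuous_at_imp_continuous_on) (simp add: isCont_kummer[OF g])
   ultimately show ?thesis by simp
  qed
  have am: "(\<lambda>u. indicator {0<..} u *\<^sub>R (complex_of_real u powr (al - 1) * of_real (exp (- u)))) \<in> borel_measurable borel"
   using borel_measurable_integrable[OF Gamma_integral_lborel(1)[OF a]] by simp
  show "Slim \<in> borel_measurable lborel" unfolding Slim_def using borel_measurable_times[OF borel_measurable_const am] by simp
  show "S n \<in> borel_measurable lborel" for n
  proof -
   have "S n = (\<lambda>u. (indicator {0<..} u *\<^sub>R (complex_of_real u powr (al - 1) * of_real (exp (- u)))) * (indicator {0<..} u *\<^sub>R h ((real n + 1) * u)))"
    by (rule ext) (simp add: S_def indicator_def)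
   then show ?thesis using borel_measurable_times[OF am hm[of n]] by (simp only: measurable_lborel2)
  qed
  show "integrable lborel dom" unfolding dom_def
   by (intro integrable_mult_right Bochner_Integration.integrable_add integrable_norm Gamma_integral_lborel(1)) (use r in auto)
  show "AE u in lborel. norm (S n u) \<le> dom u" for n
  proof (rule AE_I2)
   fix u :: real
   show "norm (S n u) \<le> dom u"
   proof (cases "u > 0")
    case True
    have "((real n + 1) * u) powr r \<le> u powr r"
     by (rule powr_mono2') (use True r in \<open>auto simp: algebra_simps\<close>)
    then have "norm (h ((real n + 1) * u)) \<le> B * (1 + u powr r)"
     using B(2)[of "(real n + 1) * u"] B(1) True by (smt (verit) mult_left_mono mult_pos_pos of_nat_0_le_iff)
    then have "u powr (- r) * exp (- u) * norm (h ((real n + 1) * u)) \<le> u powr (- r) * exp (- u) * (B * (1 + u powr r))"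
     by (intro mult_left_mono) auto
    also have "\<dots> = B * (u powr (- r) * exp (- u) + (u powr (- r) * u powr r) * exp (- u))"
     by (simp add: algebra_simps)
    also have "u powr (- r) * u powr r = 1" using True by (simp flip: powr_add)
    finally show ?thesis using True
     by (simp add: S_def dom_def norm_mult norm_powr_real_powr al_def)
   qed (simp add: S_def dom_def)
  qed
  show "AE u in lborel. (\<lambda>n. S n u) \<longlonglongrightarrow> Slim u"
  proof (rule AE_I2)
   fix u :: real
   show "(\<lambda>n. S n u) \<longlonglongrightarrow> Slim u"
   proof (cases "u > 0")
    case True
    have "filterlim (\<lambda>n. (real n + 1) * u) at_top sequentially" using True by real_asymp
    from filterlim_compose[OF l[folded h_def] this]
    have "(\<lambda>n. h ((real n + 1) * u)) \<longlonglongrightarrow> l" .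
    then have "(\<lambda>n. indicator {0<..} u *\<^sub>R (complex_of_real u powr (al - 1) * of_real (exp (- u)) * h ((real n + 1) * u))) \<longlonglongrightarrow>
      indicator {0<..} u *\<^sub>R (complex_of_real u powr (al - 1) * of_real (exp (- u)) * l)"
     by (intro tendsto_intros)
    then show ?thesis by (simp add: S_def Slim_def mult_ac)
   qed (simp add: S_def Slim_def)
  qed
 qed
 moreover have "lint Slim = l * Gamma al"
  unfolding Slim_def by (subst integral_mult_right_zero) (simp only: Gamma_integral_lborel[OF a])
 ultimately have lim1: "(\<lambda>n. lint (S n)) \<longlonglongrightarrow> l * Gamma al" by simp
 have "(\<lambda>n. complex_of_real ((real n + 1) / (real n + 2)) powr (- (\<i> * m + r))) \<longlonglongrightarrow> of_real 1 powr (- (\<i> * m + r))"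
 proof (intro tendsto_intros)
  show "(\<lambda>n. (real n + 1) / (real n + 2)) \<longlonglongrightarrow> 1" by real_asymp
 qed auto
 then have "(\<lambda>n. complex_of_real ((real n + 1) / (real n + 2)) powr (- (\<i> * m + r)) * lint (S n)) \<longlonglongrightarrow> 1 * (l * Gamma al)"
  by (intro tendsto_mult lim1) simp
 then have "(\<lambda>n::nat. Gamma ga) \<longlonglongrightarrow> l * Gamma al" unfolding main[symmetric] by simp
 then have "Gamma ga = l * Gamma al" by (simp add: LIMSEQ_const_iff)
 moreover have "Gamma al \<noteq> 0" using a by (intro Gamma_nonzero) (auto elim!: nonpos_Ints_cases)
 ultimately have "l = Gamma ga / Gamma al" by (simp add: field_simps)
 then show ?thesis using l unfolding ga_def al_def by simp
qed

text \<open>The real solution \<open>x powr (-1/2) * W\<close>. It is written as a real part because this is its value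
  for imaginary second index.\<close>

definition wh :: "real => real => real => real" where
 "wh m \<kappa> x = Re (2 * (Gamma (- 2 * \<i> * m) * rGamma (1/2 - \<i> * m - \<kappa>)) * uw m \<kappa> (of_real x))"

lemma rGamma_minus_complex: "rGamma (- z) = - z * rGamma (1 - (z::complex))"
 using rGamma_plus1[of "- z"] by (simp add: algebra_simps)

lemma wh_deriv:
 fixes r m x :: real
 assumes x: "x > 0"
 shows "(wh m (r + 1/2) has_real_derivative (((r - x / 2) * wh m (r + 1/2) x + (r^2 + m^2) * wh m (r - 1/2) x) / x)) (at x)"
  and "(wh m (r - 1/2) has_real_derivative (((x / 2 - r) * wh m (r - 1/2) x - wh m (r + 1/2) x) / x)) (at x)"
proof -
 define z where "z = Complex r m"
 have nn: "complex_of_real x \<notin> \<real>\<^sub>\<le>\<^sub>0" using x complex_nonpos_Reals_iff by auto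
 have e1: "1/2 - \<i> * m - complex_of_real (r + 1/2) = - z" by (simp add: z_def complex_eq_iff)
 have e2: "1/2 - \<i> * m - complex_of_real (r - 1/2) = 1 - z" by (simp add: z_def complex_eq_iff)
 define c where "c = 2 * (Gamma (- 2 * \<i> * m) * rGamma (1 - z))"
 have w1: "wh m (r + 1/2) = (\<lambda>x. Re ((- z * c) * uw m (r + 1/2) (of_real x)))"
  unfolding wh_def e1 rGamma_minus_complex c_def by (intro ext arg_cong[of _ _ Re]) simp
 have w2: "wh m (r - 1/2) = (\<lambda>x. Re (c * uw m (r - 1/2) (of_real x)))"
  unfolding wh_def e2 c_def ..
 let ?U = "uw m (r + 1/2) (of_real x)" and ?V = "uw m (r - 1/2) (of_real x)"
 note d = uw_deriv[OF nn, where r = r and m = m, folded z_def]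
 have zz: "z * cnj z = of_real (r^2 + m^2)"
  by (simp add: z_def complex_eq_iff power2_eq_square)
 have "(- z * c) * (((of_real r - of_real x / 2) * ?U - cnj z * ?V) / of_real x)
   = (of_real (r - x / 2) * ((- z * c) * ?U) + (z * cnj z) * (c * ?V)) / of_real x"
  using x by (simp add: field_simps)
 note Re_lincomb[OF this[unfolded zz]]
 with has_real_derivative_Re[OF d(1), of "- z * c"]
 show "(wh m (r + 1/2) has_real_derivative (((r - x / 2) * wh m (r + 1/2) x + (r^2 + m^2) * wh m (r - 1/2) x) / x)) (at x)"
  unfolding w1 w2 by (simp only:)
 have "c * (((of_real x / 2 - of_real r) * ?V + z * ?U) / of_real x)
   = (of_real (x / 2 - r) * (c * ?V) - of_real 1 * ((- z * c) * ?U)) / of_real x"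
  using x by (simp add: field_simps)
 note Re_lincomb'[OF this]
 with has_real_derivative_Re[OF d(2), of c]
 show "(wh m (r - 1/2) has_real_derivative (((x / 2 - r) * wh m (r - 1/2) x - wh m (r + 1/2) x) / x)) (at x)"
  unfolding w1 w2 by (simp only: mult_1)
qed

lemma cnj_Gamma_complex: "cnj (Gamma z) = Gamma (cnj z)"
 by (simp add: Gamma_def cnj_rGamma)

lemma Re_of_real_mult: "Re (of_real t * y) = t * Re y"
 by simp

text \<open>The combination of the two conjugate solutions is chosen so that the growing parts add up to a purely
  imaginary number.\<close>

lemma wh_limit_0:
 fixes m r :: real
 assumes m: "m \<noteq> 0" and r: "r \<le> 0"
 shows "((\<lambda>x. wh m (r - 1/2) x * exp (- x / 2) * x powr r) \<longlongrightarrow> 0) at_top"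
proof -
 define z where "z = Complex r m"
 define s where "s = 2 * \<i> * complex_of_real m"
 have e2: "1/2 - \<i> * m - complex_of_real (r - 1/2) = 1 - z" by (simp add: z_def complex_eq_iff)
 have cz: "Complex r (- m) = cnj z" by (simp add: z_def complex_eq_iff)
 define c where "c = 2 * (Gamma (- 2 * \<i> * m) * rGamma (1 - z))"
 have "((\<lambda>x. Re (c * (uw m (r - 1/2) (complex_of_real x) * of_real (exp (- x / 2) * x powr r))))
  \<longlongrightarrow> Re (c * (Gamma (1 + 2 * \<i> * of_real m) / Gamma (1 - Complex r (- m))))) at_top"
  by (intro tendsto_intros uw_limit m r)
 moreover have "Re (c * (uw m (r - 1/2) (complex_of_real x) * of_real (exp (- x / 2) * x powr r)))
   = wh m (r - 1/2) x * exp (- x / 2) * x powr r" for x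
 proof -
  have "c * (uw m (r - 1/2) (complex_of_real x) * of_real (exp (- x / 2) * x powr r))
   = of_real (exp (- x / 2) * x powr r) * (c * uw m (r - 1/2) (complex_of_real x))" by simp
  then have "Re (c * (uw m (r - 1/2) (complex_of_real x) * of_real (exp (- x / 2) * x powr r)))
   = Re (of_real (exp (- x / 2) * x powr r) * (c * uw m (r - 1/2) (complex_of_real x)))" by (simp only:)
  also have "\<dots> = (exp (- x / 2) * x powr r) * Re (c * uw m (r - 1/2) (complex_of_real x))"
   by (rule Re_of_real_mult)
  finally show ?thesis unfolding wh_def e2 c_def[symmetric] by (simp only: mult_ac)
 qed
 moreover have "Re (c * (Gamma (1 + 2 * \<i> * of_real m) / Gamma (1 - Complex r (- m)))) = 0"
 proof -
  have "s \<noteq> 0" using m by (simp add: s_def)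
  then have g1: "Gamma (1 + s) = s * Gamma s"
  proof -
   have "s \<notin> \<int>\<^sub>\<le>\<^sub>0" using m by (auto simp: s_def complex_eq_iff elim!: nonpos_Ints_cases)
   then show ?thesis unfolding add.commute[of 1 s] by (rule Gamma_plus1)
  qed
  have "Gamma (- s) = cnj (Gamma s)" by (simp add: cnj_Gamma_complex s_def)
  then have "Gamma (- s) * Gamma (1 + s) = s * of_real ((norm (Gamma s))^2)"
   unfolding g1 complex_norm_square by simp
  moreover have "rGamma (1 - z) * rGamma (1 - cnj z) = of_real ((norm (rGamma (1 - z)))^2)"
   unfolding complex_norm_square by (simp add: cnj_rGamma)
  moreover have "c * (Gamma (1 + 2 * \<i> * of_real m) / Gamma (1 - Complex r (- m)))
    = 2 * ((Gamma (- s) * Gamma (1 + s)) * (rGamma (1 - z) * rGamma (1 - cnj z)))"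
   unfolding cz by (simp add: c_def s_def rGamma_inverse_Gamma field_simps)
  ultimately have "c * (Gamma (1 + 2 * \<i> * of_real m) / Gamma (1 - Complex r (- m)))
   = of_real (4 * m * (norm (Gamma s))^2 * (norm (rGamma (1 - z)))^2) * \<i>" by (simp add: s_def)
  then show ?thesis by simp
 qed
 ultimately show ?thesis by simp
qed

text \<open>For \<open>r \<le> 0\<close> the growth coefficient vanishes. The general case follows by induction, since
  the second function of one system is the first function of the system shifted by one.\<close>

lemma wh_decay:
 assumes m: "m \<noteq> 0"
 shows "\<exists>C Y. \<forall>x\<ge>Y. \<bar>wh m \<kappa> x\<bar> \<le> C * exp (- x / 4)"
proof -
 have pair: "\<exists>C Y. \<forall>x\<ge>Y. \<bar>wh m (r + 1/2) x\<bar> \<le> C * exp (- x / 4) \<and> \<bar>sqrt (r^2 + m^2) * wh m (r - 1/2) x\<bar> \<le> C * exp (- x / 4)"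
  if l: "((\<lambda>x. wh m (r - 1/2) x * exp (- x / 2) * x powr r) \<longlongrightarrow> 0) at_top" for r
 proof (rule system_limit(2)[where w = "sqrt (r^2 + m^2)" and X = 1 and r = r])
  have pos: "r^2 + m^2 > 0" using m by (simp add: add_nonneg_pos)
  then show "sqrt (r^2 + m^2) > 0" by simp
  have ss: "sqrt (r^2 + m^2) * (sqrt (r^2 + m^2) * t) = (r^2 + m^2) * t" for t
   using pos by (simp add: mult.assoc[symmetric])
  show "(wh m (r + 1/2) has_real_derivative ((r - x / 2) * wh m (r + 1/2) x + sqrt (r^2 + m^2) * (sqrt (r^2 + m^2) * wh m (r - 1/2) x)) / x) (at x)"
   if "x \<ge> 1" for x unfolding ss using wh_deriv(1)[of x m r] that by simp
  show "((\<lambda>x. sqrt (r^2 + m^2) * wh m (r - 1/2) x) has_real_derivative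
   ((x / 2 - r) * (sqrt (r^2 + m^2) * wh m (r - 1/2) x) - sqrt (r^2 + m^2) * wh m (r + 1/2) x) / x) (at x)"
   if "x \<ge> 1" for x using DERIV_cmult[OF wh_deriv(2)[of x m r], of "sqrt (r^2 + m^2)"] that
   by (auto elim!: DERIV_cong simp: field_simps)
  show "((\<lambda>x. sqrt (r^2 + m^2) * wh m (r - 1/2) x * exp (- x / 2) * x powr r) \<longlongrightarrow> 0) at_top"
   using tendsto_mult_right_zero[OF l, of "sqrt (r^2 + m^2)"] by (simp add: mult.assoc)
 qed simp
 have "\<exists>C Y. \<forall>x\<ge>Y. \<bar>wh m (r + 1/2) x\<bar> \<le> C * exp (- x / 4)" if "r \<le> real n" for r n
  using that
 proof (induction n arbitrary: r)
  case 0
  then have "r \<le> 0" by simp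
  from pair[OF wh_limit_0[OF m this]] obtain C Y where
   "\<forall>x\<ge>Y. \<bar>wh m (r + 1/2) x\<bar> \<le> C * exp (- x / 4) \<and> \<bar>sqrt (r^2 + m^2) * wh m (r - 1/2) x\<bar> \<le> C * exp (- x / 4)"
   by (elim exE)
  then show ?case by (intro exI[of _ C] exI[of _ Y]) simp
 next
  case (Suc n)
  then have "r - 1 \<le> real n" by simp
  from Suc.IH[OF this] obtain C Y where C': "\<forall>x\<ge>Y. \<bar>wh m (r - 1 + 1/2) x\<bar> \<le> C * exp (- x / 4)"
   by (elim exE)
  have C: "\<bar>wh m (r - 1/2) x\<bar> \<le> C * exp (- x / 4)" if "x \<ge> Y" for x
   using C' that by simp
  have "((\<lambda>x. wh m (r - 1/2) x * exp (- x / 2) * x powr r) \<longlongrightarrow> 0) at_top"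
  proof (rule Lim_null_comparison)
   have "((\<lambda>x. C * (exp (- (3/4) * x) * x powr r)) \<longlongrightarrow> C * 0) at_top"
    by (intro tendsto_intros exp_powr_tendsto_0) simp
   then show "((\<lambda>x. C * (exp (- (3/4) * x) * x powr r)) \<longlongrightarrow> 0) at_top" by simp
   show "\<forall>\<^sub>F x in at_top. norm (wh m (r - 1/2) x * exp (- x / 2) * x powr r) \<le> C * (exp (- (3/4) * x) * x powr r)"
    using eventually_ge_at_top[of Y]
   proof eventually_elim
    case (elim x)
    have "norm (wh m (r - 1/2) x * exp (- x / 2) * x powr r) = \<bar>wh m (r - 1/2) x\<bar> * (exp (- x / 2) * x powr r)"
     by (simp add: abs_mult)
    also have "\<dots> \<le> C * exp (- x / 4) * (exp (- x / 2) * x powr r)"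
     using C[OF elim] by (intro mult_right_mono) auto
    also have "\<dots> = C * ((exp (- x / 4) * exp (- x / 2)) * x powr r)" by simp
    also have "exp (- x / 4) * exp (- x / 2) = exp (- (3/4) * x)" by (simp flip: exp_add)
    finally show ?case .
   qed
  qed
  from pair[OF this] obtain C Y where
   "\<forall>x\<ge>Y. \<bar>wh m (r + 1/2) x\<bar> \<le> C * exp (- x / 4) \<and> \<bar>sqrt (r^2 + m^2) * wh m (r - 1/2) x\<bar> \<le> C * exp (- x / 4)"
   by (elim exE)
  then show ?case by (intro exI[of _ C] exI[of _ Y]) simp
 qed
 moreover have "\<kappa> - 1/2 \<le> real (nat \<lceil>\<kappa>\<rceil>)" using real_nat_ceiling_ge[of \<kappa>] by linarith
 ultimately have "\<exists>C Y. \<forall>x\<ge>Y. \<bar>wh m (\<kappa> - 1/2 + 1/2) x\<bar> \<le> C * exp (- x / 4)" .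
 then show ?thesis by simp
qed

lemma wh_asymp_0:
 fixes m \<kappa> :: real
 shows "((\<lambda>x. wh m \<kappa> x - Re (2 * (Gamma (- 2 * \<i> * m) * rGamma (1/2 - \<i> * m - \<kappa>)) * of_real x powr (\<i> * m))) \<longlongrightarrow> 0) (at_right 0)"
proof -
 define c where "c = 2 * (Gamma (- 2 * \<i> * m) * rGamma (1/2 - \<i> * m - \<kappa>))"
 define g where "g x = exp (- complex_of_real x / 2) * kummer (1/2 + \<i> * m - \<kappa>) (1 + 2 * \<i> * m) (of_real x) - 1" for x
 have "isCont g 0" unfolding g_def
  by (intro continuous_intros isCont_o2[OF _ isCont_kummer]) auto
 then have "(g \<longlongrightarrow> 0) (at_right 0)"
  using kummer_0 by (auto simp: isCont_def g_def intro: tendsto_within_subset)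
 then have "((\<lambda>x. norm c * norm (g x)) \<longlongrightarrow> norm c * norm (0::complex)) (at_right 0)"
  by (intro tendsto_intros)
 then have lim: "((\<lambda>x. norm c * norm (g x)) \<longlongrightarrow> 0) (at_right 0)" by simp
 show ?thesis unfolding c_def[symmetric]
 proof (rule Lim_null_comparison[OF _ lim])
  show "\<forall>\<^sub>F x in at_right 0. norm (wh m \<kappa> x - Re (c * of_real x powr (\<i> * m))) \<le> norm c * norm (g x)"
   using eventually_at_right_less[of 0]
  proof eventually_elim
   case (elim x)
   have "wh m \<kappa> x - Re (c * of_real x powr (\<i> * m)) = Re (c * of_real x powr (\<i> * m) * g x)"
    unfolding wh_def c_def[symmetric] uw_def g_def minus_complex.sel(1)[symmetric]
    by (intro arg_cong[of _ _ Re]) (simp add: algebra_simps)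
   moreover have "norm (c * of_real x powr (\<i> * m) * g x) = norm c * norm (g x)"
    using elim by (simp add: norm_mult norm_powr_real_powr)
   ultimately show ?case using abs_Re_le_cmod by (metis real_norm_def)
  qed
 qed
qed

section \<open>Pairs of functions and their integrable kernel\<close>

lemma integrable_inverse_square_bound:
 fixes f :: "real => real"
 assumes "f \<in> borel_measurable borel" "AE y in lborel. \<bar>f y\<bar> \<le> B * inverse (1 + y^2)"
 shows "integrable lborel f"
proof (rule Bochner_Integration.integrable_bound)
 have "integrable lborel (\<lambda>x::real. inverse (1 + x^2))"
  using integrable_inverse_1_plus_square by (simp add: set_integrable_def)
 then show "integrable lborel (\<lambda>y. B * inverse (1 + y^2))" by simp
 show "AE y in lborel. norm (f y) \<le> norm (B * inverse (1 + y^2))"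
  using assms(2) by (rule AE_mp) (auto intro!: AE_I2 intro: order_trans[OF _ abs_ge_self])
qed (use assms in simp)

lemma max_square_bound:
 fixes c y :: real
 assumes "c > 0"
 shows "1 / (max c \<bar>y\<bar>)^2 \<le> (2 / (min c 1)^2) * inverse (1 + y^2)"
proof -
 define d where "d = min c 1"
 have d: "0 < d" "d \<le> c" "d \<le> 1" using assms by (auto simp: d_def)
 have "d^2 * (1 + y^2) \<le> 2 * (max c \<bar>y\<bar>)^2"
 proof -
  have "d^2 \<le> (max c \<bar>y\<bar>)^2" using d by (intro power_mono) auto
  moreover have "d^2 * y^2 \<le> 1 * (max c \<bar>y\<bar>)^2"
   using d power_le_one[of d 2] power_mono[of "\<bar>y\<bar>" "max c \<bar>y\<bar>" 2] by (intro mult_mono) auto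
  ultimately show ?thesis by (simp add: distrib_left)
 qed
 moreover have "(max c \<bar>y\<bar>)^2 > 0" "1 + y^2 > 0" using assms by (auto simp: max_def add_pos_nonneg)
 moreover have "1 / X \<le> (2 / D) * inverse Y" if "D * Y \<le> 2 * X" "X > 0" "Y > 0" "D > 0" for D X Y :: real
  using that by (simp add: field_simps)
 moreover have "d^2 > 0" using d by simp
 ultimately show ?thesis unfolding d_def[symmetric] by blast
qed

lemma exp_abs_bound:
 fixes c y :: real
 assumes "c > 0"
 shows "exp (- c * \<bar>y\<bar>) \<le> (max 1 (2 / c^2)) * inverse (1 + y^2)"
proof -
 have "1 + c * \<bar>y\<bar> + (c * \<bar>y\<bar>)^2 / 2 \<le> exp (c * \<bar>y\<bar>)"
  using exp_lower_Taylor_quadratic[of "c * \<bar>y\<bar>"] assms by simp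
 moreover have "c * \<bar>y\<bar> \<ge> 0" using assms by simp
 ultimately have "1 + c^2 * y^2 / 2 \<le> exp (c * \<bar>y\<bar>)" unfolding power_mult_distrib power2_abs by linarith
 moreover have "1 + y^2 \<le> (max 1 (2 / c^2)) * (1 + c^2 * y^2 / 2)"
 proof -
  have "y^2 = 2 / c^2 * (c^2 * y^2 / 2)" using assms by simp
  also have "\<dots> \<le> max 1 (2 / c^2) * (c^2 * y^2 / 2)" by (intro mult_right_mono) auto
  finally show ?thesis unfolding distrib_left mult_1_right by (intro add_mono) auto
 qed
 ultimately have "1 + y^2 \<le> (max 1 (2 / c^2)) * exp (c * \<bar>y\<bar>)"
  by (meson max.cobounded1 mult_left_mono order_trans zero_le_one)
 moreover have "1 + y^2 > 0" by (simp add: add_pos_nonneg)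
 ultimately show ?thesis by (simp add: exp_minus field_simps)
qed

text \<open>Differentiation under the integral sign, by dominated convergence of the difference quotients.\<close>

lemma has_real_derivative_lborel_integral:
 fixes f f' :: "real => real => real"
 assumes d: "\<delta> > 0"
  and int: "\<And>t. \<bar>t - t0\<bar> < \<delta> ==> integrable lborel (f t)"
  and deriv: "AE s in lborel. \<forall>t. \<bar>t - t0\<bar> < \<delta> \<longrightarrow> ((\<lambda>t. f t s) has_real_derivative f' t s) (at t)"
  and bound: "AE s in lborel. \<forall>t. \<bar>t - t0\<bar> < \<delta> \<longrightarrow> \<bar>f' t s\<bar> \<le> g s"
  and g: "integrable lborel g"
  and m: "f' t0 \<in> borel_measurable borel"
 shows "((\<lambda>t. lint (f t)) has_real_derivative lint (f' t0)) (at t0)"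
 unfolding DERIV_def tendsto_at_iff_sequentially
proof (intro allI impI)
 fix X :: "nat => real" assume X: "\<forall>i. X i \<in> UNIV - {0}" "X \<longlonglongrightarrow> 0"
 have X0: "X i \<noteq> 0" for i using X(1) by auto
 define Y where "Y i s = (if \<bar>X i\<bar> < \<delta> then (f (t0 + X i) s - f t0 s) / X i else 0)" for i s
 have ev: "\<forall>\<^sub>F i in sequentially. \<bar>X i\<bar> < \<delta>"
  using order_tendstoD(2)[OF tendsto_rabs[OF X(2)], of \<delta>] d by simp
 have "(\<lambda>i. lint (Y i)) \<longlonglongrightarrow> lint (f' t0)"
 proof (rule integral_dominated_convergence[OF _ _ g])
  show "f' t0 \<in> borel_measurable lborel" using m by simp
  show "Y i \<in> borel_measurable lborel" for i
  proof (cases "\<bar>X i\<bar> < \<delta>")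
   case True
   have "f (t0 + X i) \<in> borel_measurable lborel" "f t0 \<in> borel_measurable lborel"
    using int[of "t0 + X i"] int[of t0] True d by auto
   then show ?thesis using True unfolding Y_def by simp
  next
   case False
   then have "Y i = (\<lambda>_. 0)" by (simp add: Y_def fun_eq_iff)
   then show ?thesis by simp
  qed
  show "AE s in lborel. (\<lambda>i. Y i s) \<longlonglongrightarrow> f' t0 s"
   using deriv
  proof eventually_elim
   case (elim s)
   then have "((\<lambda>h. (f (t0 + h) s - f t0 s) / h) \<longlongrightarrow> f' t0 s) (at 0)"
    using d by (auto simp: DERIV_def)
   then have "(\<lambda>i. (f (t0 + X i) s - f t0 s) / X i) \<longlonglongrightarrow> f' t0 s"
    using X by (auto simp: tendsto_at_iff_sequentially o_def)
   then show ?case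
    by (rule Lim_transform_eventually) (use ev in eventually_elim, simp add: Y_def)
  qed
  show "AE s in lborel. norm (Y i s) \<le> g s" for i
   using deriv bound
  proof eventually_elim
   case (elim s)
   show ?case
   proof (cases "\<bar>X i\<bar> < \<delta>")
    case True
    have "\<exists>u. \<bar>u - t0\<bar> < \<delta> \<and> f (t0 + X i) s - f t0 s = X i * f' u s"
    proof (cases "X i > 0")
     case pos: True
     have "((\<lambda>t. f t s) has_real_derivative f' t s) (at t)" if "t0 \<le> t" "t \<le> t0 + X i" for t
      using elim(1) that True by auto
     from MVT2[of t0 "t0 + X i" "\<lambda>t. f t s" "\<lambda>t. f' t s", OF _ this] pos
     obtain u where "t0 < u" "u < t0 + X i" "f (t0 + X i) s - f t0 s = (t0 + X i - t0) * f' u s"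
      by auto
     then show ?thesis using True by (intro exI[of _ u]) auto
    next
     case neg: False
     have "((\<lambda>t. f t s) has_real_derivative f' t s) (at t)" if "t0 + X i \<le> t" "t \<le> t0" for t
      using elim(1) that True by auto
     from MVT2[of "t0 + X i" t0 "\<lambda>t. f t s" "\<lambda>t. f' t s", OF _ this] neg X0[of i]
     obtain u where u: "t0 + X i < u" "u < t0" "f t0 s - f (t0 + X i) s = (t0 - (t0 + X i)) * f' u s"
      by auto
     then have "f (t0 + X i) s - f t0 s = X i * f' u s" by (simp add: algebra_simps)
     then show ?thesis using u True by (intro exI[of _ u]) auto
    qed
    then obtain u where u: "\<bar>u - t0\<bar> < \<delta>" "f (t0 + X i) s - f t0 s = X i * f' u s" by blast
    then have "Y i s = f' u s" using True X0[of i] by (simp add: Y_def)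
    then show ?thesis using elim(2) u(1) by auto
   next
    case False
    have "0 \<le> \<bar>f' t0 s\<bar>" by simp
    also have "\<dots> \<le> g s" using elim(2) d by auto
    finally show ?thesis using False by (simp add: Y_def)
   qed
  qed
 qed
 then show "((\<lambda>h. (lint (f (t0 + h)) - lint (f t0)) / h) \<circ> X) \<longlonglongrightarrow> lint (f' t0)"
 proof (rule Lim_transform_eventually)
  show "\<forall>\<^sub>F i in sequentially. lint (Y i) =
   ((\<lambda>h. (lint (f (t0 + h)) - lint (f t0)) / h) \<circ> X) i"
   using ev
  proof eventually_elim
   case (elim i)
   have "integrable lborel (f (t0 + X i))" "integrable lborel (f t0)"
    using int[of "t0 + X i"] int[of t0] elim d by auto
   then show ?case using elim unfolding Y_def by simp
  qed
 qed
qed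

text \<open>A Gronwall-type argument: the squared norm of a solution changes at most exponentially on compact intervals.\<close>

lemma system_unique:
 fixes p q :: "real => real"
 assumes p: "\<And>x. x > 0 ==> (p has_real_derivative (((r - x / 2) * p x + w * q x) / x)) (at x)"
  and q: "\<And>x. x > 0 ==> (q has_real_derivative (((x / 2 - r) * q x - w * p x) / x)) (at x)"
  and x0: "x0 > 0" "p x0 = 0" "q x0 = 0" and x: "x > 0"
 shows "p x = 0 \<and> q x = 0"
proof -
 define S where "S x = (p x)^2 + (q x)^2" for x
 define S' where "S' x = (2 * r / x - 1) * ((p x)^2 - (q x)^2)" for x
 have S: "(S has_real_derivative S' x) (at x)" if "x > 0" for x
  unfolding S_def S'_def using that
  by (auto intro!: derivative_eq_intros p q) (simp add: field_simps power2_eq_square)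
 define a where "a = min x x0"
 have a: "a > 0" using x x0 by (simp add: a_def)
 define L where "L = 2 * \<bar>r\<bar> / a + 1"
 have b: "\<bar>S' u\<bar> \<le> L * S u" if "u \<ge> a" for u
 proof -
  have u: "u > 0" using a that by simp
  have "\<bar>2 * r / u - 1\<bar> \<le> 2 * \<bar>r\<bar> / u + 1"
   using u abs_triangle_ineq4[of "2 * r / u" 1] by (simp add: abs_mult)
  also have "\<dots> \<le> L" unfolding L_def using u a that by (simp add: frac_le)
  finally have 1: "\<bar>2 * r / u - 1\<bar> \<le> L" .
  have 2: "\<bar>(p u)^2 - (q u)^2\<bar> \<le> S u" unfolding S_def by (simp add: abs_le_iff)
  have "L \<ge> 0" using 1 by linarith
  then show ?thesis unfolding S'_def abs_mult by (intro mult_mono 1 2) auto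
 qed
 have "S x \<le> 0"
 proof (cases "x \<le> x0")
  case True
  have "S x * exp (L * x) \<le> S x0 * exp (L * x0)"
  proof (rule DERIV_nonneg_imp_nondecreasing[OF True])
   fix u assume u: "x \<le> u" "u \<le> x0"
   have "((\<lambda>x. S x * exp (L * x)) has_real_derivative (S' u + L * S u) * exp (L * u)) (at u)"
    using u x by (auto intro!: derivative_eq_intros S simp: algebra_simps)
   moreover have "(S' u + L * S u) * exp (L * u) \<ge> 0"
    using b[of u] u True by (intro mult_nonneg_nonneg) (auto simp: a_def abs_le_iff)
   ultimately show "\<exists>y. ((\<lambda>x. S x * exp (L * x)) has_real_derivative y) (at u) \<and> 0 \<le> y" by blast
  qed
  then have "S x * exp (L * x) \<le> 0" by (simp add: S_def x0)
  then show ?thesis by (simp add: mult_le_0_iff)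
 next
  case False
  then have le: "x0 \<le> x" by simp
  have "S x * exp (- L * x) \<le> S x0 * exp (- L * x0)"
  proof (rule DERIV_nonpos_imp_nonincreasing[OF le])
   fix u assume u: "x0 \<le> u" "u \<le> x"
   have "((\<lambda>x. S x * exp (- L * x)) has_real_derivative (S' u - L * S u) * exp (- L * u)) (at u)"
    using u x0 by (auto intro!: derivative_eq_intros S simp: algebra_simps)
   moreover have "(S' u - L * S u) * exp (- L * u) \<le> 0"
    using b[of u] u le by (intro mult_nonpos_nonneg) (auto simp: a_def abs_le_iff)
   ultimately show "\<exists>y. ((\<lambda>x. S x * exp (- L * x)) has_real_derivative y) (at u) \<and> y \<le> 0" by blast
  qed
  then have "S x * exp (- L * x) \<le> 0" by (simp add: S_def x0)
  then show ?thesis by (simp add: mult_le_0_iff)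
 qed
 then show ?thesis using sum_power2_le_zero_iff[of "p x" "q x"] unfolding S_def by simp
qed

text \<open>The pair solves the Whittaker system on both half-lines. At 0 it rotates like
  \<open>x\<^sup>i\<^sup>m\<close>, with amplitude \<open>a\<close> from the right and \<open>lam * a\<close>
 from the left; the second amplitude is forced by the system. Both half-lines are needed, since the
 projection property involves integrals over the whole line.\<close>

locale integrable_pair =
 fixes F1 F2 :: "real => real" and r w m :: real and a lam :: complex
 assumes w: "w > 0" and wrm: "w^2 = r^2 + m^2" and m0: "m \<noteq> 0" and a0: "a \<noteq> 0" and lam: "norm lam = 1"
  and F1_deriv: "\<And>x. x \<noteq> 0 ==> (F1 has_real_derivative (((r - x / 2) * F1 x + w * F2 x) / x)) (at x)"
  and F2_deriv: "\<And>x. x \<noteq> 0 ==> (F2 has_real_derivative (((x / 2 - r) * F2 x - w * F1 x) / x)) (at x)"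
  and bounded: "\<exists>M. \<forall>x. x \<noteq> 0 \<longrightarrow> \<bar>F1 x\<bar> \<le> M * exp (- \<bar>x\<bar> / 4) \<and> \<bar>F2 x\<bar> \<le> M * exp (- \<bar>x\<bar> / 4)"
  and F1_0: "((\<lambda>x. F1 x - Re (a * of_real x powr (\<i> * m))) \<longlongrightarrow> 0) (at_right 0)"
  and F2_0: "((\<lambda>x. F2 x - Re (- (r - \<i> * m) / w * a * of_real x powr (\<i> * m))) \<longlongrightarrow> 0) (at_right 0)"
  and F1_0': "((\<lambda>x. F1 (- x) - Re (lam * a * of_real x powr (\<i> * m))) \<longlongrightarrow> 0) (at_right 0)"
  and F2_0': "((\<lambda>x. F2 (- x) - Re (- (r - \<i> * m) / w * (lam * a) * of_real x powr (\<i> * m))) \<longlongrightarrow> 0) (at_right 0)"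
begin

definition "M = (SOME M. \<forall>x. x \<noteq> 0 \<longrightarrow> \<bar>F1 x\<bar> \<le> M * exp (- \<bar>x\<bar> / 4) \<and> \<bar>F2 x\<bar> \<le> M * exp (- \<bar>x\<bar> / 4))"

lemma M: assumes "x \<noteq> 0" shows "\<bar>F1 x\<bar> \<le> M * exp (- \<bar>x\<bar> / 4)" "\<bar>F2 x\<bar> \<le> M * exp (- \<bar>x\<bar> / 4)"
 using someI_ex[OF bounded] assms unfolding M_def[symmetric] by auto

lemma M_nonneg: "M \<ge> 0"
 using order_trans[OF abs_ge_zero M(1)[of 1]] by (simp add: zero_le_mult_iff)

lemma M': assumes "x \<noteq> 0" shows "\<bar>F1 x\<bar> \<le> M" "\<bar>F2 x\<bar> \<le> M"
 using M[OF assms] M_nonneg mult_left_mono[of "exp (- \<bar>x\<bar> / 4)" 1 M] by auto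

lemma F_measurable [measurable]: "F1 \<in> borel_measurable borel" "F2 \<in> borel_measurable borel"
proof -
 have "(\<lambda>x. if x \<in> {0} then f x else f x) \<in> borel_measurable borel"
  if "\<And>x. x \<noteq> 0 ==> isCont f x" for f :: "real => real"
 proof (rule borel_measurable_continuous_on_if)
  show "continuous_on (- {0}) f" using that by (intro continuous_at_imp_continuous_on) auto
 qed auto
 then show "F1 \<in> borel_measurable borel" "F2 \<in> borel_measurable borel"
  using DERIV_isCont[OF F1_deriv] DERIV_isCont[OF F2_deriv] by simp_all
qed

definition "L = (\<bar>r\<bar> + w + 2) * M"

text \<open>The linear factor \<open>x\<close> of the system is absorbed by the exponential decay of the pair.\<close>

lemma theta_bound:
 assumes "x \<noteq> 0"
 shows "\<bar>(r - x / 2) * F1 x + w * F2 x\<bar> \<le> L" "\<bar>(x / 2 - r) * F2 x - w * F1 x\<bar> \<le> L"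
proof -
 have e: "\<bar>x\<bar> / 2 * exp (- \<bar>x\<bar> / 4) \<le> 2"
 proof -
  have "\<bar>x\<bar> / 4 \<le> exp (\<bar>x\<bar> / 4)" using exp_ge_add_one_self[of "\<bar>x\<bar> / 4"] by linarith
  then show ?thesis by (simp add: exp_minus field_simps)
 qed
 have b: "\<bar>r - x / 2\<bar> * \<bar>u\<bar> + w * \<bar>v\<bar> \<le> L" if "\<bar>u\<bar> \<le> M * exp (- \<bar>x\<bar> / 4)" "\<bar>v\<bar> \<le> M" for u v
 proof -
  have "\<bar>r - x / 2\<bar> * \<bar>u\<bar> \<le> (\<bar>r\<bar> + \<bar>x\<bar> / 2) * (M * exp (- \<bar>x\<bar> / 4))"
   using that abs_triangle_ineq4[of r "x / 2"] by (intro mult_mono) auto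
  also have "\<dots> = M * (\<bar>r\<bar> * exp (- \<bar>x\<bar> / 4) + \<bar>x\<bar> / 2 * exp (- \<bar>x\<bar> / 4))" by (simp add: algebra_simps)
  also have "\<dots> \<le> M * (\<bar>r\<bar> * 1 + 2)"
   using e M_nonneg by (intro mult_left_mono add_mono mult_left_mono) auto
  finally have 1: "\<bar>r - x / 2\<bar> * \<bar>u\<bar> \<le> M * (\<bar>r\<bar> * 1 + 2)" .
  have "w * \<bar>v\<bar> \<le> w * M" using that w by (intro mult_left_mono) auto
  with 1 show ?thesis unfolding L_def by (simp add: algebra_simps)
 qed
 have "\<bar>(r - x / 2) * F1 x + w * F2 x\<bar> \<le> \<bar>r - x / 2\<bar> * \<bar>F1 x\<bar> + w * \<bar>F2 x\<bar>"
  using abs_triangle_ineq[of "(r - x / 2) * F1 x" "w * F2 x"] w by (simp add: abs_mult)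
 also have "\<dots> \<le> L" by (intro b M M' assms)
 finally show "\<bar>(r - x / 2) * F1 x + w * F2 x\<bar> \<le> L" .
 have "\<bar>(x / 2 - r) * F2 x - w * F1 x\<bar> \<le> \<bar>r - x / 2\<bar> * \<bar>F2 x\<bar> + w * \<bar>F1 x\<bar>"
  using abs_triangle_ineq4[of "(x / 2 - r) * F2 x" "w * F1 x"] w by (simp add: abs_mult abs_minus_commute)
 also have "\<dots> \<le> L" by (intro b M M' assms)
 finally show "\<bar>(x / 2 - r) * F2 x - w * F1 x\<bar> \<le> L" .
qed

definition k :: "real => real => real" where
 "k x y = (F1 x * F2 y - F2 x * F1 y) / (x - y)"

lemma k_sym: "k x y = k y x"
 unfolding k_def by (metis minus_diff_eq minus_divide_divide mult.commute)

lemma k_measurable [measurable]: "k x \<in> borel_measurable borel"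
 unfolding k_def by measurable

lemma k_measurable2 [measurable]: "(\<lambda>(x, y). k x y) \<in> borel_measurable (borel \<Otimes>\<^sub>M borel)"
 unfolding k_def by measurable

definition "C = 4 * M * (L + M)"

lemma L_nonneg: "L \<ge> 0" using M_nonneg w by (simp add: L_def)
lemma C_nonneg: "C \<ge> 0" using M_nonneg L_nonneg by (simp add: C_def)

text \<open>Away from the diagonal the numerator is bounded and the denominator large. Near the diagonal the mean value
  theorem is applied to the numerator, whose derivative is of order \<open>1 / |x|\<close>.\<close>

lemma k_bound_aux:
 assumes "x \<noteq> 0" "y \<noteq> 0" "\<bar>y\<bar> \<le> \<bar>x\<bar>"
 shows "\<bar>k x y\<bar> \<le> C / \<bar>x\<bar>"
proof -
 have triv: "\<bar>F1 x * F2 y - F2 x * F1 y\<bar> \<le> 2 * M * M"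
 proof -
  have "\<bar>F1 x * F2 y - F2 x * F1 y\<bar> \<le> \<bar>F1 x\<bar> * \<bar>F2 y\<bar> + \<bar>F2 x\<bar> * \<bar>F1 y\<bar>"
   using abs_triangle_ineq4[of "F1 x * F2 y" "F2 x * F1 y"] by (simp add: abs_mult)
  also have "\<dots> \<le> M * M + M * M" by (intro add_mono mult_mono M' assms M_nonneg) auto
  finally show ?thesis by simp
 qed
 show ?thesis
 proof (cases "\<bar>x - y\<bar> \<ge> \<bar>x\<bar> / 2")
  case True
  have "\<bar>k x y\<bar> = \<bar>F1 x * F2 y - F2 x * F1 y\<bar> / \<bar>x - y\<bar>" by (simp add: k_def)
  also have "\<dots> \<le> (2 * M * M) / (\<bar>x\<bar> / 2)"
   using triv True assms by (intro frac_le) auto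
  also have "\<dots> = 4 * M * M / \<bar>x\<bar>" by simp
  also have "\<dots> \<le> C / \<bar>x\<bar>" unfolding C_def using M_nonneg L_nonneg
   by (intro divide_right_mono mult_left_mono) auto
  finally show ?thesis .
 next
  case False
  then have near: "\<bar>x - y\<bar> < \<bar>x\<bar> / 2" by simp
  define I where "I = {u. \<bar>u\<bar> \<ge> \<bar>x\<bar> / 2 \<and> u \<noteq> 0}"
  have mvt: "\<bar>F x - F y\<bar> \<le> L / (\<bar>x\<bar> / 2) * \<bar>x - y\<bar>"
   if d: "\<And>u. u \<noteq> 0 ==> (F has_real_derivative f u / u) (at u)" and b: "\<And>u. u \<noteq> 0 ==> \<bar>f u\<bar> \<le> L" for F f
  proof -
   have inI: "u \<noteq> 0 \<and> \<bar>u\<bar> \<ge> \<bar>x\<bar> / 2" if "min x y \<le> u" "u \<le> max x y" for u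
    using that near assms by (auto simp: min_def max_def abs_if split: if_splits)
   have fb: "\<bar>f u / u\<bar> \<le> L / (\<bar>x\<bar> / 2)" if "min x y \<le> u" "u \<le> max x y" for u
   proof -
    have u: "u \<noteq> 0" "\<bar>u\<bar> \<ge> \<bar>x\<bar> / 2" using inI[OF that] by auto
    show ?thesis unfolding abs_divide using u b[OF u(1)] assms(1) by (intro frac_le L_nonneg) auto
   qed
   consider "x = y" | "x < y" | "y < x" by linarith
   then show ?thesis
   proof cases
    case 2
    have "(F has_real_derivative f u / u) (at u)" if "x \<le> u" "u \<le> y" for u
     using d inI[of u] that 2 by auto
    from MVT2[OF 2 this] obtain u where u: "x < u" "u < y" "F y - F x = (y - x) * (f u / u)" by auto
    have "\<bar>F x - F y\<bar> = \<bar>f u / u\<bar> * \<bar>x - y\<bar>"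
     using u(3) by (metis abs_minus_commute abs_mult mult.commute)
    also have "\<dots> \<le> L / (\<bar>x\<bar> / 2) * \<bar>x - y\<bar>" using fb[of u] u 2 by (intro mult_right_mono) auto
    finally show ?thesis .
   next
    case 3
    have "(F has_real_derivative f u / u) (at u)" if "y \<le> u" "u \<le> x" for u
     using d inI[of u] that 3 by auto
    from MVT2[OF 3 this] obtain u where u: "y < u" "u < x" "F x - F y = (x - y) * (f u / u)" by auto
    have "\<bar>F x - F y\<bar> = \<bar>f u / u\<bar> * \<bar>x - y\<bar>"
     using u(3) by (metis abs_mult mult.commute)
    also have "\<dots> \<le> L / (\<bar>x\<bar> / 2) * \<bar>x - y\<bar>" using fb[of u] u 3 by (intro mult_right_mono) auto
    finally show ?thesis .
   qed auto
  qed
  have d1: "\<bar>F1 x - F1 y\<bar> \<le> L / (\<bar>x\<bar> / 2) * \<bar>x - y\<bar>" by (rule mvt[OF F1_deriv theta_bound(1)])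
  have d2: "\<bar>F2 x - F2 y\<bar> \<le> L / (\<bar>x\<bar> / 2) * \<bar>x - y\<bar>" by (rule mvt[OF F2_deriv theta_bound(2)])
  have "F1 x * F2 y - F2 x * F1 y = (F1 x - F1 y) * F2 y - (F2 x - F2 y) * F1 y" by (simp add: algebra_simps)
  then have "\<bar>F1 x * F2 y - F2 x * F1 y\<bar> \<le> \<bar>F1 x - F1 y\<bar> * \<bar>F2 y\<bar> + \<bar>F2 x - F2 y\<bar> * \<bar>F1 y\<bar>"
   using abs_triangle_ineq4[of "(F1 x - F1 y) * F2 y" "(F2 x - F2 y) * F1 y"] by (simp add: abs_mult)
  also have "\<dots> \<le> (L / (\<bar>x\<bar> / 2) * \<bar>x - y\<bar>) * M + (L / (\<bar>x\<bar> / 2) * \<bar>x - y\<bar>) * M"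
   using L_nonneg by (intro add_mono mult_mono d1 d2 M' assms) auto
  also have "\<dots> = (4 * L * M / \<bar>x\<bar>) * \<bar>x - y\<bar>" by simp
  finally have n: "\<bar>F1 x * F2 y - F2 x * F1 y\<bar> \<le> (4 * L * M / \<bar>x\<bar>) * \<bar>x - y\<bar>" .
  have "\<bar>k x y\<bar> \<le> 4 * L * M / \<bar>x\<bar>"
  proof (cases "x = y")
   case True
   then show ?thesis using L_nonneg M_nonneg by (simp add: k_def)
  next
   case False
   then show ?thesis using n by (simp add: k_def pos_divide_le_eq)
  qed
  also have "\<dots> \<le> C / \<bar>x\<bar>" unfolding C_def using M_nonneg L_nonneg
   by (intro divide_right_mono) (auto simp: algebra_simps)
  finally show ?thesis .
 qed
qed

lemma k_bound:
 assumes "x \<noteq> 0" "y \<noteq> 0"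
 shows "\<bar>k x y\<bar> \<le> C / max \<bar>x\<bar> \<bar>y\<bar>"
 using k_bound_aux[OF assms] k_bound_aux[OF assms(2,1)] k_sym[of x y] by (auto simp: max_def)

end

section \<open>Scaling of the kernel\<close>

lemma tendsto_mult_diff_0:
 fixes f g f' g' :: "'a => real"
 assumes "((\<lambda>x. f x - f' x) \<longlongrightarrow> 0) F" "((\<lambda>x. g x - g' x) \<longlongrightarrow> 0) F"
  and "\<forall>\<^sub>F x in F. \<bar>f' x\<bar> \<le> B \<and> \<bar>g' x\<bar> \<le> B"
 shows "((\<lambda>x. f x * g x - f' x * g' x) \<longlongrightarrow> 0) F"
proof (rule Lim_null_comparison)
 have "((\<lambda>x. \<bar>f x - f' x\<bar> * B + B * \<bar>g x - g' x\<bar> + \<bar>f x - f' x\<bar> * \<bar>g x - g' x\<bar>) \<longlongrightarrow> \<bar>0\<bar> * B + B * \<bar>0\<bar> + \<bar>0\<bar> * \<bar>0\<bar>) F"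
  by (intro tendsto_intros assms)
 then show "((\<lambda>x. \<bar>f x - f' x\<bar> * B + B * \<bar>g x - g' x\<bar> + \<bar>f x - f' x\<bar> * \<bar>g x - g' x\<bar>) \<longlongrightarrow> 0) F" by simp
 show "\<forall>\<^sub>F x in F. norm (f x * g x - f' x * g' x) \<le> \<bar>f x - f' x\<bar> * B + B * \<bar>g x - g' x\<bar> + \<bar>f x - f' x\<bar> * \<bar>g x - g' x\<bar>"
  using assms(3)
 proof eventually_elim
  case (elim x)
  have "f x * g x - f' x * g' x = (f x - f' x) * g' x + f' x * (g x - g' x) + (f x - f' x) * (g x - g' x)"
   by (simp add: algebra_simps)
  then have "\<bar>f x * g x - f' x * g' x\<bar> \<le> \<bar>f x - f' x\<bar> * \<bar>g' x\<bar> + \<bar>f' x\<bar> * \<bar>g x - g' x\<bar> + \<bar>f x - f' x\<bar> * \<bar>g x - g' x\<bar>"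
   using abs_triangle_ineq[of "(f x - f' x) * g' x + f' x * (g x - g' x)" "(f x - f' x) * (g x - g' x)"]
    abs_triangle_ineq[of "(f x - f' x) * g' x" "f' x * (g x - g' x)"] by (simp add: abs_mult)
  also have "\<dots> \<le> \<bar>f x - f' x\<bar> * B + B * \<bar>g x - g' x\<bar> + \<bar>f x - f' x\<bar> * \<bar>g x - g' x\<bar>"
   using elim by (intro add_mono mult_mono) auto
  finally show ?case by simp
 qed
qed

lemma integrable_exp_bound:
 fixes f :: "real => real"
 assumes "f \<in> borel_measurable borel" "c > 0" "B \<ge> 0" "AE y in lborel. \<bar>f y\<bar> \<le> B * exp (- c * \<bar>y\<bar>)"
 shows "integrable lborel f"
proof (rule integrable_inverse_square_bound[OF assms(1)])
 show "AE y in lborel. \<bar>f y\<bar> \<le> B * max 1 (2 / c^2) * inverse (1 + y^2)"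
  using assms(4)
 proof eventually_elim
  case (elim y)
  also have "B * exp (- c * \<bar>y\<bar>) \<le> B * (max 1 (2 / c^2) * inverse (1 + y^2))"
   by (intro mult_left_mono exp_abs_bound assms)
  finally show ?case by (simp add: mult.assoc)
 qed
qed

lemma integral_lincomb:
 fixes X Y Z :: "'a => real"
 assumes "integrable Q X" "integrable Q Y" "integrable Q Z"
 shows "integral\<^sup>L Q (\<lambda>s. (a * X s + b * Y s - c * Z s) / t) = (a * integral\<^sup>L Q X + b * integral\<^sup>L Q Y - c * integral\<^sup>L Q Z) / t"
  "integral\<^sup>L Q (\<lambda>s. (a * X s - b * Y s - c * Z s) / t) = (a * integral\<^sup>L Q X - b * integral\<^sup>L Q Y - c * integral\<^sup>L Q Z) / t"
 using assms by simp_all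

lemma AE_lborel_neq: "AE s in lborel. s \<noteq> 0 \<and> s \<noteq> (x::real) \<and> s \<noteq> y"
proof -
 have "AE s in lborel. s \<noteq> c" for c :: real by (rule AE_lborel_singleton)
 then show ?thesis by (intro AE_conjI) auto
qed

context integrable_pair
begin

text \<open>The kernel of the integral operator conjugated by the dilation by \<open>t\<close>.\<close>

definition N :: "real => real => real => real" where
 "N t x s = t * k (t * x) (t * s)"

lemma N_eq: "t \<noteq> 0 ==> N t x s = (F1 (t * x) * F2 (t * s) - F2 (t * x) * F1 (t * s)) / (x - s)"
proof -
 assume t: "t \<noteq> 0"
 have "t * x - t * s = t * (x - s)" by (simp add: algebra_simps)
 then show ?thesis using t unfolding N_def k_def by simp
qed

lemma N_measurable [measurable]: "N t x \<in> borel_measurable borel"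
 unfolding N_def by measurable

lemma N_bound:
 assumes "t > 0" "x \<noteq> 0" "s \<noteq> 0"
 shows "\<bar>N t x s\<bar> \<le> C / max \<bar>x\<bar> \<bar>s\<bar>"
proof -
 have "\<bar>N t x s\<bar> \<le> t * (C / max \<bar>t * x\<bar> \<bar>t * s\<bar>)"
 proof -
  have kb: "\<bar>k (t * x) (t * s)\<bar> \<le> C / max \<bar>t * x\<bar> \<bar>t * s\<bar>"
   by (rule k_bound) (use assms in auto)
  have "\<bar>N t x s\<bar> = t * \<bar>k (t * x) (t * s)\<bar>" using assms by (simp add: N_def abs_mult)
  then show ?thesis using mult_left_mono[OF kb, of t] assms by (simp only:)
 qed
 also have "max \<bar>t * x\<bar> \<bar>t * s\<bar> = t * max \<bar>x\<bar> \<bar>s\<bar>"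
  using assms by (simp add: abs_mult max_mult_distrib_left)
 finally show ?thesis using assms by simp
qed

lemma N_bound1:
 assumes "t > 0" "x \<noteq> 0" "s \<noteq> 0"
 shows "\<bar>N t x s\<bar> \<le> C / \<bar>x\<bar>"
 using N_bound[OF assms] frac_le[OF C_nonneg order_refl, of "\<bar>x\<bar>" "max \<bar>x\<bar> \<bar>s\<bar>"] assms by simp

lemma F_scaled_deriv:
 assumes "t \<noteq> 0" "x \<noteq> 0"
 shows "((\<lambda>t. F1 (t * x)) has_real_derivative (((r - t * x / 2) * F1 (t * x) + w * F2 (t * x)) / t)) (at t)"
  and "((\<lambda>t. F2 (t * x)) has_real_derivative (((t * x / 2 - r) * F2 (t * x) - w * F1 (t * x)) / t)) (at t)"
 using DERIV_chain2[OF F1_deriv[of "t * x"] DERIV_cmult_right[OF DERIV_ident]]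
  DERIV_chain2[OF F2_deriv[of "t * x"] DERIV_cmult_right[OF DERIV_ident]] assms
 by (auto elim!: DERIV_cong)

text \<open>The Euler field of the integrable kernel has rank two: the denominator \<open>x - s\<close> cancels. All
  integral identities for the kernel come from this.\<close>

lemma N_deriv:
 assumes t: "t > 0" and x: "x \<noteq> 0" "s \<noteq> 0" "x \<noteq> s"
 shows "((\<lambda>t. N t x s) has_real_derivative (- (F1 (t * x) * F2 (t * s) + F2 (t * x) * F1 (t * s)) / 2)) (at t)"
proof -
 have "((\<lambda>t. (F1 (t * x) * F2 (t * s) - F2 (t * x) * F1 (t * s)) / (x - s)) has_real_derivative
   (- (F1 (t * x) * F2 (t * s) + F2 (t * x) * F1 (t * s)) / 2)) (at t)"
 proof (rule DERIV_cong[OF DERIV_cdivide[OF DERIV_diff[OF DERIV_mult DERIV_mult]]])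
  show "((\<lambda>t. F1 (t * x)) has_real_derivative (((r - t * x / 2) * F1 (t * x) + w * F2 (t * x)) / t)) (at t)"
   "((\<lambda>t. F2 (t * s)) has_real_derivative (((t * s / 2 - r) * F2 (t * s) - w * F1 (t * s)) / t)) (at t)"
   "((\<lambda>t. F2 (t * x)) has_real_derivative (((t * x / 2 - r) * F2 (t * x) - w * F1 (t * x)) / t)) (at t)"
   "((\<lambda>t. F1 (t * s)) has_real_derivative (((r - t * s / 2) * F1 (t * s) + w * F2 (t * s)) / t)) (at t)"
   using F_scaled_deriv t x by auto
  define A B p q where "A = F1 (t * x)" "B = F2 (t * x)" "p = F1 (t * s)" "q = F2 (t * s)"
  have "(((r - t * x / 2) * A + w * B) / t * q + ((t * s / 2 - r) * q - w * p) / t * A -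
    (((t * x / 2 - r) * B - w * A) / t * p + ((r - t * s / 2) * p + w * q) / t * B))
    = - (A * q + B * p) / 2 * (x - s)"
   using t by (simp add: field_simps)
  then show "(((r - t * x / 2) * F1 (t * x) + w * F2 (t * x)) / t * F2 (t * s) + ((t * s / 2 - r) * F2 (t * s) - w * F1 (t * s)) / t * F1 (t * x) -
    (((t * x / 2 - r) * F2 (t * x) - w * F1 (t * x)) / t * F1 (t * s) + ((r - t * s / 2) * F1 (t * s) + w * F2 (t * s)) / t * F2 (t * x))) / (x - s)
   = - (F1 (t * x) * F2 (t * s) + F2 (t * x) * F1 (t * s)) / 2"
   unfolding A_B_p_q_def[symmetric] using x by (metis nonzero_mult_div_cancel_right right_minus_eq)
 qed
 moreover have "\<forall>\<^sub>F u in nhds t. N u x s = (F1 (u * x) * F2 (u * s) - F2 (u * x) * F1 (u * s)) / (x - s)"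
  by (rule eventually_mono[OF t1_space_nhds[of t 0]]) (use t N_eq in auto)
 ultimately show ?thesis by (simp add: DERIV_cong_ev[OF refl _ refl])
qed

text \<open>The images of the pair under the kernel, written in the scale \<open>t\<close> so that only the integrand
  depends on it.\<close>

definition "Phi1 t = lint (\<lambda>s. N t 1 s * F1 (t * s))"
definition "Phi2 t = lint (\<lambda>s. N t 1 s * F2 (t * s))"
definition "C11 = lint (\<lambda>s. (F1 s)^2)"
definition "C22 = lint (\<lambda>s. (F2 s)^2)"

lemma F_scaled_bound:
 assumes "s \<noteq> 0" "0 < c" "c \<le> t"
 shows "\<bar>F1 (t * s)\<bar> \<le> M * exp (- (c / 4) * \<bar>s\<bar>)" "\<bar>F2 (t * s)\<bar> \<le> M * exp (- (c / 4) * \<bar>s\<bar>)"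
proof -
 have "exp (- \<bar>t * s\<bar> / 4) \<le> exp (- (c / 4) * \<bar>s\<bar>)"
  using assms by (simp add: abs_mult mult_right_mono)
 then have "M * exp (- \<bar>t * s\<bar> / 4) \<le> M * exp (- (c / 4) * \<bar>s\<bar>)"
  using M_nonneg by (rule mult_left_mono)
 then show "\<bar>F1 (t * s)\<bar> \<le> M * exp (- (c / 4) * \<bar>s\<bar>)" "\<bar>F2 (t * s)\<bar> \<le> M * exp (- (c / 4) * \<bar>s\<bar>)"
  using M[of "t * s"] assms by auto
qed

lemma integrable_F_sq:
 assumes "t > 0"
 shows "integrable lborel (\<lambda>s. (F1 (t * s))^2)" "integrable lborel (\<lambda>s. (F2 (t * s))^2)"
proof -
 have *: "u^2 \<le> M * M * exp (- (t / 4) * \<bar>s\<bar>)" if "\<bar>u\<bar> \<le> M * exp (- (t / 4) * \<bar>s\<bar>)" "\<bar>u\<bar> \<le> M" for u s :: real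
 proof -
  have "u^2 = \<bar>u\<bar> * \<bar>u\<bar>" by (simp add: power2_eq_square)
  also have "\<dots> \<le> M * (M * exp (- (t / 4) * \<bar>s\<bar>))" using that M_nonneg by (intro mult_mono) auto
  finally show ?thesis by (simp add: mult.assoc)
 qed
 have AE: "AE s in lborel. \<bar>(F1 (t * s))^2\<bar> \<le> M * M * exp (- (t / 4) * \<bar>s\<bar>)"
  "AE s in lborel. \<bar>(F2 (t * s))^2\<bar> \<le> M * M * exp (- (t / 4) * \<bar>s\<bar>)"
 proof -
  have e: "\<bar>(F1 (t * s))^2\<bar> \<le> M * M * exp (- (t / 4) * \<bar>s\<bar>) \<and> \<bar>(F2 (t * s))^2\<bar> \<le> M * M * exp (- (t / 4) * \<bar>s\<bar>)"
   if "s \<noteq> 0" for s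
   unfolding abs_power2 using that assms by (intro conjI * F_scaled_bound[OF _ assms order_refl] M') auto
  show "AE s in lborel. \<bar>(F1 (t * s))^2\<bar> \<le> M * M * exp (- (t / 4) * \<bar>s\<bar>)"
   using AE_lborel_neq[of 0 0] by (rule eventually_mono) (use e in blast)
  show "AE s in lborel. \<bar>(F2 (t * s))^2\<bar> \<le> M * M * exp (- (t / 4) * \<bar>s\<bar>)"
   using AE_lborel_neq[of 0 0] by (rule eventually_mono) (use e in blast)
 qed
 have t4: "t / 4 > 0" "M * M \<ge> 0" using assms M_nonneg by auto
 show "integrable lborel (\<lambda>s. (F1 (t * s))^2)" "integrable lborel (\<lambda>s. (F2 (t * s))^2)"
  by (rule integrable_exp_bound[OF _ t4 AE(1)], measurable) (rule integrable_exp_bound[OF _ t4 AE(2)], measurable)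
qed

lemma integral_F_sq:
 assumes "t > 0"
 shows "lint (\<lambda>s. (F1 (t * s))^2) = C11 / t" "lint (\<lambda>s. (F2 (t * s))^2) = C22 / t"
 using lborel_integral_real_affine[of t "\<lambda>s. (F1 s)^2" 0] lborel_integral_real_affine[of t "\<lambda>s. (F2 s)^2" 0] assms
 by (auto simp: C11_def C22_def)

lemma N_F_bound:
 assumes "s \<noteq> 0" "0 < c" "c \<le> t" "x \<noteq> 0"
 shows "\<bar>N t x s * F1 (t * s)\<bar> \<le> C / \<bar>x\<bar> * M * exp (- (c / 4) * \<bar>s\<bar>)"
  "\<bar>N t x s * F2 (t * s)\<bar> \<le> C / \<bar>x\<bar> * M * exp (- (c / 4) * \<bar>s\<bar>)"
proof -
 have "\<bar>N t x s * u\<bar> \<le> C / \<bar>x\<bar> * M * exp (- (c / 4) * \<bar>s\<bar>)" if "\<bar>u\<bar> \<le> M * exp (- (c / 4) * \<bar>s\<bar>)" for u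
  unfolding abs_mult mult.assoc using assms that
  by (intro mult_mono N_bound1 divide_nonneg_nonneg C_nonneg) auto
 then show "\<bar>N t x s * F1 (t * s)\<bar> \<le> C / \<bar>x\<bar> * M * exp (- (c / 4) * \<bar>s\<bar>)"
  "\<bar>N t x s * F2 (t * s)\<bar> \<le> C / \<bar>x\<bar> * M * exp (- (c / 4) * \<bar>s\<bar>)"
  using F_scaled_bound[OF assms(1-3)] by blast+
qed

lemma integrable_N_F:
 assumes "t > 0" "x \<noteq> 0"
 shows "integrable lborel (\<lambda>s. N t x s * F1 (t * s))" "integrable lborel (\<lambda>s. N t x s * F2 (t * s))"
proof -
 have c: "t / 4 > 0" "C / \<bar>x\<bar> * M \<ge> 0" using assms C_nonneg M_nonneg by auto
 show "integrable lborel (\<lambda>s. N t x s * F1 (t * s))"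
  by (rule integrable_exp_bound[OF _ c])
   (measurable, rule eventually_mono[OF AE_lborel_neq[of 0 0]], rule N_F_bound(1)[OF _ assms(1) order_refl assms(2)], simp)
 show "integrable lborel (\<lambda>s. N t x s * F2 (t * s))"
  by (rule integrable_exp_bound[OF _ c])
   (measurable, rule eventually_mono[OF AE_lborel_neq[of 0 0]], rule N_F_bound(2)[OF _ assms(1) order_refl assms(2)], simp)
qed

lemma Phi_scaled:
 assumes "t > 0" "x > 0"
 shows "lint (\<lambda>s. N t x s * F1 (t * s)) = Phi1 (t * x)"
  "lint (\<lambda>s. N t x s * F2 (t * s)) = Phi2 (t * x)"
proof -
 have N: "x * N t x (x * s) = N (t * x) 1 s" for s
  unfolding N_def by (simp add: algebra_simps)
 show "lint (\<lambda>s. N t x s * F1 (t * s)) = Phi1 (t * x)"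
  using lborel_integral_real_affine[of x "\<lambda>s. N t x s * F1 (t * s)" 0] assms
  unfolding Phi1_def N[symmetric] by (simp add: mult.assoc)
 show "lint (\<lambda>s. N t x s * F2 (t * s)) = Phi2 (t * x)"
  using lborel_integral_real_affine[of x "\<lambda>s. N t x s * F2 (t * s)" 0] assms
  unfolding Phi2_def N[symmetric] by (simp add: mult.assoc)
qed

text \<open>The images of the pair under the kernel satisfy the same system, up to the inhomogeneous terms \<open>C11
  F2\<close> and \<open>C22 F1\<close>.\<close>

lemma Phi_deriv:
 assumes t: "t > 0"
 shows "(Phi1 has_real_derivative (((r - t / 2) * Phi1 t + w * Phi2 t - C11 * F2 t) / t)) (at t)"
  and "(Phi2 has_real_derivative (((t / 2 - r) * Phi2 t - w * Phi1 t - C22 * F1 t) / t)) (at t)"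
proof -
 define f1 where "f1 u s = ((r - u / 2) * (N u 1 s * F1 (u * s)) + w * (N u 1 s * F2 (u * s)) - u * F2 u * (F1 (u * s))^2) / u" for u s
 define f2 where "f2 u s = ((u / 2 - r) * (N u 1 s * F2 (u * s)) - w * (N u 1 s * F1 (u * s)) - u * F1 u * (F2 (u * s))^2) / u" for u s
 define K where "K = ((\<bar>r\<bar> + t) * (C * M) + w * (C * M) + 2 * t * M * (M * M)) * (2 / t)"
 have K: "K \<ge> 0" unfolding K_def using C_nonneg M_nonneg w t by (intro mult_nonneg_nonneg add_nonneg_nonneg) auto
 define g where "g s = K * exp (- (t / 8) * \<bar>s\<bar>)" for s
 have g: "integrable lborel g" unfolding g_def
  by (rule integrable_exp_bound[of _ "t / 8" K]) (use K t in auto)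
 have near: "u > 0" "t / 2 \<le> u" "u \<le> 2 * t" if "\<bar>u - t\<bar> < t / 2" for u using that t unfolding abs_less_iff by linarith+
 have bd: "\<bar>(\<rho> * n1 + \<sigma> * n2 - u * e * h^2) / u\<bar> \<le> g s"
  if u: "\<bar>u - t\<bar> < t / 2" and "\<bar>\<rho>\<bar> \<le> \<bar>r\<bar> + u / 2" "\<bar>\<sigma>\<bar> = w" "\<bar>n1\<bar> \<le> C * M * exp (- (t / 8) * \<bar>s\<bar>)"
   "\<bar>n2\<bar> \<le> C * M * exp (- (t / 8) * \<bar>s\<bar>)" "\<bar>e\<bar> \<le> M" "\<bar>h\<bar> \<le> M * exp (- (t / 8) * \<bar>s\<bar>)" "\<bar>h\<bar> \<le> M"
  for \<rho> \<sigma> u n1 n2 e h s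
 proof -
  let ?e = "exp (- (t / 8) * \<bar>s\<bar>)"
  have rt: "\<bar>\<rho>\<bar> \<le> \<bar>r\<bar> + t" using that(2) near(3)[OF u] by linarith
  have rt0: "0 \<le> \<bar>r\<bar> + t" using t by linarith
  have ue: "\<bar>u\<bar> \<le> 2 * t" "0 \<le> 2 * t" using near[OF u] t by linarith+
  have "\<bar>\<rho> * n1\<bar> \<le> (\<bar>r\<bar> + t) * (C * M * ?e)"
   unfolding abs_mult by (rule mult_mono[OF rt that(4) rt0 abs_ge_zero])
  moreover have "\<bar>\<sigma> * n2\<bar> \<le> w * (C * M * ?e)"
   unfolding abs_mult that(3) by (rule mult_left_mono[OF that(5) less_imp_le[OF w]])
  moreover have "\<bar>u * e * h^2\<bar> \<le> 2 * t * M * (M * (M * ?e))"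
  proof -
   have "\<bar>u * e * h^2\<bar> = \<bar>u\<bar> * \<bar>e\<bar> * (\<bar>h\<bar> * \<bar>h\<bar>)" by (simp add: abs_mult power2_eq_square)
   also have "\<dots> \<le> 2 * t * M * (M * (M * ?e))"
    by (rule mult_mono[OF mult_mono[OF ue(1) that(6) ue(2) abs_ge_zero] mult_mono[OF that(8,7) M_nonneg abs_ge_zero]])
     (use ue(2) M_nonneg in simp_all)
   finally show ?thesis .
  qed
  moreover have "((\<bar>r\<bar> + t) * (C * M) + w * (C * M) + 2 * t * M * (M * M)) * ?e
    = (\<bar>r\<bar> + t) * (C * M * ?e) + w * (C * M * ?e) + 2 * t * M * (M * (M * ?e))"
   by (simp only: distrib_right mult.assoc)
  moreover have "\<bar>\<rho> * n1 + \<sigma> * n2 - u * e * h^2\<bar> \<le> \<bar>\<rho> * n1\<bar> + \<bar>\<sigma> * n2\<bar> + \<bar>u * e * h^2\<bar>" by linarith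
  ultimately have "\<bar>\<rho> * n1 + \<sigma> * n2 - u * e * h^2\<bar> \<le> ((\<bar>r\<bar> + t) * (C * M) + w * (C * M) + 2 * t * M * (M * M)) * ?e"
   by linarith
  moreover have "1 / u \<le> 2 / t" using near[OF u] t by (simp add: field_simps)
  ultimately have "\<bar>\<rho> * n1 + \<sigma> * n2 - u * e * h^2\<bar> * (1 / u) \<le> ((\<bar>r\<bar> + t) * (C * M) + w * (C * M) + 2 * t * M * (M * M)) * ?e * (2 / t)"
   using near[OF u] C_nonneg M_nonneg w t by (intro mult_mono mult_nonneg_nonneg add_nonneg_nonneg) auto
  moreover have "K * ?e = ((\<bar>r\<bar> + t) * (C * M) + w * (C * M) + 2 * t * M * (M * M)) * ?e * (2 / t)"
   by (simp only: K_def mult_ac)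
  moreover have "\<bar>(\<rho> * n1 + \<sigma> * n2 - u * e * h^2) / u\<bar> = \<bar>\<rho> * n1 + \<sigma> * n2 - u * e * h^2\<bar> * (1 / u)"
   using near[OF u] by simp
  ultimately show ?thesis unfolding g_def by linarith
 qed
 have b: "\<bar>f1 u s\<bar> \<le> g s \<and> \<bar>f2 u s\<bar> \<le> g s" if u: "\<bar>u - t\<bar> < t / 2" and s: "s \<noteq> 0" for u s
 proof -
  have t2: "0 < t / 2" using t by simp
  note NF = N_F_bound[OF s t2 near(2)[OF u], of 1, unfolded abs_one div_by_1, OF one_neq_zero]
  note FB = F_scaled_bound[OF s t2 near(2)[OF u]]
  have us: "u * s \<noteq> 0" "u \<noteq> 0" using near[OF u] s by auto
  have r1: "\<bar>r - u / 2\<bar> \<le> \<bar>r\<bar> + u / 2" and r2: "\<bar>u / 2 - r\<bar> \<le> \<bar>r\<bar> + u / 2" using near[OF u] by auto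
  have w1: "\<bar>w\<bar> = w" and w2: "\<bar>- w\<bar> = w" using w by auto
  have e: "- (t / 2 / 4) * \<bar>s\<bar> = - (t / 8) * \<bar>s\<bar>" by simp
  have "\<bar>f1 u s\<bar> \<le> g s" unfolding f1_def
   by (rule bd[OF u r1 w1 NF[unfolded e] M'(2)[OF us(2)] FB(1)[unfolded e] M'(1)[OF us(1)]])
  moreover have "\<bar>((u / 2 - r) * (N u 1 s * F2 (u * s)) + (- w) * (N u 1 s * F1 (u * s)) - u * F1 u * (F2 (u * s))^2) / u\<bar> \<le> g s"
   by (rule bd[OF u r2 w2 NF(2,1)[unfolded e] M'(1)[OF us(2)] FB(2)[unfolded e] M'(2)[OF us(1)]])
  moreover have "f2 u s = ((u / 2 - r) * (N u 1 s * F2 (u * s)) + (- w) * (N u 1 s * F1 (u * s)) - u * F1 u * (F2 (u * s))^2) / u"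
   unfolding f2_def by simp
  ultimately show ?thesis by (simp only: simp_thms)
 qed
 have pd: "((\<lambda>t. N t 1 s * F1 (t * s)) has_real_derivative f1 u s) (at u) \<and>
   ((\<lambda>t. N t 1 s * F2 (t * s)) has_real_derivative f2 u s) (at u)" if u: "u > 0" and s: "s \<noteq> 0" "s \<noteq> 1" for u s
 proof -
  define A B p q n where "A = F1 u" "B = F2 u" "p = F1 (u * s)" "q = F2 (u * s)" "n = N u 1 s"
  have "n * (1 - s) = A * q - B * p" unfolding A_B_p_q_n_def using N_eq[of u 1 s] u s by simp
  then have ns: "n * s = n - (A * q - B * p)" by (simp add: algebra_simps)
  have "n * ((r - u * s / 2) * p + w * q) = r * n * p - u / 2 * p * (n * s) + w * n * q" by (simp add: algebra_simps)
  also have "\<dots> = (r - u / 2) * (n * p) + w * (n * q) + u / 2 * (A * q - B * p) * p" unfolding ns by (simp add: algebra_simps)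
  finally have e1: "n * ((r - u * s / 2) * p + w * q) = (r - u / 2) * (n * p) + w * (n * q) + u / 2 * (A * q - B * p) * p" .
  have "n * ((u * s / 2 - r) * q - w * p) = u / 2 * q * (n * s) - r * n * q - w * n * p" by (simp add: algebra_simps)
  also have "\<dots> = (u / 2 - r) * (n * q) - w * (n * p) - u / 2 * (A * q - B * p) * q" unfolding ns by (simp add: algebra_simps)
  finally have e2: "n * ((u * s / 2 - r) * q - w * p) = (u / 2 - r) * (n * q) - w * (n * p) - u / 2 * (A * q - B * p) * q" .
  have split: "c * p' + d / u * n = (c * p' * u + n * d) / u" for c d p' using u by (simp add: add_divide_distrib)
  have D1: "- (A * q + B * p) / 2 * p + ((r - u * s / 2) * p + w * q) / u * n = ((r - u / 2) * (n * p) + w * (n * q) - u * B * p^2) / u"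
   unfolding split e1 by (rule arg_cong[of _ _ "\<lambda>y. y / u"]) (simp add: field_simps power2_eq_square)
  have D2: "- (A * q + B * p) / 2 * q + ((u * s / 2 - r) * q - w * p) / u * n = ((u / 2 - r) * (n * q) - w * (n * p) - u * A * q^2) / u"
   unfolding split e2 by (rule arg_cong[of _ _ "\<lambda>y. y / u"]) (simp add: field_simps power2_eq_square)
  have s1: "(1::real) \<noteq> s" using s by simp
  have uu: "u \<noteq> 0" using u by simp
  have dN: "((\<lambda>t. N t 1 s) has_real_derivative (- (F1 u * F2 (u * s) + F2 u * F1 (u * s)) / 2)) (at u)"
   using N_deriv[OF u _ s(1) s1] by (simp only: mult_1_right)
  show ?thesis
   using DERIV_cong[OF DERIV_mult[OF dN F_scaled_deriv(1)[OF uu s(1)]] D1[unfolded A_B_p_q_n_def]]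
    DERIV_cong[OF DERIV_mult[OF dN F_scaled_deriv(2)[OF uu s(1)]] D2[unfolded A_B_p_q_n_def]]
   unfolding f1_def f2_def by blast
 qed
 have t2: "t / 2 > 0" using t by simp
 have AEd: "AE s in lborel. \<forall>u. \<bar>u - t\<bar> < t / 2 \<longrightarrow> ((\<lambda>t. N t 1 s * F1 (t * s)) has_real_derivative f1 u s) (at u)"
  "AE s in lborel. \<forall>u. \<bar>u - t\<bar> < t / 2 \<longrightarrow> ((\<lambda>t. N t 1 s * F2 (t * s)) has_real_derivative f2 u s) (at u)"
  by (rule eventually_mono[OF AE_lborel_neq[of 1 1]], intro allI impI, rule pd[THEN conjunct1], rule near(1), assumption, simp, simp)
   (rule eventually_mono[OF AE_lborel_neq[of 1 1]], intro allI impI, rule pd[THEN conjunct2], rule near(1), assumption, simp, simp)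
 have AEb: "AE s in lborel. \<forall>u. \<bar>u - t\<bar> < t / 2 \<longrightarrow> \<bar>f1 u s\<bar> \<le> g s"
  "AE s in lborel. \<forall>u. \<bar>u - t\<bar> < t / 2 \<longrightarrow> \<bar>f2 u s\<bar> \<le> g s"
  by (rule eventually_mono[OF AE_lborel_neq[of 1 1]], intro allI impI, rule b[THEN conjunct1], assumption, simp)
   (rule eventually_mono[OF AE_lborel_neq[of 1 1]], intro allI impI, rule b[THEN conjunct2], assumption, simp)
 have I: "integrable lborel (\<lambda>s. N u 1 s * F1 (u * s))" "integrable lborel (\<lambda>s. N u 1 s * F2 (u * s))"
  if "\<bar>u - t\<bar> < t / 2" for u using integrable_N_F[OF near(1)[OF that], of 1] by auto
 have m1: "f1 t \<in> borel_measurable borel" "f2 t \<in> borel_measurable borel" unfolding f1_def f2_def by measurable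
 have tc1: "t * F2 t * (C11 / t) = C11 * F2 t" using t by simp
 have v1: "lint (f1 t) = ((r - t / 2) * Phi1 t + w * Phi2 t - C11 * F2 t) / t"
  unfolding f1_def Phi1_def Phi2_def
   integral_lincomb(1)[OF integrable_N_F[OF t one_neq_zero] integrable_F_sq(1)[OF t]] integral_F_sq[OF t] tc1 ..

 have tc2: "t * F1 t * (C22 / t) = C22 * F1 t" using t by simp
 have v2: "lint (f2 t) = ((t / 2 - r) * Phi2 t - w * Phi1 t - C22 * F1 t) / t"
  unfolding f2_def Phi1_def Phi2_def
   integral_lincomb(2)[OF integrable_N_F(2,1)[OF t one_neq_zero] integrable_F_sq(2)[OF t]] integral_F_sq[OF t] tc2 ..

 show "(Phi1 has_real_derivative (((r - t / 2) * Phi1 t + w * Phi2 t - C11 * F2 t) / t)) (at t)"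
  using has_real_derivative_lborel_integral[OF t2 I(1) AEd(1) AEb(1) g m1(1)] unfolding v1 Phi1_def[abs_def, symmetric] .
 show "(Phi2 has_real_derivative (((t / 2 - r) * Phi2 t - w * Phi1 t - C22 * F1 t) / t)) (at t)"
  using has_real_derivative_lborel_integral[OF t2 I(2) AEd(2) AEb(2) g m1(2)] unfolding v2 Phi2_def[abs_def, symmetric] .
qed

definition "E x = (F1 x)^2 + (F2 x)^2 + 2 * r / w * (F1 x * F2 x)"

text \<open>The quadratic form \<open>E\<close> is conserved up to \<open>F2\<^sup>2 - F1\<^sup>2\<close>, so its
  boundary values compare the two norms.\<close>

lemma E_deriv:
 assumes "x \<noteq> 0"
 shows "(E has_real_derivative ((F2 x)^2 - (F1 x)^2)) (at x)"
 unfolding E_def using assms w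
 by (auto intro!: derivative_eq_intros F1_deriv F2_deriv) (simp add: field_simps power2_eq_square)

lemma norm_rotation: "x > 0 ==> norm (b * complex_of_real x powr (\<i> * m)) = norm b"
 by (simp add: norm_mult norm_powr_real_powr)

lemma norm_second: "norm (- (r - \<i> * m) / w * b) = norm b"
proof -
 have "norm (complex_of_real r - \<i> * m) = sqrt (r^2 + m^2)" by (simp add: cmod_def)
 also have "\<dots> = w" unfolding wrm[symmetric] using w by simp
 finally have "norm (- (complex_of_real r - \<i> * m)) = w" unfolding norm_minus_cancel .
 then show ?thesis unfolding norm_mult norm_divide using w by simp
qed

text \<open>The form is chosen so that the oscillating terms of the two asymptotics cancel.\<close>

lemma quadratic_limit:
 fixes G1 G2 :: "real => real" and b :: complex
 assumes "((\<lambda>x. G1 x - Re (b * of_real x powr (\<i> * m))) \<longlongrightarrow> 0) (at_right 0)"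
  and "((\<lambda>x. G2 x - Re (- (r - \<i> * m) / w * b * of_real x powr (\<i> * m))) \<longlongrightarrow> 0) (at_right 0)"
 shows "((\<lambda>x. (G1 x)^2 + (G2 x)^2 + 2 * r / w * (G1 x * G2 x)) \<longlongrightarrow> m^2 / w^2 * (norm b)^2) (at_right 0)"
proof -
 define p where "p x = Re (b * of_real x powr (\<i> * m))" for x
 define q where "q x = Re (- (r - \<i> * m) / w * b * of_real x powr (\<i> * m))" for x
 have "\<forall>\<^sub>F x in at_right 0. \<bar>p x\<bar> \<le> norm b \<and> \<bar>q x\<bar> \<le> norm b"
  using eventually_at_right_less[of 0]
 proof eventually_elim
  case (elim x)
  have "\<bar>p x\<bar> \<le> norm (b * of_real x powr (\<i> * m))" unfolding p_def by (rule abs_Re_le_cmod)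
  moreover have "\<bar>q x\<bar> \<le> norm (- (r - \<i> * m) / w * b * of_real x powr (\<i> * m))" unfolding q_def by (rule abs_Re_le_cmod)
  ultimately show ?case unfolding norm_rotation[OF elim] norm_second ..
 qed
 then have bb: "\<forall>\<^sub>F x in at_right 0. \<bar>p x\<bar> \<le> norm b \<and> \<bar>p x\<bar> \<le> norm b" "\<forall>\<^sub>F x in at_right 0. \<bar>q x\<bar> \<le> norm b \<and> \<bar>q x\<bar> \<le> norm b"
   "\<forall>\<^sub>F x in at_right 0. \<bar>p x\<bar> \<le> norm b \<and> \<bar>q x\<bar> \<le> norm b" by (rule eventually_mono, simp)+
 note A = assms[folded p_def q_def]
 have "((\<lambda>x. (G1 x * G1 x - p x * p x) + (G2 x * G2 x - q x * q x) + 2 * r / w * (G1 x * G2 x - p x * q x)) \<longlongrightarrow> 0 + 0 + 2 * r / w * 0) (at_right 0)"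
  by (intro tendsto_intros tendsto_mult_diff_0[OF A(1) A(1) bb(1)] tendsto_mult_diff_0[OF A(2) A(2) bb(2)] tendsto_mult_diff_0[OF A(1) A(2) bb(3)])
 then have "((\<lambda>x. ((G1 x * G1 x - p x * p x) + (G2 x * G2 x - q x * q x) + 2 * r / w * (G1 x * G2 x - p x * q x)) + m^2 / w^2 * (norm b)^2) \<longlongrightarrow> 0 + m^2 / w^2 * (norm b)^2) (at_right 0)"
  by (intro tendsto_intros) simp
 then have lim: "((\<lambda>x. ((G1 x * G1 x - p x * p x) + (G2 x * G2 x - q x * q x) + 2 * r / w * (G1 x * G2 x - p x * q x)) + m^2 / w^2 * (norm b)^2) \<longlongrightarrow> m^2 / w^2 * (norm b)^2) (at_right 0)"
  by simp
 show ?thesis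
 proof (rule Lim_transform_eventually[OF lim])
  show "\<forall>\<^sub>F x in at_right 0. ((G1 x * G1 x - p x * p x) + (G2 x * G2 x - q x * q x) + 2 * r / w * (G1 x * G2 x - p x * q x)) + m^2 / w^2 * (norm b)^2
    = (G1 x)^2 + (G2 x)^2 + 2 * r / w * (G1 x * G2 x)"
   using eventually_at_right_less[of 0]
  proof eventually_elim
   case (elim x)
   define c where "c = b * of_real x powr (\<i> * m)"
   have nc: "(Re c)^2 + (Im c)^2 = (norm b)^2"
    unfolding cmod_power2[symmetric] c_def norm_rotation[OF elim] ..
   have p: "p x = Re c" by (simp add: p_def c_def)
   have q: "q x = - (r * Re c + m * Im c) / w"
   proof -
    have "q x = Re (- (complex_of_real r - \<i> * m) / w * c)" by (simp only: q_def c_def mult.assoc)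
    then show ?thesis by (simp add: field_simps)
   qed
   have "p x * p x + q x * q x + 2 * r / w * (p x * q x) = m^2 / w^2 * (norm b)^2"
   proof -
    have "w^2 * (p x * p x + q x * q x + 2 * r / w * (p x * q x)) = w^2 * (Re c)^2 + (r * Re c + m * Im c)^2 - 2 * r * Re c * (r * Re c + m * Im c)"
     unfolding p q using w by (simp add: field_simps power2_eq_square)
    also have "\<dots> = m^2 * ((Re c)^2 + (Im c)^2)" unfolding wrm by (simp add: algebra_simps power2_eq_square)
    finally show ?thesis unfolding nc using w by (simp add: field_simps)
   qed
   then show ?case by (simp add: algebra_simps power2_eq_square)
  qed
 qed
qed

lemma E_limit:
 "(E \<longlongrightarrow> m^2 / w^2 * (norm a)^2) (at_right 0)"
 "((\<lambda>x. E (- x)) \<longlongrightarrow> m^2 / w^2 * (norm a)^2) (at_right 0)"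
 using quadratic_limit[OF F1_0 F2_0] quadratic_limit[OF F1_0' F2_0']
 by (simp_all add: E_def[abs_def] norm_mult lam)

end

section \<open>The logarithmic kernel integral\<close>

lemma cot_imaginary:
 fixes a :: real assumes "a \<noteq> 0"
 shows "cot (\<i> * of_real a) = - \<i> * of_real (cosh a / sinh a)"
proof -
 have "sinh (complex_of_real a) = of_real (sinh a)" "cosh (complex_of_real a) = of_real (cosh a)"
  by (simp_all add: sinh_def cosh_def exp_of_real scaleR_conv_of_real flip: exp_of_real)
 moreover have "sin (\<i> * complex_of_real a) = \<i> * sinh (complex_of_real a)"
  "cos (\<i> * complex_of_real a) = cosh (complex_of_real a)"
  by (simp_all add: sinh_conv_sin cosh_conv_cos)
 ultimately show ?thesis using assms by (simp add: cot_def field_simps)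
qed

lemma Digamma_reflection:
 fixes z :: complex
 assumes z: "z \<notin> \<int>"
 shows "Digamma (1 - z) - Digamma z = of_real pi * cot (of_real pi * z)"
proof -
 have z1: "z \<notin> \<int>\<^sub>\<le>\<^sub>0" "1 - z \<notin> \<int>\<^sub>\<le>\<^sub>0"
 proof -
  show "z \<notin> \<int>\<^sub>\<le>\<^sub>0" using z nonpos_Ints_Int by blast
  show "1 - z \<notin> \<int>\<^sub>\<le>\<^sub>0"
  proof
   assume "1 - z \<in> \<int>\<^sub>\<le>\<^sub>0"
   then have "1 - (1 - z) \<in> \<int>" using nonpos_Ints_Int Ints_diff[OF Ints_1] by blast
   then show False using z by simp
  qed
 qed
 have s: "sin (of_real pi * z) \<noteq> 0" using z by (auto simp: sin_eq_0 Ints_def mult.commute)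
 have d1: "((\<lambda>z::complex. Gamma z * Gamma (1 - z)) has_field_derivative
   (Gamma z * Digamma z * Gamma (1 - z) + (Gamma (1 - z) * Digamma (1 - z) * (0 - 1)) * Gamma z)) (at z)"
  by (rule DERIV_mult DERIV_chain2[OF has_field_derivative_Gamma] has_field_derivative_Gamma z1 DERIV_diff DERIV_const DERIV_ident)+
 have d2: "(\<lambda>z::complex. Gamma z * Gamma (1 - z)) = (\<lambda>z. of_real pi / sin (of_real pi * z))"
  by (rule ext) (rule Gamma_reflection_complex)
 have d3: "((\<lambda>z::complex. of_real pi / sin (of_real pi * z)) has_field_derivative
   (- (of_real pi * (cos (of_real pi * z) * of_real pi)) / (sin (of_real pi * z))^2)) (at z)"
  using s by (auto intro!: derivative_eq_intros simp: power2_eq_square)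
 have "Gamma z * Digamma z * Gamma (1 - z) + (Gamma (1 - z) * Digamma (1 - z) * (0 - 1)) * Gamma z
   = - (of_real pi * (cos (of_real pi * z) * of_real pi)) / (sin (of_real pi * z))^2"
  by (rule DERIV_unique[OF d1[unfolded d2] d3])
 moreover have "(Gamma z * Gamma (1 - z)) * (Digamma (1 - z) - Digamma z)
   = - (Gamma z * Digamma z * Gamma (1 - z) + (Gamma (1 - z) * Digamma (1 - z) * (0 - 1)) * Gamma z)"
  by (simp add: algebra_simps)
 ultimately have eq: "of_real pi / sin (of_real pi * z) * (Digamma (1 - z) - Digamma z) = of_real pi * (cos (of_real pi * z) * of_real pi) / (sin (of_real pi * z))^2"
  unfolding Gamma_reflection_complex by simp
 have "Digamma (1 - z) - Digamma z = (of_real pi / sin (of_real pi * z) * (Digamma (1 - z) - Digamma z)) * (sin (of_real pi * z) / of_real pi)"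
  using s by simp
 also have "\<dots> = of_real pi * cot (of_real pi * z)"
  unfolding eq using s by (simp add: cot_def power2_eq_square)
 finally show ?thesis .
qed

text \<open>Imaginary part of the reflection formula of the digamma function.\<close>

lemma coth_partial_fractions:
 fixes a :: real
 assumes a: "a \<noteq> 0"
 shows "(\<lambda>n. a^2 / ((real (Suc n))^2 + a^2)) sums ((pi * a * (cosh (pi * a) / sinh (pi * a)) - 1) / 2)"
proof -
 define z where "z = \<i> * complex_of_real a"
 have z0: "z \<noteq> 0" using a by (simp add: z_def)
 have zI: "z \<notin> \<int>" using a by (auto simp: z_def complex_eq_iff elim!: Ints_cases)
 have nz: "1 + z \<noteq> 0" "1 - z \<noteq> 0" using a by (auto simp: z_def complex_eq_iff)
 have "(\<lambda>n. (inverse (of_nat (Suc n)) - inverse ((1 + z) + of_nat n)) - (inverse (of_nat (Suc n)) - inverse ((1 - z) + of_nat n)))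
   sums ((Digamma (1 + z) + euler_mascheroni) - (Digamma (1 - z) + euler_mascheroni))"
 proof (rule sums_diff)
  show "(\<lambda>n. inverse (of_nat (Suc n)) - inverse ((1 + z) + of_nat n)) sums (Digamma (1 + z) + euler_mascheroni)"
   using summable_sums[OF summable_Digamma[OF nz(1)]] unfolding Digamma_def by (simp del: of_nat_Suc)
  show "(\<lambda>n. inverse (of_nat (Suc n)) - inverse ((1 - z) + of_nat n)) sums (Digamma (1 - z) + euler_mascheroni)"
   using summable_sums[OF summable_Digamma[OF nz(2)]] unfolding Digamma_def by (simp del: of_nat_Suc)
 qed
 moreover have "(inverse (of_nat (Suc n)) - inverse ((1 + z) + of_nat n)) - (inverse (of_nat (Suc n)) - inverse ((1 - z) + of_nat n))
   = 2 * z / of_real ((real (Suc n))^2 + a^2)" for n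
 proof -
  define k where "k = complex_of_nat (Suc n)"
  have e: "(1 + z) + of_nat n = k + z" "(1 - z) + of_nat n = k - z" by (simp_all add: k_def)
  have "k + z \<noteq> 0" "k - z \<noteq> 0" using a by (auto simp: k_def z_def complex_eq_iff)
  then have "inverse (k - z) - inverse (k + z) = 2 * z / ((k - z) * (k + z))" by (simp add: field_simps)
  also have "(k - z) * (k + z) = of_real ((real (Suc n))^2 + a^2)"
   by (simp add: k_def z_def algebra_simps power2_eq_square)
  finally show ?thesis unfolding e by simp
 qed
 ultimately have "(\<lambda>n. 2 * z / of_real ((real (Suc n))^2 + a^2)) sums (Digamma (1 + z) - Digamma (1 - z))" by simp
 then have "(\<lambda>n. of_real a / (2 * \<i>) * (2 * z / of_real ((real (Suc n))^2 + a^2))) sums (of_real a / (2 * \<i>) * (Digamma (1 + z) - Digamma (1 - z)))"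
  by (rule sums_mult)
 moreover have "of_real a / (2 * \<i>) * (2 * z / of_real ((real (Suc n))^2 + a^2)) = complex_of_real (a^2 / ((real (Suc n))^2 + a^2))" for n
 proof -
  have "of_real a / (2 * \<i>) * (2 * z) = complex_of_real (a^2)"
   by (simp add: z_def complex_eq_iff power2_eq_square)
  then show ?thesis by (simp only: times_divide_eq_right of_real_divide)
 qed
 moreover have "of_real a / (2 * \<i>) * (Digamma (1 + z) - Digamma (1 - z)) = complex_of_real ((pi * a * (cosh (pi * a) / sinh (pi * a)) - 1) / 2)"
 proof -
  have "Digamma (1 + z) = Digamma z + 1 / z" using Digamma_plus1[OF z0] by (simp add: add.commute)
  then have "Digamma (1 + z) - Digamma (1 - z) = 1 / z - of_real pi * cot (of_real pi * z)"
   using Digamma_reflection[OF zI] by (simp add: algebra_simps)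
  also have "of_real pi * z = \<i> * of_real (pi * a)" by (simp add: z_def)
  finally have "Digamma (1 + z) - Digamma (1 - z) = 1 / z + \<i> * of_real (pi * (cosh (pi * a) / sinh (pi * a)))"
   using cot_imaginary[of "pi * a"] a by simp
  then show ?thesis using a by (simp only:) (simp add: z_def field_simps)
 qed
 ultimately have "(\<lambda>n. complex_of_real (a^2 / ((real (Suc n))^2 + a^2))) sums complex_of_real ((pi * a * (cosh (pi * a) / sinh (pi * a)) - 1) / 2)"
  by (simp only:)
 then show ?thesis unfolding sums_of_real_iff .
qed

text \<open>The alternating sum is the full sum minus twice its even part, and the even part is the full sum at half the
  parameter.\<close>

lemma alternating_partial_fractions:
 fixes a :: real
 assumes a: "a \<noteq> 0"
 shows "(\<lambda>n. (- 1) ^ n * (a^2 / ((real (Suc n))^2 + a^2))) sums ((1 - pi * a / sinh (pi * a)) / 2)"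
proof -
 define f where "f n = a^2 / ((real n)^2 + a^2)" for n
 define S where "S a = (pi * a * (cosh (pi * a) / sinh (pi * a)) - 1) / 2" for a :: real
 have 1: "(\<lambda>n. f (Suc n)) sums S a" unfolding f_def S_def by (rule coth_partial_fractions[OF a])
 have "(\<lambda>n. (a/2)^2 / ((real (Suc n))^2 + (a/2)^2)) sums S (a/2)" unfolding S_def using a by (intro coth_partial_fractions) simp
 moreover have "(a/2)^2 / ((real (Suc n))^2 + (a/2)^2) = f (2 * Suc n)" for n
 proof -
  have "(a/2)^2 / (k^2 + (a/2)^2) = a^2 / ((2 * k)^2 + a^2)" for k
  proof -
   have "4 * k^2 + a^2 > 0" using a by (simp add: add_nonneg_pos)
   then show ?thesis by (simp add: power_divide power_mult_distrib divide_simps)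
  qed
  from this[of "real (Suc n)"] show ?thesis unfolding f_def by simp
 qed
 ultimately have 2: "(\<lambda>n. f (2 * Suc n)) sums S (a/2)" by simp
 define h where "h n = (if odd n then f (Suc n) else 0)" for n
 have "h sums S (a/2)"
 proof -
  have "(\<lambda>n. f (2 * Suc n)) = (\<lambda>n. h (2 * n + 1))" by (simp add: h_def fun_eq_iff)
  moreover have "(\<lambda>n. h (2 * n + 1)) sums S (a/2) \<longleftrightarrow> h sums S (a/2)"
  proof (rule sums_mono_reindex)
   show "strict_mono (\<lambda>n::nat. 2 * n + 1)" by (auto simp: strict_mono_def)
   show "h n = 0" if "n \<notin> range (\<lambda>n. 2 * n + 1)" for n
    using that by (auto simp: h_def elim!: oddE)
  qed
  ultimately show ?thesis using 2 by simp
 qed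
 from sums_diff[OF 1 sums_mult[OF this, of 2]]
 have "(\<lambda>n. f (Suc n) - 2 * h n) sums (S a - 2 * S (a/2))" .
 moreover have "(\<lambda>n. f (Suc n) - 2 * h n) = (\<lambda>n. (- 1) ^ n * (a^2 / ((real (Suc n))^2 + a^2)))"
  by (rule ext) (simp add: h_def f_def)
 moreover have "S a - 2 * S (a/2) = (1 - pi * a / sinh (pi * a)) / 2"
 proof -
  define y where "y = pi * a / 2"
  have y: "sinh y \<noteq> 0" "cosh y \<noteq> 0" using a by (auto simp: y_def)
  have e: "pi * a = 2 * y" "pi * (a / 2) = y" by (simp_all add: y_def)
  have d: "sinh (2 * y) = 2 * sinh y * cosh y" "cosh (2 * y) = 2 * (cosh y)^2 - 1"
   using sinh_double[of y] cosh_double_cosh[of y] by auto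
  have key: "cosh (2 * y) / sinh (2 * y) - cosh y / sinh y = - 1 / sinh (2 * y)"
   unfolding d using y by (simp add: field_simps power2_eq_square)
  have "S a - 2 * S (a/2) = y * (cosh (2 * y) / sinh (2 * y) - cosh y / sinh y) + 1 / 2"
   unfolding S_def e by (simp add: algebra_simps diff_divide_distrib)
  also have "\<dots> = (1 - 2 * y / sinh (2 * y)) / 2" unfolding key by (simp add: diff_divide_distrib)
  finally show ?thesis unfolding e .
 qed
 ultimately show ?thesis by simp
qed

lemma exp_sin_square_integral:
 fixes m :: real and n :: nat
 defines "b \<equiv> real (Suc n)"
 shows "integrable lborel (\<lambda>u. indicator {0..} u * (exp (- b * u) * (sin (m * u))^2))"
  "lint (\<lambda>u. indicator {0..} u * (exp (- b * u) * (sin (m * u))^2)) = (2 * m)^2 / (2 * b * (b^2 + (2 * m)^2))"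
proof -
 define a where "a = 2 * m"
 have b: "b > 0" by (simp add: b_def)
 have q: "b^2 + a^2 > 0" using b by (simp add: add_pos_nonneg)
 define Q where "Q = 2 * (b^2 + a^2)"
 have Q: "Q > 0" using q by (simp add: Q_def)
 define R where "R = inverse Q"
 have R: "R > 0" using Q by (simp add: R_def)
 define G where "G u = exp (- b * u) * (- 1 / (2 * b) + (b * cos (a * u) - a * sin (a * u)) * R)" for u
 have sq: "(sin (m * u))^2 = (1 - cos (a * u)) / 2" for u
  using cos_double_sin[of "m * u"] by (simp add: a_def mult.assoc)
 have d: "(G has_real_derivative exp (- b * u) * (sin (m * u))^2) (at u)" for u
 proof -
  have "(G has_real_derivative (- b * exp (- b * u)) * (- 1 / (2 * b) + (b * cos (a * u) - a * sin (a * u)) * R)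
    + exp (- b * u) * ((- b * a * sin (a * u) - a * a * cos (a * u)) * R)) (at u)"
  proof -
   have e: "((\<lambda>u. exp (- b * u)) has_real_derivative (- b * exp (- b * u))) (at u)"
    by (auto intro!: derivative_eq_intros)
   have c: "((\<lambda>u. b * cos (a * u) - a * sin (a * u)) has_real_derivative (- b * a * sin (a * u) - a * a * cos (a * u))) (at u)"
    by (auto intro!: derivative_eq_intros)
   have "((\<lambda>u. - 1 / (2 * b) + (b * cos (a * u) - a * sin (a * u)) * R) has_real_derivative (0 + (- b * a * sin (a * u) - a * a * cos (a * u)) * R)) (at u)"
    by (rule DERIV_add[OF DERIV_const DERIV_cmult_right[OF c]])
   from DERIV_mult[OF e this] show ?thesis unfolding G_def by (simp add: mult.commute)
  qed
  also have "(- b * exp (- b * u)) * (- 1 / (2 * b) + (b * cos (a * u) - a * sin (a * u)) * R)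
    + exp (- b * u) * ((- b * a * sin (a * u) - a * a * cos (a * u)) * R)
   = exp (- b * u) * (1 / 2 - ((b^2 + a^2) * R) * cos (a * u))"
   using b by (simp add: field_simps power2_eq_square)
  also have "(b^2 + a^2) * R = 1 / 2"
  proof -
   have "t * inverse (2 * t) = 1 / 2" if "t > 0" for t :: real using that by (simp add: field_simps)
   from this[OF q] show ?thesis by (simp only: Q_def R_def)
  qed
  also have "exp (- b * u) * (1 / 2 - 1 / 2 * cos (a * u)) = exp (- b * u) * (sin (m * u))^2" unfolding sq by (simp add: diff_divide_distrib)
  finally show ?thesis .
 qed
 have lim: "(G \<longlongrightarrow> 0) at_top"
 proof (rule Lim_null_comparison)
  define K where "K = 1 / (2 * b) + (b + \<bar>a\<bar>) * R"
  have "\<bar>- 1 / (2 * b) + (b * cos (a * u) - a * sin (a * u)) * R\<bar> \<le> K" for u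
  proof -
   have "\<bar>b * cos (a * u)\<bar> \<le> b" "\<bar>a * sin (a * u)\<bar> \<le> \<bar>a\<bar>"
    unfolding abs_mult using b abs_cos_le_one abs_sin_le_one by (simp_all add: mult_left_le)
   then have "\<bar>b * cos (a * u) - a * sin (a * u)\<bar> \<le> b + \<bar>a\<bar>" by linarith
   then have "\<bar>(b * cos (a * u) - a * sin (a * u)) * R\<bar> \<le> (b + \<bar>a\<bar>) * R"
    unfolding abs_mult using R by (simp add: mult_right_mono)
   moreover have "\<bar>- 1 / (2 * b)\<bar> = 1 / (2 * b)" using b by simp
   ultimately show ?thesis unfolding K_def by linarith
  qed
  then have "norm (G u) \<le> K * exp (- b * u)" for u
   unfolding G_def real_norm_def abs_mult abs_exp_cancel by (subst mult.commute) (rule mult_right_mono, auto)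
  then show "\<forall>\<^sub>F u in at_top. norm (G u) \<le> K * exp (- b * u)" by simp
  have "((\<lambda>u. K * (exp (- b * u) * u powr 0)) \<longlongrightarrow> K * 0) at_top" by (intro tendsto_intros exp_powr_tendsto_0 b)
  moreover have "\<forall>\<^sub>F u in at_top. K * (exp (- b * u) * u powr 0) = K * exp (- b * u)"
   using eventually_gt_at_top[of "0::real"] by eventually_elim simp
  ultimately have "((\<lambda>u. K * exp (- b * u)) \<longlongrightarrow> K * 0) at_top" by (rule Lim_transform_eventually)
  then show "((\<lambda>u. K * exp (- b * u)) \<longlongrightarrow> 0) at_top" by simp
 qed
 have G0: "0 - G 0 = (2 * m)^2 / (2 * b * (b^2 + (2 * m)^2))"
 proof -
  have "0 - G 0 = 1 / (2 * b) - b / (2 * (b^2 + a^2))"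
  proof -
   have "G 0 = - 1 / (2 * b) + b * R" by (simp add: G_def)
   moreover have "b * R = b / (2 * (b^2 + a^2))" by (simp only: R_def Q_def divide_inverse)
   ultimately show ?thesis by linarith
  qed
  also have "\<dots> = a^2 / (2 * b * (b^2 + a^2))" using b q by (simp add: field_simps power2_eq_square)
  finally show ?thesis by (simp add: a_def)
 qed
 have nn: "(\<integral>\<^sup>+u. ennreal (indicator {0..} u * (exp (- b * u) * (sin (m * u))^2)) \<partial>lborel) = ennreal (0 - G 0)"
 proof -
  have "(\<integral>\<^sup>+u. ennreal (exp (- b * u) * (sin (m * u))^2) * indicator {0..} u \<partial>lborel) = ennreal (0 - G 0)"
   by (rule nn_integral_FTC_atLeast[OF _ d _ lim]) auto
  moreover have "ennreal (indicator {0..} u * (exp (- b * u) * (sin (m * u))^2)) = ennreal (exp (- b * u) * (sin (m * u))^2) * indicator {0..} u" for u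
   by (simp add: indicator_def)
  ultimately show ?thesis by (simp only:)
 qed
 have G0n: "0 \<le> 0 - G 0" unfolding G0 using b by simp
 show int: "integrable lborel (\<lambda>u. indicator {0..} u * (exp (- b * u) * (sin (m * u))^2))"
  by (rule integrableI_nn_integral_finite[OF _ _ nn]) simp_all
 show "lint (\<lambda>u. indicator {0..} u * (exp (- b * u) * (sin (m * u))^2)) = (2 * m)^2 / (2 * b * (b^2 + (2 * m)^2))"
 proof -
  have "lint (\<lambda>u. indicator {0..} u * (exp (- b * u) * (sin (m * u))^2))
   = enn2real (\<integral>\<^sup>+u. ennreal (indicator {0..} u * (exp (- b * u) * (sin (m * u))^2)) \<partial>lborel)"
   by (rule integral_eq_nn_integral) auto
  also have "\<dots> = 0 - G 0" unfolding nn using G0n by (rule enn2real_ennreal)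
  finally show ?thesis unfolding G0 .
 qed
qed

text \<open>Dominated convergence for a termwise integration. Each term is a Laplace transform of
  \<open>sin\<^sup>2\<close>.\<close>

lemma exp_series_sin_square_integral:
 fixes m e :: real
 assumes m: "m \<noteq> 0" and e: "\<bar>e\<bar> = 1" and T: "(\<lambda>n. e ^ n * ((2 * m)^2 / ((real (Suc n))^2 + (2 * m)^2))) sums T"
 shows "integrable lborel (\<lambda>u. indicator {0<..} u * ((sin (m * u))^2 * (exp (- u) / (1 - e * exp (- u))^2)))"
  "lint (\<lambda>u. indicator {0<..} u * ((sin (m * u))^2 * (exp (- u) / (1 - e * exp (- u))^2))) = T / 2"
proof -
 define g where "g n u = indicator {0..} u * (exp (- real (Suc n) * u) * (sin (m * u))^2)" for n u
 define f where "f n u = real (Suc n) * e ^ n * g n u" for n u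
 have gi: "integrable lborel (g n)" for n unfolding g_def by (rule exp_sin_square_integral)
 have gv: "lint (g n) = (2 * m)^2 / (2 * real (Suc n) * ((real (Suc n))^2 + (2 * m)^2))" for n
  unfolding g_def by (rule exp_sin_square_integral)
 have fi: "integrable lborel (f n)" for n unfolding f_def by (intro integrable_mult_right gi)
 have fv: "lint (f n) = e ^ n * ((2 * m)^2 / ((real (Suc n))^2 + (2 * m)^2)) / 2" for n
 proof -
  have *: "B * x * (A / (2 * B * D)) = x * (A / D) / 2" if "B \<noteq> 0" for A B D x :: real using that by simp
  show ?thesis unfolding f_def integral_mult_right_zero gv by (rule *) simp
 qed
 have fn: "norm (f n u) = real (Suc n) * g n u" for n u
  unfolding f_def using e by (simp add: abs_mult power_abs g_def)
 have pt: "(\<lambda>n. f n u) sums (indicator {0<..} u * ((sin (m * u))^2 * (exp (- u) / (1 - e * exp (- u))^2)))"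
  and ptn: "summable (\<lambda>n. norm (f n u))" if "u \<noteq> 0" for u
 proof -
  have "(\<lambda>n. f n u) sums (indicator {0<..} u * ((sin (m * u))^2 * (exp (- u) / (1 - e * exp (- u))^2))) \<and> summable (\<lambda>n. norm (f n u))"
  proof (cases "u > 0")
   case True
   have s: "norm (e * exp (- u)) < 1" "norm (exp (- u)) < 1" using True e by (simp_all add: abs_mult)
   have ex: "exp (- real (Suc n) * u) = exp (- u) * exp (- u) ^ n" for n
    by (simp add: exp_of_nat_mult[symmetric] exp_add[symmetric] algebra_simps)
   have p1: "(\<lambda>n. (sin (m * u))^2 * exp (- u) * (real (Suc n) * (e * exp (- u)) ^ n)) sums ((sin (m * u))^2 * exp (- u) * (1 / (1 - e * exp (- u))^2))"
    by (intro sums_mult geometric_deriv_sums s)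
   have p2: "(\<lambda>n. (sin (m * u))^2 * exp (- u) * (real (Suc n) * (e * exp (- u)) ^ n)) = (\<lambda>n. f n u)"
    using True by (intro ext) (simp only: f_def g_def ex power_mult_distrib, simp)
   have p3: "summable (\<lambda>n. (sin (m * u))^2 * exp (- u) * (real (Suc n) * (exp (- u)) ^ n))"
    by (intro summable_mult sums_summable[OF geometric_deriv_sums] s)
   have p4: "(\<lambda>n. (sin (m * u))^2 * exp (- u) * (real (Suc n) * (exp (- u)) ^ n)) = (\<lambda>n. norm (f n u))"
    using True by (intro ext) (simp only: fn g_def ex, simp)
   show ?thesis using True p1[unfolded p2] p3[unfolded p4] by simp
  next
   case False
   then show ?thesis using that by (simp add: f_def g_def)
  qed
  then show "(\<lambda>n. f n u) sums (indicator {0<..} u * ((sin (m * u))^2 * (exp (- u) / (1 - e * exp (- u))^2)))"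
   and "summable (\<lambda>n. norm (f n u))" by blast+
 qed
 have AEn: "AE u in lborel. summable (\<lambda>n. norm (f n u))"
  by (rule eventually_mono[OF AE_lborel_singleton[of 0]]) (rule ptn)
 have sn: "summable (\<lambda>n. lint (\<lambda>u. norm (f n u)))"
 proof -
  have "(\<lambda>n. lint (\<lambda>u. norm (f n u))) = (\<lambda>n. (2 * m)^2 / ((real (Suc n))^2 + (2 * m)^2) / 2)"
  proof
   fix n
   have *: "B * (A / (2 * B * D)) = A / D / 2" if "B \<noteq> 0" for A B D :: real using that by simp
   show "lint (\<lambda>u. norm (f n u)) = (2 * m)^2 / ((real (Suc n))^2 + (2 * m)^2) / 2"
    unfolding fn integral_mult_right_zero gv by (rule *) simp
  qed
  moreover have "summable (\<lambda>n. (2 * m)^2 / ((real (Suc n))^2 + (2 * m)^2) / 2)"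
   by (intro summable_divide sums_summable[OF coth_partial_fractions]) (use m in simp)
  ultimately show ?thesis by (simp only:)
 qed
 have AEs: "AE u in lborel. (\<Sum>n. f n u) = indicator {0<..} u * ((sin (m * u))^2 * (exp (- u) / (1 - e * exp (- u))^2))"
  by (rule eventually_mono[OF AE_lborel_singleton[of 0]]) (use pt in \<open>simp add: sums_iff\<close>)
 have meas: "(\<lambda>u. indicator {0<..} u * ((sin (m * u))^2 * (exp (- u) / (1 - e * exp (- u))^2))) \<in> borel_measurable lborel"
  by measurable
 have I: "integrable lborel (\<lambda>u. \<Sum>n. f n u)" by (rule integrable_suminf[OF fi AEn sn])
 have V: "(\<lambda>n. lint (f n)) sums lint (\<lambda>u. \<Sum>n. f n u)" by (rule sums_integral[OF fi AEn sn])
 have mi: "(\<lambda>u. \<Sum>n. f n u) \<in> borel_measurable lborel" using I by simp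
 show "integrable lborel (\<lambda>u. indicator {0<..} u * ((sin (m * u))^2 * (exp (- u) / (1 - e * exp (- u))^2)))"
  using I integrable_cong_AE[OF mi meas AEs] by simp
 have "lint (\<lambda>u. indicator {0<..} u * ((sin (m * u))^2 * (exp (- u) / (1 - e * exp (- u))^2))) = lint (\<lambda>u. \<Sum>n. f n u)"
  by (rule integral_cong_AE[OF meas mi]) (use AEs in eventually_elim, simp)
 also have "\<dots> = T / 2" using V sums_divide[OF T, of 2] unfolding fv by (rule sums_unique2)
 finally show "lint (\<lambda>u. indicator {0<..} u * ((sin (m * u))^2 * (exp (- u) / (1 - e * exp (- u))^2))) = T / 2" .
qed

lemma integral_half_line_split:
 fixes g :: "real => real"
 assumes "integrable lborel g"
 shows "integrable lborel (\<lambda>u. indicator {0<..} u * (g u + g (- u)))"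
  "lint g = lint (\<lambda>u. indicator {0<..} u * (g u + g (- u)))"
proof -
 have gm: "integrable lborel (\<lambda>u. g (- u))" using lborel_integrable_real_affine[OF assms, of "-1" 0] by simp
 have i1: "integrable lborel (\<lambda>u. indicator {0<..} u * g u)" "integrable lborel (\<lambda>u. indicator {0<..} u * g (- u))"
  "integrable lborel (\<lambda>u. indicator {..<0} u * g u)"
  using integrable_mult_indicator[of _ lborel g] integrable_mult_indicator[of _ lborel "\<lambda>u. g (- u)"] assms gm by auto
 show "integrable lborel (\<lambda>u. indicator {0<..} u * (g u + g (- u)))"
  unfolding distrib_left by (intro Bochner_Integration.integrable_add i1)
 have "lint (\<lambda>u. indicator {..<0} u * g u) = lint (\<lambda>u. indicator {..<0} (- u) * g (- u))"
  using lborel_integral_real_affine[of "-1" "\<lambda>u. indicator {..<0} u * g u" 0] by simp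
 also have "(\<lambda>u::real. indicator {..<0} (- u) * g (- u)) = (\<lambda>u. indicator {0<..} u * g (- u))"
  by (rule ext) (simp add: indicator_def)
 finally have e: "lint (\<lambda>u. indicator {..<0} u * g u) = lint (\<lambda>u. indicator {0<..} u * g (- u))" .
 have "lint g = lint (\<lambda>u. indicator {0<..} u * g u + indicator {..<0} u * g u)"
  by (rule integral_cong_AE) (use assms i1 in \<open>auto intro!: eventually_mono[OF AE_lborel_singleton[of 0]] simp: indicator_def\<close>)
 also have "\<dots> = lint (\<lambda>u. indicator {0<..} u * (g u + g (- u)))"
  unfolding distrib_left Bochner_Integration.integral_add[OF i1(1,3)] Bochner_Integration.integral_add[OF i1(1,2)] e ..
 finally show "lint g = lint (\<lambda>u. indicator {0<..} u * (g u + g (- u)))" .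
qed

lemma integral_exp_substitution:
 fixes g :: "real => real"
 assumes g: "integrable lborel (\<lambda>s. indicator {0<..} s * g s)" and m: "(\<lambda>u. g (exp u) * exp u) \<in> borel_measurable borel"
 shows "integrable lborel (\<lambda>u. g (exp u) * exp u)"
  "lint (\<lambda>s. indicator {0<..} s * g s) = lint (\<lambda>u. g (exp u) * exp u)"
proof -
 have img: "range (exp :: real => real) = {0<..}"
 proof (intro equalityI subsetI)
  fix x :: real assume "x \<in> {0<..}"
  then have "x = exp (ln x)" by simp
  then show "x \<in> range exp" by (rule range_eqI)
 qed auto
 have sg: "set_integrable lborel {0<..} g" using g by (simp add: set_integrable_def)
 have ga: "g absolutely_integrable_on {0<..}"
  using sg unfolding set_integrable_def by (intro integrable_completion[THEN iffD2]) auto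
 have gi: "integral {0<..} g = lint (\<lambda>s. indicator {0<..} s * g s)"
  using set_borel_integral_eq_integral(2)[OF sg] by (simp add: set_lebesgue_integral_def)
 have cv: "(\<lambda>x. \<bar>exp x\<bar> * g (exp x)) absolutely_integrable_on UNIV \<and>
   integral UNIV (\<lambda>x. \<bar>exp x\<bar> * g (exp x)) = integral {0<..} g
   \<longleftrightarrow> g absolutely_integrable_on range exp \<and> integral (range exp) g = integral {0<..} g"
 proof (rule has_absolute_integral_change_of_variables_1')
  show "inj_on (exp :: real => real) UNIV" by (simp add: inj_on_def)
 qed (simp, rule DERIV_exp)
 have "(\<lambda>x. \<bar>exp x\<bar> * g (exp x)) absolutely_integrable_on UNIV \<and>
   integral UNIV (\<lambda>x. \<bar>exp x\<bar> * g (exp x)) = integral {0<..} g"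
  unfolding cv img using ga by (intro conjI refl)
 moreover have e: "(\<lambda>x. \<bar>exp x\<bar> * g (exp x)) = (\<lambda>u. g (exp u) * exp u)"
  by (rule ext) (unfold abs_exp_cancel, rule mult.commute)
 ultimately have 1: "(\<lambda>u. g (exp u) * exp u) absolutely_integrable_on UNIV"
  and 2: "integral UNIV (\<lambda>u. g (exp u) * exp u) = integral {0<..} g"
  unfolding e by blast+
 have "(\<lambda>u. indicat_real UNIV u *\<^sub>R (g (exp u) * exp u)) = (\<lambda>u. g (exp u) * exp u)" by (rule ext) simp
 then have "integrable lebesgue (\<lambda>u. g (exp u) * exp u)" using 1 unfolding set_integrable_def by (simp only:)
 then show i: "integrable lborel (\<lambda>u. g (exp u) * exp u)" using m by (simp add: integrable_completion)
 have "set_integrable lborel UNIV (\<lambda>u. g (exp u) * exp u)" using i by (simp add: set_integrable_def)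
 from set_borel_integral_eq_integral(2)[OF this]
 show "lint (\<lambda>s. indicator {0<..} s * g s) = lint (\<lambda>u. g (exp u) * exp u)"
  using 2 gi by (simp add: set_lebesgue_integral_def)
qed

lemma logistic_integral:
 "integrable lborel (\<lambda>u::real. indicator {0<..} u * (exp (- u) / (1 + exp (- u))^2) :: real)"
 "lint (\<lambda>u::real. indicator {0<..} u * (exp (- u) / (1 + exp (- u))^2) :: real) = 1 / 2"
proof -
 define f where "f u = exp (- u) / (1 + exp (- u))^2" for u :: real
 define G where "G u = 1 / (1 + exp (- u))" for u :: real
 have p: "1 + exp (- u) > 0" for u :: real by (simp add: add_pos_pos)
 have d: "(G has_real_derivative f u) (at u)" for u
  unfolding G_def f_def using p[of u] by (auto intro!: derivative_eq_intros simp: power2_eq_square)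
 have lim: "(G \<longlongrightarrow> 1) at_top" unfolding G_def by real_asymp
 have nn: "(\<integral>\<^sup>+u. ennreal (indicator {0..} u * f u) \<partial>lborel) = ennreal (1 - G 0)"
 proof -
  have "(\<integral>\<^sup>+u. ennreal (f u) * indicator {0..} u \<partial>lborel) = ennreal (1 - G 0)"
   by (rule nn_integral_FTC_atLeast[OF _ d _ lim]) (auto simp: f_def)
  moreover have "ennreal (indicator {0..} u * f u) = ennreal (f u) * indicator {0..} u" for u
   by (simp add: indicator_def)
  ultimately show ?thesis by (simp only:)
 qed
 have int: "integrable lborel (\<lambda>u. indicator {0..} u * f u)"
  by (rule integrableI_nn_integral_finite[OF _ _ nn]) (auto simp: f_def)
 have "lint (\<lambda>u. indicator {0..} u * f u) = enn2real (\<integral>\<^sup>+u. ennreal (indicator {0..} u * f u) \<partial>lborel)"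
  by (rule integral_eq_nn_integral) (auto simp: f_def)
 also have "\<dots> = 1 - G 0" unfolding nn by (rule enn2real_ennreal) (simp add: G_def)
 also have "\<dots> = 1 / 2" by (simp add: G_def)
 finally have v: "lint (\<lambda>u. indicator {0..} u * f u) = 1 / 2" .
 have AE: "AE u in lborel. indicator {0..} u * f u = indicator {0<..} u * f u"
  by (rule eventually_mono[OF AE_lborel_singleton[of 0]]) (simp add: indicator_def)
 have m: "(\<lambda>u. indicator {0..} u * f u) \<in> borel_measurable lborel" "(\<lambda>u. indicator {0<..} u * f u) \<in> borel_measurable lborel"
  unfolding f_def by measurable
 show "integrable lborel (\<lambda>u::real. indicator {0<..} u * (exp (- u) / (1 + exp (- u))^2) :: real)"
  using int integrable_cong_AE[OF m AE] by (simp add: f_def)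
 show "lint (\<lambda>u::real. indicator {0<..} u * (exp (- u) / (1 + exp (- u))^2) :: real) = 1 / 2"
  using v integral_cong_AE[OF m AE] by (simp add: f_def)
qed

text \<open>The substitution \<open>|s| = exp (\<plusminus> u)\<close> turns the integral over each half-line into a
  series of Laplace transforms, plain for \<open>s > 0\<close> and alternating for \<open>s < 0\<close>. Their
  sums are the two partial fraction expansions.\<close>

lemma log_kernel_integral:
 fixes m :: real and lam :: complex
 defines "f \<equiv> \<lambda>s. if s > 0 then (sin (m * ln s))\<^sup>2 / (1 - s)^2 else (Im (lam * of_real (- s) powr (\<i> * m)))\<^sup>2 / (1 - s)^2"
 assumes m: "m \<noteq> 0" and lam: "norm lam = 1" and f: "integrable lborel f"
 shows "lint f = pi * m * (cosh (2 * pi * m) - Re (lam^2)) / sinh (2 * pi * m)"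
proof -
 define x y where "x = Re lam" "y = Im lam"
 have xy: "x^2 + y^2 = 1" using lam by (simp add: x_y_def cmod_power2[symmetric])
 define c where "c = Re (lam^2)"
 have c: "c = x^2 - y^2" by (simp add: c_def x_y_def power2_eq_square)
 have ex: "Im (lam * of_real (exp u) powr (\<i> * m)) = x * sin (m * u) + y * cos (m * u)" for u
 proof -
  have "complex_of_real (exp u) powr (\<i> * m) = cis (m * u)"
   by (simp add: powr_def Ln_of_real cis_conv_exp mult_ac)
  then show ?thesis by (simp add: x_y_def)
 qed
 define g1 where "g1 s = (sin (m * ln s))^2 / (1 - s)^2" for s
 define g2 where "g2 s = (Im (lam * of_real s powr (\<i> * m)))^2 / (1 + s)^2" for s
 define A where "A u = (sin (m * u))^2 / (1 - exp u)^2 * exp u" for u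
 define B where "B u = (x * sin (m * u) + y * cos (m * u))^2 / (1 + exp u)^2 * exp u" for u
 have AB: "A = (\<lambda>u. g1 (exp u) * exp u)" "B = (\<lambda>u. g2 (exp u) * exp u)"
  by (rule ext, simp add: A_def g1_def) (rule ext, simp only: B_def g2_def ex)
 have mAB: "A \<in> borel_measurable borel" "B \<in> borel_measurable borel" unfolding A_def B_def by measurable
 note hs = integral_half_line_split[OF f]
 have fe: "indicator {0<..} s * (f s + f (- s)) = indicator {0<..} s * g1 s + indicator {0<..} s * g2 s" for s
  by (simp add: f_def g1_def g2_def indicator_def)
 have f0: "(\<lambda>s. indicator {0<..} s * f s) = (\<lambda>s. indicator {0<..} s * g1 s)"
  by (simp add: f_def g1_def indicator_def fun_eq_iff)
 have ig1: "integrable lborel (\<lambda>s. indicator {0<..} s * g1 s)"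
  unfolding f0[symmetric] using integrable_mult_indicator[of "{0<..}" lborel f] f by simp
 have ig2: "integrable lborel (\<lambda>s. indicator {0<..} s * g2 s)"
  using Bochner_Integration.integrable_diff[OF hs(1)[unfolded fe] ig1] by simp
 note s1 = integral_exp_substitution[OF ig1, folded AB(1), OF mAB(1)]
 note s2 = integral_exp_substitution[OF ig2, folded AB(2), OF mAB(2)]
 have "lint f = lint A + lint B"
  unfolding hs(2) fe Bochner_Integration.integral_add[OF ig1 ig2] s1(2) s2(2) ..
 also have "\<dots> = lint (\<lambda>u. indicator {0<..} u * (A u + A (- u))) + lint (\<lambda>u. indicator {0<..} u * (B u + B (- u)))"
  using integral_half_line_split(2)[OF s1(1)] integral_half_line_split(2)[OF s2(1)] by simp
 finally have tot: "lint f = lint (\<lambda>u. indicator {0<..} u * (A u + A (- u))) + lint (\<lambda>u. indicator {0<..} u * (B u + B (- u)))" .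
 define q where "q e u = exp (- u) / (1 - e * exp (- u))^2" for e u :: real
 have qp: "exp u / (1 - e * exp u)^2 = q e u" "exp (- u) / (1 - e * exp (- u))^2 = q e u" if "\<bar>e\<bar> = 1" for e u
 proof -
  have e2: "e * e = 1" using that by (metis abs_mult_self_eq mult_1)
  have "exp u * (1 - e * exp (- u)) = - (e * (1 - e * exp u))"
   using e2 by (simp add: algebra_simps exp_minus)
  then have "(exp u * (1 - e * exp (- u)))^2 = (1 - e * exp u)^2"
   using e2 by (simp add: power_mult_distrib power2_eq_square[of e])
  then have "exp u / (1 - e * exp u)^2 = exp u / ((exp u)^2 * (1 - e * exp (- u))^2)"
   by (simp add: power_mult_distrib)
  also have "\<dots> = q e u"
  proof -
   have "t / (t^2 * D) = inverse t / D" if "t \<noteq> 0" for t D :: real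
    using that by (simp add: power2_eq_square field_simps)
   then show ?thesis unfolding q_def exp_minus by simp
  qed
  finally show "exp u / (1 - e * exp u)^2 = q e u" .
 qed (simp add: q_def)
 have qp1: "exp u / (1 - 1 * exp u)^2 = q 1 u" "exp (- u) / (1 - 1 * exp (- u))^2 = q 1 u" for u
  by (rule qp[OF abs_one])+
 have qm1: "exp u / (1 - - 1 * exp u)^2 = q (- 1) u" "exp (- u) / (1 - - 1 * exp (- u))^2 = q (- 1) u" for u
  by (rule qp, simp)+
 have Au: "A u + A (- u) = 2 * ((sin (m * u))^2 * q 1 u)" for u
 proof -
  have "A u = (sin (m * u))^2 * (exp u / (1 - 1 * exp u)^2)" by (simp add: A_def)
  moreover have "A (- u) = (sin (m * u))^2 * (exp (- u) / (1 - 1 * exp (- u))^2)" by (simp add: A_def)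
  ultimately show ?thesis unfolding qp1(1)[of u] qp1(2)[of u] by linarith
 qed
 have Bu: "B u + B (- u) = (1 - c) * q (-1) u + 2 * c * ((sin (m * u))^2 * q (-1) u)" for u
 proof -
  have "B u + B (- u) = ((x * sin (m * u) + y * cos (m * u))^2 + (- x * sin (m * u) + y * cos (m * u))^2) * q (-1) u"
  proof -
   have "B u = (x * sin (m * u) + y * cos (m * u))^2 * (exp u / (1 - - 1 * exp u)^2)" by (simp add: B_def)
   moreover have "B (- u) = (- x * sin (m * u) + y * cos (m * u))^2 * (exp (- u) / (1 - - 1 * exp (- u))^2)" by (simp add: B_def)
   ultimately show ?thesis unfolding qm1(1)[of u] qm1(2)[of u] distrib_right by linarith
  qed
  also have "(x * sin (m * u) + y * cos (m * u))^2 + (- x * sin (m * u) + y * cos (m * u))^2 = 2 * x^2 * (sin (m * u))^2 + 2 * y^2 * (cos (m * u))^2"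
   by (simp add: power2_sum power2_diff power_mult_distrib)
  also have "\<dots> = (1 - c) + 2 * c * (sin (m * u))^2"
  proof -
   have y2: "2 * y^2 = 1 - c" using xy c by simp
   have cs: "(cos (m * u))^2 = 1 - (sin (m * u))^2" using sin_cos_squared_add[of "m * u"] by linarith
   have x2: "2 * x^2 = 1 + c" using xy c by simp
   show ?thesis unfolding y2 cs x2 by (simp add: algebra_simps)
  qed
  finally show ?thesis by (simp add: distrib_right)
 qed
 define a where "a = 2 * m"
 have a0: "a \<noteq> 0" using m by (simp add: a_def)
 define T1 where "T1 = (pi * a * (cosh (pi * a) / sinh (pi * a)) - 1) / 2"
 define T2 where "T2 = (1 - pi * a / sinh (pi * a)) / 2"
 have "(\<lambda>n. 1 ^ n * ((2 * m)^2 / ((real (Suc n))^2 + (2 * m)^2))) sums T1"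
  using coth_partial_fractions[OF a0] unfolding T1_def by (simp add: a_def)
 note J1 = exp_series_sin_square_integral[OF m abs_one this, folded q_def]
 have "(\<lambda>n. (-1) ^ n * ((2 * m)^2 / ((real (Suc n))^2 + (2 * m)^2))) sums T2"
  using alternating_partial_fractions[OF a0] unfolding T2_def by (simp add: a_def)
 moreover have "\<bar>- 1 :: real\<bar> = 1" by simp
 ultimately have J2: "integrable lborel (\<lambda>u. indicator {0<..} u * ((sin (m * u))^2 * q (- 1) u))"
   "lint (\<lambda>u. indicator {0<..} u * ((sin (m * u))^2 * q (- 1) u)) = T2 / 2"
  unfolding q_def by (blast intro: exp_series_sin_square_integral[OF m])+
 have J3: "integrable lborel (\<lambda>u. indicator {0<..} u * q (-1) u)" "lint (\<lambda>u. indicator {0<..} u * q (-1) u) = 1 / 2"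
  using logistic_integral by (simp_all add: q_def)
 have "lint (\<lambda>u. indicator {0<..} u * (A u + A (- u))) = T1"
 proof -
  have "(\<lambda>u. indicator {0<..} u * (A u + A (- u))) = (\<lambda>u. 2 * (indicator {0<..} u * ((sin (m * u))^2 * q 1 u)))"
   unfolding Au by (rule ext) simp
  then show ?thesis using J1(2) by simp
 qed
 moreover have "lint (\<lambda>u. indicator {0<..} u * (B u + B (- u))) = (1 - c) / 2 + c * T2"
 proof -
  have "(\<lambda>u. indicator {0<..} u * (B u + B (- u))) = (\<lambda>u. (1 - c) * (indicator {0<..} u * q (-1) u) + 2 * c * (indicator {0<..} u * ((sin (m * u))^2 * q (-1) u)))"
   unfolding Bu by (rule ext) (simp add: algebra_simps)
  then have "lint (\<lambda>u. indicator {0<..} u * (B u + B (- u)))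
   = (1 - c) * lint (\<lambda>u. indicator {0<..} u * q (-1) u) + 2 * c * lint (\<lambda>u. indicator {0<..} u * ((sin (m * u))^2 * q (-1) u))"
   using J2(1) J3(1) by simp
  then show ?thesis unfolding J2(2) J3(2) by simp
 qed
 moreover have "T1 + ((1 - c) / 2 + c * T2) = pi * m * (cosh (2 * pi * m) - c) / sinh (2 * pi * m)"
 proof -
  have e: "pi * a = 2 * pi * m" by (simp add: a_def)
  have s: "sinh (2 * pi * m) \<noteq> 0" using m by simp
  show ?thesis unfolding T1_def T2_def e using s by (simp add: field_simps)
 qed
 ultimately show ?thesis unfolding tot c_def by simp
qed

section \<open>The kernel acting on its own pair\<close>

context integrable_pair
begin

lemma F_tendsto_0:
 assumes "filterlim (\<lambda>n. \<bar>X n\<bar>) at_top sequentially" "\<And>n. X n \<noteq> (0::real)"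
 shows "(\<lambda>n. F1 (X n)) \<longlonglongrightarrow> 0" "(\<lambda>n. F2 (X n)) \<longlonglongrightarrow> 0"
proof -
 have "((\<lambda>x::real. exp (- x / 4)) \<longlongrightarrow> 0) at_top" by real_asymp
 then have e: "((\<lambda>x::real. M * exp (- x / 4)) \<longlongrightarrow> 0) at_top" by (rule tendsto_mult_right_zero)
 have lim: "(\<lambda>n. M * exp (- \<bar>X n\<bar> / 4)) \<longlonglongrightarrow> 0"
  by (rule filterlim_compose[OF e assms(1)])
 show "(\<lambda>n. F1 (X n)) \<longlonglongrightarrow> 0"
  by (rule Lim_null_comparison[OF _ lim]) (rule always_eventually, simp only: real_norm_def M(1)[OF assms(2)] simp_thms)
 show "(\<lambda>n. F2 (X n)) \<longlonglongrightarrow> 0"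
  by (rule Lim_null_comparison[OF _ lim]) (rule always_eventually, simp only: real_norm_def M(2)[OF assms(2)] simp_thms)
qed

text \<open>The difference of the norms is the integral of the derivative of \<open>E\<close> over both half-lines. It
  vanishes as \<open>E\<close> tends to 0 at infinity and has the same limit at 0 from both sides.\<close>

lemma C11_eq_C22: "C11 = C22"
proof -
 define d where "d x = (F2 x)^2 - (F1 x)^2" for x
 have Fi: "integrable lborel (\<lambda>s. (F1 s)^2)" "integrable lborel (\<lambda>s. (F2 s)^2)"
  using integrable_F_sq[of 1] by simp_all
 have di: "integrable lborel d" unfolding d_def by (rule Bochner_Integration.integrable_diff[OF Fi(2,1)])
 have dv: "lint d = C22 - C11"
  unfolding d_def C11_def C22_def by (rule Bochner_Integration.integral_diff[OF Fi(2,1)])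
 have dc: "isCont d x" if "x \<noteq> 0" for x
  unfolding d_def using that by (intro continuous_intros DERIV_isCont[OF F1_deriv] DERIV_isCont[OF F2_deriv])
 have ftc: "lint (\<lambda>x. indicator {a..b} x *\<^sub>R d x) = E b - E a" if "a \<le> b" "0 \<notin> {a..b}" for a b
 proof (rule integral_FTC_atLeastAtMost[OF that(1)])
  show "continuous_on {a..b} d"
   by (rule continuous_at_imp_continuous_on) (use dc that(2) in force)
  fix x assume "a \<le> x" "x \<le> b"
  then have "x \<noteq> 0" using that(2) by auto
  then show "(E has_vector_derivative d x) (at x within {a..b})"
   unfolding d_def using E_deriv[of x]
   by (simp add: has_real_derivative_iff_has_vector_derivative[symmetric] has_field_derivative_at_within)
 qed
 define ep where "ep n = 1 / (real n + 1)" for n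
 define R where "R n = real n + 1" for n
 have eR: "0 < ep n" "ep n \<le> R n" "0 < R n" for n
 proof -
  have "ep n \<le> 1" "1 \<le> R n" "0 < ep n" by (auto simp: ep_def R_def field_simps)
  then show "0 < ep n" "ep n \<le> R n" "0 < R n" by linarith+
 qed
 define s where "s n x = indicator {ep n..R n} x *\<^sub>R d x + indicator {- R n..- ep n} x *\<^sub>R d x" for n x
 have i1: "integrable lborel (\<lambda>x. indicator {a..b} x *\<^sub>R d x)" for a b
  by (rule integrable_mult_indicator[OF _ di]) simp
 have sv: "lint (s n) = (E (R n) - E (ep n)) + (E (- ep n) - E (- R n))" for n
 proof -
  have "lint (s n) = lint (\<lambda>x. indicator {ep n..R n} x *\<^sub>R d x) + lint (\<lambda>x. indicator {- R n..- ep n} x *\<^sub>R d x)"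
   unfolding s_def by (rule Bochner_Integration.integral_add[OF i1 i1])
  moreover have "0 \<notin> {ep n..R n}" "0 \<notin> {- R n..- ep n}" "- R n \<le> - ep n" using eR[of n] by auto
  ultimately show ?thesis using ftc eR(2)[of n] by simp
 qed
 have "(\<lambda>n. lint (s n)) \<longlonglongrightarrow> lint d"
 proof (rule integral_dominated_convergence[where w = "\<lambda>x. \<bar>d x\<bar>"])
  show "d \<in> borel_measurable lborel" using di by simp
  show "s n \<in> borel_measurable lborel" for n unfolding s_def using di by simp
  show "integrable lborel (\<lambda>x. \<bar>d x\<bar>)" using di by simp
  show "AE x in lborel. norm (s n x) \<le> \<bar>d x\<bar>" for n
   by (rule AE_I2) (use eR(1)[of n] in \<open>simp add: s_def indicator_def\<close>)
  show "AE x in lborel. (\<lambda>n. s n x) \<longlonglongrightarrow> d x"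
  proof (rule eventually_mono[OF AE_lborel_singleton[of 0]])
   fix x :: real assume x: "x \<noteq> 0"
   obtain n0 :: nat where n0: "1 / \<bar>x\<bar> + \<bar>x\<bar> < real n0" using reals_Archimedean2 by blast
   have x0: "\<bar>x\<bar> > 0" using x by simp
   show "(\<lambda>n. s n x) \<longlonglongrightarrow> d x"
   proof (rule tendsto_eventually, rule eventually_mono[OF eventually_ge_at_top[of n0]])
    fix n assume "n \<ge> n0"
    then have n: "1 / \<bar>x\<bar> + \<bar>x\<bar> < real n" using n0 by linarith
    have "1 / \<bar>x\<bar> > 0" using x0 by simp
    then have a: "\<bar>x\<bar> \<le> R n" "1 / \<bar>x\<bar> \<le> real n + 1" unfolding R_def using n x0 by linarith+
    then have b: "ep n \<le> \<bar>x\<bar>" unfolding ep_def using x0 by (simp add: field_simps)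
    show "s n x = d x"
    proof (cases "x > 0")
     case True
     then have "x \<in> {ep n..R n}" "x \<notin> {- R n..- ep n}" using a b eR[of n] by auto
     then show ?thesis by (simp add: s_def)
    next
     case False
     then have "x \<in> {- R n..- ep n}" "x \<notin> {ep n..R n}" using a b eR[of n] x by auto
     then show ?thesis by (simp add: s_def)
    qed
   qed
  qed
 qed
 moreover have "(\<lambda>n. lint (s n)) \<longlonglongrightarrow> 0"
 proof -
  have Rt: "filterlim (\<lambda>n. \<bar>R n\<bar>) at_top sequentially" "filterlim (\<lambda>n. \<bar>- R n\<bar>) at_top sequentially"
   unfolding R_def by real_asymp+
  have R0: "R n \<noteq> 0" "- R n \<noteq> 0" for n using eR(3)[of n] by auto
  have "(\<lambda>n. E (R n)) \<longlonglongrightarrow> 0^2 + 0^2 + 2 * r / w * (0 * 0)" "(\<lambda>n. E (- R n)) \<longlonglongrightarrow> 0^2 + 0^2 + 2 * r / w * (0 * 0)"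
   unfolding E_def by (intro tendsto_intros F_tendsto_0[OF Rt(1) R0(1)] F_tendsto_0[OF Rt(2) R0(2)])+
  then have El: "(\<lambda>n. E (R n)) \<longlonglongrightarrow> 0" "(\<lambda>n. E (- R n)) \<longlonglongrightarrow> 0" by simp_all
  have et: "filterlim ep (at_right 0) sequentially" unfolding ep_def by real_asymp
  define E0 where "E0 = m^2 / w^2 * (norm a)^2"
  have Ee: "(\<lambda>n. E (ep n)) \<longlonglongrightarrow> E0" "(\<lambda>n. E (- ep n)) \<longlonglongrightarrow> E0"
   using filterlim_compose[OF E_limit(1) et] filterlim_compose[OF E_limit(2) et] by (simp_all add: E0_def)
  have "(\<lambda>n. (E (R n) - E (ep n)) + (E (- ep n) - E (- R n))) \<longlonglongrightarrow> (0 - E0) + (E0 - 0)"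
   by (intro tendsto_intros El Ee)
  then show ?thesis unfolding sv by simp
 qed
 ultimately have "lint d = 0" by (rule LIMSEQ_unique)
 then show ?thesis using dv by simp
qed

lemma F_nonzero:
 assumes "x0 > 0"
 shows "F1 x0 \<noteq> 0 \<or> F2 x0 \<noteq> 0"
proof (rule ccontr)
 assume "\<not> (F1 x0 \<noteq> 0 \<or> F2 x0 \<noteq> 0)"
 then have z: "F1 x0 = 0" "F2 x0 = 0" by auto
 have "F1 x = 0 \<and> F2 x = 0" if "x > 0" for x
  by (rule system_unique[OF F1_deriv F2_deriv assms z that]) auto
 then have "\<forall>\<^sub>F x in at_right 0. E x = 0"
  using eventually_at_right_less[of 0] by (auto simp: E_def elim!: eventually_mono)
 then have "(E \<longlongrightarrow> 0) (at_right 0)" by (rule tendsto_eventually)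
 then have "m^2 / w^2 * (norm a)^2 = 0" using tendsto_unique[OF _ E_limit(1)] by auto
 then show False using m0 w a0 by simp
qed

text \<open>Subtracting the multiple \<open>\<beta> F2\<close> removes the inhomogeneity, so the image of the pair is
  another solution. It is bounded at infinity, so it decays by the dichotomy, and it is proportional to the
  pair because the Wronskian is constant and vanishes at infinity.\<close>

lemma Phi_proportional:
 "\<exists>c \<beta>. \<forall>t>0. Phi1 t = c * F1 t \<and> Phi2 t = (c + \<beta>) * F2 t"
proof -
 define \<beta> where "\<beta> = C11 / w"
 have bw: "C11 = w * \<beta>" "C22 = w * \<beta>" using w C11_eq_C22 by (simp_all add: \<beta>_def)
 define p where "p = Phi1"
 define q where "q t = Phi2 t - \<beta> * F2 t" for t
 have pd: "(p has_real_derivative (((r - t / 2) * p t + w * q t) / t)) (at t)" if "t > 0" for t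
  unfolding p_def q_def by (rule DERIV_cong[OF Phi_deriv(1)[OF that]]) (simp add: bw algebra_simps)
 have qd: "(q has_real_derivative (((t / 2 - r) * q t - w * p t) / t)) (at t)" if "t > 0" for t
 proof -
  have t0: "t \<noteq> 0" using that by simp
  show ?thesis unfolding p_def q_def
   by (rule DERIV_cong[OF DERIV_diff[OF Phi_deriv(2)[OF that] DERIV_cmult[OF F2_deriv[OF t0]]]])
    (simp add: bw diff_divide_distrib[symmetric] algebra_simps)
 qed
 define K where "K = C * M * lint (\<lambda>s. exp (- (1/4) * \<bar>s\<bar>))"
 have Ki: "integrable lborel (\<lambda>s. C * M * exp (- (1/4) * \<bar>s\<bar>))"
  by (rule integrable_exp_bound[of _ "1/4" "C * M"]) (use C_nonneg M_nonneg in auto)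
 have P2: "\<bar>Phi2 t\<bar> \<le> K" if "t \<ge> 1" for t
 proof -
  have t: "t > 0" using that by simp
  have "\<bar>Phi2 t\<bar> \<le> lint (\<lambda>s. \<bar>N t 1 s * F2 (t * s)\<bar>)"
   unfolding Phi2_def by (rule integral_abs_bound)
  also have "\<dots> \<le> lint (\<lambda>s. C * M * exp (- (1/4) * \<bar>s\<bar>))"
  proof (rule integral_mono_AE)
   show "integrable lborel (\<lambda>s. \<bar>N t 1 s * F2 (t * s)\<bar>)" using integrable_N_F(2)[OF t, of 1] by simp
   show "AE s in lborel. \<bar>N t 1 s * F2 (t * s)\<bar> \<le> C * M * exp (- (1/4) * \<bar>s\<bar>)"
   proof (rule eventually_mono[OF AE_lborel_singleton[of 0]])
    fix s :: real assume "s \<noteq> 0"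
    then show "\<bar>N t 1 s * F2 (t * s)\<bar> \<le> C * M * exp (- (1/4) * \<bar>s\<bar>)"
     using N_F_bound(2)[of s 1 t 1] that by simp
   qed
  qed (rule Ki)
  also have "\<dots> = K" unfolding K_def by simp
  finally show ?thesis .
 qed
 have lim0: "((\<lambda>x. q x * exp (- x / 2) * x powr r) \<longlongrightarrow> 0) at_top"
 proof (rule Lim_null_comparison)
  have "((\<lambda>x. (K + \<bar>\<beta>\<bar> * M) * (exp (- (1/2) * x) * x powr r)) \<longlongrightarrow> (K + \<bar>\<beta>\<bar> * M) * 0) at_top"
   by (intro tendsto_intros exp_powr_tendsto_0) simp
  then show "((\<lambda>x. (K + \<bar>\<beta>\<bar> * M) * (exp (- (1/2) * x) * x powr r)) \<longlongrightarrow> 0) at_top" by simp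
  show "\<forall>\<^sub>F x in at_top. norm (q x * exp (- x / 2) * x powr r) \<le> (K + \<bar>\<beta>\<bar> * M) * (exp (- (1/2) * x) * x powr r)"
   using eventually_ge_at_top[of 1]
  proof eventually_elim
   case (elim x)
   have "\<bar>\<beta> * F2 x\<bar> \<le> \<bar>\<beta>\<bar> * M" unfolding abs_mult using elim by (intro mult_left_mono M'(2)) auto
   then have "\<bar>q x\<bar> \<le> K + \<bar>\<beta>\<bar> * M" unfolding q_def using P2[OF elim] by linarith
   moreover have "norm (q x * exp (- x / 2) * x powr r) = \<bar>q x\<bar> * (exp (- (1/2) * x) * x powr r)" by (simp add: abs_mult)
   ultimately show ?case by (simp only: mult_right_mono mult_nonneg_nonneg exp_ge_zero powr_ge_zero)
  qed
 qed
 have "\<exists>C' Y. \<forall>x\<ge>Y. \<bar>p x\<bar> \<le> C' * exp (- x / 4) \<and> \<bar>q x\<bar> \<le> C' * exp (- x / 4)"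
 proof (rule system_limit(2)[where p = p and q = q and w = w and X = 1 and r = r])
  show "(p has_real_derivative ((r - x / 2) * p x + w * q x) / x) (at x)" if "1 \<le> x" for x
   by (rule pd) (use that in simp)
  show "(q has_real_derivative ((x / 2 - r) * q x - w * p x) / x) (at x)" if "1 \<le> x" for x
   by (rule qd) (use that in simp)
 qed (rule w, simp, rule lim0)
 then obtain C' Y where dec0: "\<forall>x\<ge>Y. \<bar>p x\<bar> \<le> C' * exp (- x / 4) \<and> \<bar>q x\<bar> \<le> C' * exp (- x / 4)"
  by (elim exE)
 have dec: "\<bar>p x\<bar> \<le> C' * exp (- x / 4) \<and> \<bar>q x\<bar> \<le> C' * exp (- x / 4)" if "x \<ge> Y" for x
  using dec0 that by (simp only: simp_thms)
 define W where "W t = p t * F2 t - q t * F1 t" for t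
 have Wd: "(W has_real_derivative 0) (at t)" if "t > 0" for t
 proof -
  have t0: "t \<noteq> 0" using that by simp
  show ?thesis unfolding W_def
   by (rule DERIV_cong[OF DERIV_diff[OF DERIV_mult[OF pd[OF that] F2_deriv[OF t0]] DERIV_mult[OF qd[OF that] F1_deriv[OF t0]]]])
    (simp add: add_divide_distrib[symmetric] diff_divide_distrib[symmetric] algebra_simps)
 qed
 have Wc: "W t = W 1" if "t \<ge> 1" for t
 proof (cases "t = 1")
  case False
  then have "1 < t" using that by simp
  moreover have "continuous_on {1..t} W"
   by (intro continuous_at_imp_continuous_on ballI DERIV_isCont[OF Wd]) auto
  ultimately show ?thesis
   by (rule DERIV_isconst_end) (use Wd in auto)
 qed simp
 have W1: "W 1 = 0"
 proof -
  have n1: "filterlim (\<lambda>n. \<bar>real (Suc n)\<bar>) at_top sequentially" by real_asymp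
  note Fl = F_tendsto_0[OF n1]
  have "(\<lambda>n. exp (- real (Suc n) / 4)) \<longlonglongrightarrow> 0" by real_asymp
  then have e: "(\<lambda>n. C' * exp (- real (Suc n) / 4)) \<longlonglongrightarrow> 0" by (rule tendsto_mult_right_zero)
  obtain n0 :: nat where n0: "Y \<le> real n0" using real_arch_simple by blast
  have ev: "\<forall>\<^sub>F n in sequentially. norm (p (real (Suc n))) \<le> C' * exp (- real (Suc n) / 4) \<and> norm (q (real (Suc n))) \<le> C' * exp (- real (Suc n) / 4)"
   by (rule eventually_mono[OF eventually_ge_at_top[of n0]], unfold real_norm_def, rule dec) (use n0 in simp)
  have pl: "(\<lambda>n. p (real (Suc n))) \<longlonglongrightarrow> 0" by (rule Lim_null_comparison[OF _ e]) (rule eventually_mono[OF ev], simp)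
  have ql: "(\<lambda>n. q (real (Suc n))) \<longlonglongrightarrow> 0" by (rule Lim_null_comparison[OF _ e]) (rule eventually_mono[OF ev], simp)
  have "(\<lambda>n. W (real (Suc n))) \<longlonglongrightarrow> 0 * 0 - 0 * 0"
   unfolding W_def by (intro tendsto_intros pl ql Fl) simp_all
  moreover have "W (real (Suc n)) = W 1" for n by (rule Wc) simp
  ultimately show ?thesis by (simp add: LIMSEQ_const_iff)
 qed
 obtain c where c: "p 1 = c * F1 1" "q 1 = c * F2 1"
 proof (cases "F1 1 = 0")
  case True
  then have F2: "F2 1 \<noteq> 0" using F_nonzero[of 1] by simp
  then have "p 1 = 0" using W1 True by (simp add: W_def)
  then show ?thesis using True F2 by (intro that[of "q 1 / F2 1"]) simp_all
 next
  case False
  have "q 1 = p 1 / F1 1 * F2 1" using W1 False by (simp add: W_def field_simps)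
  then show ?thesis using False by (intro that[of "p 1 / F1 1"]) simp_all
 qed
 have "p t - c * F1 t = 0 \<and> q t - c * F2 t = 0" if "t > 0" for t
 proof (rule system_unique[of "\<lambda>t. p t - c * F1 t" r w "\<lambda>t. q t - c * F2 t" 1 t])
  fix x :: real assume x: "x > 0"
  then have x0: "x \<noteq> 0" by simp
  show "((\<lambda>t. p t - c * F1 t) has_real_derivative ((r - x / 2) * (p x - c * F1 x) + w * (q x - c * F2 x)) / x) (at x)"
   by (rule DERIV_cong[OF DERIV_diff[OF pd[OF x] DERIV_cmult[OF F1_deriv[OF x0]]]])
    (simp add: diff_divide_distrib[symmetric] algebra_simps)
  show "((\<lambda>t. q t - c * F2 t) has_real_derivative ((x / 2 - r) * (q x - c * F2 x) - w * (p x - c * F1 x)) / x) (at x)"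
   by (rule DERIV_cong[OF DERIV_diff[OF qd[OF x] DERIV_cmult[OF F2_deriv[OF x0]]]])
    (use x0 in \<open>simp add: field_simps\<close>)
 qed (use c that in simp_all)
 then have "\<forall>t>0. Phi1 t = c * F1 t \<and> Phi2 t = (c + \<beta>) * F2 t"
  by (simp add: p_def q_def algebra_simps)
 then show ?thesis by (intro exI)
qed

text \<open>The diagonal value is the limit of the off-diagonal ones, with the derivatives expressed through the system.\<close>

definition kd :: "real => real => real" where
 "kd x y = (if x = y then (w * ((F1 x)^2 + (F2 x)^2) + (2 * r - x) * (F1 x * F2 x)) / x else k x y)"

text \<open>The diagonal values are those that make the scaling law hold on the diagonal too.\<close>

lemma kd_scaled_deriv:
 assumes t: "t > 0" and x: "x \<noteq> 0" "y \<noteq> 0"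
 shows "((\<lambda>t. t * kd (t * x) (t * y)) has_real_derivative (- (F1 (t * x) * F2 (t * y) + F2 (t * x) * F1 (t * y)) / 2)) (at t)"
proof (cases "x = y")
 case False
 have "((\<lambda>t. N t x y) has_real_derivative (- (F1 (t * x) * F2 (t * y) + F2 (t * x) * F1 (t * y)) / 2)) (at t)"
  by (rule N_deriv[OF t x False])
 moreover have "\<forall>\<^sub>F u in nhds t. u * kd (u * x) (u * y) = N u x y"
  by (rule eventually_mono[OF t1_space_nhds[of t 0]]) (use t False in \<open>auto simp: kd_def N_def\<close>)
 ultimately show ?thesis by (simp add: DERIV_cong_ev[OF refl _ refl])
next
 case True
 define g where "g u = w * ((F1 u)^2 + (F2 u)^2) + (2 * r - u) * (F1 u * F2 u)" for u
 have gd: "(g has_real_derivative (- F1 u * F2 u)) (at u)" if "u \<noteq> 0" for u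
  unfolding g_def using that
  by (auto intro!: derivative_eq_intros F1_deriv F2_deriv) (simp add: field_simps power2_eq_square)
 have dx: "((\<lambda>t. t * x) has_real_derivative x) (at t)" by (auto intro!: derivative_eq_intros)
 have tx: "t * x \<noteq> 0" using t x by simp
 have "((\<lambda>t. g (t * x) / x) has_real_derivative (- F1 (t * x) * F2 (t * x) * x / x)) (at t)"
  by (rule DERIV_cdivide[OF DERIV_chain2[OF gd[OF tx] dx]])
 then have "((\<lambda>t. g (t * x) / x) has_real_derivative (- (F1 (t * x) * F2 (t * y) + F2 (t * x) * F1 (t * y)) / 2)) (at t)"
  by (rule DERIV_cong) (use x True in simp)
 moreover have "\<forall>\<^sub>F u in nhds t. u * kd (u * x) (u * y) = g (u * x) / x"
  by (rule eventually_mono[OF t1_space_nhds[of t 0]]) (use t True x in \<open>auto simp: kd_def g_def\<close>)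
 ultimately show ?thesis by (simp add: DERIV_cong_ev[OF refl _ refl])
qed

lemma kd_scaled_tendsto_0:
 assumes "x > 0" "y > 0"
 shows "(\<lambda>n. real (Suc n) * kd (real (Suc n) * x) (real (Suc n) * y)) \<longlonglongrightarrow> 0"
proof -
 define X where "X n = real (Suc n) * x" for n
 define Y where "Y n = real (Suc n) * y" for n
 have Xn: "X n \<noteq> 0" "Y n \<noteq> 0" for n using assms by (auto simp: X_def Y_def)
 have inf: "filterlim (\<lambda>n. \<bar>X n\<bar>) at_top sequentially" "filterlim (\<lambda>n. \<bar>Y n\<bar>) at_top sequentially"
  unfolding X_def Y_def using assms by real_asymp+
 note FX = F_tendsto_0[OF inf(1) Xn(1)] and FY = F_tendsto_0[OF inf(2) Xn(2)]
 show ?thesis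
 proof (cases "x = y")
  case False
  have "(\<lambda>n. (F1 (X n) * F2 (Y n) - F2 (X n) * F1 (Y n)) / (x - y)) \<longlonglongrightarrow> (0 * 0 - 0 * 0) / (x - y)"
   using False by (intro tendsto_intros FX FY) simp
  moreover have "real (Suc n) * kd (real (Suc n) * x) (real (Suc n) * y) = (F1 (X n) * F2 (Y n) - F2 (X n) * F1 (Y n)) / (x - y)" for n
   using N_eq[of "real (Suc n)" x y] False unfolding N_def X_def Y_def kd_def by (simp del: of_nat_Suc)
  ultimately show ?thesis by simp
 next
  case True
  have b: "\<bar>X n * (F1 (X n) * F2 (X n))\<bar> \<le> X n * (M * exp (- (X n) / 4) * M)" for n
  proof -
   have X0: "X n > 0" using assms by (simp add: X_def)
   have "\<bar>F1 (X n)\<bar> \<le> M * exp (- X n / 4)" using M(1)[OF Xn(1), of n] X0 by simp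
   then have "\<bar>F1 (X n)\<bar> * \<bar>F2 (X n)\<bar> \<le> M * exp (- X n / 4) * M" by (rule mult_mono[OF _ M'(2)[OF Xn(1)]]) (use M_nonneg in simp_all)
   then show ?thesis unfolding abs_mult using X0 by simp
  qed
  have "((\<lambda>u::real. u * exp (- u / 4)) \<longlongrightarrow> 0) at_top" by real_asymp
  then have "((\<lambda>u::real. (M * M) * (u * exp (- u / 4))) \<longlongrightarrow> 0) at_top" by (rule tendsto_mult_right_zero)
  then have e: "((\<lambda>u::real. u * (M * exp (- u / 4) * M)) \<longlongrightarrow> 0) at_top" by (simp only: mult_ac)
  have Xt: "filterlim X at_top sequentially" unfolding X_def using assms by real_asymp
  have z: "(\<lambda>n. X n * (F1 (X n) * F2 (X n))) \<longlonglongrightarrow> 0"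
   by (rule Lim_null_comparison[OF always_eventually filterlim_compose[OF e Xt]]) (simp only: real_norm_def b simp_thms)
  have "(\<lambda>n. (w * ((F1 (X n))^2 + (F2 (X n))^2) + 2 * r * (F1 (X n) * F2 (X n)) - X n * (F1 (X n) * F2 (X n))) / x) \<longlonglongrightarrow> (w * (0^2 + 0^2) + 2 * r * (0 * 0) - 0) / x"
   using assms by (intro tendsto_intros FX z) simp
  moreover have "real (Suc n) * kd (real (Suc n) * x) (real (Suc n) * y) = (w * ((F1 (X n))^2 + (F2 (X n))^2) + 2 * r * (F1 (X n) * F2 (X n)) - X n * (F1 (X n) * F2 (X n))) / x" for n
  proof -
   have "kd (X n) (X n) = (w * ((F1 (X n))^2 + (F2 (X n))^2) + 2 * r * (F1 (X n) * F2 (X n)) - X n * (F1 (X n) * F2 (X n))) / (real (Suc n) * x)"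
    by (simp add: kd_def left_diff_distrib X_def del: of_nat_Suc)
   then have "real (Suc n) * kd (X n) (X n) = (w * ((F1 (X n))^2 + (F2 (X n))^2) + 2 * r * (F1 (X n) * F2 (X n)) - X n * (F1 (X n) * F2 (X n))) / x"
    by (simp only:) (simp del: of_nat_Suc)
   then show ?thesis unfolding True[symmetric] X_def[symmetric] .
  qed
  ultimately show ?thesis by simp
 qed
qed

lemma N_product_integrable:
 assumes "t > 0" "x > 0" "y > 0"
 shows "integrable lborel (\<lambda>s. N t x s * N t y s)"
  and "AE s in lborel. \<bar>N t x s * N t y s\<bar> \<le> C * C * (2 / (min (min x y) 1)^2) * inverse (1 + s^2)"
proof -
 show b: "AE s in lborel. \<bar>N t x s * N t y s\<bar> \<le> C * C * (2 / (min (min x y) 1)^2) * inverse (1 + s^2)"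
 proof (rule eventually_mono[OF AE_lborel_singleton[of 0]])
  fix s :: real assume s: "s \<noteq> 0"
  define c where "c = min x y"
  have c: "c > 0" "c \<le> \<bar>x\<bar>" "c \<le> \<bar>y\<bar>" using assms by (auto simp: c_def)
  have mx: "max c \<bar>s\<bar> > 0" using c by simp
  have "\<bar>N t x s\<bar> \<le> C / max \<bar>x\<bar> \<bar>s\<bar>" "\<bar>N t y s\<bar> \<le> C / max \<bar>y\<bar> \<bar>s\<bar>" using N_bound[of t x s] N_bound[of t y s] assms s by simp_all
  moreover have "C / max \<bar>x\<bar> \<bar>s\<bar> \<le> C / max c \<bar>s\<bar>" "C / max \<bar>y\<bar> \<bar>s\<bar> \<le> C / max c \<bar>s\<bar>"
   using c mx C_nonneg by (intro frac_le; simp)+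
  ultimately have "\<bar>N t x s\<bar> \<le> C / max c \<bar>s\<bar>" "\<bar>N t y s\<bar> \<le> C / max c \<bar>s\<bar>" by linarith+
  then have "\<bar>N t x s * N t y s\<bar> \<le> (C / max c \<bar>s\<bar>) * (C / max c \<bar>s\<bar>)"
   unfolding abs_mult using C_nonneg mx by (intro mult_mono) auto
  also have "\<dots> = C * C * (1 / (max c \<bar>s\<bar>)^2)" by (simp add: power2_eq_square)
  also have "\<dots> \<le> C * C * ((2 / (min c 1)^2) * inverse (1 + s^2))"
   using C_nonneg by (intro mult_left_mono max_square_bound c) simp
  finally show "\<bar>N t x s * N t y s\<bar> \<le> C * C * (2 / (min (min x y) 1)^2) * inverse (1 + s^2)"
   by (simp add: c_def mult.assoc)
 qed
 show "integrable lborel (\<lambda>s. N t x s * N t y s)"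
  by (rule integrable_inverse_square_bound[OF _ b]) measurable
qed

end

section \<open>The kernel as a projection, up to a constant\<close>

context integrable_pair
begin

lemma half_le: "(S::real) \<le> 2 * P + 2 * Q ==> S / 2 \<le> P + Q" by simp

text \<open>Each factor contributes a rank-two derivative, and the remaining integrals are the images of the pair, which
  are multiples of it.\<close>

lemma product_deriv:
 assumes Phi: "\<forall>t>0. Phi1 t = c * F1 t \<and> Phi2 t = (c + \<beta>) * F2 t"
  and x: "x > 0" and y: "y > 0" and t: "t > 0"
 shows "((\<lambda>t. lint (\<lambda>s. N t x s * N t y s)) has_real_derivative
   (2 * c + \<beta>) * (- (F1 (t * x) * F2 (t * y) + F2 (t * x) * F1 (t * y)) / 2)) (at t)"
proof -
 define f' where "f' u s = - (1/2) * (F1 (u * x) * (N u y s * F2 (u * s)) + F2 (u * x) * (N u y s * F1 (u * s))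
   + F1 (u * y) * (N u x s * F2 (u * s)) + F2 (u * y) * (N u x s * F1 (u * s)))" for u s
 define K where "K = M * (C / \<bar>y\<bar> * M) + M * (C / \<bar>x\<bar> * M)"
 have K: "K \<ge> 0" unfolding K_def using C_nonneg M_nonneg by simp
 define g where "g s = K * exp (- (t / 2 / 4) * \<bar>s\<bar>)" for s
 have g: "integrable lborel g" unfolding g_def
  by (rule integrable_exp_bound[of _ "t / 2 / 4" K]) (use K t in auto)
 have near: "u > 0" "t / 2 \<le> u" if "\<bar>u - t\<bar> < t / 2" for u using that t unfolding abs_less_iff by linarith+
 have xy: "x \<noteq> 0" "y \<noteq> 0" using x y by auto
 have t2: "t / 2 > 0" using t by simp
 have b: "\<bar>f' u s\<bar> \<le> g s" if u: "\<bar>u - t\<bar> < t / 2" and s: "s \<noteq> 0" for u s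
 proof -
  let ?e = "exp (- (t / 2 / 4) * \<bar>s\<bar>)"
  have ux: "u * x \<noteq> 0" "u * y \<noteq> 0" using near[OF u] xy by auto
  note NX = N_F_bound[OF s t2 near(2)[OF u] xy(1)] and NY = N_F_bound[OF s t2 near(2)[OF u] xy(2)]
  have 1: "\<bar>F1 (u * x) * (N u y s * F2 (u * s))\<bar> \<le> M * (C / \<bar>y\<bar> * M * ?e)"
   unfolding abs_mult[of "F1 (u * x)"] by (rule mult_mono[OF M'(1)[OF ux(1)] NY(2) M_nonneg abs_ge_zero])
  have 2: "\<bar>F2 (u * x) * (N u y s * F1 (u * s))\<bar> \<le> M * (C / \<bar>y\<bar> * M * ?e)"
   unfolding abs_mult[of "F2 (u * x)"] by (rule mult_mono[OF M'(2)[OF ux(1)] NY(1) M_nonneg abs_ge_zero])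
  have 3: "\<bar>F1 (u * y) * (N u x s * F2 (u * s))\<bar> \<le> M * (C / \<bar>x\<bar> * M * ?e)"
   unfolding abs_mult[of "F1 (u * y)"] by (rule mult_mono[OF M'(1)[OF ux(2)] NX(2) M_nonneg abs_ge_zero])
  have 4: "\<bar>F2 (u * y) * (N u x s * F1 (u * s))\<bar> \<le> M * (C / \<bar>x\<bar> * M * ?e)"
   unfolding abs_mult[of "F2 (u * y)"] by (rule mult_mono[OF M'(2)[OF ux(2)] NX(1) M_nonneg abs_ge_zero])
  have "\<bar>f' u s\<bar> \<le> M * (C / \<bar>y\<bar> * M * ?e) + M * (C / \<bar>x\<bar> * M * ?e)"
  proof -
   have gen: "\<bar>- (1/2) * (p + q + u + v)\<bar> \<le> P + Q" if "\<bar>p\<bar> \<le> P" "\<bar>q\<bar> \<le> P" "\<bar>u\<bar> \<le> Q" "\<bar>v\<bar> \<le> Q" for p q u v P Q :: real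
   proof -
    have "\<bar>p + q + u + v\<bar> \<le> 2 * P + 2 * Q" using that by linarith
    then have "\<bar>p + q + u + v\<bar> / 2 \<le> P + Q" by (rule half_le)
    moreover have "\<bar>- (1/2) * (p + q + u + v)\<bar> = \<bar>p + q + u + v\<bar> / 2" unfolding abs_mult by simp
    ultimately show ?thesis by (simp only:)
   qed
   show ?thesis unfolding f'_def by (rule gen[OF 1 2 3 4])
  qed
  also have "\<dots> = g s" unfolding g_def K_def by (simp only: distrib_right mult.assoc)
  finally show ?thesis .
 qed
 have pd: "((\<lambda>t. N t x s * N t y s) has_real_derivative f' u s) (at u)" if "u > 0" "s \<noteq> 0" "s \<noteq> x" "s \<noteq> y" for u s
 proof -
  have ne: "x \<noteq> s" "y \<noteq> s" using that by auto
  show ?thesis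
   by (rule DERIV_cong[OF DERIV_mult[OF N_deriv[OF that(1) xy(1) that(2) ne(1)] N_deriv[OF that(1) xy(2) that(2) ne(2)]]])
    (simp add: f'_def field_simps)
 qed
 have "((\<lambda>t. lint (\<lambda>s. N t x s * N t y s)) has_real_derivative lint (f' t)) (at t)"
 proof (rule has_real_derivative_lborel_integral[OF t2 _ _ _ g])
  show "integrable lborel (\<lambda>s. N u x s * N u y s)" if "\<bar>u - t\<bar> < t / 2" for u
   by (rule N_product_integrable(1)[OF near(1)[OF that] x y])
  show "AE s in lborel. \<forall>u. \<bar>u - t\<bar> < t / 2 \<longrightarrow> ((\<lambda>t. N t x s * N t y s) has_real_derivative f' u s) (at u)"
   by (rule eventually_mono[OF AE_lborel_neq[of x y]], intro allI impI, rule pd, rule near(1), assumption, simp_all)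
  show "AE s in lborel. \<forall>u. \<bar>u - t\<bar> < t / 2 \<longrightarrow> \<bar>f' u s\<bar> \<le> g s"
   by (rule eventually_mono[OF AE_lborel_neq[of x y]], intro allI impI, rule b, assumption, simp)
  show "f' t \<in> borel_measurable borel" unfolding f'_def by measurable
 qed
 moreover have "lint (f' t) = - (1/2) * (F1 (t * x) * Phi2 (t * y) + F2 (t * x) * Phi1 (t * y) + F1 (t * y) * Phi2 (t * x) + F2 (t * y) * Phi1 (t * x))"
  unfolding f'_def Phi_scaled[OF t x, symmetric] Phi_scaled[OF t y, symmetric]
  using integrable_N_F[OF t xy(1)] integrable_N_F[OF t xy(2)] by simp
 moreover have "t * x > 0" "t * y > 0" using t x y by auto
 ultimately show ?thesis
  by (elim DERIV_cong) (simp add: Phi algebra_simps)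
qed

text \<open>Both sides have proportional derivatives in the scale and vanish at infinity.\<close>

lemma reproducing_up_to_constant:
 "\<exists>\<tau>. \<forall>x>0. \<forall>y>0. \<forall>t>0. lint (\<lambda>s. N t x s * N t y s) = \<tau> * (t * kd (t * x) (t * y))"
proof -
 obtain c \<beta> where Phi: "\<forall>t>0. Phi1 t = c * F1 t \<and> Phi2 t = (c + \<beta>) * F2 t"
  using Phi_proportional by (elim exE)
 define \<tau> where "\<tau> = 2 * c + \<beta>"
 have "lint (\<lambda>s. N t x s * N t y s) = \<tau> * (t * kd (t * x) (t * y))" if x: "x > 0" and y: "y > 0" and t: "t > 0" for x y t
 proof -
  define D where "D t = lint (\<lambda>s. N t x s * N t y s) - \<tau> * (t * kd (t * x) (t * y))" for t
  have xy: "x \<noteq> 0" "y \<noteq> 0" using x y by auto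
  have "(D has_real_derivative 0) (at t)" if "t > 0" for t
   unfolding D_def
   by (rule DERIV_cong[OF DERIV_diff[OF product_deriv[OF Phi x y that] DERIV_cmult[OF kd_scaled_deriv[OF that xy]]]])
    (simp add: \<tau>_def)
  then have "\<exists>c. \<forall>x\<in>{0<..}. D x = c"
   by (intro has_field_derivative_zero_constant) (auto intro: has_field_derivative_at_within)
  then obtain c' where c': "D u = c'" if "u > 0" for u by auto
  have h0: "(\<lambda>n. lint (\<lambda>s. N (real (Suc n)) x s * N (real (Suc n)) y s)) \<longlonglongrightarrow> lint (\<lambda>s::real. 0)"
  proof (rule integral_dominated_convergence[where w = "\<lambda>s. C * C * (2 / (min (min x y) 1)^2) * inverse (1 + s^2)"])
   show "integrable lborel (\<lambda>s. C * C * (2 / (min (min x y) 1)^2) * inverse (1 + s^2))"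
    by (rule integrable_inverse_square_bound[of _ "C * C * (2 / (min (min x y) 1)^2)"]) (auto simp: C_nonneg abs_mult)
   show "AE s in lborel. norm (N (real (Suc n)) x s * N (real (Suc n)) y s) \<le> C * C * (2 / (min (min x y) 1)^2) * inverse (1 + s^2)" for n
    unfolding real_norm_def by (rule N_product_integrable(2)) (use x y in simp_all)
   show "AE s in lborel. (\<lambda>n. N (real (Suc n)) x s * N (real (Suc n)) y s) \<longlonglongrightarrow> 0"
   proof (rule eventually_mono[OF AE_lborel_singleton[of 0]])
    fix s :: real assume s: "s \<noteq> 0"
    have lim: "filterlim (\<lambda>n. \<bar>real (Suc n) * v\<bar>) at_top sequentially" if "v \<noteq> 0" for v :: real
    proof -
     have "\<bar>v\<bar> > 0" using that by simp
     then have "filterlim (\<lambda>n. real (Suc n) * \<bar>v\<bar>) at_top sequentially" by real_asymp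
     then show ?thesis by (simp add: abs_mult)
    qed
    have z: "real (Suc n) * v \<noteq> 0" if "v \<noteq> 0" for n v using that by simp
    note L = F_tendsto_0[OF lim z]
    have "(\<lambda>n. N (real (Suc n)) v s) \<longlonglongrightarrow> 0" if v: "v \<noteq> 0" for v
    proof -
     have "(\<lambda>n. (F1 (real (Suc n) * v) * F2 (real (Suc n) * s) - F2 (real (Suc n) * v) * F1 (real (Suc n) * s)) * inverse (v - s)) \<longlonglongrightarrow> (0 * 0 - 0 * 0) * inverse (v - s)"
      by (intro tendsto_mult tendsto_diff tendsto_const L v s)
     moreover have "N (real (Suc n)) v s = (F1 (real (Suc n) * v) * F2 (real (Suc n) * s) - F2 (real (Suc n) * v) * F1 (real (Suc n) * s)) * inverse (v - s)" for n
      by (subst N_eq) (simp_all only: of_nat_eq_0_iff nat.distinct simp_thms divide_inverse not_False_eq_True)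
     ultimately show ?thesis by simp
    qed
    from tendsto_mult[OF this[OF xy(1)] this[OF xy(2)]]
    show "(\<lambda>n. N (real (Suc n)) x s * N (real (Suc n)) y s) \<longlonglongrightarrow> 0" by simp
   qed
  qed simp_all
  have "(\<lambda>n. D (real (Suc n))) \<longlonglongrightarrow> lint (\<lambda>s::real. 0) - \<tau> * 0"
   unfolding D_def by (intro tendsto_diff tendsto_mult tendsto_const h0 kd_scaled_tendsto_0 x y)
  moreover have "D (real (Suc n)) = c'" for n by (rule c') simp
  ultimately have "c' = 0" by (simp add: LIMSEQ_const_iff)
  then show ?thesis using c'[OF t] by (simp add: D_def)
 qed
 then show ?thesis by (intro exI[of _ \<tau>]) simp
qed

text \<open>The Wronskian of the two asymptotic rotations at 0, up to sign.\<close>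

definition "DD = (norm a)^2 * m / w"

lemma wronskian_rotation:
 fixes \<mu> :: complex
 assumes "t > 0" "v > 0"
 shows "Re (a * of_real t powr (\<i> * m)) * Re (- (r - \<i> * m) / w * (\<mu> * a) * of_real (t * v) powr (\<i> * m))
   - Re (- (r - \<i> * m) / w * a * of_real t powr (\<i> * m)) * Re (\<mu> * a * of_real (t * v) powr (\<i> * m))
  = - DD * Im (\<mu> * of_real v powr (\<i> * m))"
proof -
 define b where "b = a * of_real t powr (\<i> * m)"
 define e where "e = \<mu> * a * of_real (t * v) powr (\<i> * m)"
 have tv: "complex_of_real (t * v) powr (\<i> * m) = of_real t powr (\<i> * m) * of_real v powr (\<i> * m)"
 proof -
  have P: "complex_of_real y powr s = exp (s * of_real (ln y))" if "y > 0" for y s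
   using that by (simp add: powr_def Ln_of_real)
  have "t * v > 0" using assms by simp
  then show ?thesis unfolding P[OF assms(1)] P[OF assms(2)] P[OF \<open>t * v > 0\<close>]
   using assms by (simp add: ln_mult distrib_left exp_add)
 qed
 have e: "e = b * (\<mu> * of_real v powr (\<i> * m))" unfolding e_def b_def tv by (simp only: mult_ac)
 define h where "h = \<mu> * of_real v powr (\<i> * m)"
 have nb: "(Re b)^2 + (Im b)^2 = (norm a)^2"
  unfolding cmod_power2[symmetric] b_def norm_rotation[OF assms(1)] ..
 have Rk: "Re (- (r - \<i> * m) / w * y) = - (r * Re y + m * Im y) / w" for y
  using w by (simp add: field_simps)
 have "Re b * Re (- (r - \<i> * m) / w * e) - Re (- (r - \<i> * m) / w * b) * Re e = - (m / w) * (Re b * Im e - Im b * Re e)"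
  unfolding Rk using w by (simp add: field_simps)
 also have "Re b * Im e - Im b * Re e = ((Re b)^2 + (Im b)^2) * Im h"
  unfolding e h_def[symmetric] by (simp add: algebra_simps power2_eq_square)
 finally have fin: "Re b * Re (- (r - \<i> * m) / w * e) - Re (- (r - \<i> * m) / w * b) * Re e = - DD * Im h"
  unfolding nb DD_def by (simp add: mult_ac)
 have k1: "- (r - \<i> * m) / w * (\<mu> * a) * of_real (t * v) powr (\<i> * m) = - (r - \<i> * m) / w * e"
  "- (r - \<i> * m) / w * a * of_real t powr (\<i> * m) = - (r - \<i> * m) / w * b"
  unfolding e_def b_def by (simp_all only: mult.assoc)
 show ?thesis unfolding k1 e_def[symmetric] h_def[symmetric] unfolding b_def[symmetric] by (rule fin)
qed

lemma N_limit_pos: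
 assumes "s > 0"
 shows "((\<lambda>t. F1 t * F2 (t * s) - F2 t * F1 (t * s)) \<longlongrightarrow> - DD * sin (m * ln s)) (at_right 0)"
  "((\<lambda>t. F1 t * F2 (- (t * s)) - F2 t * F1 (- (t * s))) \<longlongrightarrow> - DD * Im (lam * of_real s powr (\<i> * m))) (at_right 0)"
proof -
 have ts: "filterlim (\<lambda>t. t * s) (at_right 0) (at_right 0)"
 proof (rule tendsto_imp_filterlim_at_right)
  have "((\<lambda>t. t * s) \<longlongrightarrow> 0 * s) (at_right 0)" by (intro tendsto_intros)
  then show "((\<lambda>t. t * s) \<longlongrightarrow> 0) (at_right 0)" by simp
  show "\<forall>\<^sub>F t in at_right 0. t * s > 0" using eventually_at_right_less[of 0] by eventually_elim (use assms in simp)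
 qed
 have gen: "((\<lambda>t. F1 t * G2 (t * s) - F2 t * G1 (t * s)) \<longlongrightarrow> - DD * Im (\<mu> * of_real s powr (\<i> * m))) (at_right 0)"
  if G1: "((\<lambda>x. G1 x - Re (\<mu> * a * of_real x powr (\<i> * m))) \<longlongrightarrow> 0) (at_right 0)"
  and G2: "((\<lambda>x. G2 x - Re (- (r - \<i> * m) / w * (\<mu> * a) * of_real x powr (\<i> * m))) \<longlongrightarrow> 0) (at_right 0)"
  and mu: "norm \<mu> = 1" for G1 G2 \<mu>
 proof -
  define p1 where "p1 t = Re (a * of_real t powr (\<i> * m))" for t
  define p2 where "p2 t = Re (- (r - \<i> * m) / w * a * of_real t powr (\<i> * m))" for t
  define q1 where "q1 t = Re (\<mu> * a * of_real t powr (\<i> * m))" for t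
  define q2 where "q2 t = Re (- (r - \<i> * m) / w * (\<mu> * a) * of_real t powr (\<i> * m))" for t
  have bp: "\<bar>p1 t\<bar> \<le> norm a" "\<bar>p2 t\<bar> \<le> norm a" if "t > 0" for t
  proof -
   have "\<bar>p1 t\<bar> \<le> norm (a * of_real t powr (\<i> * m))" unfolding p1_def by (rule abs_Re_le_cmod)
   then show "\<bar>p1 t\<bar> \<le> norm a" unfolding norm_rotation[OF that] .
   have "\<bar>p2 t\<bar> \<le> norm (- (r - \<i> * m) / w * a * of_real t powr (\<i> * m))" unfolding p2_def by (rule abs_Re_le_cmod)
   then show "\<bar>p2 t\<bar> \<le> norm a" unfolding norm_rotation[OF that] norm_second .
  qed
  have na: "norm (\<mu> * a) = norm a" using mu by (simp add: norm_mult)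
  have bq: "\<bar>q1 t\<bar> \<le> norm a" "\<bar>q2 t\<bar> \<le> norm a" if "t > 0" for t
  proof -
   have "\<bar>q1 t\<bar> \<le> norm (\<mu> * a * of_real t powr (\<i> * m))" unfolding q1_def by (rule abs_Re_le_cmod)
   then show "\<bar>q1 t\<bar> \<le> norm a" unfolding norm_rotation[OF that] na .
   have "\<bar>q2 t\<bar> \<le> norm (- (r - \<i> * m) / w * (\<mu> * a) * of_real t powr (\<i> * m))" unfolding q2_def by (rule abs_Re_le_cmod)
   then show "\<bar>q2 t\<bar> \<le> norm a" unfolding norm_rotation[OF that] norm_second na .
  qed
  have tsp: "t * s > 0" if "t > 0" for t using that assms by simp
  have e1: "\<forall>\<^sub>F t in at_right 0. \<bar>p1 t\<bar> \<le> norm a \<and> \<bar>q2 (t * s)\<bar> \<le> norm a"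
   by (rule eventually_mono[OF eventually_at_right_less[of 0]]) (intro conjI bp(1) bq(2) tsp)
  have e2: "\<forall>\<^sub>F t in at_right 0. \<bar>p2 t\<bar> \<le> norm a \<and> \<bar>q1 (t * s)\<bar> \<le> norm a"
   by (rule eventually_mono[OF eventually_at_right_less[of 0]]) (intro conjI bp(2) bq(1) tsp)
  note g1 = filterlim_compose[OF G1[folded q1_def] ts] and g2 = filterlim_compose[OF G2[folded q2_def] ts]
  have "((\<lambda>t. (F1 t * G2 (t * s) - p1 t * q2 (t * s)) - (F2 t * G1 (t * s) - p2 t * q1 (t * s)) + (- DD * Im (\<mu> * of_real s powr (\<i> * m)))) \<longlongrightarrow> (0 - 0) + (- DD * Im (\<mu> * of_real s powr (\<i> * m)))) (at_right 0)"
   by (intro tendsto_add tendsto_diff tendsto_const tendsto_mult_diff_0[OF F1_0[folded p1_def] g2 e1] tendsto_mult_diff_0[OF F2_0[folded p2_def] g1 e2])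
  then have L: "((\<lambda>t. (F1 t * G2 (t * s) - p1 t * q2 (t * s)) - (F2 t * G1 (t * s) - p2 t * q1 (t * s)) + (- DD * Im (\<mu> * of_real s powr (\<i> * m)))) \<longlongrightarrow> - DD * Im (\<mu> * of_real s powr (\<i> * m))) (at_right 0)"
   by simp
  show ?thesis
  proof (rule Lim_transform_eventually[OF L], rule eventually_mono[OF eventually_at_right_less[of 0]])
   fix t :: real assume t: "0 < t"
   have "p1 t * q2 (t * s) - p2 t * q1 (t * s) = - DD * Im (\<mu> * of_real s powr (\<i> * m))"
    unfolding p1_def p2_def q1_def q2_def by (rule wronskian_rotation[OF t assms])
   then show "(F1 t * G2 (t * s) - p1 t * q2 (t * s)) - (F2 t * G1 (t * s) - p2 t * q1 (t * s)) + (- DD * Im (\<mu> * of_real s powr (\<i> * m))) = F1 t * G2 (t * s) - F2 t * G1 (t * s)"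
    by linarith
  qed
 qed
 have "Im (1 * of_real s powr (\<i> * m)) = sin (m * ln s)"
  using assms by (simp add: powr_def Ln_of_real Im_exp)
 then show "((\<lambda>t. F1 t * F2 (t * s) - F2 t * F1 (t * s)) \<longlongrightarrow> - DD * sin (m * ln s)) (at_right 0)"
  using gen[of F1 1 F2] F1_0 F2_0 by simp
 show "((\<lambda>t. F1 t * F2 (- (t * s)) - F2 t * F1 (- (t * s))) \<longlongrightarrow> - DD * Im (lam * of_real s powr (\<i> * m))) (at_right 0)"
  by (rule gen[of "\<lambda>x. F1 (- x)" lam "\<lambda>x. F2 (- x)", OF F1_0' F2_0' lam])
qed

text \<open>As the scale tends to 0, the pair becomes a rotating vector and the kernel the logarithmic sine kernel, so
  the constant is a quotient of two explicit limits.\<close>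

lemma reproducing_constant:
 assumes tau: "\<forall>x>0. \<forall>y>0. \<forall>t>0. lint (\<lambda>s. N t x s * N t y s) = \<tau> * (t * kd (t * x) (t * y))"
 shows "\<tau> = DD * pi * (cosh (2 * pi * m) - Re (lam^2)) / sinh (2 * pi * m)"
proof -
 define f where "f s = (if s > 0 then (sin (m * ln s))\<^sup>2 / (1 - s)^2 else (Im (lam * of_real (- s) powr (\<i> * m)))\<^sup>2 / (1 - s)^2)" for s
 define ep where "ep n = 1 / (real n + 1)" for n
 have e0: "ep n > 0" for n by (simp add: ep_def)
 have et: "filterlim ep (at_right 0) sequentially" unfolding ep_def by real_asymp
 have DD: "DD \<noteq> 0" using a0 m0 w by (simp add: DD_def)
 have fm: "(\<lambda>s. DD^2 * f s) \<in> borel_measurable borel"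
 proof -
  have "f = (\<lambda>s. if s > 0 then (sin (m * ln s))\<^sup>2 / (1 - s)^2 else if s < 0 then (Im (lam * exp (\<i> * m * of_real (ln (- s)))))\<^sup>2 / (1 - s)^2 else (Im (lam * 0 powr (\<i> * m)))\<^sup>2)"
   by (rule ext) (simp add: f_def powr_def Ln_of_real[symmetric] del: of_real_minus)
  then show ?thesis by simp
 qed
 have bnd: "integrable lborel (\<lambda>s. C * C * (2 / (min (min 1 1) 1)^2) * inverse (1 + s^2))"
  by (rule integrable_inverse_square_bound[of _ "C * C * (2 / (min (min 1 1) 1)^2)"]) (auto simp: C_nonneg abs_mult)
 have pw: "AE s in lborel. (\<lambda>n. N (ep n) 1 s * N (ep n) 1 s) \<longlonglongrightarrow> DD^2 * f s"
 proof (rule eventually_mono[OF AE_lborel_neq[of 1 1]])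
  fix s :: real assume s: "s \<noteq> 0 \<and> s \<noteq> 1 \<and> s \<noteq> 1"
  have Ne: "N (ep n) 1 s = (F1 (ep n) * F2 (ep n * s) - F2 (ep n) * F1 (ep n * s)) / (1 - s)" for n
   using N_eq[of "ep n" 1 s] e0[of n] by simp
  have s1: "1 - s \<noteq> 0" using s by simp
  show "(\<lambda>n. N (ep n) 1 s * N (ep n) 1 s) \<longlonglongrightarrow> DD^2 * f s"
  proof (cases "s > 0")
   case True
   note L = filterlim_compose[OF N_limit_pos(1)[OF True] et]
   have "(\<lambda>n. N (ep n) 1 s * N (ep n) 1 s) \<longlonglongrightarrow> (- DD * sin (m * ln s)) / (1 - s) * ((- DD * sin (m * ln s)) / (1 - s))"
    unfolding Ne by (intro tendsto_mult tendsto_divide L tendsto_const s1)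
   then show ?thesis using True by (simp add: f_def power2_eq_square mult_ac)
  next
   case False
   then have "- s > 0" using s by simp
   note L = filterlim_compose[OF N_limit_pos(2)[OF this] et]
   have "(\<lambda>n. N (ep n) 1 s * N (ep n) 1 s) \<longlonglongrightarrow> (- DD * Im (lam * of_real (- s) powr (\<i> * m))) / (1 - s) * ((- DD * Im (lam * of_real (- s) powr (\<i> * m))) / (1 - s))"
    unfolding Ne using L by (intro tendsto_mult tendsto_divide tendsto_const s1) simp_all
   then show ?thesis using False by (simp add: f_def power2_eq_square mult_ac del: of_real_minus)
  qed
 qed
 have nb: "AE s in lborel. norm (N (ep n) 1 s * N (ep n) 1 s) \<le> C * C * (2 / (min (min 1 1) 1)^2) * inverse (1 + s^2)" for n
  unfolding real_norm_def by (rule N_product_integrable(2)[OF e0]) simp_all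
 have Nm: "(\<lambda>s. N (ep n) 1 s * N (ep n) 1 s) \<in> borel_measurable lborel" for n by measurable
 have fm': "(\<lambda>s. DD^2 * f s) \<in> borel_measurable lborel" using fm by simp
 have fi: "integrable lborel (\<lambda>s. DD^2 * f s)"
  by (rule integrable_dominated_convergence[OF fm' Nm bnd pw nb])
 have lim: "(\<lambda>n. lint (\<lambda>s. N (ep n) 1 s * N (ep n) 1 s)) \<longlonglongrightarrow> lint (\<lambda>s. DD^2 * f s)"
  by (rule integral_dominated_convergence[OF fm' Nm bnd pw nb])
 have fi': "integrable lborel f" using integrable_mult_right[OF fi, of "1 / DD^2"] DD by simp
 have val: "lint (\<lambda>s. DD^2 * f s) = DD^2 * (pi * m * (cosh (2 * pi * m) - Re (lam^2)) / sinh (2 * pi * m))"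
  unfolding integral_mult_right_zero f_def[abs_def]
  by (subst log_kernel_integral[OF m0 lam]) (use fi' in \<open>simp_all only: f_def[abs_def]\<close>)
 have kdlim: "(\<lambda>n. \<tau> * (ep n * kd (ep n * 1) (ep n * 1))) \<longlonglongrightarrow> \<tau> * (DD * m)"
 proof (rule tendsto_mult_left)
  have El: "(\<lambda>n. E (ep n)) \<longlonglongrightarrow> m^2 / w^2 * (norm a)^2" by (rule filterlim_compose[OF E_limit(1) et])
  have z: "(\<lambda>n. ep n * (F1 (ep n) * F2 (ep n))) \<longlonglongrightarrow> 0"
  proof (rule Lim_null_comparison)
   have ez: "ep \<longlonglongrightarrow> 0" unfolding ep_def by real_asymp
   show "(\<lambda>n. ep n * (M * M)) \<longlonglongrightarrow> 0" by (rule tendsto_mult_left_zero[OF ez])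
   have "\<bar>ep n * (F1 (ep n) * F2 (ep n))\<bar> \<le> ep n * (M * M)" for n
    unfolding abs_mult using e0[of n] M'[of "ep n"] M_nonneg by (simp add: mult_mono mult_left_mono)
   then show "\<forall>\<^sub>F n in sequentially. norm (ep n * (F1 (ep n) * F2 (ep n))) \<le> ep n * (M * M)" by simp
  qed
  have "ep n * kd (ep n * 1) (ep n * 1) = w * E (ep n) - ep n * (F1 (ep n) * F2 (ep n))" for n
  proof -
   have "ep n * kd (ep n * 1) (ep n * 1) = w * ((F1 (ep n))^2 + (F2 (ep n))^2) + (2 * r - ep n) * (F1 (ep n) * F2 (ep n))"
    using e0[of n] by (simp only: kd_def mult_1_right if_True refl) simp
   also have "\<dots> = w * E (ep n) - ep n * (F1 (ep n) * F2 (ep n))"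
    using w by (simp add: E_def field_simps)
   finally show ?thesis .
  qed
  moreover have "(\<lambda>n. w * E (ep n) - ep n * (F1 (ep n) * F2 (ep n))) \<longlonglongrightarrow> w * (m^2 / w^2 * (norm a)^2) - 0"
   by (intro tendsto_diff tendsto_mult tendsto_const El z)
  moreover have "w * (m^2 / w^2 * (norm a)^2) - 0 = DD * m" using w by (simp add: DD_def power2_eq_square)
  ultimately show "(\<lambda>n. ep n * kd (ep n * 1) (ep n * 1)) \<longlonglongrightarrow> DD * m" by simp
 qed
 have "lint (\<lambda>s. N (ep n) 1 s * N (ep n) 1 s) = \<tau> * (ep n * kd (ep n * 1) (ep n * 1))" for n
  using tau e0[of n] by simp
 then have "DD^2 * (pi * m * (cosh (2 * pi * m) - Re (lam^2)) / sinh (2 * pi * m)) = \<tau> * (DD * m)"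
  using LIMSEQ_unique[OF lim[unfolded val]] kdlim by simp
 then have eq: "(DD * m) * (DD * pi * (cosh (2 * pi * m) - Re (lam^2)) / sinh (2 * pi * m)) = (DD * m) * \<tau>"
  by (simp add: power2_eq_square mult_ac)
 have "DD * m \<noteq> 0" using DD m0 by simp
 from iffD1[OF mult_left_cancel[OF this] eq] show ?thesis by (rule sym)
qed

end

section \<open>Positive definiteness on a half-line\<close>

text \<open>The normalization says that the constant in the projection property is 1; the other assumptions are
  invariant under scaling of the pair.\<close>

locale balanced_pair = integrable_pair +
 assumes normalized: "(norm a)^2 * m / w * pi * (cosh (2 * pi * m) - Re (lam^2)) = sinh (2 * pi * m)"
begin

lemma N_1: "N 1 x s = k x s" by (simp add: N_def)

lemma k_product_integrable:
 assumes "x > 0" "y > 0"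
 shows "integrable lborel (\<lambda>s. k x s * k y s)"
 using N_product_integrable(1)[of 1 x y] assms by (simp add: N_1)

text \<open>The connection coefficients at 0 are normalized exactly so that the constant is 1.\<close>

lemma reproducing:
 assumes "x > 0" "y > 0"
 shows "lint (\<lambda>s. k x s * k y s) = kd x y"
proof -
 obtain \<tau> where tau: "\<forall>x>0. \<forall>y>0. \<forall>t>0. lint (\<lambda>s. N t x s * N t y s) = \<tau> * (t * kd (t * x) (t * y))"
  using reproducing_up_to_constant by (elim exE)
 have "sinh (2 * pi * m) \<noteq> 0" using m0 by simp
 moreover have "\<tau> = sinh (2 * pi * m) / sinh (2 * pi * m)"
  using reproducing_constant[OF tau] unfolding DD_def normalized .
 ultimately have "\<tau> = 1" by simp
 then show ?thesis using tau[rule_format, OF assms, of 1] by (simp add: N_1)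
qed

end

context integrable_pair
begin

text \<open>Near 0 the function oscillates like the cosine of a logarithm.\<close>

lemma F2_alternates:
 "\<exists>\<rho> y. \<rho> > 0 \<and> y \<longlonglongrightarrow> 0 \<and> (\<forall>n. y n > (0::real)) \<and> (\<forall>i j. i < j \<longrightarrow> y j < y i) \<and> (\<lambda>n. F2 (y n) - (-1) ^ n * \<rho>) \<longlonglongrightarrow> 0"
proof -
 define b where "b = - (r - \<i> * m) / w * a"
 define \<rho> where "\<rho> = norm b"
 have rho: "\<rho> > 0" using norm_second[of a] a0 by (simp add: \<rho>_def b_def)
 define \<phi> where "\<phi> = Arg b"
 define \<sigma> where "\<sigma> = sgn m"
 define y where "y n = exp (- (pi * real n + \<sigma> * \<phi>) / \<bar>m\<bar>)" for n
 have y0: "y n > 0" for n by (simp add: y_def)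
 have am: "\<bar>m\<bar> > 0" using m0 by simp
 have yl: "y \<longlonglongrightarrow> 0" unfolding y_def using am by real_asymp
 have ya: "(\<forall>i j. i < j \<longrightarrow> y j < y i)"
  unfolding y_def using am by (auto intro!: divide_strict_right_mono)
 have b: "b = of_real \<rho> * exp (\<i> * of_real \<phi>)"
  using Arg_eq[of b] rho by (simp add: \<rho>_def \<phi>_def)
 have val: "Re (- (r - \<i> * m) / w * a * of_real (y n) powr (\<i> * m)) = (-1) ^ n * \<rho>" for n
 proof -
  have ms: "m / \<bar>m\<bar> = \<sigma>" using m0 by (simp add: \<sigma>_def sgn_real_def)
  have ss: "\<sigma> * \<sigma> = 1" using m0 by (simp add: \<sigma>_def sgn_real_def)
  have "ln (y n) = - (pi * real n + \<sigma> * \<phi>) / \<bar>m\<bar>" by (simp only: y_def ln_exp)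
  then have "m * ln (y n) = - (m / \<bar>m\<bar>) * (pi * real n + \<sigma> * \<phi>)" by (simp only: times_divide_eq_right times_divide_eq_left mult_minus_left mult_minus_right minus_divide_left)
  also have "\<dots> = - \<sigma> * pi * real n - \<phi>"
   unfolding ms using ss by (simp add: algebra_simps) (simp add: mult.assoc[symmetric])?
  finally have l: "m * ln (y n) + \<phi> = - \<sigma> * pi * real n" by simp
  have "of_real (y n) powr (\<i> * m) = exp (\<i> * of_real (m * ln (y n)))"
   using y0[of n] by (simp add: powr_def Ln_of_real mult_ac)
  then have "b * of_real (y n) powr (\<i> * m) = of_real \<rho> * exp (\<i> * of_real (m * ln (y n) + \<phi>))"
   unfolding b by (simp add: exp_add[symmetric] algebra_simps)
  also have "Re \<dots> = \<rho> * cos (m * ln (y n) + \<phi>)" by (simp add: Re_exp)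
  also have "cos (m * ln (y n) + \<phi>) = cos (pi * real n)"
   unfolding l using m0 by (auto simp: \<sigma>_def sgn_real_def)
  also have "cos (pi * real n) = (-1) ^ n" by (rule cos_npi2)
  finally show ?thesis by (simp only: b_def mult.commute)
 qed
 have "filterlim y (at_right 0) sequentially"
  by (rule tendsto_imp_filterlim_at_right[OF yl]) (simp add: y0)
 from filterlim_compose[OF F2_0 this]
 have "(\<lambda>n. F2 (y n) - (-1) ^ n * \<rho>) \<longlonglongrightarrow> 0" unfolding val .
 then show ?thesis using rho yl y0 ya by blast
qed

text \<open>Infinitely many zeros by the intermediate value theorem between the alternating signs.\<close>

lemma infinite_F2_zeros:
 assumes "\<delta> > 0"
 shows "infinite {y. 0 < y \<and> y < \<delta> \<and> F2 y = 0}" "infinite {y. 0 < y \<and> y < \<delta> \<and> F2 y \<noteq> 0}"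
proof -
 obtain \<rho> y where R: "\<rho> > 0" "y \<longlonglongrightarrow> 0" "\<And>n. y n > (0::real)" "(\<forall>i j. i < j \<longrightarrow> y j < y i)" "(\<lambda>n. F2 (y n) - (-1) ^ n * \<rho>) \<longlonglongrightarrow> 0"
  using F2_alternates by blast
 have e1: "\<forall>\<^sub>F n in sequentially. y n < \<delta>" by (rule order_tendstoD(2)[OF R(2) assms])
 have e2: "\<forall>\<^sub>F n in sequentially. \<bar>F2 (y n) - (-1) ^ n * \<rho>\<bar> < \<rho>"
  using order_tendstoD(2)[OF tendsto_rabs_zero[OF R(5)] R(1)] .
 obtain n0 where n0: "\<And>n. n \<ge> n0 ==> y n < \<delta> \<and> \<bar>F2 (y n) - (-1) ^ n * \<rho>\<bar> < \<rho>"
  using eventually_conj[OF e1 e2] by (auto simp: eventually_sequentially)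
 have mono: "y j < y i" if "i < j" for i j using R(4) that by blast
 have nz: "F2 (y n) \<noteq> 0" if "n \<ge> n0" for n
 proof
  assume "F2 (y n) = 0"
  then show False using n0[OF that] R(1) by (simp add: abs_mult)
 qed
 have inj: "inj y"
 proof (rule linorder_injI)
  fix i j :: nat assume "i < j"
  from mono[OF this] show "y i \<noteq> y j" by simp
 qed
 have "infinite (y ` {n0..})" using finite_imageD[OF _ inj_on_subset[OF inj subset_UNIV]] infinite_Ici by blast
 moreover have "y ` {n0..} \<subseteq> {y. 0 < y \<and> y < \<delta> \<and> F2 y \<noteq> 0}" using n0 nz R(3) by auto
 ultimately show "infinite {y. 0 < y \<and> y < \<delta> \<and> F2 y \<noteq> 0}" by (meson finite_subset)
 have z: "\<exists>u. y (Suc n) < u \<and> u < y n \<and> F2 u = 0" if n: "n \<ge> n0" for n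
 proof -
  have lt: "y (Suc n) < y n" by (rule mono) simp
  have c: "isCont F2 x" if "y (Suc n) \<le> x" for x
   using R(3)[of "Suc n"] that by (intro DERIV_isCont[OF F2_deriv]) auto
  have a1: "\<bar>F2 (y n) - (-1) ^ n * \<rho>\<bar> < \<rho>" "\<bar>F2 (y (Suc n)) - (-1) ^ Suc n * \<rho>\<bar> < \<rho>"
   using n0[OF n] n0[of "Suc n"] n by (simp_all del: power_Suc)
  have "\<exists>u\<ge>y (Suc n). u \<le> y n \<and> F2 u = 0"
  proof (cases "even n")
   case True
   then have "F2 (y (Suc n)) \<le> 0" "0 \<le> F2 (y n)" using a1 by (simp_all add: abs_less_iff)
   then show ?thesis using IVT[of F2 "y (Suc n)" 0 "y n"] lt c by auto
  next
   case False
   then have "F2 (y n) \<le> 0" "0 \<le> F2 (y (Suc n))" using a1 by (simp_all add: abs_less_iff)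
   then show ?thesis using IVT2[of F2 "y n" 0 "y (Suc n)"] lt c by auto
  qed
  then obtain u where u: "y (Suc n) \<le> u" "u \<le> y n" "F2 u = 0" by blast
  have "u \<noteq> y n" "u \<noteq> y (Suc n)" using u(3) nz[of n] nz[of "Suc n"] n by auto
  then show ?thesis using u by (intro exI[of _ u]) auto
 qed
 define u where "u n = (SOME u. y (Suc n) < u \<and> u < y n \<and> F2 u = 0)" for n
 have u: "y (Suc n) < u n" "u n < y n" "F2 (u n) = 0" if "n \<ge> n0" for n
  using someI_ex[OF z[OF that]] unfolding u_def by auto
 have ui: "u i \<noteq> u j" if "i \<ge> n0" "i < j" for i j
 proof -
  have "u j < y j" using u(2)[of j] that by simp
  also have "y j \<le> y (Suc i)" using mono[of "Suc i" j] that by (cases "j = Suc i") auto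
  also have "y (Suc i) < u i" using u(1)[of i] that by simp
  finally show ?thesis by simp
 qed
 have "inj_on u {n0..}"
 proof (rule inj_onI)
  fix i j assume "i \<in> {n0..}" "j \<in> {n0..}" "u i = u j"
  then show "i = j" using ui[of i j] ui[of j i] by (cases i j rule: linorder_cases) auto
 qed
 then have "infinite (u ` {n0..})" using finite_imageD infinite_Ici by blast
 moreover have "u ` {n0..} \<subseteq> {y. 0 < y \<and> y < \<delta> \<and> F2 y = 0}"
 proof
  fix x assume "x \<in> u ` {n0..}"
  then obtain n where n: "n \<ge> n0" "x = u n" by auto
  have "0 < u n" using u(1)[OF n(1)] R(3)[of "Suc n"] by linarith
  moreover have "u n < \<delta>" using u(2)[OF n(1)] n0[OF n(1)] by linarith
  ultimately show "x \<in> {y. 0 < y \<and> y < \<delta> \<and> F2 y = 0}" using u(3)[OF n(1)] n(2) by simp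
 qed
 ultimately show "infinite {y. 0 < y \<and> y < \<delta> \<and> F2 y = 0}" by (meson finite_subset)
qed

lemma k_isCont:
 assumes "y \<noteq> 0" "x \<noteq> y" shows "isCont (k x) y"
 unfolding k_def using assms
 by (intro continuous_intros DERIV_isCont[OF F1_deriv] DERIV_isCont[OF F2_deriv]) auto

text \<open>Near 0 a vanishing combination reads \<open>F2 y * p1 y = F1 y * p2 y\<close> after clearing denominators,
  with polynomials \<open>p1\<close> and \<open>p2\<close> whose values at the points are multiples of
  \<open>c i * F1 (x i)\<close> and \<open>c i * F2 (x i)\<close>. The infinitely many zeros of
  \<open>F2\<close> are zeros of \<open>p2\<close>, so \<open>p2 = 0\<close>, and then \<open>p1\<close>
 vanishes wherever \<open>F2\<close> does not.\<close>

lemma k_linearly_independent: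
 fixes x c :: "'i => real"
 assumes I: "finite I" "inj_on x I" "\<And>i. i \<in> I ==> x i > 0"
  and z: "AE y in lborel. (\<Sum>i\<in>I. c i * k (x i) y) = 0" and i: "i \<in> I"
 shows "c i = 0"
proof -
 define \<delta> where "\<delta> = Min (x ` I)"
 have ne: "I \<noteq> {}" using i by auto
 have d: "\<delta> > 0" "\<And>i. i \<in> I ==> \<delta> \<le> x i" using I ne by (auto simp: \<delta>_def)
 define h where "h y = (\<Sum>i\<in>I. c i * k (x i) y)" for y
 have h0: "h y = 0" if y: "0 < y" "y < \<delta>" for y
 proof (rule ccontr)
  assume "h y \<noteq> 0"
  define U where "U = {v \<in> {0<..<\<delta>}. h v \<noteq> 0}"
  have hc: "continuous_on {0<..<\<delta>} h"
   unfolding h_def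
  proof (intro continuous_on_sum continuous_on_mult continuous_on_const continuous_at_imp_continuous_on ballI)
   fix j v assume "j \<in> I" "v \<in> {0<..<\<delta>}"
   then show "isCont (k (x j)) v" using d(2)[of j] by (intro k_isCont) auto
  qed
  have "open U"
  proof -
   have "open ({0<..<\<delta>} \<inter> h -` (- {0}))" by (rule continuous_open_preimage[OF hc]) auto
   also have "{0<..<\<delta>} \<inter> h -` (- {0}) = U" by (auto simp: U_def)
   finally show ?thesis .
  qed
  moreover have "y \<in> U" using y \<open>h y \<noteq> 0\<close> by (simp add: U_def)
  ultimately have "\<not> negligible U" using open_not_negligible by blast
  moreover have "negligible U"
  proof -
   have "{v. h v \<noteq> 0} \<in> null_sets lborel"
    using z unfolding h_def[symmetric] by (subst AE_iff_null_sets) (auto simp: h_def)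
   then have "{v. h v \<noteq> 0} \<in> null_sets lebesgue" by (rule null_sets_completionI)
   then have "negligible {v. h v \<noteq> 0}" by (simp add: negligible_iff_null_sets)
   then show ?thesis by (rule negligible_subset) (auto simp: U_def)
  qed
  ultimately show False by simp
 qed
 define P where "P F = (\<Sum>i\<in>I. Polynomial.smult (c i * F (x i)) (\<Prod>j\<in>I - {i}. [:x j, - 1:]))" for F :: "real => real"
 have Pe: "poly (P F) y = (\<Sum>i\<in>I. c i * F (x i) * (\<Prod>j\<in>I - {i}. x j - y))" for F y
  by (simp add: P_def poly_sum poly_prod)
 have rel: "F2 y * poly (P F1) y = F1 y * poly (P F2) y" if y: "0 < y" "y < \<delta>" for y
 proof -
  have nz: "x j - y \<noteq> 0" if "j \<in> I" for j using d(2)[OF that] y by simp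
  have "c i * k (x i) y * (\<Prod>j\<in>I. x j - y) = c i * (F1 (x i) * F2 y - F2 (x i) * F1 y) * (\<Prod>j\<in>I - {i}. x j - y)" if "i \<in> I" for i
   using nz[OF that] prod.remove[OF I(1) that, of "\<lambda>j. x j - y"] by (simp add: k_def)
  then have "(\<Sum>i\<in>I. c i * (F1 (x i) * F2 y - F2 (x i) * F1 y) * (\<Prod>j\<in>I - {i}. x j - y)) = h y * (\<Prod>j\<in>I. x j - y)"
   unfolding h_def sum_distrib_right by (intro sum.cong refl) (rule sym)
  then have "(\<Sum>i\<in>I. c i * (F1 (x i) * F2 y - F2 (x i) * F1 y) * (\<Prod>j\<in>I - {i}. x j - y)) = 0" using h0[OF y] by simp
  moreover have "(\<Sum>i\<in>I. c i * (F1 (x i) * F2 y - F2 (x i) * F1 y) * (\<Prod>j\<in>I - {i}. x j - y)) = F2 y * poly (P F1) y - F1 y * poly (P F2) y"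
   unfolding Pe sum_distrib_left sum_subtractf[symmetric] by (intro sum.cong refl) (simp add: algebra_simps)
  ultimately show ?thesis by simp
 qed
 have P2: "P F2 = 0"
 proof (rule ccontr)
  assume "P F2 \<noteq> 0"
  then have "finite {y. poly (P F2) y = 0}" by (rule poly_roots_finite)
  moreover have "{y. 0 < y \<and> y < \<delta> \<and> F2 y = 0} \<subseteq> {y. poly (P F2) y = 0}"
  proof
   fix y assume "y \<in> {y. 0 < y \<and> y < \<delta> \<and> F2 y = 0}"
   then have y: "0 < y" "y < \<delta>" "F2 y = 0" by auto
   then have "F1 y * poly (P F2) y = 0" using rel[of y] by simp
   then show "y \<in> {y. poly (P F2) y = 0}" using F_nonzero[OF y(1)] y(3) by simp
  qed
  ultimately show False using infinite_F2_zeros(1)[OF d(1)] finite_subset by blast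
 qed
 have P1: "P F1 = 0"
 proof (rule ccontr)
  assume "P F1 \<noteq> 0"
  then have "finite {y. poly (P F1) y = 0}" by (rule poly_roots_finite)
  moreover have "{y. 0 < y \<and> y < \<delta> \<and> F2 y \<noteq> 0} \<subseteq> {y. poly (P F1) y = 0}"
   using rel P2 by auto
  ultimately show False using infinite_F2_zeros(2)[OF d(1)] finite_subset by blast
 qed
 have cF: "c i * F (x i) = 0" if "P F = 0" for F
 proof -
  have "0 = poly (P F) (x i)" using that by simp
  also have "\<dots> = (\<Sum>l\<in>I. if l = i then c i * F (x i) * (\<Prod>j\<in>I - {i}. x j - x i) else 0)"
   unfolding Pe
  proof (rule sum.cong[OF refl])
   fix l assume l: "l \<in> I"
   show "c l * F (x l) * (\<Prod>j\<in>I - {l}. x j - x i) = (if l = i then c i * F (x i) * (\<Prod>j\<in>I - {i}. x j - x i) else 0)"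
   proof (cases "l = i")
    case False
    then have "(\<Prod>j\<in>I - {l}. x j - x i) = 0" using i I(1) by (intro prod_zero) auto
    then show ?thesis using False by simp
   qed simp
  qed
  also have "\<dots> = c i * F (x i) * (\<Prod>j\<in>I - {i}. x j - x i)" using i I(1) by simp
  finally have "c i * F (x i) * (\<Prod>j\<in>I - {i}. x j - x i) = 0" by simp
  moreover have "(\<Prod>j\<in>I - {i}. x j - x i) \<noteq> 0"
   using I(1) inj_onD[OF I(2)] i by (auto simp: prod_zero_iff)
  ultimately show ?thesis by simp
 qed
 show ?thesis using cF[OF P1] cF[OF P2] F_nonzero[OF I(3)[OF i]] by auto
qed

end

context balanced_pair
begin

text \<open>The reproducing identity makes the kernel the Gram matrix of the functions \<open>k (x i)\<close>.\<close>

lemma gram: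
 fixes x c :: "'i => real"
 assumes I: "finite I" "\<And>i. i \<in> I ==> x i > 0"
 shows "integrable lborel (\<lambda>y. (\<Sum>i\<in>I. c i * k (x i) y)^2)"
  "(\<Sum>i\<in>I. \<Sum>j\<in>I. c i * c j * kd (x i) (x j)) = lint (\<lambda>y. (\<Sum>i\<in>I. c i * k (x i) y)^2)"
proof -
 have e: "(\<Sum>i\<in>I. c i * k (x i) y)^2 = (\<Sum>i\<in>I. \<Sum>j\<in>I. c i * c j * (k (x i) y * k (x j) y))" for y
  by (simp add: power2_eq_square sum_product mult_ac)
 have ij: "integrable lborel (\<lambda>y. c i * c j * (k (x i) y * k (x j) y))" if "i \<in> I" "j \<in> I" for i j
  by (intro integrable_mult_right k_product_integrable I that)
 show "integrable lborel (\<lambda>y. (\<Sum>i\<in>I. c i * k (x i) y)^2)"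
  unfolding e by (intro Bochner_Integration.integrable_sum ij)
 have "lint (\<lambda>y. (\<Sum>i\<in>I. c i * k (x i) y)^2) = (\<Sum>i\<in>I. \<Sum>j\<in>I. lint (\<lambda>y. c i * c j * (k (x i) y * k (x j) y)))"
  unfolding e by (subst Bochner_Integration.integral_sum, intro Bochner_Integration.integrable_sum ij, assumption+)
   (intro sum.cong refl Bochner_Integration.integral_sum ij)
 also have "\<dots> = (\<Sum>i\<in>I. \<Sum>j\<in>I. c i * c j * kd (x i) (x j))"
  by (intro sum.cong refl) (simp add: reproducing I)
 finally show "(\<Sum>i\<in>I. \<Sum>j\<in>I. c i * c j * kd (x i) (x j)) = lint (\<lambda>y. (\<Sum>i\<in>I. c i * k (x i) y)^2)" by simp
qed

lemma kernel_nonneg: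
 fixes x c :: "'i => real"
 assumes I: "finite I" "\<And>i. i \<in> I ==> x i > 0"
 shows "(\<Sum>i\<in>I. \<Sum>j\<in>I. c i * c j * kd (x i) (x j)) \<ge> 0"
proof -
 have "0 \<le> lint (\<lambda>y. (\<Sum>i\<in>I. c i * k (x i) y)^2)" by (rule integral_nonneg_AE) simp
 also have "\<dots> = (\<Sum>i\<in>I. \<Sum>j\<in>I. c i * c j * kd (x i) (x j))" by (rule sym, rule gram(2)[OF I])
 finally show ?thesis .
qed

lemma kernel_positive_definite:
 fixes x c :: "'i => real"
 assumes I: "finite I" "inj_on x I" "\<And>i. i \<in> I ==> x i > 0"
  and z: "(\<Sum>i\<in>I. \<Sum>j\<in>I. c i * c j * kd (x i) (x j)) = 0" and i: "i \<in> I"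
 shows "c i = 0"
proof (rule k_linearly_independent[OF I _ i])
 have "lint (\<lambda>y. (\<Sum>i\<in>I. c i * k (x i) y)^2) = 0"
  using gram(2)[of I x c, OF I(1,3)] z by simp
 then have "AE y in lborel. (\<Sum>i\<in>I. c i * k (x i) y)^2 = 0"
  using integral_nonneg_eq_0_iff_AE[OF gram(1)[of I x c, OF I(1,3)]] by simp
 then show "AE y in lborel. (\<Sum>i\<in>I. c i * k (x i) y) = 0" by (rule eventually_mono) simp
qed

end

section \<open>The Whittaker functions as one pair on the punctured line\<close>

lemma cnj_powr_real:
 assumes "x > 0" shows "cnj (complex_of_real x powr s) = of_real x powr cnj s"
 using assms by (simp add: powr_def Ln_of_real exp_cnj)

lemma cnj_pochhammer: "cnj (pochhammer al n) = pochhammer (cnj al) n"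
 by (induction n) (simp_all add: pochhammer_Suc)

lemma cnj_kummer: "cnj (kummer al ga (of_real x)) = kummer (cnj al) (cnj ga) (of_real x)" if "Re ga = 1"
proof -
 have "(\<lambda>n. cnj (pochhammer al n / (pochhammer ga n * fact n) * of_real x ^ n)) sums cnj (kummer al ga (of_real x))"
  unfolding sums_cnj by (rule kummer_sums[OF that])
 moreover have "cnj (pochhammer al n / (pochhammer ga n * fact n) * of_real x ^ n) =
   pochhammer (cnj al) n / (pochhammer (cnj ga) n * fact n) * of_real x ^ n" for n
  by (simp add: cnj_pochhammer)
 ultimately have "(\<lambda>n. pochhammer (cnj al) n / (pochhammer (cnj ga) n * fact n) * of_real x ^ n) sums cnj (kummer al ga (of_real x))"
  by simp
 moreover have "(\<lambda>n. pochhammer (cnj al) n / (pochhammer (cnj ga) n * fact n) * of_real x ^ n) sums kummer (cnj al) (cnj ga) (of_real x)"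
  by (rule kummer_sums) (simp add: that)
 ultimately show ?thesis by (rule sums_unique2)
qed

text \<open>The two terms of the connection formula are complex conjugates of each other for real first and imaginary
  second index.\<close>

lemma whittaker_W_eq:
 fixes m \<kappa> x :: real
 assumes m: "m \<noteq> 0" and x: "x > 0"
 shows "whittaker_W (of_real \<kappa>) (\<i> * of_real m) x = of_real (sqrt x * wh m \<kappa> x)"
proof -
 define b where "b = \<i> * complex_of_real m"
 have nI: "2 * b \<notin> \<int>" using m by (auto simp: b_def complex_eq_iff elim!: Ints_cases)
 define A where "A = Gamma (- 2 * b) * rGamma (1/2 - b - of_real \<kappa>) * uw m \<kappa> (of_real x)"
 have sx: "complex_of_real x powr (1/2) = of_real (sqrt x)"
  using x powr_of_real[of x "1/2"] by (simp add: powr_half_sqrt)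
 have M: "whittaker_M (of_real \<kappa>) b x = of_real (sqrt x) * uw m \<kappa> (of_real x)"
  using x by (simp add: whittaker_M_def uw_def kummer_def b_def powr_add sx mult.assoc)
 have u: "uw m \<kappa> (of_real x) = exp (of_real (- x / 2)) * of_real x powr b * kummer (1/2 + b - of_real \<kappa>) (1 + 2 * b) (of_real x)"
  by (simp add: uw_def b_def mult.assoc)
 have cb: "cnj b = - b" by (simp add: b_def)
 have cu: "cnj (uw m \<kappa> (of_real x)) = exp (of_real (- x / 2)) * of_real x powr (- b) * kummer (1/2 - b - of_real \<kappa>) (1 - 2 * b) (of_real x)"
 proof -
  have "Re (1 + 2 * b) = 1" by (simp add: b_def)
  from cnj_kummer[OF this, of "1/2 + b - of_real \<kappa>" x]
  have "cnj (kummer (1/2 + b - of_real \<kappa>) (1 + 2 * b) (of_real x)) = kummer (1/2 - b - of_real \<kappa>) (1 - 2 * b) (of_real x)"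
   by (simp add: cb)
  moreover have "cnj (exp (complex_of_real (- x / 2))) = exp (of_real (- x / 2))" by (simp only: exp_cnj complex_cnj_complex_of_real)
  ultimately show ?thesis unfolding u complex_cnj_mult cnj_powr_real[OF x] cb by (simp only:)
 qed
 have M': "whittaker_M (of_real \<kappa>) (- b) x = of_real (sqrt x) * cnj (uw m \<kappa> (of_real x))"
 proof -
  have "of_real x powr (1/2 - b) = complex_of_real (sqrt x) * of_real x powr (- b)"
   using x powr_add[of "complex_of_real x" "1/2" "- b"] by (simp add: sx)
  then show ?thesis unfolding cu by (simp add: whittaker_M_def kummer_def mult_ac)
 qed
 have cA: "cnj A = Gamma (2 * b) * rGamma (1/2 + b - of_real \<kappa>) * cnj (uw m \<kappa> (of_real x))"
  by (simp add: A_def cnj_Gamma_complex cnj_rGamma cb)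
 have "whittaker_W (of_real \<kappa>) b x = of_real (sqrt x) * (A + cnj A)"
  unfolding whittaker_W_def whittaker_W_generic_def M M' cA using nI by (simp add: A_def algebra_simps)
 also have "wh m \<kappa> x = Re (2 * A)"
  unfolding wh_def A_def b_def by (simp add: mult_ac)
 then have "A + cnj A = of_real (wh m \<kappa> x)"
  by (simp add: complex_add_cnj)
 finally show ?thesis by (simp add: b_def)
qed

lemma wh_bounded:
 assumes m: "m \<noteq> 0"
 shows "\<exists>M. \<forall>x>0. \<bar>wh m \<kappa> x\<bar> \<le> M * exp (- x / 4)"
proof -
 obtain C Y where CY: "\<forall>x\<ge>Y. \<bar>wh m \<kappa> x\<bar> \<le> C * exp (- x / 4)" using wh_decay[OF m, of \<kappa>] by (elim exE)
 define c where "c = 2 * (Gamma (- 2 * \<i> * m) * rGamma (1/2 - \<i> * m - \<kappa>))"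
 define al ga where "al = 1/2 + \<i> * m - complex_of_real \<kappa>" and "ga = 1 + 2 * \<i> * complex_of_real m"
 have g: "Re ga = 1" by (simp add: ga_def)
 have "continuous_on {0..\<bar>Y\<bar>} (\<lambda>x. norm (kummer al ga (complex_of_real x)))"
 proof (intro continuous_on_norm)
  have "continuous_on UNIV (kummer al ga)"
   by (rule continuous_at_imp_continuous_on) (simp add: isCont_kummer[OF g])
  then show "continuous_on {0..\<bar>Y\<bar>} (\<lambda>x. kummer al ga (complex_of_real x))"
   by (rule continuous_on_compose2) (auto intro: continuous_intros)
 qed
 then obtain B where B: "\<forall>y\<in>{0..\<bar>Y\<bar>}. norm (kummer al ga (complex_of_real y)) \<le> B"
  using continuous_attains_sup[of "{0..\<bar>Y\<bar>}" "\<lambda>x. norm (kummer al ga (complex_of_real x))"] by auto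
 have B0: "B \<ge> 0" using B[rule_format, of 0] order_trans[OF norm_ge_zero] by auto
 have "\<bar>wh m \<kappa> x\<bar> \<le> (\<bar>C\<bar> + norm c * B * exp (\<bar>Y\<bar> / 4)) * exp (- x / 4)" if x: "x > 0" for x
 proof (cases "x \<ge> Y")
  case True
  then have "\<bar>wh m \<kappa> x\<bar> \<le> C * exp (- x / 4)" using CY by simp
  also have "\<dots> \<le> (\<bar>C\<bar> + norm c * B * exp (\<bar>Y\<bar> / 4)) * exp (- x / 4)"
  proof (rule mult_right_mono)
   have "0 \<le> norm c * B * exp (\<bar>Y\<bar> / 4)" using B0 by simp
   then show "C \<le> \<bar>C\<bar> + norm c * B * exp (\<bar>Y\<bar> / 4)" by linarith
  qed simp
  finally show ?thesis .
 next
  case False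
  have "\<bar>wh m \<kappa> x\<bar> \<le> norm (c * uw m \<kappa> (of_real x))" unfolding wh_def c_def[symmetric] by (rule abs_Re_le_cmod)
  also have "\<dots> = norm c * (exp (- x / 2) * norm (kummer al ga (of_real x)))"
   using x by (simp add: uw_def norm_mult norm_powr_real_powr al_def ga_def)
  also have "\<dots> \<le> norm c * (1 * B)"
   using x False B by (intro mult_left_mono mult_mono) auto
  also have "\<dots> = norm c * B * 1" by simp
  also have "\<dots> \<le> norm c * B * (exp (\<bar>Y\<bar> / 4) * exp (- x / 4))"
  proof (rule mult_left_mono)
   have "0 \<le> \<bar>Y\<bar> / 4 + - x / 4" using False by simp
   then show "1 \<le> exp (\<bar>Y\<bar> / 4) * exp (- x / 4)" unfolding exp_add[symmetric] by simp
  qed (use B0 in simp)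
  also have "\<dots> \<le> (\<bar>C\<bar> + norm c * B * exp (\<bar>Y\<bar> / 4)) * exp (- x / 4)"
   by (simp add: distrib_right mult.assoc)
  finally show ?thesis .
 qed
 then show ?thesis by (intro exI[of _ "\<bar>C\<bar> + norm c * B * exp (\<bar>Y\<bar> / 4)"]) simp
qed

text \<open>The sign and the order of \<open>P\<^sub>-\<close> and \<open>Q\<^sub>-\<close> are chosen so that the same
  linear system holds on both half-lines.\<close>

definition glued1 :: "complex => real => real" where
 "glued1 z x = (if x > 0 then sqrt (norm z) / norm (Gamma (1 + z)) * wh (Im z) (Re z + 1/2) x
   else sqrt (norm z) / norm (Gamma (1 - z)) * norm z * wh (Im z) (- Re z - 1/2) (- x))"

definition glued2 :: "complex => real => real" where
 "glued2 z x = (if x > 0 then sqrt (norm z) / norm (Gamma (1 + z)) * norm z * wh (Im z) (Re z - 1/2) x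
   else - (sqrt (norm z) / norm (Gamma (1 - z)) * wh (Im z) (- Re z + 1/2) (- x)))"

lemma glued_deriv:
 assumes x: "x \<noteq> 0"
 shows "(glued1 z has_real_derivative (((Re z - x / 2) * glued1 z x + norm z * glued2 z x) / x)) (at x)"
  "(glued2 z has_real_derivative (((x / 2 - Re z) * glued2 z x - norm z * glued1 z x) / x)) (at x)"
proof -
 define w r m where "w = norm z" and "r = Re z" and "m = Im z"
 have w2: "r^2 + m^2 = w * w" using cmod_power2[of z] unfolding w_def r_def m_def by (simp only: power2_eq_square)
 define cp where "cp = sqrt w / norm (Gamma (1 + z))"
 define cm where "cm = sqrt w / norm (Gamma (1 - z))"
 note defs = glued1_def glued2_def w_def[symmetric] r_def[symmetric] m_def[symmetric] cp_def[symmetric] cm_def[symmetric]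
 have "(glued1 z has_real_derivative (((r - x / 2) * glued1 z x + w * glued2 z x) / x)) (at x) \<and>
  (glued2 z has_real_derivative (((x / 2 - r) * glued2 z x - w * glued1 z x) / x)) (at x)"
 proof (cases "x > 0")
  case True
  have ev: "\<forall>\<^sub>F u in nhds x. u > 0" using True by (intro order_tendstoD(1)[OF filterlim_ident])
  have e1: "\<forall>\<^sub>F u in nhds x. glued1 z u = cp * wh m (r + 1/2) u" "\<forall>\<^sub>F u in nhds x. glued2 z u = cp * w * wh m (r - 1/2) u"
   by (rule eventually_mono[OF ev], simp add: defs)+
  have g: "glued1 z x = cp * wh m (r + 1/2) x" "glued2 z x = cp * w * wh m (r - 1/2) x" using True by (simp_all add: defs)
  show ?thesis unfolding DERIV_cong_ev[OF refl e1(1) refl] DERIV_cong_ev[OF refl e1(2) refl] g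
   by (rule conjI; rule DERIV_cong[OF DERIV_cmult[OF wh_deriv(1)[OF True, of m r, unfolded w2]]] DERIV_cong[OF DERIV_cmult[OF wh_deriv(2)[OF True, of m r, unfolded w2]]])
    (use True in \<open>simp_all add: field_simps\<close>)
 next
  case False
  then have y: "- x > 0" using x by simp
  have ev: "\<forall>\<^sub>F u in nhds x. u < 0" using y by (intro order_tendstoD(2)[OF filterlim_ident]) simp
  have e1: "\<forall>\<^sub>F u in nhds x. glued1 z u = cm * w * wh m (- r - 1/2) (- u)" "\<forall>\<^sub>F u in nhds x. glued2 z u = - cm * wh m (- r + 1/2) (- u)"
   by (rule eventually_mono[OF ev], simp add: defs)+
  have g: "glued1 z x = cm * w * wh m (- r - 1/2) (- x)" "glued2 z x = - cm * wh m (- r + 1/2) (- x)" using False by (simp_all add: defs)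
  have dm: "((\<lambda>u. - u) has_real_derivative - 1) (at x)" by (rule DERIV_minus[OF DERIV_ident])
  have w2': "(- r)^2 + m^2 = w * w" using w2 by simp
  note d1 = DERIV_chain2[OF wh_deriv(1)[OF y, of m "- r", unfolded w2'] dm]
   and d2 = DERIV_chain2[OF wh_deriv(2)[OF y, of m "- r", unfolded w2'] dm]
  show ?thesis unfolding DERIV_cong_ev[OF refl e1(1) refl] DERIV_cong_ev[OF refl e1(2) refl] g
   by (rule conjI; rule DERIV_cong[OF DERIV_cmult[OF d2]] DERIV_cong[OF DERIV_cmult[OF d1]])
    (use x in \<open>simp_all add: field_simps\<close>)
 qed
 then show "(glued1 z has_real_derivative (((Re z - x / 2) * glued1 z x + norm z * glued2 z x) / x)) (at x)"
  "(glued2 z has_real_derivative (((x / 2 - Re z) * glued2 z x - norm z * glued1 z x) / x)) (at x)"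
  unfolding w_def r_def by simp_all
qed

lemma glued_bounded:
 assumes "Im z \<noteq> 0"
 shows "\<exists>M. \<forall>x. x \<noteq> 0 \<longrightarrow> \<bar>glued1 z x\<bar> \<le> M * exp (- \<bar>x\<bar> / 4) \<and> \<bar>glued2 z x\<bar> \<le> M * exp (- \<bar>x\<bar> / 4)"
proof -
 have ex: "\<exists>B. B \<ge> 0 \<and> (\<forall>x>0. \<bar>c * wh (Im z) \<kappa> x\<bar> \<le> B * exp (- x / 4))" for c \<kappa>
 proof -
  obtain M where M: "\<forall>x>0. \<bar>wh (Im z) \<kappa> x\<bar> \<le> M * exp (- x / 4)" using wh_bounded[OF assms, of \<kappa>] by (elim exE)
  have "\<bar>c * wh (Im z) \<kappa> x\<bar> \<le> (\<bar>c\<bar> * \<bar>M\<bar>) * exp (- x / 4)" if "x > 0" for x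
  proof -
   have "\<bar>wh (Im z) \<kappa> x\<bar> \<le> M * exp (- x / 4)" using M that by simp
   also have "\<dots> \<le> \<bar>M\<bar> * exp (- x / 4)" by (rule mult_right_mono) simp_all
   finally show ?thesis unfolding abs_mult mult.assoc by (rule mult_left_mono) simp
  qed
  then show ?thesis by (intro exI[of _ "\<bar>c\<bar> * \<bar>M\<bar>"]) simp
 qed
 define cp where "cp = sqrt (norm z) / norm (Gamma (1 + z))"
 define cm where "cm = sqrt (norm z) / norm (Gamma (1 - z))"
 obtain B1 where B1: "B1 \<ge> 0" "\<forall>x>0. \<bar>cp * wh (Im z) (Re z + 1/2) x\<bar> \<le> B1 * exp (- x / 4)" using ex[of cp "Re z + 1/2"] by (elim exE conjE)
 obtain B2 where B2: "B2 \<ge> 0" "\<forall>x>0. \<bar>(cm * norm z) * wh (Im z) (- Re z - 1/2) x\<bar> \<le> B2 * exp (- x / 4)" using ex[of "cm * norm z" "- Re z - 1/2"] by (elim exE conjE)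
 obtain B3 where B3: "B3 \<ge> 0" "\<forall>x>0. \<bar>(cp * norm z) * wh (Im z) (Re z - 1/2) x\<bar> \<le> B3 * exp (- x / 4)" using ex[of "cp * norm z" "Re z - 1/2"] by (elim exE conjE)
 obtain B4 where B4: "B4 \<ge> 0" "\<forall>x>0. \<bar>cm * wh (Im z) (- Re z + 1/2) x\<bar> \<le> B4 * exp (- x / 4)" using ex[of cm "- Re z + 1/2"] by (elim exE conjE)
 define B where "B = B1 + B2 + B3 + B4"
 have le: "B1 * exp t \<le> B * exp t" "B2 * exp t \<le> B * exp t" "B3 * exp t \<le> B * exp t" "B4 * exp t \<le> B * exp t" for t
  by (rule mult_right_mono, use B1(1) B2(1) B3(1) B4(1) in \<open>simp add: B_def\<close>, simp)+
 have "\<bar>glued1 z x\<bar> \<le> B * exp (- \<bar>x\<bar> / 4) \<and> \<bar>glued2 z x\<bar> \<le> B * exp (- \<bar>x\<bar> / 4)" if x: "x \<noteq> 0" for x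
 proof (cases "x > 0")
  case True
  then have "glued1 z x = cp * wh (Im z) (Re z + 1/2) x" "glued2 z x = (cp * norm z) * wh (Im z) (Re z - 1/2) x" "\<bar>x\<bar> = x"
   by (simp_all add: glued1_def glued2_def cp_def)
  then show ?thesis using order_trans[OF B1(2)[rule_format, OF True] le(1)] order_trans[OF B3(2)[rule_format, OF True] le(3)] by simp
 next
  case False
  then have y: "- x > 0" using x by simp
  then have "glued1 z x = (cm * norm z) * wh (Im z) (- Re z - 1/2) (- x)" "\<bar>glued2 z x\<bar> = \<bar>cm * wh (Im z) (- Re z + 1/2) (- x)\<bar>" "\<bar>x\<bar> = - x"
   by (simp_all add: glued1_def glued2_def cm_def)
  then show ?thesis using order_trans[OF B2(2)[rule_format, OF y] le(2)] order_trans[OF B4(2)[rule_format, OF y] le(4)] by simp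
 qed
 then show ?thesis by (intro exI[of _ B]) simp
qed

text \<open>The coefficient of \<open>x\<^sup>i\<^sup>m\<close> in the first function at 0 from the right. The
  coefficient from the left is \<open>phase z\<close> times as large.\<close>

definition amp :: "complex => complex" where
 "amp z = of_real (sqrt (norm z) / norm (Gamma (1 + z))) * (2 * (Gamma (- 2 * \<i> * Im z) * rGamma (- z)))"

definition phase :: "complex => complex" where
 "phase z = of_real (norm (Gamma (1 + z)) / norm (Gamma (1 - z)) * norm z) * rGamma (1 + cnj z) / rGamma (- z)"

lemma nonreal_not_Int: assumes "Im z \<noteq> 0" shows "z \<notin> \<int>" "z \<notin> \<int>\<^sub>\<le>\<^sub>0"
 using assms by (auto elim!: Ints_cases nonpos_Ints_cases)

lemma wh_asymp_scaled:
 "((\<lambda>x. c * wh m \<kappa> x - Re (of_real c * (2 * (Gamma (- 2 * \<i> * m) * rGamma (1/2 - \<i> * m - \<kappa>))) * of_real x powr (\<i> * m))) \<longlongrightarrow> 0) (at_right 0)"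
proof -
 have "((\<lambda>x. c * (wh m \<kappa> x - Re (2 * (Gamma (- 2 * \<i> * m) * rGamma (1/2 - \<i> * m - \<kappa>)) * of_real x powr (\<i> * m)))) \<longlongrightarrow> c * 0) (at_right 0)"
  by (intro tendsto_mult tendsto_const wh_asymp_0)
 then show ?thesis by (simp only: right_diff_distrib Re_of_real_mult mult.assoc mult_zero_right)
qed

lemma glued_asymp:
 assumes m: "Im z \<noteq> 0"
 shows "((\<lambda>x. glued1 z x - Re (amp z * of_real x powr (\<i> * Im z))) \<longlongrightarrow> 0) (at_right 0)"
  and "((\<lambda>x. glued2 z x - Re (- (Re z - \<i> * Im z) / norm z * amp z * of_real x powr (\<i> * Im z))) \<longlongrightarrow> 0) (at_right 0)"
  and "((\<lambda>x. glued1 z (- x) - Re (phase z * amp z * of_real x powr (\<i> * Im z))) \<longlongrightarrow> 0) (at_right 0)"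
  and "((\<lambda>x. glued2 z (- x) - Re (- (Re z - \<i> * Im z) / norm z * (phase z * amp z) * of_real x powr (\<i> * Im z))) \<longlongrightarrow> 0) (at_right 0)"
proof -
 define w r m where "w = norm z" and "r = Re z" and "m = Im z"
 have z0: "z \<noteq> 0" using assms by auto
 have w0: "w > 0" using z0 by (simp add: w_def)
 have m0: "m \<noteq> 0" using assms by (simp add: m_def)
 define cp where "cp = sqrt w / norm (Gamma (1 + z))"
 define cm where "cm = sqrt w / norm (Gamma (1 - z))"
 have z1: "1 + z \<notin> \<int>\<^sub>\<le>\<^sub>0" "1 - z \<notin> \<int>\<^sub>\<le>\<^sub>0" "- z \<notin> \<int>\<^sub>\<le>\<^sub>0"
  using assms by (intro nonreal_not_Int; simp)+
 have G0: "Gamma (1 + z) \<noteq> 0" "Gamma (1 - z) \<noteq> 0" "rGamma (- z) \<noteq> 0"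
  using z1 by (auto simp: Gamma_eq_zero_iff rGamma_eq_zero_iff)
 have cz: "complex_of_real r - \<i> * m = cnj z" by (simp add: r_def m_def complex_eq_iff)
 have zz: "z * cnj z = of_real w * of_real w" using complex_norm_square[of z] by (simp add: w_def power2_eq_square)
 have k1: "1/2 - \<i> * m - complex_of_real (r + 1/2) = - z" "1/2 - \<i> * m - complex_of_real (r - 1/2) = 1 - z"
  "1/2 - \<i> * m - complex_of_real (- r - 1/2) = 1 + cnj z" "1/2 - \<i> * m - complex_of_real (- r + 1/2) = cnj z"
  by (simp_all add: r_def m_def complex_eq_iff)
 define g where "g = Gamma (- 2 * \<i> * complex_of_real m)"
 have amp: "amp z = of_real cp * (2 * (g * rGamma (- z)))" by (simp add: amp_def cp_def w_def g_def m_def)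
 have rg: "rGamma (- z) = - z * rGamma (1 - z)" by (rule rGamma_minus_complex)
 have a2: "- (of_real r - \<i> * m) / of_real w * amp z = of_real (cp * w) * (2 * (g * rGamma (1 - z)))"
 proof -
  have "- (of_real r - \<i> * m) / of_real w * amp z = (z * cnj z) / of_real w * (of_real cp * (2 * (g * rGamma (1 - z))))"
   unfolding cz amp rg by simp
  then show ?thesis unfolding zz using w0 by simp
 qed
 have pa: "phase z * amp z = of_real (cm * w) * (2 * (g * rGamma (1 + cnj z)))"
  unfolding phase_def amp using G0 by (simp add: cp_def cm_def w_def field_simps)
 have rg2: "rGamma (cnj z) = cnj z * rGamma (1 + cnj z)" using rGamma_plus1[of "cnj z"] by (simp add: add.commute)
 have pa2: "- (of_real r - \<i> * m) / of_real w * (phase z * amp z) = of_real (- cm) * (2 * (g * rGamma (cnj z)))"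
  unfolding pa cz rg2 using w0 by simp
 have pos: "\<forall>\<^sub>F x in at_right (0::real). x > 0" by (rule eventually_at_right_less)
 note W = wh_asymp_scaled[where m = m, folded g_def]
 have "((\<lambda>x. glued1 z x - Re (amp z * of_real x powr (\<i> * m))) \<longlongrightarrow> 0) (at_right 0)"
  by (rule Lim_transform_eventually[OF W[of cp "r + 1/2", unfolded k1]], rule eventually_mono[OF pos])
   (simp only: amp, simp add: glued1_def cp_def w_def r_def m_def)
 then show "((\<lambda>x. glued1 z x - Re (amp z * of_real x powr (\<i> * Im z))) \<longlongrightarrow> 0) (at_right 0)" by (simp only: m_def)
 have "((\<lambda>x. glued2 z x - Re (- (of_real r - \<i> * m) / of_real w * amp z * of_real x powr (\<i> * m))) \<longlongrightarrow> 0) (at_right 0)"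
  by (rule Lim_transform_eventually[OF W[of "cp * w" "r - 1/2", unfolded k1]], rule eventually_mono[OF pos])
   (simp only: a2, simp add: glued2_def cp_def w_def r_def m_def)
 then show "((\<lambda>x. glued2 z x - Re (- (Re z - \<i> * Im z) / norm z * amp z * of_real x powr (\<i> * Im z))) \<longlongrightarrow> 0) (at_right 0)"
  by (simp only: m_def r_def w_def)
 have "((\<lambda>x. glued1 z (- x) - Re (phase z * amp z * of_real x powr (\<i> * m))) \<longlongrightarrow> 0) (at_right 0)"
  by (rule Lim_transform_eventually[OF W[of "cm * w" "- r - 1/2", unfolded k1]], rule eventually_mono[OF pos])
   (simp only: pa, simp add: glued1_def cm_def w_def r_def m_def)
 then show "((\<lambda>x. glued1 z (- x) - Re (phase z * amp z * of_real x powr (\<i> * Im z))) \<longlongrightarrow> 0) (at_right 0)" by (simp only: m_def)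
 have "((\<lambda>x. glued2 z (- x) - Re (- (of_real r - \<i> * m) / of_real w * (phase z * amp z) * of_real x powr (\<i> * m))) \<longlongrightarrow> 0) (at_right 0)"
  by (rule Lim_transform_eventually[OF W[of "- cm" "- r + 1/2", unfolded k1]], rule eventually_mono[OF pos])
   (simp only: pa2, simp add: glued2_def cm_def w_def r_def m_def)
 then show "((\<lambda>x. glued2 z (- x) - Re (- (Re z - \<i> * Im z) / norm z * (phase z * amp z) * of_real x powr (\<i> * Im z))) \<longlongrightarrow> 0) (at_right 0)"
  by (simp only: m_def r_def w_def)
qed

text \<open>The reflection formula for the Gamma function turns the moduli into sines and hyperbolic sines. The
  normalization is then the addition theorem for \<open>cosh\<close>.\<close>

lemma amp_phase_identities:
 assumes m: "Im z \<noteq> 0"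
 shows "amp z \<noteq> 0" "norm (phase z) = 1"
  "(norm (amp z))^2 * Im z / norm z * pi * (cosh (2 * pi * Im z) - Re ((phase z)^2)) = sinh (2 * pi * Im z)"
proof -
 have z0: "z \<noteq> 0" using m by auto
 have z1: "1 + z \<notin> \<int>\<^sub>\<le>\<^sub>0" "1 - z \<notin> \<int>\<^sub>\<le>\<^sub>0" "- z \<notin> \<int>\<^sub>\<le>\<^sub>0" "1 + cnj z \<notin> \<int>\<^sub>\<le>\<^sub>0" "- 2 * \<i> * complex_of_real (Im z) \<notin> \<int>\<^sub>\<le>\<^sub>0"
  using m by (intro nonreal_not_Int; simp)+
 have G0: "Gamma (1 + z) \<noteq> 0" "Gamma (1 - z) \<noteq> 0" "rGamma (- z) \<noteq> 0" "rGamma (1 + cnj z) \<noteq> 0" "Gamma (- 2 * \<i> * complex_of_real (Im z)) \<noteq> 0"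
  using z1 by (auto simp: Gamma_eq_zero_iff rGamma_eq_zero_iff)
 show "amp z \<noteq> 0" unfolding amp_def using z0 G0 by simp
 have ncj: "norm (rGamma (1 + cnj z)) = 1 / norm (Gamma (1 + z))"
 proof -
  have "rGamma (1 + cnj z) = cnj (rGamma (1 + z))" by (simp add: cnj_rGamma)
  then show ?thesis by (simp add: rGamma_inverse_Gamma norm_inverse norm_divide inverse_eq_divide)
 qed
 have nr: "norm (rGamma (- z)) = norm z / norm (Gamma (1 - z))"
  unfolding rGamma_minus_complex by (simp add: norm_mult rGamma_inverse_Gamma norm_inverse norm_divide inverse_eq_divide)
 show np: "norm (phase z) = 1"
  unfolding phase_def norm_mult norm_divide ncj nr norm_of_real using G0 z0 by simp
 define m where "m = Im z"
 have m0: "m \<noteq> 0" using assms by (simp add: m_def)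
 define sz where "sz = sin (of_real pi * z)"
 have R1: "rGamma (- z) * rGamma (1 + z) = - sz / of_real pi"
  using rGamma_reflection_complex[of "- z"] by (simp add: sz_def)
 have R2: "rGamma (- cnj z) * rGamma (1 + cnj z) = - cnj sz / of_real pi"
  using arg_cong[OF R1, of cnj] by (simp add: cnj_rGamma)
 have sh: "sinh (2 * pi * m) \<noteq> 0" using m0 by simp
 have Gs: "(norm (Gamma (- 2 * \<i> * complex_of_real m)))^2 = pi / (2 * m * sinh (2 * pi * m))"
 proof -
  define s where "s = 2 * \<i> * complex_of_real m"
  have sI: "s \<notin> \<int>\<^sub>\<le>\<^sub>0" "- s \<notin> \<int>\<^sub>\<le>\<^sub>0" using m0 by (intro nonreal_not_Int; simp add: s_def)+
  have s0: "s \<noteq> 0" using m0 by (simp add: s_def)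
  have "complex_of_real ((norm (Gamma (- s)))^2) = Gamma (- s) * Gamma s"
   unfolding complex_norm_square cnj_Gamma_complex by (simp add: s_def)
  moreover have "Gamma (1 - s) = - s * Gamma (- s)" using Gamma_plus1[OF sI(2)] by (simp add: add.commute)
  then have "Gamma (- s) * Gamma s = - (Gamma s * Gamma (1 - s)) / s" using s0 by simp
  moreover have "Gamma s * Gamma (1 - s) = of_real pi / sin (of_real pi * s)" by (rule Gamma_reflection_complex)
  moreover have "sin (of_real pi * s) = \<i> * of_real (sinh (2 * pi * m))"
  proof -
   have "sinh (complex_of_real (2 * pi * m)) = of_real (sinh (2 * pi * m))"
    by (simp add: sinh_def scaleR_conv_of_real exp_of_real flip: exp_of_real)
   moreover have "sin (\<i> * complex_of_real (2 * pi * m)) = \<i> * sinh (complex_of_real (2 * pi * m))" by (simp add: sinh_conv_sin)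
   moreover have "of_real pi * s = \<i> * complex_of_real (2 * pi * m)" by (simp add: s_def)
   ultimately show ?thesis by (simp only:)
  qed
  ultimately have "complex_of_real ((norm (Gamma (- s)))^2) = - (of_real pi / (\<i> * of_real (sinh (2 * pi * m)))) / s" by simp
  also have "\<dots> = complex_of_real (pi / (2 * m * sinh (2 * pi * m)))"
   using m0 sh by (simp add: s_def field_simps)
  finally show ?thesis unfolding of_real_eq_iff by (simp add: s_def)
 qed
 have na: "(norm (amp z))^2 = 2 * norm z * (norm sz)^2 / (pi * m * sinh (2 * pi * m))"
 proof -
  have "norm (amp z) = sqrt (norm z) / norm (Gamma (1 + z)) * (2 * (norm (Gamma (- 2 * \<i> * complex_of_real m)) * norm (rGamma (- z))))"
   unfolding amp_def norm_mult m_def norm_of_real by simp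
  also have "\<dots> = sqrt (norm z) * 2 * norm (Gamma (- 2 * \<i> * complex_of_real m)) * norm (rGamma (- z) * rGamma (1 + z))"
   by (simp add: rGamma_inverse_Gamma norm_mult norm_inverse divide_inverse mult_ac)
  also have "norm (rGamma (- z) * rGamma (1 + z)) = norm sz / pi" unfolding R1 by (simp add: norm_divide)
  finally have "(norm (amp z))^2 = norm z * 4 * (norm (Gamma (- 2 * \<i> * complex_of_real m)))^2 * ((norm sz)^2 / pi^2)"
   by (simp add: power_mult_distrib power_divide)
  also have "\<dots> = 2 * norm z * (norm sz)^2 / (pi * m * sinh (2 * pi * m))"
   unfolding Gs using m0 sh by (simp add: field_simps power2_eq_square)
  finally show ?thesis .
 qed
 have sz0: "sz \<noteq> 0" using R1 G0(3) z1(1) by (auto simp: rGamma_eq_zero_iff)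
 have ph: "(phase z)^2 = cnj sz / sz"
 proof -
  have pc: "phase z * cnj (phase z) = 1" using complex_norm_square[of "phase z"] np by simp
  from np have c0: "cnj (phase z) \<noteq> 0" by auto
  have "phase z = 1 / cnj (phase z)" by (rule nonzero_eq_divide_eq[THEN iffD2, OF c0]) (rule pc)
  then have "(phase z)^2 = phase z / cnj (phase z)" by (metis power2_eq_square times_divide_eq_right mult_1_right)
  also have "\<dots> = (rGamma (- cnj z) * rGamma (1 + cnj z)) / (rGamma (- z) * rGamma (1 + z))"
   unfolding phase_def using G0 z0 by (simp add: cnj_rGamma field_simps)
  also have "\<dots> = cnj sz / sz" unfolding R1 R2 using sz0 by simp
  finally show ?thesis .
 qed
 define A B where "A = Re sz" and "B = Im sz"
 have n2: "(norm sz)^2 = A^2 + B^2" by (simp add: A_def B_def cmod_power2)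
 have Re2: "(norm sz)^2 * Re ((phase z)^2) = A^2 - B^2"
 proof -
  have "cnj sz / sz = (cnj sz)^2 / of_real ((norm sz)^2)"
   using sz0 unfolding complex_norm_square by (simp add: power2_eq_square)
  then have "Re ((phase z)^2) = Re ((cnj sz)^2) / (norm sz)^2" unfolding ph by (simp add: Re_divide_of_real)
  moreover have "Re ((cnj sz)^2) = A^2 - B^2" by (simp add: A_def B_def power2_eq_square)
  ultimately show ?thesis using sz0 by simp
 qed
 define S C s where "S = sin (pi * Re z)" and "C = cosh (pi * m)" and "s = sinh (pi * m)"
 have AB: "A = S * C" "B = cos (pi * Re z) * s"
 proof -
  have e: "of_real pi * z = Complex (pi * Re z) (pi * m)" by (simp add: complex_eq_iff m_def)
  show "A = S * C" "B = cos (pi * Re z) * s"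
   unfolding A_def B_def sz_def e by (simp_all add: S_def C_def s_def Re_sin Im_sin cosh_def sinh_def)
 qed
 have c2: "(cos (pi * Re z))^2 = 1 - S^2" unfolding S_def using sin_cos_squared_add[of "pi * Re z"] by linarith
 have hy: "C^2 = s^2 + 1" unfolding C_def s_def by (rule cosh_square_eq)
 have ch: "cosh (2 * pi * m) = C^2 + s^2" "sinh (2 * pi * m) = 2 * s * C"
  using cosh_double[of "pi * m"] sinh_double[of "pi * m"] by (simp_all add: C_def s_def mult.assoc)
 have key: "(norm sz)^2 * (cosh (2 * pi * m) - Re ((phase z)^2)) = (sinh (2 * pi * m))^2 / 2"
 proof -
  have "(norm sz)^2 * (cosh (2 * pi * m) - Re ((phase z)^2)) = (A^2 + B^2) * (C^2 + s^2) - (A^2 - B^2)"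
   unfolding right_diff_distrib Re2 unfolding n2 ch ..
  also have "\<dots> = S^2 * (s^2 + 1) * (2 * s^2) + (1 - S^2) * s^2 * (2 * (s^2 + 1))"
   unfolding AB power_mult_distrib c2 hy by (simp add: algebra_simps)
  also have "\<dots> = 2 * s^2 * (s^2 + 1)" by (simp add: algebra_simps)
  also have "\<dots> = (sinh (2 * pi * m))^2 / 2" unfolding ch power_mult_distrib hy by simp
  finally show ?thesis .
 qed
 have "(norm (amp z))^2 * m / norm z * pi * (cosh (2 * pi * m) - Re ((phase z)^2))
   = 2 / sinh (2 * pi * m) * ((norm sz)^2 * (cosh (2 * pi * m) - Re ((phase z)^2)))"
  unfolding na using m0 sh z0 by simp
 also have "\<dots> = sinh (2 * pi * m)" unfolding key using sh by (simp add: power2_eq_square)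
 finally show "(norm (amp z))^2 * Im z / norm z * pi * (cosh (2 * pi * Im z) - Re ((phase z)^2)) = sinh (2 * pi * Im z)"
  unfolding m_def .
qed

lemma balanced_pair_glued:
 assumes m: "Im z \<noteq> 0"
 shows "balanced_pair (glued1 z) (glued2 z) (Re z) (norm z) (Im z) (amp z) (phase z)"
proof -
 have z0: "z \<noteq> 0" using m by auto
 show ?thesis
  by unfold_locales
   (use m z0 glued_bounded[OF m] glued_asymp[OF m] amp_phase_identities[OF m] glued_deriv in \<open>simp_all add: cmod_power2\<close>)
qed

text \<open>Reflection at 0 maps solutions to solutions with \<open>-r\<close> in place of \<open>r\<close>, so facts
  about the positive half-line carry over to the negative one.\<close>

lemma (in balanced_pair) balanced_pair_reflected:
 "balanced_pair (\<lambda>x. F2 (- x)) (\<lambda>x. - F1 (- x)) (- r) w m (lam * (- (r - \<i> * m) / w * a)) (cnj lam)"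
proof
 have cl: "cnj lam * lam = 1" using complex_norm_square[of lam] lam by (simp add: mult.commute)
 have w2: "(complex_of_real r - \<i> * m) * (r + \<i> * m) = of_real w * of_real w"
  using wrm by (simp add: complex_eq_iff power2_eq_square algebra_simps)
 have k2: "- (of_real (- r) - \<i> * m) / w * (lam * (- (r - \<i> * m) / w * a)) = - (lam * a)"
 proof -
  have "- (of_real (- r) - \<i> * m) / w * (lam * (- (r - \<i> * m) / w * a)) = - ((complex_of_real r - \<i> * m) * (r + \<i> * m)) / (of_real w * of_real w) * (lam * a)"
   using w by (simp add: field_simps)
  then show ?thesis unfolding w2 using w by simp
 qed
 show "w > 0" "m \<noteq> 0" "norm (cnj lam) = 1" using w m0 lam by auto
 show "w^2 = (- r)^2 + m^2" using wrm by simp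
 have n: "norm (lam * (- (r - \<i> * m) / w * a)) = norm a" unfolding norm_mult[of lam] norm_second lam by simp
 then show "lam * (- (r - \<i> * m) / w * a) \<noteq> 0" using a0 by (metis norm_eq_zero)
 have dm: "((\<lambda>u. - u) has_real_derivative - 1) (at x)" for x :: real by (rule DERIV_minus[OF DERIV_ident])
 show "((\<lambda>x. F2 (- x)) has_real_derivative ((- r - x / 2) * F2 (- x) + w * - F1 (- x)) / x) (at x)" if "x \<noteq> 0" for x
 proof -
  have x: "- x \<noteq> 0" using that by simp
  show ?thesis by (rule DERIV_cong[OF DERIV_chain2[OF F2_deriv[OF x] dm]]) (use that in \<open>simp add: field_simps\<close>)
 qed
 show "((\<lambda>x. - F1 (- x)) has_real_derivative ((x / 2 - - r) * - F1 (- x) - w * F2 (- x)) / x) (at x)" if "x \<noteq> 0" for x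
 proof -
  have x: "- x \<noteq> 0" using that by simp
  show ?thesis by (rule DERIV_cong[OF DERIV_minus[OF DERIV_chain2[OF F1_deriv[OF x] dm]]]) (use that in \<open>simp add: field_simps\<close>)
 qed
 show "\<exists>M. \<forall>x. x \<noteq> 0 \<longrightarrow> \<bar>F2 (- x)\<bar> \<le> M * exp (- \<bar>x\<bar> / 4) \<and> \<bar>- F1 (- x)\<bar> \<le> M * exp (- \<bar>x\<bar> / 4)"
 proof (intro exI[of _ M] allI impI)
  fix x :: real assume "x \<noteq> 0"
  then have "- x \<noteq> 0" by simp
  from M[OF this] show "\<bar>F2 (- x)\<bar> \<le> M * exp (- \<bar>x\<bar> / 4) \<and> \<bar>- F1 (- x)\<bar> \<le> M * exp (- \<bar>x\<bar> / 4)" by simp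
 qed
 show "((\<lambda>x. F2 (- x) - Re (lam * (- (r - \<i> * m) / w * a) * of_real x powr (\<i> * m))) \<longlongrightarrow> 0) (at_right 0)"
  using F2_0' by (simp only: mult.left_commute[of lam])
 show "((\<lambda>x. - F1 (- x) - Re (- (of_real (- r) - \<i> * m) / w * (lam * (- (r - \<i> * m) / w * a)) * of_real x powr (\<i> * m))) \<longlongrightarrow> 0) (at_right 0)"
 proof -
  have "- F1 (- x) - Re (- (lam * a) * of_real x powr (\<i> * m)) = - (F1 (- x) - Re (lam * a * of_real x powr (\<i> * m)))" for x
   by simp
  then show ?thesis unfolding k2 using tendsto_minus[OF F1_0'] by (simp only: minus_zero)
 qed
 show "((\<lambda>x. F2 (- (- x)) - Re (cnj lam * (lam * (- (r - \<i> * m) / w * a)) * of_real x powr (\<i> * m))) \<longlongrightarrow> 0) (at_right 0)"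
  using F2_0 cl by (simp only: minus_minus mult.assoc[symmetric] mult_1_left)
 show "((\<lambda>x. - F1 (- (- x)) - Re (- (of_real (- r) - \<i> * m) / w * (cnj lam * (lam * (- (r - \<i> * m) / w * a))) * of_real x powr (\<i> * m))) \<longlongrightarrow> 0) (at_right 0)"
 proof -
  have "- (of_real (- r) - \<i> * m) / w * (cnj lam * (lam * (- (r - \<i> * m) / w * a))) = cnj lam * (- (lam * a))"
   unfolding k2[symmetric] by (simp only: mult.left_commute)
  also have "\<dots> = - a" using cl by (simp add: mult.assoc[symmetric])
  finally have e: "- (of_real (- r) - \<i> * m) / w * (cnj lam * (lam * (- (r - \<i> * m) / w * a))) = - a" .
  have "- F1 (- (- x)) - Re (- a * of_real x powr (\<i> * m)) = - (F1 x - Re (a * of_real x powr (\<i> * m)))" for x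
   by simp
  then show ?thesis unfolding e using tendsto_minus[OF F1_0] by (simp only: minus_zero)
 qed
 show "(norm (lam * (- (r - \<i> * m) / w * a)))^2 * m / w * pi * (cosh (2 * pi * m) - Re ((cnj lam)^2)) = sinh (2 * pi * m)"
 proof -
  have "Re ((cnj lam)^2) = Re (lam^2)" unfolding complex_cnj_power[symmetric] by (simp del: complex_cnj_power)
  then show ?thesis unfolding n using normalized by (simp only:)
 qed
qed

section \<open>The Whittaker kernel\<close>

lemma whittaker_prefactor:
 assumes m: "Im z \<noteq> 0" and x: "x > 0"
 shows "(z * cnj z) powr of_real e / (Gamma (1 + of_real s * z) * Gamma (1 + of_real s * cnj z) * of_real x) powr (1/2) *
   whittaker_W (of_real \<kappa>) ((z - cnj z) / 2) x
  = of_real (((norm z)^2) powr e / norm (Gamma (1 + of_real s * z)) * wh (Im z) \<kappa> x)"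
proof -
 have b: "(z - cnj z) / 2 = \<i> * of_real (Im z)" by (simp add: complex_eq_iff)
 have 1: "(z * cnj z) powr complex_of_real e = of_real (((norm z)^2) powr e)"
  unfolding complex_norm_square[symmetric] by (rule powr_of_real) simp_all
 have "cnj (1 + of_real s * z) = 1 + of_real s * cnj z" by simp
 then have "Gamma (1 + of_real s * z) * Gamma (1 + of_real s * cnj z) = of_real ((norm (Gamma (1 + of_real s * z)))^2)"
  unfolding complex_norm_square cnj_Gamma_complex by simp
 then have "(Gamma (1 + of_real s * z) * Gamma (1 + of_real s * cnj z) * of_real x) powr (1/2)
   = complex_of_real ((norm (Gamma (1 + of_real s * z)))^2 * x) powr of_real (1/2)" by simp
 also have "\<dots> = of_real (((norm (Gamma (1 + of_real s * z)))^2 * x) powr (1/2))"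
  by (rule powr_of_real) (use x in simp_all)
 also have "\<dots> = of_real (norm (Gamma (1 + of_real s * z)) * sqrt x)"
  using x by (simp add: powr_half_sqrt real_sqrt_mult)
 finally show ?thesis unfolding 1 b whittaker_W_eq[OF m x] using x by simp
qed

lemma whittaker_PQ_eq:
 assumes m: "Im z \<noteq> 0" and x: "x > 0"
 shows "whittaker_P 1 z (cnj z) x = of_real (sqrt (norm z) / norm (Gamma (1 + z)) * wh (Im z) (Re z + 1/2) x)"
  and "whittaker_Q 1 z (cnj z) x = of_real (sqrt (norm z) / norm (Gamma (1 + z)) * norm z * wh (Im z) (Re z - 1/2) x)"
  and "whittaker_P (-1) z (cnj z) x = of_real (sqrt (norm z) / norm (Gamma (1 - z)) * wh (Im z) (- Re z + 1/2) x)"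
  and "whittaker_Q (-1) z (cnj z) x = of_real (sqrt (norm z) / norm (Gamma (1 - z)) * norm z * wh (Im z) (- Re z - 1/2) x)"
proof -
 have z0: "norm z > 0" using m by auto
 have sq: "(norm z)^2 = norm z powr 2" using z0 by simp
 have q1: "((norm z)^2) powr (1/4) = sqrt (norm z)"
  unfolding sq powr_powr using z0 by (simp add: powr_half_sqrt)
 have "((norm z)^2) powr (3/4) = norm z powr (1/2 + 1)" unfolding sq powr_powr by simp
 then have q3: "((norm z)^2) powr (3/4) = sqrt (norm z) * norm z"
  unfolding powr_add using z0 by (simp add: powr_half_sqrt)
 have f: "complex_of_real (1/4) = 1/4" "complex_of_real (3/4) = 3/4" by simp_all
 have k: "(1 * (z + cnj z) + 1) / 2 = of_real (Re z + 1/2)" "(1 * (z + cnj z) - 1) / 2 = of_real (Re z - 1/2)"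
  "((-1) * (z + cnj z) + 1) / 2 = of_real (- Re z + 1/2)" "((-1) * (z + cnj z) - 1) / 2 = of_real (- Re z - 1/2)"
  by (simp_all add: complex_eq_iff)
 show "whittaker_P 1 z (cnj z) x = of_real (sqrt (norm z) / norm (Gamma (1 + z)) * wh (Im z) (Re z + 1/2) x)"
  using whittaker_prefactor[OF m x, of "1/4" 1 "Re z + 1/2", unfolded f q1] unfolding whittaker_P_def k by simp
 show "whittaker_Q 1 z (cnj z) x = of_real (sqrt (norm z) / norm (Gamma (1 + z)) * norm z * wh (Im z) (Re z - 1/2) x)"
  using whittaker_prefactor[OF m x, of "3/4" 1 "Re z - 1/2", unfolded f q3] unfolding whittaker_Q_def k by simp
 show "whittaker_P (-1) z (cnj z) x = of_real (sqrt (norm z) / norm (Gamma (1 - z)) * wh (Im z) (- Re z + 1/2) x)"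
  using whittaker_prefactor[OF m x, of "1/4" "-1" "- Re z + 1/2", unfolded f q1] unfolding whittaker_P_def k by simp
 show "whittaker_Q (-1) z (cnj z) x = of_real (sqrt (norm z) / norm (Gamma (1 - z)) * norm z * wh (Im z) (- Re z - 1/2) x)"
  using whittaker_prefactor[OF m x, of "3/4" "-1" "- Re z - 1/2", unfolded f q3] unfolding whittaker_Q_def k by simp
qed

context integrable_pair
begin

lemma k_tendsto_kd:
 assumes x: "x \<noteq> 0"
 shows "((\<lambda>t. k t x) \<longlongrightarrow> kd x x) (at x)"
proof -
 define G where "G t = F1 t * F2 x - F2 t * F1 x" for t
 have "(G has_real_derivative (((r - x / 2) * F1 x + w * F2 x) / x) * F2 x - (((x / 2 - r) * F2 x - w * F1 x) / x) * F1 x) (at x)"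
  unfolding G_def by (intro DERIV_diff DERIV_cmult_right F1_deriv F2_deriv x)
 moreover have "(((r - x / 2) * F1 x + w * F2 x) / x) * F2 x - (((x / 2 - r) * F2 x - w * F1 x) / x) * F1 x = kd x x"
  using x by (simp add: kd_def field_simps power2_eq_square)
 moreover have "G x = 0" by (simp add: G_def)
 ultimately show ?thesis unfolding has_field_derivative_iff k_def by (simp add: G_def)
qed

lemma kd_sym: "kd x y = kd y x"
 unfolding kd_def using k_sym[of x y] by simp

end

locale whittaker_pair =
 fixes z :: complex
 assumes nonreal: "Im z \<noteq> 0"
begin

sublocale balanced_pair "glued1 z" "glued2 z" "Re z" "norm z" "Im z" "amp z" "phase z"
 by (rule balanced_pair_glued[OF nonreal])

sublocale refl: balanced_pair "\<lambda>x. glued2 z (- x)" "\<lambda>x. - glued1 z (- x)" "- Re z" "norm z" "Im z"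
  "phase z * (- (Re z - \<i> * Im z) / norm z * amp z)" "cnj (phase z)"
 by (rule balanced_pair_reflected)

lemma refl_k: "refl.k x y = - k (- x) (- y)"
proof -
 have "refl.k x y = (glued1 z (- x) * glued2 z (- y) - glued2 z (- x) * glued1 z (- y)) / (x - y)"
  unfolding refl.k_def by (simp add: algebra_simps)
 also have "x - y = - (- x - - y)" by simp
 finally show ?thesis unfolding k_def minus_divide_right[symmetric] by simp
qed

lemma refl_kd: "refl.kd x y = - kd (- x) (- y)"
 unfolding refl.kd_def kd_def by (simp add: refl_k algebra_simps)

abbreviation kernel :: "real => real => complex" where
 "kernel \<equiv> whittaker_kernel z (cnj z)"

lemma offdiag_eq:
 assumes x: "x \<noteq> 0" and y: "y \<noteq> 0"
 shows "whittaker_kernel_offdiag z (cnj z) x y = of_real (sgn y * k x y)"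
proof -
 note PQ = whittaker_PQ_eq[OF nonreal]
 consider "x > 0 \<and> y > 0" | "x > 0 \<and> y < 0" | "x < 0 \<and> y > 0" | "x < 0 \<and> y < 0" using x y by linarith
 then show ?thesis
 proof cases
  case 1
  then show ?thesis by (simp add: whittaker_kernel_offdiag_def Let_def PQ k_def glued1_def glued2_def)
 next
  case 2
  then have "whittaker_kernel_offdiag z (cnj z) x y = of_real (- ((glued1 z x * glued2 z y - glued2 z x * glued1 z y) / (x - y)))"
   unfolding minus_divide_left by (simp add: whittaker_kernel_offdiag_def Let_def PQ glued1_def glued2_def)
  moreover have sg: "sgn y = - 1" using 2 by simp
  ultimately show ?thesis unfolding k_def sg mult_minus1 by (simp only:)
 next
  case 3
  then have "whittaker_kernel_offdiag z (cnj z) x y = of_real ((glued1 z x * glued2 z y - glued2 z x * glued1 z y) / (x - y))"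
   by (simp add: whittaker_kernel_offdiag_def Let_def PQ glued1_def glued2_def add_ac mult_ac)
  then show ?thesis using 3 by (simp add: k_def)
 next
  case 4
  then have "whittaker_kernel_offdiag z (cnj z) x y = of_real ((glued1 z x * glued2 z y - glued2 z x * glued1 z y) / (y - x))"
   by (simp add: whittaker_kernel_offdiag_def Let_def PQ glued1_def glued2_def add_ac mult_ac)
  also have "y - x = - (x - y)" by simp
  finally have "whittaker_kernel_offdiag z (cnj z) x y = of_real (- ((glued1 z x * glued2 z y - glued2 z x * glued1 z y) / (x - y)))"
   unfolding minus_divide_right[symmetric] .
  moreover have sg: "sgn y = - 1" using 4 by simp
  ultimately show ?thesis unfolding k_def sg mult_minus1 by (simp only:)
 qed
qed

lemma kernel_eq:
 assumes x: "x \<noteq> 0" and y: "y \<noteq> 0"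
 shows "kernel x y = of_real (sgn y * kd x y)"
proof (cases "x = y")
 case False
 then show ?thesis by (simp add: whittaker_kernel_def offdiag_eq[OF x y] kd_def)
next
 case True
 have "((\<lambda>t. complex_of_real (sgn x * k t x)) \<longlongrightarrow> of_real (sgn x * kd x x)) (at x)"
  by (intro tendsto_intros k_tendsto_kd x)
 moreover have "\<forall>\<^sub>F t in at x. complex_of_real (sgn x * k t x) = whittaker_kernel_offdiag z (cnj z) t x"
 proof -
  have "\<forall>\<^sub>F t in at x. t \<noteq> 0" by (rule tendsto_imp_eventually_ne[OF tendsto_ident_at x])
  then show ?thesis by (rule eventually_mono) (rule offdiag_eq[OF _ x, symmetric])
 qed
 ultimately have "((\<lambda>t. whittaker_kernel_offdiag z (cnj z) t x) \<longlongrightarrow> of_real (sgn x * kd x x)) (at x)"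
  by (rule Lim_transform_eventually)
 then have "Lim (at x) (\<lambda>t. whittaker_kernel_offdiag z (cnj z) t x) = of_real (sgn x * kd x x)"
  by (intro tendsto_Lim) simp_all
 then show ?thesis using True by (simp add: whittaker_kernel_def)
qed

text \<open>The reproducing identity on the diagonal, at negative points by reflection.\<close>

lemma kernel_diagonal_gram:
 assumes x: "x \<noteq> 0"
 shows "integrable lborel (\<lambda>s. (k x s)^2)" "lint (\<lambda>s. (k x s)^2) = sgn x * kd x x"
proof -
 have "integrable lborel (\<lambda>s. (k x s)^2) \<and> lint (\<lambda>s. (k x s)^2) = sgn x * kd x x"
 proof (cases "x > 0")
  case True
  then show ?thesis using k_product_integrable[OF True True] reproducing[OF True True] by (simp add: power2_eq_square)
 next
  case False
  then have nx: "- x > 0" using x by simp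
  have e: "refl.k (- x) (0 + (- 1) * s) * refl.k (- x) (0 + (- 1) * s) = (k x s)^2" for s unfolding refl_k by (simp add: power2_eq_square)
  have "integrable lborel (\<lambda>s. (k x s)^2)"
   using lborel_integrable_real_affine[OF refl.k_product_integrable[OF nx nx], of "-1" 0] unfolding e by simp
  moreover have "lint (\<lambda>s. (k x s)^2) = refl.kd (- x) (- x)"
   using refl.reproducing[OF nx nx] lborel_integral_real_affine[of "-1" "\<lambda>s. refl.k (- x) s * refl.k (- x) s" 0] unfolding e by simp
  ultimately show ?thesis using nx by (simp add: refl_kd)
 qed
 then show "integrable lborel (\<lambda>s. (k x s)^2)" "lint (\<lambda>s. (k x s)^2) = sgn x * kd x x" by simp_all
qed

text \<open>On each half-line the gauge by \<open>sgn\<close> is constant, so both quadratic forms are Gram forms.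
  The cross terms have opposite signs and cancel by symmetry.\<close>

lemma null_vector_trivial:
 fixes q u :: "'i => real"
 assumes I: "finite I" "inj_on q I" "\<And>i. i \<in> I ==> q i \<noteq> 0"
  and null: "\<And>i. i \<in> I ==> (\<Sum>j\<in>I. kd (q i) (q j) * u j) = 0" and i: "i \<in> I"
 shows "u i = 0"
proof -
 define A where "A = {i \<in> I. q i > 0}"
 define B where "B = {i \<in> I. q i < 0}"
 have AB: "I = A \<union> B" "A \<inter> B = {}" "finite A" "finite B"
  using I(1) I(3) unfolding A_def B_def by force+
 define T where "T C D = (\<Sum>i\<in>C. \<Sum>j\<in>D. u i * u j * kd (q i) (q j))" for C D
 have row: "(\<Sum>j\<in>A. u i * u j * kd (q i) (q j)) + (\<Sum>j\<in>B. u i * u j * kd (q i) (q j)) = 0" if "i \<in> I" for i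
 proof -
  have "(\<Sum>j\<in>A. u i * u j * kd (q i) (q j)) + (\<Sum>j\<in>B. u i * u j * kd (q i) (q j)) = (\<Sum>j\<in>I. u i * u j * kd (q i) (q j))"
   unfolding AB(1) by (rule sum.union_disjoint[symmetric, OF AB(3,4,2)])
  also have "\<dots> = u i * (\<Sum>j\<in>I. kd (q i) (q j) * u j)" by (simp add: sum_distrib_left mult_ac)
  finally show ?thesis using null[OF that] by simp
 qed
 have "T A A + T A B = (\<Sum>i\<in>A. 0)" unfolding T_def sum.distrib[symmetric]
  by (rule sum.cong[OF refl]) (rule row, simp add: AB(1))
 moreover have "T B A + T B B = (\<Sum>i\<in>B. 0)" unfolding T_def sum.distrib[symmetric]
  by (rule sum.cong[OF refl]) (rule row, simp add: AB(1))
 moreover have "T B A = T A B" unfolding T_def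
  by (subst sum.swap) (intro sum.cong refl, simp add: kd_sym mult_ac)
 ultimately have eq: "T A A = T B B" by simp
 have TB: "T B B = - (\<Sum>i\<in>B. \<Sum>j\<in>B. u i * u j * refl.kd (- q i) (- q j))"
  unfolding T_def by (simp add: refl_kd sum_negf)
 have pA: "\<And>i. i \<in> A ==> q i > 0" and pB: "\<And>i. i \<in> B ==> - q i > 0" by (simp_all add: A_def B_def)
 have "T A A \<ge> 0" unfolding T_def by (rule kernel_nonneg[OF AB(3) pA])
 moreover have "- T B B \<ge> 0" unfolding TB minus_minus by (rule refl.kernel_nonneg[OF AB(4) pB])
 ultimately have z: "T A A = 0" "- T B B = 0" using eq by simp_all
 have inj: "inj_on q A" "inj_on (\<lambda>i. - q i) B" using I(2) unfolding AB(1) by (auto simp: inj_on_def)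
 show ?thesis
 proof (cases "i \<in> A")
  case True
  show ?thesis by (rule kernel_positive_definite[OF AB(3) inj(1) pA z(1)[unfolded T_def] True])
 next
  case False
  then have "i \<in> B" using i AB(1) by simp
  then show ?thesis
   using refl.kernel_positive_definite[where I = B and x = "\<lambda>i. - q i" and c = u and i = i, OF AB(4) inj(2) pB] z(2)
   unfolding TB minus_minus by blast
 qed
qed

lemma kernel_det_nonzero:
 assumes q: "inj_on q {..<m}" "\<And>i. i < m ==> q i \<noteq> 0"
 shows "kernel_det kernel m q \<noteq> 0"
proof
 assume "kernel_det kernel m q = 0"
 define A where "A = Matrix.mat m m (\<lambda>(i, j). kernel (q i) (q j))"
 have A: "A \<in> carrier_mat m m" by (simp add: A_def)
 have "Determinant.det A = 0" using \<open>kernel_det kernel m q = 0\<close> by (simp add: kernel_det_def A_def)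
 then obtain v where v: "v \<in> carrier_vec m" "v \<noteq> 0\<^sub>v m" "A *\<^sub>v v = 0\<^sub>v m"
  using det_0_iff_vec_prod_zero[OF A] by auto
 have row: "(\<Sum>j<m. of_real (sgn (q j) * kd (q i) (q j)) * vec_index v j) = 0" if "i < m" for i
 proof -
  have "vec_index (A *\<^sub>v v) i = (\<Sum>j<m. kernel (q i) (q j) * vec_index v j)"
   using that v(1) A by (simp add: A_def scalar_prod_def atLeast0LessThan)
  also have "\<dots> = (\<Sum>j<m. of_real (sgn (q j) * kd (q i) (q j)) * vec_index v j)"
   using that q(2) by (intro sum.cong refl) (simp add: kernel_eq)
  finally show ?thesis using v(3) that by simp
 qed
 have "vec_index v i = 0" if i: "i < m" for i
 proof -
  have "(\<Sum>j\<in>{..<m}. kd (q i) (q j) * (sgn (q j) * Re (vec_index v j))) = 0" if "i \<in> {..<m}" for i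
   using arg_cong[OF row, of i Re] that by (simp add: mult_ac)
  from null_vector_trivial[OF _ q(1) _ this] have R: "sgn (q i) * Re (vec_index v i) = 0" using i q(2) by simp
  have "(\<Sum>j\<in>{..<m}. kd (q i) (q j) * (sgn (q j) * Im (vec_index v j))) = 0" if "i \<in> {..<m}" for i
   using arg_cong[OF row, of i Im] that by (simp add: mult_ac)
  from null_vector_trivial[OF _ q(1) _ this] have I: "sgn (q i) * Im (vec_index v i) = 0" using i q(2) by simp
  show ?thesis using R I q(2)[OF i] by (simp add: complex_eq_iff sgn_eq_0_iff)
 qed
 then have "v = 0\<^sub>v m" using v(1) by (intro eq_vecI) auto
 then show False using v(2) by simp
qed

end

section \<open>Counting points of configurations\<close>

lemma space_conf_algebra [simp]: "space conf_algebra = Conf"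
 unfolding conf_algebra_def by (rule space_measure_of) auto

lemma relcompact_borelD:
 assumes "B \<in> relcompact_borel"
 shows "B \<in> sets borel" "compact (closure B)" "closure B \<subseteq> Rstar" "B \<subseteq> Rstar"
 using assms closure_subset[of B] unfolding relcompact_borel_def by auto

lemma relcompact_borel_subset:
 assumes "B \<in> relcompact_borel" "D \<subseteq> B" "D \<in> sets borel"
 shows "D \<in> relcompact_borel"
proof -
 note B = relcompact_borelD[OF assms(1)]
 have c: "closure D \<subseteq> closure B" by (rule closure_mono[OF assms(2)])
 have "compact (closure B \<inter> closure D)" by (rule compact_Int_closed[OF B(2) closed_closure])
 then have "compact (closure D)" using c by (simp add: Int_absorb1)
 then show ?thesis using B(3) c assms(3) unfolding relcompact_borel_def by auto
qed

lemma relcompact_borel_annulus: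
 assumes "B \<in> sets borel" "ep > 0" "\<And>x. x \<in> B ==> ep \<le> \<bar>x\<bar> \<and> \<bar>x\<bar> \<le> R"
 shows "B \<in> relcompact_borel"
proof -
 have cl: "closed {x::real. ep \<le> \<bar>x\<bar> \<and> \<bar>x\<bar> \<le> R}"
  by (intro closed_Collect_conj closed_Collect_le continuous_intros)
 have sub: "closure B \<subseteq> {x. ep \<le> \<bar>x\<bar> \<and> \<bar>x\<bar> \<le> R}"
  by (rule closure_minimal[OF _ cl]) (use assms(3) in auto)
 have "bounded (closure B)"
  by (rule bounded_subset[OF _ sub]) (rule boundedI[of _ R], simp)
 then have "compact (closure B)" by (simp add: compact_eq_bounded_closed)
 then show ?thesis using sub assms(1,2) unfolding relcompact_borel_def by auto
qed

lemma relcompact_borel_bounds: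
 assumes "B \<in> relcompact_borel"
 shows "\<exists>ep b. ep > 0 \<and> (\<forall>x\<in>B. ep \<le> \<bar>x\<bar> \<and> \<bar>x\<bar> \<le> real b)"
proof -
 note B = relcompact_borelD[OF assms]
 obtain ep where e: "ep > 0" "\<forall>x\<in>closure B. ep \<le> dist 0 x"
  using separate_point_closed[of "closure B" 0] B(3) by auto
 obtain b where b: "\<forall>x\<in>closure B. norm x \<le> b"
  using compact_imp_bounded[OF B(2)] unfolding bounded_iff by auto
 have "ep \<le> \<bar>x\<bar> \<and> \<bar>x\<bar> \<le> real (nat \<lceil>b\<rceil>)" if "x \<in> B" for x
 proof -
  have "x \<in> closure B" using that closure_subset[of B] by auto
  then have "ep \<le> dist 0 x" "norm x \<le> b" using e(2) b by auto
  moreover have "b \<le> real (nat \<lceil>b\<rceil>)" by (rule real_nat_ceiling_ge)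
  ultimately show ?thesis unfolding dist_real_def real_norm_def by linarith
 qed
 then show ?thesis using e(1) by (intro exI[of _ ep] exI[of _ "nat \<lceil>b\<rceil>"]) simp
qed

lemma Conf_finite:
 assumes "X \<in> Conf" "B \<in> relcompact_borel" shows "finite (X \<inter> B)"
proof -
 have "finite (X \<inter> closure B)" using assms relcompact_borelD[OF assms(2)] unfolding Conf_def by auto
 then show ?thesis by (rule finite_subset[rotated]) (use closure_subset[of B] in auto)
qed

lemma count_measurable [measurable]:
 assumes "B \<in> relcompact_borel"
 shows "(\<lambda>X. card (X \<inter> B)) \<in> measurable conf_algebra (count_space UNIV)"
proof (subst measurable_count_space_eq_countable, simp, intro conjI ballI)
 show "(\<lambda>X. card (X \<inter> B)) \<in> space conf_algebra \<rightarrow> UNIV" by simp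
next
 fix j :: nat
 have "(\<lambda>X. card (X \<inter> B)) -` {j} \<inter> Conf \<in> sets (sigma Conf {(\<lambda>X. card (X \<inter> B)) -` {j} \<inter> Conf | B j. B \<in> relcompact_borel})"
  by (subst sets_measure_of) (use assms in \<open>auto intro!: sigma_sets.Basic\<close>)
 then show "(\<lambda>X. card (X \<inter> B)) -` {j} \<inter> space conf_algebra \<in> sets conf_algebra"
  unfolding space_conf_algebra by (simp only: conf_algebra_def)
qed

text \<open>The generators of the configuration algebra are the preimages of counts.\<close>

lemma measurable_conf_algebraI:
 assumes "\<And>w. w \<in> space M ==> f w \<in> Conf"
  and "\<And>B. B \<in> relcompact_borel ==> (\<lambda>w. card (f w \<inter> B)) \<in> measurable M (count_space UNIV)"
 shows "f \<in> measurable M conf_algebra"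
 unfolding conf_algebra_def
proof (rule measurable_measure_of)
 show "f \<in> space M \<rightarrow> Conf" using assms(1) by simp
next
 fix y assume "y \<in> {(\<lambda>X. card (X \<inter> B)) -` {j} \<inter> Conf | B j. B \<in> relcompact_borel}"
 then obtain B j where B: "B \<in> relcompact_borel" and y: "y = (\<lambda>X. card (X \<inter> B)) -` {j} \<inter> Conf" by auto
 have "f -` y \<inter> space M = (\<lambda>w. card (f w \<inter> B)) -` {j} \<inter> space M" using assms(1) unfolding y by auto
 then show "f -` y \<inter> space M \<in> sets M" using measurable_sets[OF assms(2)[OF B], of "{j}"] by simp
qed auto

text \<open>Dyadic cells. Counts and diagonals are reached through them in the limit \<open>n \<rightarrow>
  \<infinity>\<close>.\<close>

definition cell :: "nat => int => real set" where
 "cell n a = {real_of_int a / 2 ^ n ..< (real_of_int a + 1) / 2 ^ n}"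

lemma cell_borel [measurable]: "cell n a \<in> sets borel" by (simp add: cell_def)

lemma mem_cell: "x \<in> cell n a \<longleftrightarrow> \<lfloor>2 ^ n * x\<rfloor> = a"
 unfolding cell_def floor_eq_iff by (simp add: field_simps)

definition cell_range :: "nat => nat => int set" where
 "cell_range b n = {- ((int b + 1) * 2 ^ n) .. (int b + 1) * 2 ^ n}"

lemma finite_cell_range [simp]: "finite (cell_range b n)" by (simp add: cell_range_def)

lemma floor_in_cell_range:
 assumes "\<bar>x\<bar> \<le> real b" shows "\<lfloor>2 ^ n * x\<rfloor> \<in> cell_range b n"
proof -
 have p: "(1::real) \<le> 2 ^ n" by simp
 have "2 ^ n * x \<le> real b * 2 ^ n"
  unfolding mult.commute[of "real b"] using assms by (intro mult_left_mono) auto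
 moreover have "- (real b * 2 ^ n) \<le> 2 ^ n * x"
  unfolding mult.commute[of "real b"] mult_minus_right[symmetric] using assms by (intro mult_left_mono) auto
 ultimately have "2 ^ n * x \<le> of_int ((int b + 1) * 2 ^ n)" "of_int (- ((int b + 1) * 2 ^ n)) \<le> 2 ^ n * x"
  using p unfolding of_int_minus of_int_mult of_int_add of_int_power of_int_of_nat_eq of_int_numeral of_int_1 distrib_right
  by linarith+
 then show ?thesis unfolding cell_range_def by (simp add: le_floor_iff floor_le_iff del: of_int_minus of_int_mult)
qed

lemma card_eq_sum_cells:
 assumes "finite F" "\<And>x. x \<in> F ==> \<bar>x\<bar> \<le> real b"
 shows "card F = (\<Sum>a\<in>cell_range b n. card (F \<inter> cell n a))"
proof -
 have "F = (\<Union>a\<in>cell_range b n. F \<inter> cell n a)"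
  using floor_in_cell_range[OF assms(2)] by (auto simp: mem_cell)
 then have "card F = card (\<Union>a\<in>cell_range b n. F \<inter> cell n a)" by simp
 also have "\<dots> = (\<Sum>a\<in>cell_range b n. card (F \<inter> cell n a))"
  by (rule card_UN_disjoint) (use assms(1) in \<open>auto simp: mem_cell\<close>)
 finally show ?thesis .
qed

lemma eventually_floor_inj:
 assumes "finite F" shows "\<forall>\<^sub>F n in sequentially. inj_on (\<lambda>x::real. \<lfloor>2 ^ n * x\<rfloor>) F"
proof -
 have "\<forall>\<^sub>F n in sequentially. \<lfloor>2 ^ n * x\<rfloor> \<noteq> \<lfloor>2 ^ n * y\<rfloor>" if "x \<noteq> y" for x y :: real
 proof -
  obtain N where N: "1 / \<bar>x - y\<bar> < 2 ^ N" using real_arch_pow[of 2 "1 / \<bar>x - y\<bar>"] by auto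
  have "\<lfloor>2 ^ n * x\<rfloor> \<noteq> \<lfloor>2 ^ n * y\<rfloor>" if n: "n \<ge> N" for n
  proof
   assume e: "\<lfloor>2 ^ n * x\<rfloor> = \<lfloor>2 ^ n * y\<rfloor>"
   have "(2::real) ^ N \<le> 2 ^ n" using n by (intro power_increasing) auto
   then have "1 / \<bar>x - y\<bar> < 2 ^ n" using N by linarith
   then have "1 < 2 ^ n * \<bar>x - y\<bar>" using \<open>x \<noteq> y\<close> by (simp add: divide_less_eq)
   then have "1 < \<bar>2 ^ n * x - 2 ^ n * y\<bar>" by (simp add: abs_mult right_diff_distrib[symmetric])
   then show False using e by linarith
  qed
  then show ?thesis unfolding eventually_sequentially by (intro exI[of _ N]) blast
 qed
 then have "\<forall>\<^sub>F n in sequentially. x \<noteq> y \<longrightarrow> \<lfloor>2 ^ n * x\<rfloor> \<noteq> \<lfloor>2 ^ n * y\<rfloor>" for x y :: real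
  by (cases "x = y") simp_all
 then have "\<forall>\<^sub>F n in sequentially. \<forall>x\<in>F. \<forall>y\<in>F. x \<noteq> y \<longrightarrow> \<lfloor>2 ^ n * x\<rfloor> \<noteq> \<lfloor>2 ^ n * y\<rfloor>"
  by (intro eventually_ball_finite[OF assms] ballI)
 then show ?thesis by (rule eventually_mono) (auto simp: inj_on_def)
qed

lemma card_cell_le_1:
 assumes "inj_on (\<lambda>x. \<lfloor>2 ^ n * x\<rfloor>) F"
 shows "card (F \<inter> cell n a) = (if F \<inter> cell n a = {} then 0 else 1)"
proof (cases "F \<inter> cell n a = {}")
 case False
 then obtain x where x: "x \<in> F \<inter> cell n a" by auto
 have "F \<inter> cell n a = {x}" using x assms unfolding inj_on_def by (auto simp: mem_cell)
 then show ?thesis by simp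
qed simp

text \<open>A finite set is counted by the cells it meets, once the cells separate its points.
  Counts are therefore measurable as soon as the hitting events are.\<close>

lemma count_measurable_from_hits:
 assumes B: "B \<in> relcompact_borel" and fin: "\<And>w. w \<in> space M ==> finite (f w \<inter> B)"
  and hits: "\<And>D. D \<in> sets borel ==> D \<subseteq> B ==> {w \<in> space M. f w \<inter> D \<noteq> {}} \<in> sets M"
 shows "(\<lambda>w. card (f w \<inter> B)) \<in> measurable M (count_space UNIV)"
proof -
 note Bm = relcompact_borelD(1)[OF B]
 obtain ep b where b: "\<forall>x\<in>B. ep \<le> \<bar>x\<bar> \<and> \<bar>x\<bar> \<le> real b" using relcompact_borel_bounds[OF B] by auto
 define H where "H n a = {w \<in> space M. f w \<inter> (B \<inter> cell n a) \<noteq> {}}" for n a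
 have H: "H n a \<in> sets M" for n a unfolding H_def using Bm by (intro hits) auto
 define h where "h n w = (\<Sum>a\<in>cell_range b n. indicator (H n a) w :: real)" for n w
 have hm: "h n \<in> borel_measurable M" for n unfolding h_def
  by (intro borel_measurable_sum borel_measurable_indicator H)
 have lim: "(\<lambda>n. h n w) \<longlonglongrightarrow> real (card (f w \<inter> B))" if w: "w \<in> space M" for w
 proof (rule tendsto_eventually, rule eventually_mono[OF eventually_floor_inj[OF fin[OF w]]])
  fix n assume inj: "inj_on (\<lambda>x. \<lfloor>2 ^ n * x\<rfloor>) (f w \<inter> B)"
  have "card (f w \<inter> B) = (\<Sum>a\<in>cell_range b n. card (f w \<inter> B \<inter> cell n a))"
   by (rule card_eq_sum_cells[OF fin[OF w]]) (use b in auto)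
  then have "real (card (f w \<inter> B)) = (\<Sum>a\<in>cell_range b n. real (card (f w \<inter> B \<inter> cell n a)))" by simp
  also have "\<dots> = h n w" unfolding h_def
   by (intro sum.cong refl) (use w in \<open>simp add: card_cell_le_1[OF inj] H_def Int_assoc[symmetric] indicator_def\<close>)
  finally show "h n w = real (card (f w \<inter> B))" by simp
 qed
 have R: "(\<lambda>w. real (card (f w \<inter> B))) \<in> borel_measurable M"
  by (rule borel_measurable_LIMSEQ_real[OF lim hm])
 show ?thesis
 proof (subst measurable_count_space_eq_countable, simp, intro conjI ballI)
  fix j :: nat
  have "(\<lambda>w. card (f w \<inter> B)) -` {j} \<inter> space M = (\<lambda>w. real (card (f w \<inter> B))) -` {real j} \<inter> space M" by auto
  also have "\<dots> \<in> sets M" by (rule measurable_sets[OF R]) simp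
  finally show "(\<lambda>w. card (f w \<inter> B)) -` {j} \<inter> space M \<in> sets M" .
 qed simp
qed

lemma Conf_union:
 assumes "X \<in> Conf" "finite F" "F \<subseteq> Rstar" shows "X \<union> F \<in> Conf"
 using assms unfolding Conf_def by (auto simp: Int_Un_distrib2)

lemma tuples_range:
 assumes "q \<in> space (tuples m)" "i < m" shows "q i \<noteq> 0"
 using assms by (auto simp: space_PiM space_restrict_space PiE_iff)

text \<open>A union meets a set if one of its parts does, so its hitting events are measurable even though its counts
  are not sums when points coincide.\<close>

lemma union_measurable:
 "(\<lambda>(X, q). X \<union> q ` {..<m}) \<in> measurable (conf_algebra \<Otimes>\<^sub>M tuples m) conf_algebra"
proof (rule measurable_conf_algebraI)
 fix w assume w: "w \<in> space (conf_algebra \<Otimes>\<^sub>M tuples m)"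
 then show "(case w of (X, q) => X \<union> q ` {..<m}) \<in> Conf"
  using tuples_range by (auto simp: space_pair_measure intro!: Conf_union)
next
 fix B assume B: "B \<in> relcompact_borel"
 let ?f = "\<lambda>w. (case w of (X, q) => X \<union> q ` {..<m})"
 show "(\<lambda>w. card (?f w \<inter> B)) \<in> measurable (conf_algebra \<Otimes>\<^sub>M tuples m) (count_space UNIV)"
 proof (rule count_measurable_from_hits[OF B])
  fix w assume w: "w \<in> space (conf_algebra \<Otimes>\<^sub>M tuples m)"
  then have "?f w \<in> Conf" using tuples_range by (auto simp: space_pair_measure intro!: Conf_union)
  then show "finite (?f w \<inter> B)" by (rule Conf_finite[OF _ B])
 next
  fix D assume D: "D \<in> sets (borel :: real measure)" "D \<subseteq> B"
  have DR: "D \<in> relcompact_borel" by (rule relcompact_borel_subset[OF B D(2,1)])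
  have "{w \<in> space (conf_algebra \<Otimes>\<^sub>M tuples m). ?f w \<inter> D \<noteq> {}} =
    ({w \<in> space (conf_algebra \<Otimes>\<^sub>M tuples m). card (fst w \<inter> D) \<noteq> 0} \<union>
     (\<Union>i<m. {w \<in> space (conf_algebra \<Otimes>\<^sub>M tuples m). snd w i \<in> D}))"
  proof -
   have "card (fst w \<inter> D) \<noteq> 0 \<longleftrightarrow> fst w \<inter> D \<noteq> {}" if "w \<in> space (conf_algebra \<Otimes>\<^sub>M tuples m)" for w
    using that Conf_finite[OF _ DR, of "fst w"] by (auto simp: space_pair_measure card_eq_0_iff)
   note h = this
   have "?f w \<inter> D \<noteq> {} \<longleftrightarrow> fst w \<inter> D \<noteq> {} \<or> (\<exists>i<m. snd w i \<in> D)" for w by (auto split: prod.splits)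
   then show ?thesis using h by (simp only: set_eq_iff Un_iff UN_iff mem_Collect_eq lessThan_iff) blast
  qed
  also have "\<dots> \<in> sets (conf_algebra \<Otimes>\<^sub>M tuples m)"
  proof (intro sets.Un sets.finite_UN)
   have "(\<lambda>w. card (fst w \<inter> D)) \<in> measurable (conf_algebra \<Otimes>\<^sub>M tuples m) (count_space UNIV)"
    by (rule measurable_compose[OF measurable_fst count_measurable[OF DR]])
   from measurable_sets[OF this, of "- {0}"]
   show "{w \<in> space (conf_algebra \<Otimes>\<^sub>M tuples m). card (fst w \<inter> D) \<noteq> 0} \<in> sets (conf_algebra \<Otimes>\<^sub>M tuples m)"
    by (simp add: vimage_def Int_def conj_commute)
   fix i assume i: "i \<in> {..<m}"
   have "(\<lambda>w. snd w i) \<in> measurable (conf_algebra \<Otimes>\<^sub>M tuples m) (restrict_space borel Rstar)"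
    by (rule measurable_compose[OF measurable_snd measurable_component_singleton[OF i]])
   then have "(\<lambda>w. snd w i) \<in> measurable (conf_algebra \<Otimes>\<^sub>M tuples m) borel"
    unfolding measurable_restrict_space2_iff by (rule conjunct1)
   from measurable_sets[OF this D(1)]
   show "{w \<in> space (conf_algebra \<Otimes>\<^sub>M tuples m). snd w i \<in> D} \<in> sets (conf_algebra \<Otimes>\<^sub>M tuples m)"
    by (simp add: vimage_def Int_def conj_commute)
  qed simp
  finally show "{w \<in> space (conf_algebra \<Otimes>\<^sub>M tuples m). ?f w \<inter> D \<noteq> {}} \<in> sets (conf_algebra \<Otimes>\<^sub>M tuples m)" .
 qed
qed

section \<open>The coupling measure of a kernel\<close>

lemma lessThan_2: "{..<2::nat} = {0, 1}" by auto

lemma sigma_finite_tuples: "product_sigma_finite (\<lambda>_::nat. restrict_space lborel Rstar)"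
 unfolding product_sigma_finite_def
 by (intro allI sigma_finite_measure_restrict_space lborel.sigma_finite_measure_axioms) simp

lemma sets_lebesgue_tuples: "sets (lebesgue_tuples m) = sets (tuples m)"
 by (intro sets_PiM_cong refl sets_restrict_space_cong) simp

lemma space_lebesgue_tuples: "space (lebesgue_tuples m) = {..<m} \<rightarrow>\<^sub>E Rstar"
 by (simp add: space_PiM space_restrict_space)

lemma nn_integral_tuples_1:
 assumes [measurable]: "f \<in> borel_measurable borel" and z: "f 0 = 0"
 shows "(\<integral>\<^sup>+p. f (p 0) \<partial>lebesgue_tuples 1) = (\<integral>\<^sup>+x. f x \<partial>lborel)"
proof -
 interpret product_sigma_finite "\<lambda>_::nat. restrict_space lborel Rstar" by (rule sigma_finite_tuples)
 have "(\<integral>\<^sup>+p. f (p 0) \<partial>Pi\<^sub>M {0::nat} (\<lambda>_. restrict_space lborel Rstar)) = (\<integral>\<^sup>+x. f x \<partial>restrict_space lborel Rstar)"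
  by (rule product_nn_integral_singleton) (simp add: measurable_restrict_space1)
 also have "\<dots> = (\<integral>\<^sup>+x. f x * indicator Rstar x \<partial>lborel)" by (rule nn_integral_restrict_space) simp
 also have "\<dots> = (\<integral>\<^sup>+x. f x \<partial>lborel)" by (intro nn_integral_cong) (use z in \<open>auto simp: indicator_def\<close>)
 finally show ?thesis by (simp add: lessThan_Suc)
qed

lemma nn_integral_tuples_2:
 assumes f [measurable]: "(\<lambda>z. f (fst z) (snd z)) \<in> borel_measurable (borel \<Otimes>\<^sub>M borel)"
  and z: "\<And>x. f x 0 = 0" "\<And>y. f 0 y = 0"
 shows "(\<integral>\<^sup>+p. f (p 0) (p 1) \<partial>lebesgue_tuples 2) = (\<integral>\<^sup>+x. \<integral>\<^sup>+y. f x y \<partial>lborel \<partial>lborel)"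
proof -
 interpret product_sigma_finite "\<lambda>_::nat. restrict_space lborel Rstar" by (rule sigma_finite_tuples)
 have sf: "sigma_finite_measure (restrict_space lborel Rstar)"
  by (rule sigma_finite_measure_restrict_space[OF lborel.sigma_finite_measure_axioms]) simp
 let ?R = "restrict_space lborel Rstar"
 have z0: "f 0 = (\<lambda>_. 0)" using z(2) by auto
 have id: "(\<lambda>x. x) \<in> measurable ?R borel" by (rule measurable_restrict_space1) simp
 have "(\<lambda>z. (fst z, snd z)) \<in> measurable (?R \<Otimes>\<^sub>M ?R) (borel \<Otimes>\<^sub>M borel)"
  by (intro measurable_Pair measurable_compose[OF measurable_fst id] measurable_compose[OF measurable_snd id])
 from measurable_compose[OF this f]
 have fm: "case_prod f \<in> borel_measurable (?R \<Otimes>\<^sub>M ?R)" by (simp add: case_prod_beta')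
 have "(\<integral>\<^sup>+p. f (p 0) (p 1) \<partial>Pi\<^sub>M {0::nat, 1} (\<lambda>_. ?R)) = (\<integral>\<^sup>+z. f (fst z) (snd z) \<partial>(?R \<Otimes>\<^sub>M ?R))"
  by (rule product_nn_integral_pair[OF fm]) simp
 also have "\<dots> = (\<integral>\<^sup>+x. \<integral>\<^sup>+y. f x y \<partial>?R \<partial>?R)"
  using sigma_finite_measure.nn_integral_fst[OF sf fm] by (simp add: case_prod_beta')
 also have "\<dots> = (\<integral>\<^sup>+x. \<integral>\<^sup>+y. f x y \<partial>lborel \<partial>lborel)"
  by (subst nn_integral_restrict_space, simp, intro nn_integral_cong, subst nn_integral_restrict_space, simp)
   (use z z0 in \<open>auto simp: indicator_def intro!: nn_integral_cong\<close>)
 finally show ?thesis by (simp only: lessThan_2)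
qed

lemma kernel_det_1: "kernel_det K 1 p = K (p 0) (p 0)"
 unfolding kernel_det_def by (subst det_single) auto

lemma kernel_det_2: "kernel_det K 2 p = K (p 0) (p 0) * K (p 1) (p 1) - K (p 0) (p 1) * K (p 1) (p 0)"
proof -
 define A where "A = Matrix.mat 2 2 (\<lambda>(i, j). K (p i) (p j))"
 have A: "A \<in> carrier_mat 2 2" by (simp add: A_def)
 have d: "Determinant.det (mat_delete A i 0) = K (p (1 - i)) (p 1)" if "i < 2" for i
  by (subst det_single) (use that in \<open>auto simp: A_def mat_delete_def less_2_cases_iff\<close>)
 have "Determinant.det A = (\<Sum>i<2. index_mat A (i, 0) * cofactor A i 0)"
  by (rule laplace_expansion_column[OF A]) simp
 also have "\<dots> = K (p 0) (p 0) * K (p 1) (p 1) - K (p 0) (p 1) * K (p 1) (p 0)"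
 proof -
  have "index_mat A (0, 0) = K (p 0) (p 0)" "index_mat A (1, 0) = K (p 1) (p 0)" by (simp_all add: A_def)
  then show ?thesis unfolding lessThan_2 by (simp add: cofactor_def d[of 0, simplified] d[of 1, simplified] mult.commute)
 qed
 finally show ?thesis by (simp add: kernel_det_def A_def)
qed

text \<open>These properties are all that the screening of charges uses. The values of \<open>k\<close> on the diagonal
  belong to the assumptions, so the determinants need no exceptional sets.\<close>

locale charge_kernel =
 fixes K :: "real => real => complex" and k :: "real => real => real" and C :: real
 assumes K_eq: "\<And>x y. x \<noteq> 0 ==> y \<noteq> 0 ==> K x y = of_real (sgn y * k x y)"
  and k_sym: "\<And>x y. k x y = k y x"
  and k_measurable: "(\<lambda>z. k (fst z) (snd z)) \<in> borel_measurable (borel \<Otimes>\<^sub>M borel)"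
  and k_bound: "\<And>x y. x \<noteq> 0 ==> y \<noteq> 0 ==> \<bar>k x y\<bar> \<le> C / max \<bar>x\<bar> \<bar>y\<bar>"
  and diagonal_integrable: "\<And>x. x \<noteq> 0 ==> integrable lborel (\<lambda>s. (k x s)^2)"
  and diagonal: "\<And>x. x \<noteq> 0 ==> lint (\<lambda>s. (k x s)^2) = sgn x * k x x"
begin

declare k_measurable [measurable]

lemma k_measurable1 [measurable]: "(\<lambda>y. k x y) \<in> borel_measurable borel"
proof -
 have "(\<lambda>y. (x, y)) \<in> measurable borel (borel \<Otimes>\<^sub>M borel)" by simp
 from measurable_compose[OF this k_measurable] show ?thesis by simp
qed

lemma k_measurable_diag [measurable]: "(\<lambda>x. k x x) \<in> borel_measurable borel"
proof -
 have "(\<lambda>y::real. (y, y)) \<in> measurable borel (borel \<Otimes>\<^sub>M borel)" by simp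
 from measurable_compose[OF this k_measurable] show ?thesis by simp
qed

definition diag :: "real => real" where "diag x = sgn x * k x x"

lemma sgn_measurable [measurable]: "(sgn :: real => real) \<in> borel_measurable borel"
 unfolding sgn_if[abs_def] by measurable

lemma diag_measurable [measurable]: "diag \<in> borel_measurable borel" unfolding diag_def by measurable

lemma diag_nonneg: assumes "x \<noteq> 0" shows "diag x \<ge> 0"
 unfolding diag_def diagonal[OF assms, symmetric] by (rule integral_nonneg_AE) simp

lemma diag_nn_integral: assumes "x \<noteq> 0" shows "(\<integral>\<^sup>+s. ennreal ((k x s)^2) \<partial>lborel) = ennreal (diag x)"
 unfolding diag_def diagonal[OF assms, symmetric] by (rule nn_integral_eq_integral[OF diagonal_integrable[OF assms]]) simp

lemma C_nonneg: "C \<ge> 0"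
 using order_trans[OF abs_ge_zero k_bound[of 1 1]] by simp

lemma sets_lborel2: "sets (lborel \<Otimes>\<^sub>M lborel) = sets (borel \<Otimes>\<^sub>M (borel :: real measure))"
 by (intro sets_pair_measure_cong) simp_all

lemma measurable_lborel2:
 fixes f :: "real \<times> real => _"
 assumes "f \<in> measurable (borel \<Otimes>\<^sub>M borel) N" shows "f \<in> measurable (lborel \<Otimes>\<^sub>M lborel) N"
 using assms by (simp only: measurable_cong_sets[OF sets_lborel2 refl])

text \<open>The measure with density \<open>k\<^sup>2\<close> on the plane. As a measure it makes the additivity in both
  sets immediate.\<close>

definition J :: "(real \<times> real) measure" where
 "J = density (lborel \<Otimes>\<^sub>M lborel) (\<lambda>z. ennreal ((k (fst z) (snd z))^2))"

lemma sets_J [simp]: "sets J = sets (borel \<Otimes>\<^sub>M borel)"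
 unfolding J_def sets_density by (rule sets_lborel2)

lemma emeasure_J:
 assumes [measurable]: "A \<in> sets borel" "B \<in> sets borel"
 shows "emeasure J (A \<times> B) = (\<integral>\<^sup>+x. \<integral>\<^sup>+y. ennreal ((k x y)^2) * indicator A x * indicator B y \<partial>lborel \<partial>lborel)"
proof -
 have m: "(\<lambda>z. ennreal ((k (fst z) (snd z))^2)) \<in> borel_measurable (lborel \<Otimes>\<^sub>M lborel)"
  by (rule measurable_lborel2) measurable
 have AB: "A \<times> B \<in> sets (lborel \<Otimes>\<^sub>M lborel)" by (intro pair_measureI) simp_all
 have "emeasure J (A \<times> B) = (\<integral>\<^sup>+z. ennreal ((k (fst z) (snd z))^2) * indicator (A \<times> B) z \<partial>(lborel \<Otimes>\<^sub>M lborel))"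
  unfolding J_def by (rule emeasure_density[OF m AB])
 also have "\<dots> = (\<integral>\<^sup>+x. \<integral>\<^sup>+y. ennreal ((k (fst (x, y)) (snd (x, y)))^2) * indicator (A \<times> B) (x, y) \<partial>lborel \<partial>lborel)"
  by (rule lborel.nn_integral_fst[symmetric]) (intro borel_measurable_times_ennreal m borel_measurable_indicator AB)
 finally show ?thesis by (simp add: indicator_times mult.assoc)
qed

lemma emeasure_J_UNIV:
 assumes A [measurable]: "A \<in> sets borel" and "A \<subseteq> Rstar"
 shows "emeasure J (A \<times> UNIV) = (\<integral>\<^sup>+x. ennreal (diag x) * indicator A x \<partial>lborel)"
proof -
 have "emeasure J (A \<times> UNIV) = (\<integral>\<^sup>+x. \<integral>\<^sup>+y. ennreal ((k x y)^2) * indicator A x \<partial>lborel \<partial>lborel)"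
  by (subst emeasure_J) simp_all
 also have "\<dots> = (\<integral>\<^sup>+x. ennreal (diag x) * indicator A x \<partial>lborel)"
 proof (rule nn_integral_cong)
  fix x
  show "(\<integral>\<^sup>+y. ennreal ((k x y)^2) * indicator A x \<partial>lborel) = ennreal (diag x) * indicator A x"
   using assms(2) diag_nn_integral[of x] by (subst nn_integral_multc) (auto simp: indicator_def)
 qed
 finally show ?thesis .
qed

lemma diag_bound: assumes "x \<noteq> 0" shows "diag x \<le> C / \<bar>x\<bar>"
 unfolding diag_def using k_bound[OF assms assms] assms by (cases "x > 0") auto

lemma J_UNIV_finite:
 assumes D: "D \<in> relcompact_borel" shows "emeasure J (D \<times> UNIV) < \<infinity>"
proof -
 note d = relcompact_borelD[OF D]
 obtain ep b where b: "ep > 0" "\<forall>x\<in>D. ep \<le> \<bar>x\<bar> \<and> \<bar>x\<bar> \<le> real b" using relcompact_borel_bounds[OF D] by auto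
 have "emeasure J (D \<times> UNIV) \<le> (\<integral>\<^sup>+x. ennreal (C / ep) * indicator D x \<partial>lborel)"
  unfolding emeasure_J_UNIV[OF d(1,4)]
 proof (intro nn_integral_mono)
  fix x
  show "ennreal (diag x) * indicator D x \<le> ennreal (C / ep) * indicator D x"
  proof (cases "x \<in> D")
   case True
   then have "x \<noteq> 0" "ep \<le> \<bar>x\<bar>" using b d(4) by auto
   then have "diag x \<le> C / ep" using diag_bound[of x] divide_left_mono[of ep "\<bar>x\<bar>" C] C_nonneg b(1) by fastforce
   then show ?thesis by (simp add: ennreal_leI mult_right_mono)
  qed simp
 qed
 also have "\<dots> = ennreal (C / ep) * emeasure lborel D" using d(1) by (simp add: nn_integral_cmult_indicator)
 also have "\<dots> < \<infinity>"
 proof -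
  have "bounded D" by (rule boundedI[of _ "real b"]) (use b in auto)
  then have "emeasure lborel D < \<infinity>" by (rule emeasure_bounded_finite)
  then show ?thesis by (simp add: ennreal_mult_less_top)
 qed
 finally show ?thesis .
qed

lemma J_finite:
 assumes D: "D \<in> relcompact_borel" and E [measurable]: "E \<in> sets borel" shows "emeasure J (D \<times> E) < \<infinity>"
proof -
 note d = relcompact_borelD[OF D]
 have "emeasure J (D \<times> E) \<le> emeasure J (D \<times> UNIV)"
  by (rule emeasure_mono) (use d(1) in auto)
 then show ?thesis using J_UNIV_finite[OF D] by (rule le_less_trans)
qed

lemma J_union2:
 assumes D: "D \<in> relcompact_borel" and E: "E1 \<in> sets borel" "E2 \<in> sets borel" "E1 \<inter> E2 = {}"
 shows "measure J (D \<times> (E1 \<union> E2)) = measure J (D \<times> E1) + measure J (D \<times> E2)"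
proof -
 note d = relcompact_borelD[OF D]
 have "measure J ((D \<times> E1) \<union> (D \<times> E2)) = measure J (D \<times> E1) + measure J (D \<times> E2)"
  by (rule measure_Union) (use d(1) E J_finite[OF D E(1)] J_finite[OF D E(2)] in \<open>auto simp: less_top\<close>)
 then show ?thesis by (simp add: Sigma_Un_distrib2)
qed

lemma J_union1:
 assumes D: "D1 \<in> relcompact_borel" "D2 \<in> relcompact_borel" "D1 \<inter> D2 = {}" and E: "E \<in> sets borel"
 shows "measure J ((D1 \<union> D2) \<times> E) = measure J (D1 \<times> E) + measure J (D2 \<times> E)"
proof -
 have "measure J ((D1 \<times> E) \<union> (D2 \<times> E)) = measure J (D1 \<times> E) + measure J (D2 \<times> E)"
  by (rule measure_Union) (use relcompact_borelD(1)[OF D(1)] relcompact_borelD(1)[OF D(2)] D(3) E J_finite[OF D(1) E] J_finite[OF D(2) E] in \<open>auto simp: less_top\<close>)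
 then show ?thesis by (simp add: Sigma_Un_distrib1)
qed

lemma J_sym:
 assumes [measurable]: "A \<in> sets borel" "B \<in> sets borel"
 shows "emeasure J (A \<times> B) = emeasure J (B \<times> A)"
proof -
 have m: "(\<lambda>(x, y). ennreal ((k x y)^2) * indicator A x * indicator B y) \<in> borel_measurable (lborel \<Otimes>\<^sub>M lborel)"
  by (rule measurable_lborel2) measurable
 have "emeasure J (A \<times> B) = (\<integral>\<^sup>+y. \<integral>\<^sup>+x. ennreal ((k x y)^2) * indicator A x * indicator B y \<partial>lborel \<partial>lborel)"
  unfolding emeasure_J[OF assms] by (rule lborel_pair.Fubini'[OF m, symmetric])
 also have "\<dots> = emeasure J (B \<times> A)" unfolding emeasure_J[OF assms(2,1)]
  by (intro nn_integral_cong) (simp add: k_sym mult_ac)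
 finally show ?thesis .
qed

lemma nn_integral_inverse_square:
 fixes c B :: real
 assumes c: "c > 0" and B: "B \<ge> 0"
 shows "(\<integral>\<^sup>+y. ennreal (B / y^2) * indicator {y. c \<le> \<bar>y\<bar>} y \<partial>lborel) \<le> ennreal (2 * B / c)"
proof -
 have 1: "(\<integral>\<^sup>+y. ennreal (B / y^2) * indicator {c..} y \<partial>lborel) = ennreal (0 - (- B / c))"
 proof (rule nn_integral_FTC_atLeast)
  fix x :: real assume "c \<le> x"
  then have "x \<noteq> 0" using c by simp
  then show "((\<lambda>x. - B / x) has_real_derivative B / x^2) (at x)"
   by (auto intro!: derivative_eq_intros simp: power2_eq_square)
  show "0 \<le> B / x^2" using B by simp
 next
  show "((\<lambda>x. - B / x) \<longlongrightarrow> 0) at_top" by real_asymp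
 qed simp
 have 2: "(\<integral>\<^sup>+y. ennreal (B / y^2) * indicator {..-c} y \<partial>lborel) = ennreal (0 - (- B / c))"
  unfolding 1[symmetric] by (subst nn_integral_real_affine[of _ "-1" 0]) (auto simp: indicator_def intro!: nn_integral_cong)
 have "(\<integral>\<^sup>+y. ennreal (B / y^2) * indicator {y. c \<le> \<bar>y\<bar>} y \<partial>lborel) \<le>
   (\<integral>\<^sup>+y. ennreal (B / y^2) * indicator {c..} y + ennreal (B / y^2) * indicator {..-c} y \<partial>lborel)"
  by (intro nn_integral_mono) (auto simp: indicator_def)
 also have "\<dots> = ennreal (B / c) + ennreal (B / c)" by (subst nn_integral_add) (simp_all add: 1 2)
 also have "\<dots> = ennreal (2 * B / c)" using B c by (simp flip: ennreal_plus)
 finally show ?thesis .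
qed

text \<open>The kernel decays like the reciprocal of the larger argument, so distant scales decouple.\<close>

lemma J_far:
 assumes "0 < b" "0 < c"
 shows "emeasure J ({x. \<bar>x\<bar> < b} \<times> {y. c \<le> \<bar>y\<bar>}) \<le> ennreal (4 * C^2 * b / c)"
proof -
 have [measurable]: "{y::real. c \<le> \<bar>y\<bar>} \<in> sets borel" "{x::real. \<bar>x\<bar> < b} \<in> sets borel" by measurable
 have "emeasure J ({x. \<bar>x\<bar> < b} \<times> {y. c \<le> \<bar>y\<bar>}) =
   (\<integral>\<^sup>+x. \<integral>\<^sup>+y. ennreal ((k x y)^2) * indicator {x. \<bar>x\<bar> < b} x * indicator {y. c \<le> \<bar>y\<bar>} y \<partial>lborel \<partial>lborel)"
  by (rule emeasure_J) measurable
 also have "\<dots> \<le> (\<integral>\<^sup>+x. ennreal (2 * C^2 / c) * indicator {- b..b} x \<partial>lborel)"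
 proof (rule nn_integral_mono_AE, rule AE_mp[OF AE_lborel_singleton[of 0]], rule AE_I2, rule impI)
  fix x :: real assume x: "x \<noteq> 0"
  show "(\<integral>\<^sup>+y. ennreal ((k x y)^2) * indicator {x. \<bar>x\<bar> < b} x * indicator {y. c \<le> \<bar>y\<bar>} y \<partial>lborel)
    \<le> ennreal (2 * C^2 / c) * indicator {- b..b} x"
  proof (cases "\<bar>x\<bar> < b")
   case True
   have "(\<integral>\<^sup>+y. ennreal ((k x y)^2) * indicator {x. \<bar>x\<bar> < b} x * indicator {y. c \<le> \<bar>y\<bar>} y \<partial>lborel)
    \<le> (\<integral>\<^sup>+y. ennreal (C^2 / y^2) * indicator {y. c \<le> \<bar>y\<bar>} y \<partial>lborel)"
   proof (rule nn_integral_mono)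
    fix y
    show "ennreal ((k x y)^2) * indicator {x. \<bar>x\<bar> < b} x * indicator {y. c \<le> \<bar>y\<bar>} y \<le> ennreal (C^2 / y^2) * indicator {y. c \<le> \<bar>y\<bar>} y"
    proof (cases "c \<le> \<bar>y\<bar>")
     case c: True
     then have y: "y \<noteq> 0" using assms by auto
     have "C / max \<bar>x\<bar> \<bar>y\<bar> \<le> C / \<bar>y\<bar>" by (rule frac_le) (use C_nonneg y in auto)
     then have "\<bar>k x y\<bar> \<le> C / \<bar>y\<bar>" using k_bound[OF x y] by linarith
     then have "\<bar>k x y\<bar>\<^sup>2 \<le> (C / \<bar>y\<bar>)^2" by (rule power_mono) simp
     then have "(k x y)^2 \<le> C^2 / y^2" by (simp add: power_divide)
     then show ?thesis using c True by (simp add: ennreal_leI)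
    qed simp
   qed
   also have "\<dots> \<le> ennreal (2 * C^2 / c)" by (rule nn_integral_inverse_square[OF assms(2)]) simp
   finally show ?thesis using True by (simp add: abs_less_iff less_imp_le)
  qed simp
 qed
 also have "\<dots> = ennreal (2 * C^2 / c) * ennreal (2 * b)" using assms(1) by (subst nn_integral_cmult_indicator) simp_all
 also have "\<dots> = ennreal (4 * C^2 * b / c)" using assms by (simp flip: ennreal_mult)
 finally show ?thesis .
qed

definition annulus :: "nat => real set" where
 "annulus j = {x. 1 / 2 ^ j \<le> \<bar>x\<bar> \<and> \<bar>x\<bar> < 2 ^ j}"

lemma annulus_borel [measurable]: "annulus j \<in> sets borel" unfolding annulus_def by measurable

lemma annulus_relcompact: "annulus j \<in> relcompact_borel"
 by (rule relcompact_borel_annulus[of _ "1 / 2 ^ j" "2 ^ j"]) (auto simp: annulus_def)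

text \<open>A point outside the larger annulus is either farther from 0 by the ratio of scales or closer by the same
  ratio; by symmetry both cases are \<open>J_far\<close>.\<close>

lemma J_annulus:
 assumes ij: "i \<le> j"
 shows "measure J (annulus i \<times> (- annulus j)) \<le> 8 * C^2 * (1/2) ^ (j - i)"
proof -
 let ?L = "\<lambda>b::real. {x::real. \<bar>x\<bar> < b}" and ?G = "\<lambda>c::real. {x::real. c \<le> \<bar>x\<bar>}"
 have m: "?L b \<in> sets borel" "?G c \<in> sets borel" for b c by measurable
 have s: "annulus i \<times> (- annulus j) \<subseteq> (?L (2 ^ i) \<times> ?G (2 ^ j)) \<union> (?G (1 / 2 ^ i) \<times> ?L (1 / 2 ^ j))"
  by (auto simp: annulus_def)
 have "emeasure J (annulus i \<times> (- annulus j)) \<le> emeasure J ((?L (2 ^ i) \<times> ?G (2 ^ j)) \<union> (?G (1 / 2 ^ i) \<times> ?L (1 / 2 ^ j)))"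
  by (rule emeasure_mono[OF s]) (use m in \<open>auto intro!: pair_measureI\<close>)
 also have "\<dots> \<le> emeasure J (?L (2 ^ i) \<times> ?G (2 ^ j)) + emeasure J (?G (1 / 2 ^ i) \<times> ?L (1 / 2 ^ j))"
  by (rule emeasure_subadditive) (use m in \<open>auto intro!: pair_measureI\<close>)
 also have "emeasure J (?G (1 / 2 ^ i) \<times> ?L (1 / 2 ^ j)) = emeasure J (?L (1 / 2 ^ j) \<times> ?G (1 / 2 ^ i))"
  by (rule J_sym[OF m(2,1)])
 also have "emeasure J (?L (2 ^ i) \<times> ?G (2 ^ j)) + emeasure J (?L (1 / 2 ^ j) \<times> ?G (1 / 2 ^ i)) \<le>
   ennreal (4 * C^2 * 2 ^ i / 2 ^ j) + ennreal (4 * C^2 * (1 / 2 ^ j) / (1 / 2 ^ i))"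
  by (intro add_mono J_far) simp_all
 also have "\<dots> = ennreal (8 * C^2 * (1/2) ^ (j - i))"
 proof -
  have "(2::real) ^ j = 2 ^ (j - i) * 2 ^ i" using ij by (simp flip: power_add)
  then have "4 * C^2 * 2 ^ i / 2 ^ j = 4 * C^2 * (1/2) ^ (j - i)" "4 * C^2 * (1 / 2 ^ j) / (1 / 2 ^ i) = 4 * C^2 * (1/2) ^ (j - i)"
   by (simp_all add: power_one_over)
  then show ?thesis by (simp flip: ennreal_plus)
 qed
 finally show ?thesis unfolding measure_def by (intro enn2real_leI) simp_all
qed

end

section \<open>Correlation measures of the kernel\<close>

lemma box_in_tuples:
 assumes "\<And>i. i < m ==> D i \<in> sets borel" "\<And>i. i < m ==> D i \<subseteq> Rstar"
 shows "Pi\<^sub>E {..<m} D \<in> sets (lebesgue_tuples m)"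
 by (rule sets_PiM_I_finite) (use assms in \<open>auto simp: sets_restrict_space_iff\<close>)

lemma coordinate_measurable:
 assumes "i < m" shows "(\<lambda>p. p i) \<in> measurable (lebesgue_tuples m) borel"
proof -
 have "(\<lambda>p. p i) \<in> measurable (lebesgue_tuples m) (restrict_space lborel Rstar)"
  by (rule measurable_component_singleton) (use assms in simp)
 then have "(\<lambda>p. p i) \<in> measurable (lebesgue_tuples m) lborel"
  unfolding measurable_restrict_space2_iff by (rule conjunct1)
 then show ?thesis by simp
qed

lemma lebesgue_tuples_nonzero:
 assumes "p \<in> space (lebesgue_tuples m)" "i < m" shows "p i \<noteq> 0"
 using assms unfolding space_lebesgue_tuples by (auto simp: PiE_iff)

lemma integrable_from_nn_integral:
 fixes f :: "'a => real"
 assumes "f \<in> borel_measurable M" "\<And>x. f x \<ge> 0" "(\<integral>\<^sup>+x. ennreal (f x) \<partial>M) \<le> ennreal c" "c \<ge> 0"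
 shows "integrable M f" "integral\<^sup>L M f \<le> c"
proof -
 have "(\<integral>\<^sup>+x. ennreal (f x) \<partial>M) < \<infinity>" using assms(3) by (rule le_less_trans) simp
 then show i: "integrable M f" using assms(1,2) by (intro integrableI_nonneg) auto
 have "ennreal (integral\<^sup>L M f) \<le> ennreal c" using nn_integral_eq_integral[OF i] assms(2,3) by simp
 then show "integral\<^sup>L M f \<le> c" using assms(4) by (simp add: ennreal_le_iff)
qed

context charge_kernel
begin

lemma kernel_det_expand:
 assumes "p \<in> space (lebesgue_tuples m)"
 shows "kernel_det K m p = (\<Sum>\<pi> | \<pi> permutes {0..<m}. signof \<pi> * (\<Prod>i=0..<m. of_real (sgn (p (\<pi> i)) * k (p i) (p (\<pi> i)))))"
proof -
 have "kernel_det K m p = (\<Sum>\<pi> | \<pi> permutes {0..<m}. signof \<pi> * (\<Prod>i=0..<m. index_mat (Matrix.mat m m (\<lambda>(i, j). K (p i) (p j))) (i, \<pi> i)))"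
  unfolding kernel_det_def by (rule det_def') simp
 also have "\<dots> = (\<Sum>\<pi> | \<pi> permutes {0..<m}. signof \<pi> * (\<Prod>i=0..<m. of_real (sgn (p (\<pi> i)) * k (p i) (p (\<pi> i)))))"
 proof (intro sum.cong refl arg_cong2[of _ _ _ _ "(*)"] prod.cong)
  fix \<pi> i assume "\<pi> \<in> {\<pi>. \<pi> permutes {0..<m}}" "i \<in> {0..<m}"
  then have i: "i < m" "\<pi> i < m" using permutes_in_image[of \<pi> "{0..<m}" i] by auto
  then show "index_mat (Matrix.mat m m (\<lambda>(i, j). K (p i) (p j))) (i, \<pi> i) = of_real (sgn (p (\<pi> i)) * k (p i) (p (\<pi> i)))"
   using lebesgue_tuples_nonzero[OF assms] by (simp add: K_eq)
 qed
 finally show ?thesis .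
qed

lemma kernel_det_measurable: "(\<lambda>p. ennreal (Re (kernel_det K m p))) \<in> borel_measurable (lebesgue_tuples m)"
proof -
 have "(\<lambda>p. complex_of_real (sgn (p (\<pi> i)) * k (p i) (p (\<pi> i)))) \<in> borel_measurable (lebesgue_tuples m)"
  if "\<pi> permutes {0..<m}" "i \<in> {0..<m}" for \<pi> i
 proof -
  have i: "i < m" "\<pi> i < m" using that permutes_in_image[of \<pi> "{0..<m}" i] by auto
  note [measurable] = coordinate_measurable[OF i(1)] coordinate_measurable[OF i(2)]
  have "(\<lambda>p. (p i, p (\<pi> i))) \<in> measurable (lebesgue_tuples m) (borel \<Otimes>\<^sub>M borel)" by measurable
  from measurable_compose[OF this k_measurable]
  have [measurable]: "(\<lambda>p. k (p i) (p (\<pi> i))) \<in> borel_measurable (lebesgue_tuples m)" by simp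
  show ?thesis by measurable
 qed
 then have "(\<lambda>p. ennreal (Re (\<Sum>\<pi> | \<pi> permutes {0..<m}. signof \<pi> * (\<Prod>i=0..<m. complex_of_real (sgn (p (\<pi> i)) * k (p i) (p (\<pi> i)))))))
   \<in> borel_measurable (lebesgue_tuples m)"
  by (intro measurable_compose[OF _ measurable_ennreal] measurable_compose[OF _ borel_measurable_Re] borel_measurable_sum borel_measurable_times borel_measurable_const borel_measurable_prod) auto
 then show ?thesis by (rule measurable_cong[THEN iffD2, rotated]) (simp only: kernel_det_expand)
qed

text \<open>By the Leibniz expansion: on sets bounded away from 0 the entries are bounded.\<close>

lemma kernel_det_bound:
 assumes D: "\<And>i. i < m ==> D i \<in> relcompact_borel"
 shows "\<exists>c. \<forall>p\<in>Pi\<^sub>E {..<m} D. Re (kernel_det K m p) \<le> c"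
proof -
 have "\<exists>B. \<forall>i<m. \<forall>x\<in>D i. \<forall>y. y \<noteq> 0 \<longrightarrow> \<bar>k x y\<bar> \<le> B i" for dummy :: nat
 proof -
  have "\<exists>b. \<forall>x\<in>D i. \<forall>y. y \<noteq> 0 \<longrightarrow> \<bar>k x y\<bar> \<le> b" if i: "i < m" for i
  proof -
   obtain ep b where b: "ep > 0" "\<forall>x\<in>D i. ep \<le> \<bar>x\<bar> \<and> \<bar>x\<bar> \<le> real b" using relcompact_borel_bounds[OF D[OF i]] by auto
   have "\<bar>k x y\<bar> \<le> C / ep" if "x \<in> D i" "y \<noteq> 0" for x y
   proof -
    have e: "ep \<le> \<bar>x\<bar>" using b that by auto
    then have "x \<noteq> 0" using b(1) by auto
    then have "\<bar>k x y\<bar> \<le> C / max \<bar>x\<bar> \<bar>y\<bar>" by (rule k_bound[OF _ that(2)])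
    also have "\<dots> \<le> C / ep" by (rule frac_le) (use C_nonneg b(1) e in auto)
    finally show ?thesis .
   qed
   then show ?thesis by blast
  qed
  then have "\<forall>i. \<exists>b. i < m \<longrightarrow> (\<forall>x\<in>D i. \<forall>y. y \<noteq> 0 \<longrightarrow> \<bar>k x y\<bar> \<le> b)" by blast
  then show ?thesis by (simp only: choice_iff)
 qed
 then obtain B where B: "\<And>i x y. i < m ==> x \<in> D i ==> y \<noteq> 0 ==> \<bar>k x y\<bar> \<le> B i" by blast
 define c where "c = (\<Sum>\<pi> | \<pi> permutes {0..<m}. (\<Prod>i=0..<m. B i))"
 have "Re (kernel_det K m p) \<le> c" if p: "p \<in> Pi\<^sub>E {..<m} D" for p
 proof -
  have pD: "p i \<in> D i" if "i < m" for i using p that by (auto simp: PiE_iff)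
  have p0: "p i \<noteq> 0" if "i < m" for i using pD[OF that] relcompact_borelD(4)[OF D[OF that]] by auto
  have ps: "p \<in> space (lebesgue_tuples m)" unfolding space_lebesgue_tuples using p p0 by (auto simp: PiE_iff)
  have "Re (kernel_det K m p) \<le> norm (kernel_det K m p)" by (rule complex_Re_le_cmod)
  also have "\<dots> \<le> c" unfolding kernel_det_expand[OF ps] c_def
  proof (rule order_trans[OF norm_sum], rule sum_mono)
   fix \<pi> assume "\<pi> \<in> {\<pi>. \<pi> permutes {0..<m}}"
   then have pi: "\<pi> i < m" if "i < m" for i using permutes_in_image[of \<pi> "{0..<m}" i] that by auto
   have "norm (signof \<pi> * (\<Prod>i=0..<m. complex_of_real (sgn (p (\<pi> i)) * k (p i) (p (\<pi> i))))) = (\<Prod>i=0..<m. \<bar>sgn (p (\<pi> i)) * k (p i) (p (\<pi> i))\<bar>)"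
    by (simp add: norm_mult prod_norm[symmetric] sign_def del: of_real_mult)
   also have "\<dots> \<le> (\<Prod>i=0..<m. B i)"
    by (intro prod_mono conjI) (use pi p0 pD B in \<open>auto simp: abs_mult abs_sgn_eq\<close>)
   finally show "norm (signof \<pi> * (\<Prod>i=0..<m. complex_of_real (sgn (p (\<pi> i)) * k (p i) (p (\<pi> i))))) \<le> (\<Prod>i=0..<m. B i)" .
  qed
  finally show ?thesis .
 qed
 then show ?thesis by blast
qed

definition rho :: "nat => (nat => real) measure" where
 "rho m = density (lebesgue_tuples m) (\<lambda>p. ennreal (Re (kernel_det K m p)))"

lemma emeasure_rho_box:
 assumes "\<And>i. i < m ==> D i \<in> sets borel" "\<And>i. i < m ==> D i \<subseteq> Rstar"
 shows "emeasure (rho m) (Pi\<^sub>E {..<m} D) = (\<integral>\<^sup>+p. ennreal (Re (kernel_det K m p)) * indicator (Pi\<^sub>E {..<m} D) p \<partial>lebesgue_tuples m)"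
 unfolding rho_def by (rule emeasure_density[OF kernel_det_measurable box_in_tuples[OF assms]])

lemma Re_kernel_det_1: assumes "p \<in> space (lebesgue_tuples 1)" shows "Re (kernel_det K 1 p) = diag (p 0)"
 using lebesgue_tuples_nonzero[OF assms, of 0] unfolding kernel_det_1 by (simp add: K_eq diag_def)

lemma Re_kernel_det_2:
 assumes "p \<in> space (lebesgue_tuples 2)"
 shows "Re (kernel_det K 2 p) = diag (p 0) * diag (p 1) - sgn (p 0) * sgn (p 1) * (k (p 0) (p 1))^2"
proof -
 have nz: "p 0 \<noteq> 0" "p 1 \<noteq> 0" using lebesgue_tuples_nonzero[OF assms] by auto
 have "kernel_det K 2 p = of_real (diag (p 0) * diag (p 1) - sgn (p 0) * sgn (p 1) * (k (p 0) (p 1))^2)"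
  unfolding kernel_det_2 using nz k_sym[of "p 1" "p 0"] by (simp add: K_eq diag_def power2_eq_square)
 then show ?thesis by simp
qed

lemma emeasure_rho_1:
 assumes "D \<in> sets borel" "D \<subseteq> Rstar"
 shows "emeasure (rho 1) (Pi\<^sub>E {..<1} (\<lambda>_. D)) = emeasure J (D \<times> UNIV)"
proof -
 have "emeasure (rho 1) (Pi\<^sub>E {..<1} (\<lambda>_. D)) = (\<integral>\<^sup>+p. ennreal (diag (p 0)) * indicator D (p 0) \<partial>lebesgue_tuples 1)"
  unfolding emeasure_rho_box[of 1 "\<lambda>_. D", OF assms]
 proof (rule nn_integral_cong)
  fix p assume p: "p \<in> space (lebesgue_tuples 1)"
  have "p \<in> Pi\<^sub>E {..<1} (\<lambda>_. D) \<longleftrightarrow> p 0 \<in> D" using p unfolding space_lebesgue_tuples by (auto simp: PiE_iff)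
  then show "ennreal (Re (kernel_det K 1 p)) * indicator (Pi\<^sub>E {..<1} (\<lambda>_. D)) p = ennreal (diag (p 0)) * indicator D (p 0)"
   by (simp only: Re_kernel_det_1[OF p] indicator_def)
 qed
 also have "\<dots> = (\<integral>\<^sup>+x. ennreal (diag x) * indicator D x \<partial>lborel)"
  by (rule nn_integral_tuples_1) (use assms in \<open>auto simp: indicator_def\<close>)
 finally show ?thesis unfolding emeasure_J_UNIV[OF assms] .
qed

abbreviation box2 :: "real set => real set => (nat => real) set" where
 "box2 D E \<equiv> Pi\<^sub>E {..<2} (\<lambda>i. if i = 0 then D else E)"

lemma mem_box2:
 assumes "p \<in> space (lebesgue_tuples 2)" shows "p \<in> box2 D E \<longleftrightarrow> p 0 \<in> D \<and> p 1 \<in> E"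
 using assms unfolding space_lebesgue_tuples unfolding lessThan_2 by (auto simp: PiE_iff)

text \<open>On a pair of half-lines the product of signs is constant, so the second correlation is the product of
  intensities minus or plus \<open>k\<^sup>2\<close>.\<close>

lemma rho_box2:
 assumes D: "D \<in> sets borel" "D \<subseteq> Rstar" and E: "E \<in> sets borel" "E \<subseteq> Rstar"
  and pos: "AE p in lebesgue_tuples 2. Re (kernel_det K 2 p) \<ge> 0"
 shows "(\<And>x y. x \<in> D ==> y \<in> E ==> sgn x * sgn y = 1) ==>
   emeasure (rho 2) (box2 D E) + emeasure J (D \<times> E) = emeasure J (D \<times> UNIV) * emeasure J (E \<times> UNIV)"
  and "(\<And>x y. x \<in> D ==> y \<in> E ==> sgn x * sgn y = - 1) ==>
   emeasure (rho 2) (box2 D E) = emeasure J (D \<times> UNIV) * emeasure J (E \<times> UNIV) + emeasure J (D \<times> E)"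
proof -
 note [measurable] = D(1) E(1)
 define h where "h x y = ennreal ((k x y)^2) * indicator D x * indicator E y" for x y
 define g where "g x y = (ennreal (diag x) * indicator D x) * (ennreal (diag y) * indicator E y)" for x y
 have hm: "(\<lambda>z. h (fst z) (snd z)) \<in> borel_measurable (borel \<Otimes>\<^sub>M borel)" unfolding h_def by measurable
 have gm: "(\<lambda>z. g (fst z) (snd z)) \<in> borel_measurable (borel \<Otimes>\<^sub>M borel)" unfolding g_def by measurable
 have pm: "(\<lambda>p. (p 0, p 1)) \<in> measurable (lebesgue_tuples 2) (borel \<Otimes>\<^sub>M borel)"
  by (intro measurable_Pair coordinate_measurable) simp_all
 have hm': "(\<lambda>p. h (p 0) (p 1)) \<in> borel_measurable (lebesgue_tuples 2)" using measurable_compose[OF pm hm] by simp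
 have gm': "(\<lambda>p. g (p 0) (p 1)) \<in> borel_measurable (lebesgue_tuples 2)" using measurable_compose[OF pm gm] by simp
 have hJ: "(\<integral>\<^sup>+p. h (p 0) (p 1) \<partial>lebesgue_tuples 2) = emeasure J (D \<times> E)"
  unfolding emeasure_J[OF D(1) E(1)] h_def[symmetric]
  by (rule nn_integral_tuples_2[OF hm]) (use D E in \<open>auto simp: h_def indicator_def\<close>)
 have gJ: "(\<integral>\<^sup>+p. g (p 0) (p 1) \<partial>lebesgue_tuples 2) = emeasure J (D \<times> UNIV) * emeasure J (E \<times> UNIV)"
 proof -
  have "(\<integral>\<^sup>+p. g (p 0) (p 1) \<partial>lebesgue_tuples 2) = (\<integral>\<^sup>+x. \<integral>\<^sup>+y. g x y \<partial>lborel \<partial>lborel)"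
   by (rule nn_integral_tuples_2[OF gm]) (use D E in \<open>auto simp: g_def indicator_def\<close>)
  also have "\<dots> = (\<integral>\<^sup>+x. (ennreal (diag x) * indicator D x) * (\<integral>\<^sup>+y. ennreal (diag y) * indicator E y \<partial>lborel) \<partial>lborel)"
   unfolding g_def by (intro nn_integral_cong nn_integral_cmult) measurable
  also have "\<dots> = emeasure J (D \<times> UNIV) * emeasure J (E \<times> UNIV)"
   unfolding emeasure_J_UNIV[OF D] emeasure_J_UNIV[OF E] by (intro nn_integral_multc) measurable
  finally show ?thesis .
 qed
 have DE: "\<And>i. i < 2 ==> (if i = (0::nat) then D else E) \<in> sets borel" "\<And>i. i < 2 ==> (if i = (0::nat) then D else E) \<subseteq> Rstar"
  using D E by auto
 have R: "emeasure (rho 2) (box2 D E) = (\<integral>\<^sup>+p. ennreal (Re (kernel_det K 2 p)) * indicator (box2 D E) p \<partial>lebesgue_tuples 2)"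
  by (rule emeasure_rho_box) (use DE in auto)
 let ?r = "\<lambda>p. ennreal (Re (kernel_det K 2 p)) * indicator (box2 D E) p"
 have rm: "?r \<in> borel_measurable (lebesgue_tuples 2)"
  by (intro borel_measurable_times_ennreal kernel_det_measurable borel_measurable_indicator box_in_tuples DE)
 have gp: "g (p 0) (p 1) = ennreal (diag (p 0) * diag (p 1)) * indicator (box2 D E) p"
  and hp: "h (p 0) (p 1) = ennreal ((k (p 0) (p 1))^2) * indicator (box2 D E) p"
  if "p \<in> space (lebesgue_tuples 2)" for p
  using lebesgue_tuples_nonzero[OF that, of 0] lebesgue_tuples_nonzero[OF that, of 1] mem_box2[OF that, of D E]
  by (auto simp: g_def h_def indicator_def ennreal_mult diag_nonneg)
 show "emeasure (rho 2) (box2 D E) + emeasure J (D \<times> E) = emeasure J (D \<times> UNIV) * emeasure J (E \<times> UNIV)"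
  if s: "\<And>x y. x \<in> D ==> y \<in> E ==> sgn x * sgn y = 1"
 proof -
  have "(\<integral>\<^sup>+p. ?r p + h (p 0) (p 1) \<partial>lebesgue_tuples 2) = (\<integral>\<^sup>+p. g (p 0) (p 1) \<partial>lebesgue_tuples 2)"
  proof (rule nn_integral_cong_AE, rule AE_mp[OF pos], rule AE_I2, rule impI)
   fix p assume p: "p \<in> space (lebesgue_tuples 2)" and nn: "0 \<le> Re (kernel_det K 2 p)"
   show "?r p + h (p 0) (p 1) = g (p 0) (p 1)"
   proof (cases "p \<in> box2 D E")
    case True
    then have "sgn (p 0) * sgn (p 1) = 1" using mem_box2[OF p] s by blast
    then have "diag (p 0) * diag (p 1) = Re (kernel_det K 2 p) + (k (p 0) (p 1))^2" unfolding Re_kernel_det_2[OF p] by simp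
    then show ?thesis unfolding gp[OF p] hp[OF p] using True nn by (simp add: ennreal_plus)
   next
    case False
    then show ?thesis unfolding gp[OF p] hp[OF p] by simp
   qed
  qed
  then show ?thesis unfolding nn_integral_add[OF rm hm'] R hJ gJ .
 qed
 show "emeasure (rho 2) (box2 D E) = emeasure J (D \<times> UNIV) * emeasure J (E \<times> UNIV) + emeasure J (D \<times> E)"
  if s: "\<And>x y. x \<in> D ==> y \<in> E ==> sgn x * sgn y = - 1"
 proof -
  have "(\<integral>\<^sup>+p. ?r p \<partial>lebesgue_tuples 2) = (\<integral>\<^sup>+p. g (p 0) (p 1) + h (p 0) (p 1) \<partial>lebesgue_tuples 2)"
  proof (rule nn_integral_cong)
   fix p assume p: "p \<in> space (lebesgue_tuples 2)"
   show "?r p = g (p 0) (p 1) + h (p 0) (p 1)"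
   proof (cases "p \<in> box2 D E")
    case True
    then have "sgn (p 0) * sgn (p 1) = - 1" using mem_box2[OF p] s by blast
    then have "Re (kernel_det K 2 p) = diag (p 0) * diag (p 1) + (k (p 0) (p 1))^2" unfolding Re_kernel_det_2[OF p] by simp
    moreover have "diag (p 0) * diag (p 1) \<ge> 0" using lebesgue_tuples_nonzero[OF p] by (simp add: diag_nonneg)
    ultimately show ?thesis unfolding gp[OF p] hp[OF p] using True by (simp add: ennreal_plus)
   next
    case False
    then show ?thesis unfolding gp[OF p] hp[OF p] by simp
   qed
  qed
  then show ?thesis unfolding nn_integral_add[OF gm' hm'] R hJ gJ .
 qed
qed

end

section \<open>Second moments of counts\<close>

lemma sum_half_powers_le:
 assumes "finite A" "inj_on f A" shows "(\<Sum>j\<in>A. (1/2::real) ^ f j) \<le> 2"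
proof -
 have s: "(\<lambda>d. (1/2::real) ^ d) sums 2" using geometric_sums[of "1/2::real"] by simp
 have "(\<Sum>j\<in>A. (1/2::real) ^ f j) = (\<Sum>d\<in>f ` A. (1/2) ^ d)" by (subst sum.reindex[OF assms(2)]) simp
 also have "\<dots> \<le> (\<Sum>d. (1/2) ^ d)" by (rule sum_le_suminf) (use assms(1) s in \<open>auto simp: sums_iff\<close>)
 finally show ?thesis using s by (simp add: sums_iff)
qed

lemma sum_half_distance_le:
 "(\<Sum>j<n. (1/2::real) ^ (max i j - min i j)) \<le> 4"
proof -
 have "(\<Sum>j<n. (1/2::real) ^ (max i j - min i j)) = (\<Sum>j\<in>{..<n} \<inter> {..i}. (1/2::real) ^ (max i j - min i j)) + (\<Sum>j\<in>{..<n} - {..i}. (1/2::real) ^ (max i j - min i j))"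
  by (rule sum.Int_Diff) simp
 also have "\<dots> \<le> 2 + 2"
  by (intro add_mono sum_half_powers_le) (auto simp: inj_on_def max_def min_def)
 finally show ?thesis by simp
qed

locale charge_process = charge_kernel +
 fixes P :: "real set measure"
 assumes det: "determinantal P K"
begin

sublocale prob_space P using det by (simp add: determinantal_def point_process_def)

lemma sets_P: "sets P = sets conf_algebra" using det by (simp add: determinantal_def point_process_def)

lemma space_P: "space P = Conf" using sets_eq_imp_space_eq[OF sets_P] by simp

lemma det_nonneg: assumes "m \<ge> 1" shows "AE p in lebesgue_tuples m. kernel_det K m p \<in> \<real>\<^sub>\<ge>\<^sub>0"
 using det assms by (simp add: determinantal_def)

lemma correlation: assumes "m \<ge> 1" shows "correlation_measure P m (rho m)"
 using det assms by (simp add: determinantal_def rho_def)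

definition N :: "real set => real set => real" where "N D X = real (card (X \<inter> D))"

lemma N_nonneg: "N D X \<ge> 0" by (simp add: N_def)

lemma N_measurable: assumes "D \<in> relcompact_borel" shows "N D \<in> borel_measurable P"
proof -
 have "(\<lambda>X. card (X \<inter> D)) \<in> measurable P (count_space UNIV)"
  using count_measurable[OF assms] by (simp only: measurable_cong_sets[OF sets_P refl])
 from measurable_compose[OF this, of real borel] show ?thesis by (simp add: N_def[abs_def])
qed

lemma N_union:
 assumes "X \<in> Conf" "D \<in> relcompact_borel" "E \<in> relcompact_borel" "D \<inter> E = {}"
 shows "N (D \<union> E) X = N D X + N E X"
proof -
 have "card (X \<inter> D \<union> X \<inter> E) = card (X \<inter> D) + card (X \<inter> E)"
  by (rule card_Un_disjoint) (use Conf_finite assms in auto)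
 then show ?thesis by (simp add: N_def Int_Un_distrib)
qed

definition a :: "real set => real" where "a D = measure J (D \<times> UNIV)"

definition j :: "real set => real set => real" where "j D E = measure J (D \<times> E)"

lemma a_nonneg: "a D \<ge> 0" by (simp add: a_def)

lemma emeasure_a: assumes "D \<in> relcompact_borel" shows "emeasure J (D \<times> UNIV) = ennreal (a D)"
 unfolding a_def by (rule emeasure_eq_ennreal_measure) (use J_UNIV_finite[OF assms] in \<open>auto simp: less_top\<close>)

lemma emeasure_j: assumes "D \<in> relcompact_borel" "E \<in> sets borel" shows "emeasure J (D \<times> E) = ennreal (j D E)"
 unfolding j_def by (rule emeasure_eq_ennreal_measure) (use J_finite[OF assms] in \<open>auto simp: less_top\<close>)

lemma a_eq_j: assumes "D \<in> relcompact_borel" "E \<in> sets borel" shows "a D = j D E + j D (- E)"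
proof -
 have "a D = measure J (D \<times> (E \<union> - E))" by (simp add: a_def)
 also have "\<dots> = j D E + j D (- E)" unfolding j_def by (rule J_union2[OF assms(1)]) (use assms(2) in auto)
 finally show ?thesis .
qed

lemma correlation_box:
 fixes m :: nat
 assumes "m \<ge> 1" "\<And>i. i < m ==> D i \<in> relcompact_borel" "disjoint_family_on D {..<m}"
 shows "(\<integral>\<^sup>+X. (\<Prod>i<m. of_nat (card (X \<inter> D i))) \<partial>P) = emeasure (rho m) (Pi\<^sub>E {..<m} D)"
 using correlation[OF assms(1)] assms(2,3) unfolding correlation_measure_def by blast

lemma nn_integral_N: assumes D: "D \<in> relcompact_borel" shows "(\<integral>\<^sup>+X. ennreal (N D X) \<partial>P) = ennreal (a D)"
proof -
 have "(\<integral>\<^sup>+X. (\<Prod>i<(1::nat). of_nat (card (X \<inter> D))) \<partial>P) = emeasure (rho 1) (Pi\<^sub>E {..<1} (\<lambda>_. D))"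
  by (rule correlation_box) (use D in \<open>simp_all add: disjoint_family_on_def\<close>)
 then show ?thesis unfolding emeasure_rho_1[OF relcompact_borelD(1,4)[OF D]] emeasure_a[OF D]
  by (simp add: N_def ennreal_of_nat_eq_real_of_nat)
qed

lemma N_integrable: assumes D: "D \<in> relcompact_borel" shows "integrable P (N D)"
 by (rule integrable_from_nn_integral(1)[OF N_measurable[OF D] N_nonneg, of "a D"]) (simp_all add: nn_integral_N[OF D] a_nonneg)

lemma N_mean: assumes D: "D \<in> relcompact_borel" shows "expectation (N D) = a D"
 using nn_integral_N[OF D] nn_integral_eq_integral[OF N_integrable[OF D]] by (simp add: N_nonneg a_nonneg integral_nonneg_AE)

lemma nn_integral_NN:
 assumes D: "D \<in> relcompact_borel" "E \<in> relcompact_borel" "D \<inter> E = {}"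
 shows "(\<integral>\<^sup>+X. ennreal (N D X * N E X) \<partial>P) = emeasure (rho 2) (box2 D E)"
proof -
 have "(\<integral>\<^sup>+X. (\<Prod>i<(2::nat). of_nat (card (X \<inter> (if i = 0 then D else E)))) \<partial>P) = emeasure (rho 2) (box2 D E)"
  by (rule correlation_box) (use D in \<open>auto simp: disjoint_family_on_def less_2_cases_iff lessThan_2\<close>)
 moreover have "(\<Prod>i<(2::nat). of_nat (card (X \<inter> (if i = 0 then D else E)))) = ennreal (N D X * N E X)" for X
  unfolding lessThan_2 by (simp add: N_def ennreal_of_nat_eq_real_of_nat ennreal_mult)
 ultimately show ?thesis by simp
qed

lemma Re_det_2_nonneg: "AE p in lebesgue_tuples 2. Re (kernel_det K 2 p) \<ge> 0"
proof -
 have "AE p in lebesgue_tuples 2. kernel_det K 2 p \<in> \<real>\<^sub>\<ge>\<^sub>0" by (rule det_nonneg) simp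
 then show ?thesis by (rule AE_mp) (rule AE_I2, simp add: complex_nonneg_Reals_iff)
qed

lemma rho_box2_real:
 assumes D: "D \<in> relcompact_borel" and E: "E \<in> relcompact_borel"
  and s: "s = 1 \<or> s = - 1" "\<And>x y. x \<in> D ==> y \<in> E ==> sgn x * sgn y = s"
 shows "emeasure (rho 2) (box2 D E) = ennreal (a D * a E - s * j D E)" "a D * a E - s * j D E \<ge> 0"
proof -
 note d = relcompact_borelD(1,4)[OF D] and e = relcompact_borelD(1,4)[OF E]
 have j0: "j D E \<ge> 0" by (simp add: j_def)
 note ea = emeasure_a[OF D] emeasure_a[OF E] emeasure_j[OF D e(1)]
 have "emeasure (rho 2) (box2 D E) = ennreal (a D * a E - s * j D E) \<and> a D * a E - s * j D E \<ge> 0"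
 proof (cases "s = 1")
  case True
  have "emeasure (rho 2) (box2 D E) + ennreal (j D E) = ennreal (a D) * ennreal (a E)"
   using rho_box2(1)[OF d e Re_det_2_nonneg] s(2) unfolding True ea by blast
  then have eq: "emeasure (rho 2) (box2 D E) + ennreal (j D E) = ennreal (a D * a E)" by (simp add: ennreal_mult a_nonneg)
  have "ennreal (j D E) \<le> emeasure (rho 2) (box2 D E) + ennreal (j D E)" by (rule add_increasing) simp_all
  then have le: "j D E \<le> a D * a E" unfolding eq by (simp add: ennreal_le_iff a_nonneg)
  have "emeasure (rho 2) (box2 D E) = emeasure (rho 2) (box2 D E) + ennreal (j D E) - ennreal (j D E)" by simp
  also have "\<dots> = ennreal (a D * a E - j D E)" unfolding eq by (rule ennreal_minus[OF j0])
  finally show ?thesis using True le by simp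
 next
  case False
  then have sm: "s = - 1" using s(1) by simp
  have "emeasure (rho 2) (box2 D E) = ennreal (a D) * ennreal (a E) + ennreal (j D E)"
   using rho_box2(2)[OF d e Re_det_2_nonneg] s(2) unfolding sm ea by blast
  then show ?thesis unfolding sm using j0 by (simp add: ennreal_mult[symmetric] a_nonneg ennreal_plus)
 qed
 then show "emeasure (rho 2) (box2 D E) = ennreal (a D * a E - s * j D E)" "a D * a E - s * j D E \<ge> 0" by simp_all
qed

text \<open>The correlation measures only see pairs of distinct points in disjoint sets. The diagonal
  part of the second moment is recovered from finer and finer cells, at the price of an inequality
  from Fatou's lemma.\<close>

lemma nn_integral_N_square:
 assumes D: "D \<in> relcompact_borel" and s: "\<And>x y. x \<in> D ==> y \<in> D ==> sgn x * sgn y = 1"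
 shows "(\<integral>\<^sup>+X. ennreal ((N D X)^2) \<partial>P) \<le> ennreal ((a D)^2 - j D D + a D)"
proof -
 note d = relcompact_borelD(1,4)[OF D]
 obtain b where b: "\<forall>x\<in>D. \<bar>x\<bar> \<le> real b" using relcompact_borel_bounds[OF D] by auto
 define Dc where "Dc n c = D \<inter> cell n c" for n c
 have Dc: "Dc n c \<in> relcompact_borel" for n c
  by (rule relcompact_borel_subset[OF D]) (use d in \<open>auto simp: Dc_def\<close>)
 define I where "I n = {(c, c') \<in> cell_range b n \<times> cell_range b n. c \<noteq> c'}" for n
 have I: "finite (I n)" for n unfolding I_def by (rule finite_subset[of _ "cell_range b n \<times> cell_range b n"]) auto
 define h where "h n X = (\<Sum>z\<in>I n. N (Dc n (fst z)) X * N (Dc n (snd z)) X)" for n X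
 have hn: "h n X \<ge> 0" for n X unfolding h_def by (intro sum_nonneg mult_nonneg_nonneg N_nonneg)
 have hm: "h n \<in> borel_measurable P" for n unfolding h_def by (intro borel_measurable_sum borel_measurable_times N_measurable Dc)
 have ev: "\<forall>\<^sub>F n in sequentially. h n X + N D X = (N D X)^2" if X: "X \<in> Conf" for X
 proof (rule eventually_mono[OF eventually_floor_inj[OF Conf_finite[OF X D]]])
  fix n assume inj: "inj_on (\<lambda>x. \<lfloor>2 ^ n * x\<rfloor>) (X \<inter> D)"
  have "card (X \<inter> D) = (\<Sum>c\<in>cell_range b n. card (X \<inter> D \<inter> cell n c))"
   by (rule card_eq_sum_cells[OF Conf_finite[OF X D]]) (use b in auto)
  then have S: "N D X = (\<Sum>c\<in>cell_range b n. N (Dc n c) X)" by (simp add: N_def Dc_def Int_assoc)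
  have sq: "N (Dc n c) X * N (Dc n c) X = N (Dc n c) X" for c
   using card_cell_le_1[OF inj, of c] by (simp add: N_def Dc_def Int_assoc)
  have "(N D X)^2 = (\<Sum>z\<in>cell_range b n \<times> cell_range b n. N (Dc n (fst z)) X * N (Dc n (snd z)) X)"
   unfolding S power2_eq_square sum_product sum.cartesian_product by (simp add: case_prod_beta')
  also have "cell_range b n \<times> cell_range b n = I n \<union> (\<lambda>c. (c, c)) ` cell_range b n" by (auto simp: I_def)
  also have "(\<Sum>z\<in>I n \<union> (\<lambda>c. (c, c)) ` cell_range b n. N (Dc n (fst z)) X * N (Dc n (snd z)) X) =
    h n X + (\<Sum>z\<in>(\<lambda>c. (c, c)) ` cell_range b n. N (Dc n (fst z)) X * N (Dc n (snd z)) X)"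
   unfolding h_def by (rule sum.union_disjoint) (use I in \<open>auto simp: I_def\<close>)
  also have "(\<Sum>z\<in>(\<lambda>c. (c, c)) ` cell_range b n. N (Dc n (fst z)) X * N (Dc n (snd z)) X) = N D X"
   unfolding S by (subst sum.reindex) (simp_all add: inj_on_def sq)
  finally show "h n X + N D X = (N D X)^2" by simp
 qed
 have int_h: "(\<integral>\<^sup>+X. ennreal (h n X) \<partial>P) \<le> emeasure (rho 2) (box2 D D)" for n
 proof -
  have bs: "box2 (Dc n c) (Dc n c') \<in> sets (rho 2)" for c c'
   unfolding rho_def sets_density by (rule box_in_tuples) (use relcompact_borelD(1,4)[OF Dc] in auto)
  have bD: "box2 D D \<in> sets (rho 2)"
   unfolding rho_def sets_density by (rule box_in_tuples) (use d in auto)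
  have "(\<integral>\<^sup>+X. ennreal (h n X) \<partial>P) = (\<integral>\<^sup>+X. (\<Sum>z\<in>I n. ennreal (N (Dc n (fst z)) X * N (Dc n (snd z)) X)) \<partial>P)"
   unfolding h_def by (intro nn_integral_cong sum_ennreal[symmetric] mult_nonneg_nonneg N_nonneg)
  also have "\<dots> = (\<Sum>z\<in>I n. (\<integral>\<^sup>+X. ennreal (N (Dc n (fst z)) X * N (Dc n (snd z)) X) \<partial>P))"
   by (intro nn_integral_sum measurable_compose[OF _ measurable_ennreal] borel_measurable_times N_measurable Dc)
  also have "\<dots> = (\<Sum>z\<in>I n. emeasure (rho 2) (box2 (Dc n (fst z)) (Dc n (snd z))))"
   by (intro sum.cong refl nn_integral_NN Dc) (auto simp: I_def Dc_def mem_cell)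
  also have "\<dots> = emeasure (rho 2) (\<Union>z\<in>I n. box2 (Dc n (fst z)) (Dc n (snd z)))"
  proof (rule sum_emeasure)
   show "disjoint_family_on (\<lambda>z. box2 (Dc n (fst z)) (Dc n (snd z))) (I n)"
   proof (unfold disjoint_family_on_def, intro ballI impI)
    fix z w assume zw: "z \<in> I n" "w \<in> I n" "z \<noteq> w"
    have False if "q \<in> box2 (Dc n (fst z)) (Dc n (snd z))" "q \<in> box2 (Dc n (fst w)) (Dc n (snd w))" for q
    proof -
     have "q 0 \<in> Dc n (fst z)" "q 1 \<in> Dc n (snd z)" "q 0 \<in> Dc n (fst w)" "q 1 \<in> Dc n (snd w)"
      using PiE_mem[OF that(1), of 0] PiE_mem[OF that(1), of 1] PiE_mem[OF that(2), of 0] PiE_mem[OF that(2), of 1] by simp_all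
     then have "fst z = fst w" "snd z = snd w" by (auto simp: Dc_def mem_cell)
     then show False using zw(3) by (simp add: prod_eq_iff)
    qed
    then show "box2 (Dc n (fst z)) (Dc n (snd z)) \<inter> box2 (Dc n (fst w)) (Dc n (snd w)) = {}" by blast
   qed
  qed (use bs I in auto)
  also have "\<dots> \<le> emeasure (rho 2) (box2 D D)"
  proof (rule emeasure_mono[OF _ bD], rule UN_least, rule PiE_mono)
   show "(if i = 0 then Dc n (fst z) else Dc n (snd z)) \<subseteq> (if i = 0 then D else D)" for i :: nat and z by (auto simp: Dc_def)
  qed
  finally show ?thesis .
 qed
 have "(\<integral>\<^sup>+X. ennreal ((N D X)^2) \<partial>P) = (\<integral>\<^sup>+X. liminf (\<lambda>n. ennreal (h n X + N D X)) \<partial>P)"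
 proof (rule nn_integral_cong)
  fix X assume "X \<in> space P"
  then have "\<forall>\<^sub>F n in sequentially. ennreal (h n X + N D X) = ennreal ((N D X)^2)"
   unfolding space_P using eventually_mono[OF ev[of X]] by auto
  then have "(\<lambda>n. ennreal (h n X + N D X)) \<longlonglongrightarrow> ennreal ((N D X)^2)" by (rule tendsto_eventually)
  from lim_imp_Liminf[OF _ this] show "ennreal ((N D X)^2) = liminf (\<lambda>n. ennreal (h n X + N D X))" by simp
 qed
 also have "\<dots> \<le> liminf (\<lambda>n. \<integral>\<^sup>+X. ennreal (h n X + N D X) \<partial>P)"
  by (rule nn_integral_liminf) (intro measurable_compose[OF _ measurable_ennreal] borel_measurable_add hm N_measurable D)
 also have "\<dots> \<le> liminf (\<lambda>n::nat. ennreal ((a D)^2 - j D D + a D))"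
 proof (rule Liminf_mono, rule always_eventually, rule allI)
  fix n
  have "(\<integral>\<^sup>+X. ennreal (h n X + N D X) \<partial>P) = (\<integral>\<^sup>+X. ennreal (h n X) + ennreal (N D X) \<partial>P)"
   by (simp add: ennreal_plus hn N_nonneg)
  also have "\<dots> = (\<integral>\<^sup>+X. ennreal (h n X) \<partial>P) + ennreal (a D)"
   by (subst nn_integral_add) (intro measurable_compose[OF _ measurable_ennreal] hm N_measurable D | simp add: nn_integral_N[OF D])+
  also have "\<dots> \<le> emeasure (rho 2) (box2 D D) + ennreal (a D)" by (intro add_right_mono int_h)
  also have "\<dots> = ennreal ((a D)^2 - j D D + a D)"
   using rho_box2_real[OF D D _ s] by (simp add: power2_eq_square ennreal_plus a_nonneg)
  finally show "(\<integral>\<^sup>+X. ennreal (h n X + N D X) \<partial>P) \<le> ennreal ((a D)^2 - j D D + a D)" .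
 qed
 also have "\<dots> = ennreal ((a D)^2 - j D D + a D)" by (simp add: Liminf_const)
 finally show ?thesis .
qed

lemma N_square:
 assumes D: "D \<in> relcompact_borel" and s: "\<And>x y. x \<in> D ==> y \<in> D ==> sgn x * sgn y = 1"
 shows "integrable P (\<lambda>X. (N D X)^2)" "expectation (\<lambda>X. (N D X)^2) \<le> (a D)^2 + j D (- D)"
proof -
 have e: "(a D)^2 - j D D + a D = (a D)^2 + j D (- D)"
  using a_eq_j[OF D relcompact_borelD(1)[OF D]] by simp
 have nn: "(a D)^2 + j D (- D) \<ge> 0" by (simp add: j_def)
 note m = borel_measurable_power[OF N_measurable[OF D], of 2]
 show "integrable P (\<lambda>X. (N D X)^2)" "expectation (\<lambda>X. (N D X)^2) \<le> (a D)^2 + j D (- D)"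
  by (rule integrable_from_nn_integral[OF m _ nn_integral_N_square[OF D s, unfolded e] nn], simp_all)+
qed

lemma N_cross:
 assumes D: "D \<in> relcompact_borel" and E: "E \<in> relcompact_borel" and DE: "D \<inter> E = {}"
  and s: "s = 1 \<or> s = - 1" "\<And>x y. x \<in> D ==> y \<in> E ==> sgn x * sgn y = s"
 shows "integrable P (\<lambda>X. N D X * N E X)" "expectation (\<lambda>X. N D X * N E X) = a D * a E - s * j D E"
proof -
 note R = rho_box2_real[OF D E s]
 have nn: "(\<integral>\<^sup>+X. ennreal (N D X * N E X) \<partial>P) = ennreal (a D * a E - s * j D E)"
  unfolding nn_integral_NN[OF D E DE] by (rule R(1))
 have m: "(\<lambda>X. N D X * N E X) \<in> borel_measurable P" by (intro borel_measurable_times N_measurable D E)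
 have p: "N D X * N E X \<ge> 0" for X by (intro mult_nonneg_nonneg N_nonneg)
 show i: "integrable P (\<lambda>X. N D X * N E X)"
  by (rule integrable_from_nn_integral(1)[OF m p, of "a D * a E - s * j D E"]) (simp add: nn, rule R(2))
 show "expectation (\<lambda>X. N D X * N E X) = a D * a E - s * j D E"
  using nn nn_integral_eq_integral[OF i] R(2) p by (simp add: integral_nonneg_AE)
qed

end

section \<open>Screening of the charge\<close>

context charge_process
begin

lemma NN_integrable:
 assumes D: "D \<in> relcompact_borel" "\<And>x y. x \<in> D ==> y \<in> D ==> sgn x * sgn y = 1"
  and E: "E \<in> relcompact_borel" "\<And>x y. x \<in> E ==> y \<in> E ==> sgn x * sgn y = 1"
 shows "integrable P (\<lambda>X. N D X * N E X)"
proof (rule Bochner_Integration.integrable_bound[of P "\<lambda>X. (N D X)^2 + (N E X)^2"])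
 show "integrable P (\<lambda>X. (N D X)^2 + (N E X)^2)"
  by (intro Bochner_Integration.integrable_add N_square(1)[OF D] N_square(1)[OF E])
 show "(\<lambda>X. N D X * N E X) \<in> borel_measurable P" by (intro borel_measurable_times N_measurable D E)
 have "\<bar>u * v\<bar> \<le> \<bar>u\<^sup>2 + v^2\<bar>" for u v :: real
 proof -
  have "2 * \<bar>u * v\<bar> \<le> u^2 + v^2" using sum_squares_bound[of "\<bar>u\<bar>" "\<bar>v\<bar>"] by (simp add: abs_mult)
  then show ?thesis by linarith
 qed
 then show "AE X in P. norm (N D X * N E X) \<le> norm ((N D X)^2 + (N E X)^2)" by simp
qed

definition pos :: "real set => real set" where "pos D = D \<inter> {0<..}"
definition neg :: "real set => real set" where "neg D = D \<inter> {..<0}"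

lemma halves:
 assumes D: "D \<in> relcompact_borel"
 shows "pos D \<in> relcompact_borel" "neg D \<in> relcompact_borel" "D = pos D \<union> neg D" "pos D \<inter> neg D = {}"
  "\<And>x y. x \<in> pos D ==> y \<in> pos D ==> sgn x * sgn y = 1" "\<And>x y. x \<in> neg D ==> y \<in> neg D ==> sgn x * sgn y = 1"
proof -
 note d = relcompact_borelD[OF D]
 show "pos D \<in> relcompact_borel" "neg D \<in> relcompact_borel"
  by (rule relcompact_borel_subset[OF D]; use d in \<open>auto simp: pos_def neg_def\<close>)+
 have "x > 0 \<or> x < 0" if "x \<in> D" for x using that d(4) by (cases x "0::real" rule: linorder_cases) auto
 then show "D = pos D \<union> neg D" by (auto simp: pos_def neg_def)
 show "pos D \<inter> neg D = {}" by (auto simp: pos_def neg_def)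
qed (auto simp: pos_def neg_def)

definition charge :: "real set => real set => real" where
 "charge D X = N (pos D) X - N (neg D) X"

definition mean_charge :: "real set => real" where
 "mean_charge D = a (pos D) - a (neg D)"

lemma charge_measurable: assumes "D \<in> relcompact_borel" shows "charge D \<in> borel_measurable P"
 unfolding charge_def[abs_def] by (intro borel_measurable_diff N_measurable halves(1,2) assms)

lemma charge_expand:
 "charge D X * charge E X = N (pos D) X * N (pos E) X - N (pos D) X * N (neg E) X - N (neg D) X * N (pos E) X + N (neg D) X * N (neg E) X"
 by (simp add: charge_def algebra_simps)

lemma NN_halves_integrable:
 assumes D: "D \<in> relcompact_borel" and E: "E \<in> relcompact_borel"
  and F: "F = pos D \<or> F = neg D" and G: "G = pos E \<or> G = neg E"
 shows "integrable P (\<lambda>X. N F X * N G X)"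
proof (rule NN_integrable)
 show "F \<in> relcompact_borel" "G \<in> relcompact_borel" using F G halves(1,2)[OF D] halves(1,2)[OF E] by auto
 show "sgn x * sgn y = 1" if "x \<in> F" "y \<in> F" for x y using F that by (auto simp: pos_def neg_def)
 show "sgn x * sgn y = 1" if "x \<in> G" "y \<in> G" for x y using G that by (auto simp: pos_def neg_def)
qed

lemma charge_integrable:
 assumes "D \<in> relcompact_borel" "E \<in> relcompact_borel"
 shows "integrable P (\<lambda>X. charge D X * charge E X)"
 unfolding charge_expand
 by (intro Bochner_Integration.integrable_add Bochner_Integration.integrable_diff NN_halves_integrable[OF assms]) simp_all

lemma charge_integrable1: assumes "D \<in> relcompact_borel" shows "integrable P (charge D)"
 unfolding charge_def[abs_def] by (intro Bochner_Integration.integrable_diff N_integrable halves(1,2) assms)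

lemma charge_mean: assumes "D \<in> relcompact_borel" shows "expectation (charge D) = mean_charge D"
 unfolding charge_def[abs_def] mean_charge_def
 by (simp add: Bochner_Integration.integral_diff N_integrable N_mean halves(1,2)[OF assms])

lemma charge_product_expectation:
 assumes D: "D \<in> relcompact_borel" and E: "E \<in> relcompact_borel"
 shows "expectation (\<lambda>X. charge D X * charge E X) = expectation (\<lambda>X. N (pos D) X * N (pos E) X) - expectation (\<lambda>X. N (pos D) X * N (neg E) X)
   - expectation (\<lambda>X. N (neg D) X * N (pos E) X) + expectation (\<lambda>X. N (neg D) X * N (neg E) X)"
proof -
 have i: "integrable P (\<lambda>X. N (pos D) X * N (pos E) X)" "integrable P (\<lambda>X. N (pos D) X * N (neg E) X)"
  "integrable P (\<lambda>X. N (neg D) X * N (pos E) X)" "integrable P (\<lambda>X. N (neg D) X * N (neg E) X)"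
  by (rule NN_halves_integrable[OF D E]; simp)+
 note i12 = Bochner_Integration.integrable_diff[OF i(1) i(2)]
 note i123 = Bochner_Integration.integrable_diff[OF i12 i(3)]
 show ?thesis
  unfolding charge_expand Bochner_Integration.integral_add[OF i123 i(4)]
   Bochner_Integration.integral_diff[OF i12 i(3)] Bochner_Integration.integral_diff[OF i(1) i(2)] ..
qed

lemma j_split:
 assumes D: "D \<in> relcompact_borel" and E: "E \<in> relcompact_borel"
 shows "j D E = j (pos D) (pos E) + j (pos D) (neg E) + j (neg D) (pos E) + j (neg D) (neg E)"
proof -
 note hD = halves[OF D] and hE = halves[OF E]
 have "j D E = measure J ((pos D \<union> neg D) \<times> E)" unfolding j_def using hD(3) by simp
 also have "\<dots> = measure J (pos D \<times> E) + measure J (neg D \<times> E)"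
  by (rule J_union1[OF hD(1,2,4) relcompact_borelD(1)[OF E]])
 also have "measure J (F \<times> E) = j F (pos E) + j F (neg E)" if "F \<in> relcompact_borel" for F
  using J_union2[OF that relcompact_borelD(1)[OF hE(1)] relcompact_borelD(1)[OF hE(2)] hE(4)] hE(3) unfolding j_def by simp
 note this[OF hD(1)]
 also have "measure J (neg D \<times> E) = j (neg D) (pos E) + j (neg D) (neg E)"
  using J_union2[OF hD(2) relcompact_borelD(1)[OF hE(1)] relcompact_borelD(1)[OF hE(2)] hE(4)] hE(3) unfolding j_def by simp
 finally show ?thesis by simp
qed

text \<open>The product of the signs of the points cancels the sign of the correlation for each of the four pairs of
  half-lines.\<close>

lemma charge_cov_disjoint:
 assumes D: "D \<in> relcompact_borel" and E: "E \<in> relcompact_borel" and DE: "D \<inter> E = {}"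
 shows "expectation (\<lambda>X. charge D X * charge E X) = mean_charge D * mean_charge E - j D E"
proof -
 note hD = halves[OF D] and hE = halves[OF E]
 have "expectation (\<lambda>X. N (pos D) X * N (pos E) X) = a (pos D) * a (pos E) - 1 * j (pos D) (pos E)"
  by (rule N_cross(2)[OF hD(1) hE(1)]) (use DE in \<open>auto simp: pos_def neg_def\<close>)
 moreover have "expectation (\<lambda>X. N (pos D) X * N (neg E) X) = a (pos D) * a (neg E) - (- 1) * j (pos D) (neg E)"
  by (rule N_cross(2)[OF hD(1) hE(2)]) (use DE in \<open>auto simp: pos_def neg_def\<close>)
 moreover have "expectation (\<lambda>X. N (neg D) X * N (pos E) X) = a (neg D) * a (pos E) - (- 1) * j (neg D) (pos E)"
  by (rule N_cross(2)[OF hD(2) hE(1)]) (use DE in \<open>auto simp: pos_def neg_def\<close>)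
 moreover have "expectation (\<lambda>X. N (neg D) X * N (neg E) X) = a (neg D) * a (neg E) - 1 * j (neg D) (neg E)"
  by (rule N_cross(2)[OF hD(2) hE(2)]) (use DE in \<open>auto simp: pos_def neg_def\<close>)
 ultimately show ?thesis unfolding charge_product_expectation[OF D E] j_split[OF D E] mean_charge_def
  by (simp add: algebra_simps)
qed

text \<open>Total mass \<open>a\<close> splits into the coupling inside and outside; the inside part cancels the
  correlations between distinct points.\<close>

lemma charge_square:
 assumes D: "D \<in> relcompact_borel"
 shows "expectation (\<lambda>X. charge D X * charge D X) \<le> mean_charge D * mean_charge D + j D (- D)"
proof -
 note hD = halves[OF D]
 note b = relcompact_borelD(1)[OF hD(1)] relcompact_borelD(1)[OF hD(2)] relcompact_borelD(1)[OF D]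
 have pp: "expectation (\<lambda>X. N (pos D) X * N (pos D) X) \<le> a (pos D) * a (pos D) + j (pos D) (- pos D)"
  using N_square(2)[OF hD(1,5)] by (simp add: power2_eq_square)
 have nn: "expectation (\<lambda>X. N (neg D) X * N (neg D) X) \<le> a (neg D) * a (neg D) + j (neg D) (- neg D)"
  using N_square(2)[OF hD(2,6)] by (simp add: power2_eq_square)
 have pn: "expectation (\<lambda>X. N (pos D) X * N (neg D) X) = a (pos D) * a (neg D) - (- 1) * j (pos D) (neg D)"
  by (rule N_cross(2)[OF hD(1,2,4)]) (auto simp: pos_def neg_def)
 have np: "expectation (\<lambda>X. N (neg D) X * N (pos D) X) = a (neg D) * a (pos D) - (- 1) * j (neg D) (pos D)"
  by (rule N_cross(2)[OF hD(2,1)]) (auto simp: pos_def neg_def)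
 have "j D (- D) = a D - j D D" using a_eq_j[OF D b(3)] by simp
 also have "a D = a (pos D) + a (neg D)"
  using J_union1[OF hD(1,2,4), of UNIV] hD(3) unfolding a_def by simp
 also have "a (pos D) = j (pos D) (pos D) + j (pos D) (- pos D)" by (rule a_eq_j[OF hD(1) b(1)])
 also have "a (neg D) = j (neg D) (neg D) + j (neg D) (- neg D)" by (rule a_eq_j[OF hD(2) b(2)])
 finally have "j D (- D) = j (pos D) (- pos D) + j (neg D) (- neg D) - j (pos D) (neg D) - j (neg D) (pos D)"
  unfolding j_split[OF D D] by simp
 then show ?thesis unfolding charge_product_expectation[OF D D] mean_charge_def
  using pp nn pn np by (simp add: algebra_simps)
qed

text \<open>For nested sets only the mass coupling the smaller one to the outside of the larger one survives:
  the charge inside is screened.\<close>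

lemma charge_cov:
 assumes D: "D \<in> relcompact_borel" and E: "E \<in> relcompact_borel" and DE: "D \<subseteq> E"
 shows "expectation (\<lambda>X. charge D X * charge E X) \<le> mean_charge D * mean_charge E + j D (- E)"
proof -
 note hD = halves[OF D] and d = relcompact_borelD(1)[OF D] and e = relcompact_borelD(1)[OF E]
 define F where "F = E - D"
 have F: "F \<in> relcompact_borel" by (rule relcompact_borel_subset[OF E]) (use d e in \<open>auto simp: F_def\<close>)
 have DF: "D \<inter> F = {}" by (auto simp: F_def)
 note hF = halves[OF F]
 have pn: "pos E = pos D \<union> pos F" "neg E = neg D \<union> neg F" "pos D \<inter> pos F = {}" "neg D \<inter> neg F = {}"
  using DE by (auto simp: F_def pos_def neg_def)
 have ch: "charge E X = charge D X + charge F X" if "X \<in> Conf" for X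
  unfolding charge_def pn(1,2) N_union[OF that hD(1) hF(1) pn(3)] N_union[OF that hD(2) hF(2) pn(4)] by simp
 have mean: "mean_charge E = mean_charge D + mean_charge F"
  unfolding mean_charge_def pn(1,2) a_def
  using J_union1[OF hD(1) hF(1) pn(3), of UNIV] J_union1[OF hD(2) hF(2) pn(4), of UNIV] by simp
 have "expectation (\<lambda>X. charge D X * charge E X) = expectation (\<lambda>X. charge D X * charge D X + charge D X * charge F X)"
  by (rule Bochner_Integration.integral_cong[OF refl]) (simp add: ch space_P distrib_left)
 also have "\<dots> = expectation (\<lambda>X. charge D X * charge D X) + expectation (\<lambda>X. charge D X * charge F X)"
  by (intro Bochner_Integration.integral_add charge_integrable D F)
 also have "\<dots> \<le> mean_charge D * mean_charge D + j D (- D) + (mean_charge D * mean_charge F - j D F)"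
  using charge_square[OF D] charge_cov_disjoint[OF D F DF] by simp
 also have "\<dots> = mean_charge D * mean_charge E + (j D (- D) - j D F)" unfolding mean by (simp add: algebra_simps)
 also have "j D (- D) = j D F + j D (- E)"
 proof -
  have "- D = F \<union> - E" using DE by (auto simp: F_def)
  then show ?thesis unfolding j_def using J_union2[OF D relcompact_borelD(1)[OF F], of "- E"] e by (auto simp: F_def)
 qed
 finally show ?thesis by simp
qed

lemma charge_cov_annulus:
 "expectation (\<lambda>X. charge (annulus i) X * charge (annulus l) X) - mean_charge (annulus i) * mean_charge (annulus l)
   \<le> 8 * C^2 * (1/2) ^ (max i l - min i l)"
proof -
 have *: "expectation (\<lambda>X. charge (annulus i) X * charge (annulus l) X) - mean_charge (annulus i) * mean_charge (annulus l)
   \<le> 8 * C^2 * (1/2) ^ (l - i)" if "i \<le> l" for i l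
 proof -
  have p: "(2::real) ^ i \<le> 2 ^ l" using that by (intro power_increasing) auto
  then have "1 / (2::real) ^ l \<le> 1 / 2 ^ i" by (intro divide_left_mono) auto
  then have "x \<in> annulus l" if "x \<in> annulus i" for x
   using p that unfolding annulus_def mem_Collect_eq by linarith
  then have "annulus i \<subseteq> annulus l" by (rule subsetI)
  from charge_cov[OF annulus_relcompact annulus_relcompact this] J_annulus[OF that] show ?thesis by (simp add: j_def)
 qed
 show ?thesis
 proof (cases "i \<le> l")
  case True then show ?thesis using *[OF True] by (simp add: max_def min_def)
 next
  case False
  then have "l \<le> i" by simp
  from *[OF this] False show ?thesis by (simp add: max_def min_def mult.commute)
 qed
qed

definition avg :: "nat => real set => real" where
 "avg n X = (\<Sum>i<n. charge (annulus i) X) / real n"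

definition mean_avg :: "nat => real" where
 "mean_avg n = (\<Sum>i<n. mean_charge (annulus i)) / real n"

lemma avg_measurable: "avg n \<in> borel_measurable P"
 unfolding avg_def[abs_def] by (intro borel_measurable_divide borel_measurable_sum charge_measurable annulus_relcompact borel_measurable_const)

text \<open>Nearby scales only: the covariances decay geometrically, so each row of the covariance matrix has bounded
  sum.\<close>

lemma avg_variance:
 assumes n: "n > 0"
 shows "integrable P (\<lambda>X. (avg n X - mean_avg n)^2)" "expectation (\<lambda>X. (avg n X - mean_avg n)^2) \<le> 32 * C^2 / real n"
proof -
 define c where "c i X = charge (annulus i) X - mean_charge (annulus i)" for i X
 have cc: "c i X * c l X = charge (annulus i) X * charge (annulus l) X - mean_charge (annulus i) * charge (annulus l) X
   - mean_charge (annulus l) * charge (annulus i) X + mean_charge (annulus i) * mean_charge (annulus l)" for i l X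
  by (simp add: c_def algebra_simps)
 have ci: "integrable P (\<lambda>X. c i X * c l X)" for i l unfolding cc
  by (intro Bochner_Integration.integrable_add Bochner_Integration.integrable_diff charge_integrable integrable_mult_right charge_integrable1 annulus_relcompact) simp
 have ce: "expectation (\<lambda>X. c i X * c l X) = expectation (\<lambda>X. charge (annulus i) X * charge (annulus l) X) - mean_charge (annulus i) * mean_charge (annulus l)" for i l
  unfolding cc by (simp add: charge_integrable charge_integrable1 annulus_relcompact charge_mean prob_space)
 have eq: "(avg n X - mean_avg n)^2 = (\<Sum>i<n. \<Sum>l<n. c i X * c l X) / (real n)^2" for X
 proof -
  have "avg n X - mean_avg n = (\<Sum>i<n. c i X) / real n" unfolding avg_def mean_avg_def c_def by (simp add: sum_subtractf diff_divide_distrib)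
  then show ?thesis by (simp add: power_divide sum_product power2_eq_square)
 qed
 show "integrable P (\<lambda>X. (avg n X - mean_avg n)^2)" unfolding eq
  by (intro integrable_divide Bochner_Integration.integrable_sum ci)
 have "expectation (\<lambda>X. (avg n X - mean_avg n)^2) = (\<Sum>i<n. \<Sum>l<n. expectation (\<lambda>X. c i X * c l X)) / (real n)^2"
  unfolding eq by (simp add: ci)
 also have "\<dots> \<le> (\<Sum>i<n. \<Sum>l<n. 8 * C^2 * (1/2) ^ (max i l - min i l)) / (real n)^2"
  unfolding ce by (intro divide_right_mono sum_mono charge_cov_annulus) simp
 also have "\<dots> = 8 * C^2 * (\<Sum>i<n. \<Sum>l<n. (1/2) ^ (max i l - min i l)) / (real n)^2" by (simp add: sum_distrib_left)
 also have "\<dots> \<le> 8 * C^2 * (\<Sum>i<n. 4) / (real n)^2"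
  by (intro divide_right_mono mult_left_mono sum_mono sum_half_distance_le) simp_all
 also have "\<dots> = 32 * C^2 / real n" using n by (simp add: power2_eq_square)
 finally show "expectation (\<lambda>X. (avg n X - mean_avg n)^2) \<le> 32 * C^2 / real n" .
qed

text \<open>Along powers of two the variances are summable, so the squared deviations are summable almost surely.\<close>

definition limit_event :: "real set set" where
 "limit_event = {X \<in> Conf. (\<lambda>l. avg (2 ^ l) X - mean_avg (2 ^ l)) \<longlonglongrightarrow> 0}"

lemma limit_event_measurable: "limit_event \<in> sets P"
proof -
 have "{X \<in> space P. (\<lambda>l. avg (2 ^ l) X - mean_avg (2 ^ l)) \<longlonglongrightarrow> 0} \<in> sets P"
  using measurable_limit2[of "\<lambda>l X. avg (2 ^ l) X - mean_avg (2 ^ l)" P "\<lambda>_. 0"] avg_measurable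
  by (simp add: pred_def borel_measurable_diff)
 then show ?thesis by (simp add: limit_event_def space_P)
qed

lemma AE_limit_event: "AE X in P. X \<in> limit_event"
proof -
 define Y where "Y l X = (avg (2 ^ l) X - mean_avg (2 ^ l))^2" for l X
 have Ym: "Y l \<in> borel_measurable P" for l
  unfolding Y_def[abs_def] by (intro borel_measurable_power borel_measurable_diff avg_measurable borel_measurable_const)
 have Yi: "integrable P (Y l)" "expectation (Y l) \<le> 32 * C^2 * (1/2) ^ l" for l
 proof -
  have e: "32 * C^2 * (1/2) ^ l = 32 * C^2 / real (2 ^ l)" by (simp add: power_one_over)
  show "integrable P (Y l)" "expectation (Y l) \<le> 32 * C^2 * (1/2) ^ l"
   unfolding e Y_def[abs_def] by (rule avg_variance, simp)+
 qed
 have s: "(\<lambda>l. 32 * C^2 * (1/2) ^ l) sums (32 * C^2 * 2)"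
  using sums_mult[OF geometric_sums[of "1/2::real"], of "32 * C^2"] by simp
 have "(\<integral>\<^sup>+X. (\<Sum>l. ennreal (Y l X)) \<partial>P) = (\<Sum>l. (\<integral>\<^sup>+X. ennreal (Y l X) \<partial>P))"
  by (rule nn_integral_suminf) (rule measurable_compose[OF Ym measurable_ennreal])
 also have "\<dots> \<le> (\<Sum>l. ennreal (32 * C^2 * (1/2) ^ l))"
 proof (rule suminf_le)
  fix l
  have "(\<integral>\<^sup>+X. ennreal (Y l X) \<partial>P) = ennreal (expectation (Y l))"
   by (rule nn_integral_eq_integral[OF Yi(1)]) (simp add: Y_def)
  then show "(\<integral>\<^sup>+X. ennreal (Y l X) \<partial>P) \<le> ennreal (32 * C^2 * (1/2) ^ l)" using Yi(2) by (simp add: ennreal_leI)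
 qed simp_all
 also have "\<dots> = ennreal (32 * C^2 * 2)" by (rule suminf_ennreal_eq[OF _ s]) simp
 finally have "(\<integral>\<^sup>+X. (\<Sum>l. ennreal (Y l X)) \<partial>P) \<le> ennreal (32 * C^2 * 2)" .
 then have "(\<integral>\<^sup>+X. (\<Sum>l. ennreal (Y l X)) \<partial>P) < \<infinity>" by (rule le_less_trans) simp
 then have "(\<integral>\<^sup>+X. (\<Sum>l. ennreal (Y l X)) \<partial>P) \<noteq> \<infinity>" by (rule less_imp_neq)
 then have "AE X in P. (\<Sum>l. ennreal (Y l X)) \<noteq> \<infinity>"
  by (intro nn_integral_PInf_AE borel_measurable_suminf_order measurable_compose[OF Ym measurable_ennreal])
 then show ?thesis
 proof (rule AE_mp, intro AE_I2 impI)
  fix X assume X: "X \<in> space P" and fin: "(\<Sum>l. ennreal (Y l X)) \<noteq> \<infinity>"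
  have "summable (\<lambda>l. Y l X)" by (rule summable_suminf_not_top[OF _ fin[unfolded infinity_ennreal_def]]) (simp add: Y_def)
  then have "(\<lambda>l. Y l X) \<longlonglongrightarrow> 0" by (rule summable_LIMSEQ_zero)
  then have "(\<lambda>l. sqrt (Y l X)) \<longlonglongrightarrow> sqrt 0" by (intro tendsto_real_sqrt)
  then have "(\<lambda>l. \<bar>avg (2 ^ l) X - mean_avg (2 ^ l)\<bar>) \<longlonglongrightarrow> 0" by (simp add: Y_def)
  then have "(\<lambda>l. avg (2 ^ l) X - mean_avg (2 ^ l)) \<longlonglongrightarrow> 0" by (rule tendsto_rabs_zero_cancel)
  then show "X \<in> limit_event" using X unfolding limit_event_def space_P by (intro CollectI conjI)
 qed
qed

end

section \<open>Singularity of reduced Palm measures\<close>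

text \<open>Cells cut off at 0 and at infinity are relatively compact in the punctured line.\<close>

definition safe_cell :: "nat => int => real set" where
 "safe_cell n c = cell n c \<inter> {x. 1 / 2 ^ n \<le> \<bar>x\<bar> \<and> \<bar>x\<bar> \<le> 2 ^ n}"

lemma safe_cell_relcompact: "safe_cell n c \<in> relcompact_borel"
 by (rule relcompact_borel_annulus[of _ "1 / 2 ^ n" "2 ^ n"]) (auto simp: safe_cell_def)

definition cell_box :: "nat => nat => int list => (nat => real) set" where
 "cell_box m n cs = Pi\<^sub>E {..<m} (\<lambda>i. safe_cell n (cs ! i))"

lemma eventually_powers_bracket:
 assumes "x \<noteq> (0::real)"
 shows "\<forall>\<^sub>F n in sequentially. 1 / 2 ^ n \<le> \<bar>x\<bar> \<and> \<bar>x\<bar> < 2 ^ n"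
proof -
 obtain N1 where N1: "\<bar>x\<bar> < 2 ^ N1" using real_arch_pow[of 2 "\<bar>x\<bar>"] by auto
 obtain N2 where N2: "1 / \<bar>x\<bar> < 2 ^ N2" using real_arch_pow[of 2 "1 / \<bar>x\<bar>"] by auto
 have "1 / 2 ^ n \<le> \<bar>x\<bar> \<and> \<bar>x\<bar> < 2 ^ n" if n: "n \<ge> max N1 N2" for n
 proof -
  have "(2::real) ^ N1 \<le> 2 ^ n" "(2::real) ^ N2 \<le> 2 ^ n" using n by (auto intro!: power_increasing)
  then have "\<bar>x\<bar> < 2 ^ n" "1 / \<bar>x\<bar> < 2 ^ n" using N1 N2 by linarith+
  moreover have "1 / 2 ^ n \<le> \<bar>x\<bar>"
   using \<open>1 / \<bar>x\<bar> < 2 ^ n\<close> assms by (simp add: field_simps)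
  ultimately show ?thesis by simp
 qed
 then show ?thesis unfolding eventually_sequentially by blast
qed

text \<open>For fine cells distinct coordinates lie in distinct cells, so countably many products of disjoint cells
  suffice.\<close>

lemma cell_boxes_cover:
 assumes q: "q \<in> {..<m} \<rightarrow>\<^sub>E Rstar" "inj_on q {..<m}"
 shows "\<exists>n cs. length cs = m \<and> distinct cs \<and> q \<in> cell_box m n cs"
proof -
 have q0: "q i \<noteq> 0" if "i < m" for i using q(1) that by (auto simp: PiE_iff)
 have "\<forall>\<^sub>F n in sequentially. \<forall>i\<in>{..<m}. 1 / 2 ^ n \<le> \<bar>q i\<bar> \<and> \<bar>q i\<bar> < 2 ^ n"
  by (intro eventually_ball_finite ballI eventually_powers_bracket q0) auto
 moreover have "\<forall>\<^sub>F n in sequentially. inj_on (\<lambda>x. \<lfloor>2 ^ n * x\<rfloor>) (q ` {..<m})"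
  by (rule eventually_floor_inj) simp
 ultimately have "\<forall>\<^sub>F n in sequentially. (\<forall>i\<in>{..<m}. 1 / 2 ^ n \<le> \<bar>q i\<bar> \<and> \<bar>q i\<bar> < 2 ^ n) \<and> inj_on (\<lambda>x. \<lfloor>2 ^ n * x\<rfloor>) (q ` {..<m})"
  by (rule eventually_conj)
 then obtain n where n: "\<forall>i\<in>{..<m}. 1 / 2 ^ n \<le> \<bar>q i\<bar> \<and> \<bar>q i\<bar> < 2 ^ n" "inj_on (\<lambda>x. \<lfloor>2 ^ n * x\<rfloor>) (q ` {..<m})"
  unfolding eventually_sequentially by blast
 define cs where "cs = map (\<lambda>i. \<lfloor>2 ^ n * q i\<rfloor>) [0..<m]"
 have "inj_on (\<lambda>i. \<lfloor>2 ^ n * q i\<rfloor>) {..<m}" using comp_inj_on[OF q(2) n(2)] by (simp add: o_def)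
 then have "distinct cs" by (simp add: cs_def distinct_map atLeast0LessThan)
 moreover have "q \<in> cell_box m n cs" unfolding cell_box_def
 proof (rule PiE_I)
  fix i assume "i \<in> {..<m}"
  then show "q i \<in> safe_cell n (cs ! i)" using n(1) by (auto simp: cs_def safe_cell_def mem_cell less_imp_le)
 next
  fix i assume "i \<notin> {..<m}"
  then show "q i = undefined" using q(1) by (rule PiE_arb[rotated])
 qed
 ultimately show ?thesis by (intro exI[of _ n] exI[of _ cs]) (simp add: cs_def)
qed

context charge_process
begin

lemma rho_box_finite:
 assumes D: "\<And>i. i < m ==> D i \<in> relcompact_borel"
 shows "emeasure (rho m) (Pi\<^sub>E {..<m} D) \<noteq> \<infinity>"
proof -
 interpret product_sigma_finite "\<lambda>_::nat. restrict_space lborel Rstar" by (rule sigma_finite_tuples)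
 obtain c where c: "\<forall>p\<in>Pi\<^sub>E {..<m} D. Re (kernel_det K m p) \<le> c" using kernel_det_bound[of m D] D by blast
 have Ds: "D i \<in> sets (restrict_space lborel Rstar)" if "i < m" for i
  using relcompact_borelD(1,4)[OF D[OF that]] by (auto simp: sets_restrict_space_iff)
 have box: "Pi\<^sub>E {..<m} D \<in> sets (lebesgue_tuples m)" by (rule sets_PiM_I_finite) (use Ds in auto)
 have fin: "emeasure (restrict_space lborel Rstar) (D i) = ennreal (measure lborel (D i))" if "i < m" for i
 proof -
  note Di = D[OF that]
  obtain b where b: "\<forall>x\<in>D i. \<bar>x\<bar> \<le> real b" using relcompact_borel_bounds[OF Di] by auto
  have "bounded (D i)" by (rule boundedI[of _ "real b"]) (use b in auto)
  then have "emeasure lborel (D i) < \<infinity>" by (rule emeasure_bounded_finite)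
  then have "emeasure lborel (D i) = ennreal (measure lborel (D i))" by (intro emeasure_eq_ennreal_measure) auto
  moreover have "emeasure (restrict_space lborel Rstar) (D i) = emeasure lborel (D i)"
   by (rule emeasure_restrict_space) (use relcompact_borelD(4)[OF Di] in auto)
  ultimately show ?thesis by simp
 qed
 have "emeasure (lebesgue_tuples m) (Pi\<^sub>E {..<m} D) = (\<Prod>i\<in>{..<m}. emeasure (restrict_space lborel Rstar) (D i))"
  by (rule emeasure_PiM) (use Ds in auto)
 also have "\<dots> = (\<Prod>i\<in>{..<m}. ennreal (measure lborel (D i)))" by (rule prod.cong) (auto simp: fin)
 also have "\<dots> = ennreal (\<Prod>i\<in>{..<m}. measure lborel (D i))" by (rule prod_ennreal) simp
 finally have L: "emeasure (lebesgue_tuples m) (Pi\<^sub>E {..<m} D) = ennreal (\<Prod>i\<in>{..<m}. measure lborel (D i))" .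
 have "emeasure (rho m) (Pi\<^sub>E {..<m} D) = (\<integral>\<^sup>+p. ennreal (Re (kernel_det K m p)) * indicator (Pi\<^sub>E {..<m} D) p \<partial>lebesgue_tuples m)"
  unfolding rho_def by (rule emeasure_density[OF kernel_det_measurable box])
 also have "\<dots> \<le> (\<integral>\<^sup>+p. ennreal c * indicator (Pi\<^sub>E {..<m} D) p \<partial>lebesgue_tuples m)"
  by (intro nn_integral_mono) (use c in \<open>auto simp: indicator_def ennreal_leI\<close>)
 also have "\<dots> = ennreal c * ennreal (\<Prod>i\<in>{..<m}. measure lborel (D i))"
  unfolding L[symmetric] by (rule nn_integral_cmult_indicator[OF box])
 also have "\<dots> < \<infinity>" by (simp add: ennreal_mult_less_top)
 finally show ?thesis by simp
qed

text \<open>A correlation measure is determined off the diagonals by its values on products of disjoint sets.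
  So a null set of any correlation measure is null for the density given by the kernel.\<close>

lemma AE_correlation_imp_AE_rho:
 assumes m: "m \<ge> 1" and cm: "correlation_measure P m \<rho>" and AE: "AE q in \<rho>. Q q"
 shows "AE q in rho m. inj_on q {..<m} \<longrightarrow> Q q"
proof -
 have sets_rho: "sets (rho m) = sets (tuples m)" by (simp only: rho_def sets_density sets_lebesgue_tuples)
 have sets_\<rho>: "sets \<rho> = sets (tuples m)" using cm unfolding correlation_measure_def by blast
 have agree: "emeasure \<rho> (Pi\<^sub>E {..<m} D) = emeasure (rho m) (Pi\<^sub>E {..<m} D)"
  if "\<And>i. i < m ==> D i \<in> relcompact_borel" "disjoint_family_on D {..<m}" for D
 proof -
  have "(\<integral>\<^sup>+X. (\<Prod>i<m. of_nat (card (X \<inter> D i))) \<partial>P) = emeasure \<rho> (Pi\<^sub>E {..<m} D)"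
   using cm that unfolding correlation_measure_def by blast
  moreover have "(\<integral>\<^sup>+X. (\<Prod>i<m. of_nat (card (X \<inter> D i))) \<partial>P) = emeasure (rho m) (Pi\<^sub>E {..<m} D)"
   by (rule correlation_box[OF m that])
  ultimately show ?thesis by (simp only:)
 qed
 obtain Z where Z: "{q \<in> space \<rho>. \<not> Q q} \<subseteq> Z" "emeasure \<rho> Z = 0" "Z \<in> sets \<rho>" using AE_E[OF AE] by blast
 have Z0: "cell_box m n cs \<inter> Z \<in> null_sets (rho m)" if cs: "length cs = m" "distinct cs" for n cs
 proof -
  let ?B = "cell_box m n cs"
  define D where "D i = safe_cell n (cs ! i)" for i
  have D: "D i \<in> relcompact_borel" for i unfolding D_def by (rule safe_cell_relcompact)
  have B: "?B = Pi\<^sub>E {..<m} D" unfolding cell_box_def D_def[abs_def] ..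
  have Bs: "?B \<in> sets (rho m)" unfolding B rho_def sets_density
   by (rule box_in_tuples) (use relcompact_borelD(1,4)[OF D] in auto)
  have Bs': "?B \<in> sets \<rho>" using Bs unfolding sets_rho sets_\<rho> .
  have disj: "disjoint_family_on D {..<m}"
   using cs by (auto simp: disjoint_family_on_def D_def safe_cell_def mem_cell nth_eq_iff_index_eq)
  have "density \<rho> (indicator ?B) = density (rho m) (indicator ?B)"
  proof (rule measure_eqI_PiM_finite[where I = "{..<m}" and M = "\<lambda>_. restrict_space borel Rstar" and A = "\<lambda>_. Pi\<^sub>E {..<m} (\<lambda>_. Rstar)"])
   show "finite {..<m}" by simp
   show "sets (density \<rho> (indicator ?B)) = sets (tuples m)" "sets (density (rho m) (indicator ?B)) = sets (tuples m)"
    by (simp_all only: sets_density sets_rho sets_\<rho>)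
   fix A assume A: "\<And>i. i \<in> {..<m} ==> A i \<in> sets (restrict_space borel Rstar)"
   have A': "A i \<in> sets borel" if "i < m" for i using A[of i] that by (auto simp: sets_restrict_space_iff)
   have As: "Pi\<^sub>E {..<m} A \<in> sets (tuples m)" by (rule sets_PiM_I_finite) (use A in auto)
   have DA: "D i \<inter> A i \<in> relcompact_borel" if "i < m" for i
    by (rule relcompact_borel_subset[OF D]) (use A'[OF that] relcompact_borelD(1)[OF D[of i]] in auto)
   have dis: "disjoint_family_on (\<lambda>i. D i \<inter> A i) {..<m}" using disj by (auto simp: disjoint_family_on_def)
   have "?B \<inter> Pi\<^sub>E {..<m} A = Pi\<^sub>E {..<m} (\<lambda>i. D i \<inter> A i)" unfolding B by (rule PiE_Int)
   moreover have "emeasure \<rho> (Pi\<^sub>E {..<m} (\<lambda>i. D i \<inter> A i)) = emeasure (rho m) (Pi\<^sub>E {..<m} (\<lambda>i. D i \<inter> A i))"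
    by (rule agree[OF DA dis])
   ultimately have "emeasure \<rho> (?B \<inter> Pi\<^sub>E {..<m} A) = emeasure (rho m) (?B \<inter> Pi\<^sub>E {..<m} A)" by simp
   then show "emeasure (density \<rho> (indicator ?B)) (Pi\<^sub>E {..<m} A) = emeasure (density (rho m) (indicator ?B)) (Pi\<^sub>E {..<m} A)"
    unfolding emeasure_restricted[OF Bs' As[folded sets_\<rho>]] emeasure_restricted[OF Bs As[folded sets_rho]] .
  next
   show "range (\<lambda>_. Pi\<^sub>E {..<m} (\<lambda>_. Rstar)) \<subseteq> prod_algebra {..<m} (\<lambda>_. restrict_space borel Rstar)"
    by (auto intro!: prod_algebraI_finite simp: sets_restrict_space_iff)
   show "(\<Union>i. Pi\<^sub>E {..<m} (\<lambda>_. Rstar)) = space (tuples m)" by (simp add: space_PiM space_restrict_space)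
   fix i :: nat
   have fin: "emeasure (rho m) ?B \<noteq> \<infinity>" unfolding B by (rule rho_box_finite) (rule D)
   have "Pi\<^sub>E {..<m} (\<lambda>_. Rstar) \<in> sets (tuples m)" by (rule sets_PiM_I_finite) (auto simp: sets_restrict_space_iff)
   note S = this
   have "?B \<subseteq> Pi\<^sub>E {..<m} (\<lambda>_. Rstar)" unfolding B by (rule PiE_mono) (rule relcompact_borelD(4)[OF D])
   then have "?B \<inter> Pi\<^sub>E {..<m} (\<lambda>_. Rstar) = ?B" by (rule Int_absorb2)
   moreover have "emeasure \<rho> ?B = emeasure (rho m) ?B"
    unfolding B by (rule agree[OF D disj])
   ultimately show "emeasure (density \<rho> (indicator ?B)) (Pi\<^sub>E {..<m} (\<lambda>_. Rstar)) \<noteq> \<infinity>"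
    unfolding emeasure_restricted[OF Bs' S[folded sets_\<rho>]] using fin by (simp only:) simp
  qed
  then have "emeasure (density \<rho> (indicator ?B)) Z = emeasure (density (rho m) (indicator ?B)) Z" by simp
  moreover have "emeasure (density \<rho> (indicator ?B)) Z = emeasure \<rho> (?B \<inter> Z)" by (rule emeasure_restricted[OF Bs' Z(3)])
  moreover have Zr: "Z \<in> sets (rho m)" using Z(3) unfolding sets_rho sets_\<rho> .
  moreover from Zr have "emeasure (density (rho m) (indicator ?B)) Z = emeasure (rho m) (?B \<inter> Z)" by (rule emeasure_restricted[OF Bs])
  moreover have "emeasure \<rho> (?B \<inter> Z) \<le> emeasure \<rho> Z" by (rule emeasure_mono) (use Z(3) in auto)
  ultimately show ?thesis using Z(2) Bs by (simp add: null_sets_def sets.Int)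
 qed
 define U where "U = (\<Union>(n, cs) \<in> UNIV \<times> {cs :: int list. length cs = m \<and> distinct cs}. cell_box m n cs \<inter> Z)"
 have "U \<in> null_sets (rho m)" unfolding U_def by (rule null_sets_UN') (use Z0 in auto)
 then have "AE q in rho m. q \<notin> U" by (rule AE_not_in)
 then show ?thesis
 proof (rule AE_mp, intro AE_I2 impI)
  fix q assume q: "q \<in> space (rho m)" "q \<notin> U" "inj_on q {..<m}"
  have qs: "q \<in> {..<m} \<rightarrow>\<^sub>E Rstar" using q(1) by (simp add: rho_def space_lebesgue_tuples)
  obtain n cs where "length cs = m" "distinct cs" "q \<in> cell_box m n cs" using cell_boxes_cover[OF qs q(3)] by blast
  then have "q \<notin> Z" using q(2) unfolding U_def by blast
  moreover have "q \<in> space \<rho>" using q(1) sets_eq_imp_space_eq[OF sets_rho] sets_eq_imp_space_eq[OF sets_\<rho>] by simp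
  ultimately show "Q q" using Z(1) by blast
 qed
qed

text \<open>The density is positive almost everywhere on tuples of distinct points, so null sets transfer to Lebesgue
  measure.\<close>

lemma AE_correlation_imp_AE_lebesgue:
 assumes m: "m \<ge> 1" and cm: "correlation_measure P m \<rho>" and AE: "AE q in \<rho>. Q q"
  and nz: "\<And>q. inj_on q {..<m} ==> (\<And>i. i < m ==> q i \<noteq> 0) ==> kernel_det K m q \<noteq> 0"
 shows "AE q in lebesgue_tuples m. inj_on q {..<m} \<longrightarrow> Q q"
proof -
 have "AE q in lebesgue_tuples m. 0 < ennreal (Re (kernel_det K m q)) \<longrightarrow> inj_on q {..<m} \<longrightarrow> Q q"
  using AE_correlation_imp_AE_rho[OF m cm AE] unfolding rho_def by (subst (asm) AE_density[OF kernel_det_measurable])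
 from AE_conjI[OF det_nonneg[OF m] this] show ?thesis
 proof (rule AE_mp, intro AE_I2 impI)
  fix q assume q1: "q \<in> space (lebesgue_tuples m)"
   and c: "kernel_det K m q \<in> \<real>\<^sub>\<ge>\<^sub>0 \<and> (0 < ennreal (Re (kernel_det K m q)) \<longrightarrow> inj_on q {..<m} \<longrightarrow> Q q)"
   and q3: "inj_on q {..<m}"
  note q = q1 conjunct1[OF c] q3 and Q = conjunct2[OF c]
  have "kernel_det K m q \<noteq> 0" by (rule nz[OF q(3) lebesgue_tuples_nonzero[OF q(1)]])
  then have "Re (kernel_det K m q) > 0" using q(2) by (auto simp: complex_nonneg_Reals_iff complex_eq_iff)
  then show "Q q" using Q q(3) by simp
 qed
qed

lemma card_insert_points:
 fixes q :: "nat => real"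
 assumes X: "X \<in> Conf" and q: "inj_on q {..<m}" "X \<inter> q ` {..<m} = {}" and B: "B \<in> relcompact_borel"
 shows "N B (X \<union> q ` {..<m}) = N B X + (\<Sum>i<m. indicator B (q i))"
proof -
 have "card ((X \<inter> B) \<union> (q ` {..<m} \<inter> B)) = card (X \<inter> B) + card (q ` {..<m} \<inter> B)"
  by (rule card_Un_disjoint) (use Conf_finite[OF X B] q(2) in auto)
 moreover have "card (q ` {..<m} \<inter> B) = card {i. i < m \<and> q i \<in> B}"
 proof -
  have "q ` {..<m} \<inter> B = q ` {i. i < m \<and> q i \<in> B}" by auto
  then show ?thesis using q(1) by (simp add: card_image inj_on_def)
 qed
 moreover have "(\<Sum>i<m. indicator B (q i)) = real (card {i. i < m \<and> q i \<in> B})"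
  by (simp add: indicator_def Int_def)
 ultimately show ?thesis by (simp add: N_def Int_Un_distrib2)
qed

lemma charge_insert_points:
 fixes q :: "nat => real"
 assumes X: "X \<in> Conf" and q: "inj_on q {..<m}" "X \<inter> q ` {..<m} = {}" "\<And>i. i < m ==> q i \<noteq> 0" and D: "D \<in> relcompact_borel"
 shows "charge D (X \<union> q ` {..<m}) = charge D X + (\<Sum>i<m. sgn (q i) * indicator D (q i))"
proof -
 have "(\<Sum>i<m. indicator (pos D) (q i)) - (\<Sum>i<m. indicator (neg D) (q i)) = (\<Sum>i<m. sgn (q i) * indicator D (q i) :: real)"
  unfolding sum_subtractf[symmetric]
 proof (rule sum.cong[OF refl])
  fix i assume "i \<in> {..<m}"
  then have "q i \<noteq> 0" using q(3) by simp
  then show "indicator (pos D) (q i) - indicator (neg D) (q i) = sgn (q i) * indicator D (q i)"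
   by (cases "q i" "0::real" rule: linorder_cases) (simp_all add: pos_def neg_def indicator_def)
 qed
 then show ?thesis unfolding charge_def card_insert_points[OF X q(1,2) halves(1)[OF D]] card_insert_points[OF X q(1,2) halves(2)[OF D]]
  by simp
qed

text \<open>Inserting finitely many points moves the averaged charge by the total charge inserted, in the limit.\<close>

lemma avg_insert_points:
 fixes q :: "nat => real"
 assumes X: "X \<in> Conf" and q: "inj_on q {..<m}" "X \<inter> q ` {..<m} = {}" "\<And>i. i < m ==> q i \<noteq> 0"
 shows "(\<lambda>n. avg n (X \<union> q ` {..<m}) - avg n X) \<longlonglongrightarrow> (\<Sum>i<m. sgn (q i))"
proof -
 define s where "s = (\<Sum>i<m. sgn (q i))"
 define e where "e l = (\<Sum>i<m. sgn (q i) * indicator (annulus l) (q i)) - s" for l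
 have "\<forall>\<^sub>F l in sequentially. \<forall>i\<in>{..<m}. 1 / 2 ^ l \<le> \<bar>q i\<bar> \<and> \<bar>q i\<bar> < 2 ^ l"
  by (intro eventually_ball_finite ballI eventually_powers_bracket q(3)) auto
 then obtain L where L: "\<forall>l\<ge>L. \<forall>i\<in>{..<m}. 1 / 2 ^ l \<le> \<bar>q i\<bar> \<and> \<bar>q i\<bar> < 2 ^ l" unfolding eventually_sequentially by blast
 have e0: "e l = 0" if "l \<ge> L" for l
  using L that by (simp add: e_def s_def annulus_def)
 have eq: "avg n (X \<union> q ` {..<m}) - avg n X = s + (\<Sum>l<L. e l) / real n" if n: "n > 0" "n \<ge> L" for n
 proof -
  have "avg n (X \<union> q ` {..<m}) - avg n X = (\<Sum>l<n. charge (annulus l) (X \<union> q ` {..<m}) - charge (annulus l) X) / real n"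
   by (simp add: avg_def diff_divide_distrib sum_subtractf)
  also have "\<dots> = (\<Sum>l<n. s + e l) / real n"
   by (simp add: charge_insert_points[OF X q annulus_relcompact] e_def)
  also have "\<dots> = s + (\<Sum>l<n. e l) / real n" using n(1) by (simp add: sum.distrib add_divide_distrib)
  also have "(\<Sum>l<n. e l) = (\<Sum>l<L. e l)"
   by (rule sum.mono_neutral_right) (use n(2) e0 in auto)
  finally show ?thesis .
 qed
 have "(\<lambda>n. s + (\<Sum>l<L. e l) / real n) \<longlonglongrightarrow> s + 0"
  by (intro tendsto_add tendsto_const lim_const_over_n)
 moreover have "\<forall>\<^sub>F n in sequentially. s + (\<Sum>l<L. e l) / real n = avg n (X \<union> q ` {..<m}) - avg n X"
  using eq unfolding eventually_sequentially by (intro exI[of _ "max 1 L"]) auto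
 ultimately show ?thesis unfolding s_def[symmetric] by (simp add: Lim_transform_eventually)
qed

lemma limit_event_insert_points:
 fixes q :: "nat => real"
 assumes X: "X \<in> limit_event" and q: "inj_on q {..<m}" "X \<inter> q ` {..<m} = {}" "\<And>i. i < m ==> q i \<noteq> 0"
  and s: "(\<Sum>i<m. sgn (q i)) \<noteq> 0"
 shows "X \<union> q ` {..<m} \<notin> limit_event"
proof
 assume XL: "X \<union> q ` {..<m} \<in> limit_event"
 have XC: "X \<in> Conf" using X by (simp add: limit_event_def)
 have pw: "filterlim (\<lambda>l::nat. 2 ^ l :: nat) sequentially sequentially"
  by (rule filterlim_subseq) (simp add: strict_mono_def)
 have "(\<lambda>l. avg (2 ^ l) (X \<union> q ` {..<m}) - avg (2 ^ l) X) \<longlonglongrightarrow> (\<Sum>i<m. sgn (q i))"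
  by (rule filterlim_compose[OF avg_insert_points[OF XC q] pw])
 moreover have "(\<lambda>l. (avg (2 ^ l) (X \<union> q ` {..<m}) - mean_avg (2 ^ l)) - (avg (2 ^ l) X - mean_avg (2 ^ l))) \<longlonglongrightarrow> 0 - 0"
  by (rule tendsto_diff) (use X XL in \<open>simp_all add: limit_event_def\<close>)
 ultimately have "(\<Sum>i<m. sgn (q i)) = 0 - (0::real)" by (intro LIMSEQ_unique) simp_all
 then show False using s by simp
qed

lemma AE_avoids_point:
 assumes "x \<noteq> 0" shows "AE X in P. x \<notin> X"
proof -
 have D: "{x} \<in> relcompact_borel" by (rule relcompact_borel_annulus[of _ "\<bar>x\<bar>" "\<bar>x\<bar>"]) (use assms in auto)
 have "AE t in lborel. ennreal (diag t) * indicator {x} t = 0"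
  using AE_lborel_singleton[of x] by (rule AE_mp) (rule AE_I2, simp)
 then have "emeasure J ({x} \<times> UNIV) = 0"
  unfolding emeasure_J_UNIV[OF relcompact_borelD(1,4)[OF D]] by (subst nn_integral_cong_AE[of _ "\<lambda>_. 0"]) simp_all
 then have "(\<integral>\<^sup>+X. ennreal (N {x} X) \<partial>P) = 0" unfolding nn_integral_N[OF D] by (simp add: emeasure_a[OF D, symmetric])
 then have "AE X in P. ennreal (N {x} X) = 0"
  by (subst (asm) nn_integral_0_iff_AE) (rule measurable_compose[OF N_measurable[OF D] measurable_ennreal])
 then show ?thesis
 proof (rule AE_mp, intro AE_I2 impI)
  fix X assume "X \<in> space P" "ennreal (N {x} X) = 0"
  then have "card (X \<inter> {x}) = 0" by (simp add: N_def)
  then have "X \<inter> {x} = {}" by (simp add: card_eq_0_iff)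
  then show "x \<notin> X" by blast
 qed
qed

text \<open>The event of limit 0, restricted to configurations that avoid the points of \<open>q\<close>, has full
  measure for the process. The Palm identity for the complement of the limit event shows that the restricted
  event is null for the Palm measure, since after inserting \<open>q\<close> the limit would be the nonzero
  inserted charge.\<close>

theorem palm_singular:
 assumes m: "m \<ge> 1" and palm: "reduced_palm P m Palm"
  and nz: "\<And>q. inj_on q {..<m} ==> (\<And>i. i < m ==> q i \<noteq> 0) ==> kernel_det K m q \<noteq> 0"
 shows "AE q in lebesgue_tuples m. inj_on q {..<m} \<and> (\<Sum>i<m. sgn (q i)) \<noteq> 0 \<longrightarrow> mutually_singular (Palm q) P"
proof -
 obtain \<rho> where cm: "correlation_measure P m \<rho>"
  and Q'ex: "\<exists>Q' \<in> tuples m \<rightarrow>\<^sub>M prob_algebra conf_algebra. AE q in \<rho>. Palm q = Q' q"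
  and eq: "\<forall>u \<in> borel_measurable (conf_algebra \<Otimes>\<^sub>M tuples m).
      (\<integral>\<^sup>+X. (\<integral>\<^sup>+q. u (X, q) \<partial>count_space {q \<in> {..<m} \<rightarrow>\<^sub>E X. inj_on q {..<m}}) \<partial>P) =
      (\<integral>\<^sup>+q. (\<integral>\<^sup>+X. (u (X \<union> q ` {..<m}, q) :: ennreal) \<partial>Palm q) \<partial>\<rho>)"
  using palm unfolding reduced_palm_def by blast
 obtain Q' where Q': "Q' \<in> tuples m \<rightarrow>\<^sub>M prob_algebra conf_algebra" and QAE: "AE q in \<rho>. Palm q = Q' q" using Q'ex by blast
 have sets_\<rho>: "sets \<rho> = sets (tuples m)" using cm unfolding correlation_measure_def by blast
 define B where "B = Conf - limit_event"
 have Lc: "limit_event \<in> sets conf_algebra" using limit_event_measurable unfolding sets_P .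
 have Bc: "B \<in> sets conf_algebra" unfolding B_def using sets.compl_sets[OF Lc] by simp
 have um: "(\<lambda>w. indicator B (fst w) :: ennreal) \<in> borel_measurable (conf_algebra \<Otimes>\<^sub>M tuples m)"
  by (rule measurable_compose[OF measurable_fst borel_measurable_indicator[OF Bc]])
 define G where "G q = (\<integral>\<^sup>+X. indicator B (X \<union> q ` {..<m}) \<partial>Q' q)" for q
 have "(\<integral>\<^sup>+q. G q \<partial>\<rho>) = (\<integral>\<^sup>+q. (\<integral>\<^sup>+X. indicator B (X \<union> q ` {..<m}) \<partial>Palm q) \<partial>\<rho>)"
  by (rule nn_integral_cong_AE, rule AE_mp[OF QAE]) (rule AE_I2, simp add: G_def)
 also have "\<dots> = (\<integral>\<^sup>+X. (\<integral>\<^sup>+q. indicator B X \<partial>count_space {q \<in> {..<m} \<rightarrow>\<^sub>E X. inj_on q {..<m}}) \<partial>P)"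
  using bspec[OF eq um] by simp
 also have "\<dots> = (\<integral>\<^sup>+X. 0 \<partial>P)"
  by (rule nn_integral_cong_AE, rule AE_mp[OF AE_limit_event]) (rule AE_I2, simp add: B_def)
 finally have G0: "(\<integral>\<^sup>+q. G q \<partial>\<rho>) = 0" by simp
 have "G \<in> borel_measurable (tuples m)" unfolding G_def
 proof (rule nn_integral_measurable_subprob_algebra2[where N = conf_algebra])
  have "(\<lambda>w. (snd w, fst w)) \<in> measurable (tuples m \<Otimes>\<^sub>M conf_algebra) (conf_algebra \<Otimes>\<^sub>M tuples m)"
   by (intro measurable_Pair measurable_fst measurable_snd)
  from measurable_compose[OF measurable_compose[OF this union_measurable] borel_measurable_indicator[OF Bc]]
  show "(\<lambda>(q, X). indicator B (X \<union> q ` {..<m}) :: ennreal) \<in> borel_measurable (tuples m \<Otimes>\<^sub>M conf_algebra)"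
   by (simp add: case_prod_beta')
  show "Q' \<in> measurable (tuples m) (subprob_algebra conf_algebra)" by (rule measurable_prob_algebraD[OF Q'])
 qed
 then have "G \<in> borel_measurable \<rho>" by (simp only: measurable_cong_sets[OF sets_\<rho> refl])
 then have "AE q in \<rho>. G q = 0" using G0 by (simp only: nn_integral_0_iff_AE)
 then have H: "AE q in \<rho>. G q = 0 \<and> Palm q = Q' q" using QAE by (rule AE_conjI)
 have "AE q in lebesgue_tuples m. inj_on q {..<m} \<longrightarrow> G q = 0 \<and> Palm q = Q' q"
 proof (rule AE_correlation_imp_AE_lebesgue[OF m cm H])
  fix q :: "nat => real" assume "inj_on q {..<m}" "\<And>i. i < m ==> q i \<noteq> 0"
  then show "kernel_det K m q \<noteq> 0" by (rule nz)
 qed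
 then show ?thesis
 proof (rule AE_mp, intro AE_I2 impI)
  fix q assume q: "q \<in> space (lebesgue_tuples m)" and imp: "inj_on q {..<m} \<longrightarrow> G q = 0 \<and> Palm q = Q' q"
   and c: "inj_on q {..<m} \<and> (\<Sum>i<m. sgn (q i)) \<noteq> 0"
  have q0: "q i \<noteq> 0" if "i < m" for i by (rule lebesgue_tuples_nonzero[OF q that])
  have G: "G q = 0" and PQ: "Palm q = Q' q" using imp c by simp_all
  have "q \<in> space (tuples m)" using q sets_eq_imp_space_eq[OF sets_lebesgue_tuples] by simp
  then have sQ: "sets (Q' q) = sets conf_algebra" using measurable_space[OF Q'] by (simp add: space_prob_algebra)
  define A where "A = {X \<in> limit_event. X \<inter> q ` {..<m} = {}}"
  have Aeq: "A = limit_event \<inter> (\<Inter>i\<in>{..<m}. {X \<in> space conf_algebra. card (X \<inter> {q i}) = 0}) \<inter> space conf_algebra"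
  proof -
   define c where "c X i \<longleftrightarrow> card (X \<inter> {q i}) = 0" for X i
   have ci: "c X i \<longleftrightarrow> q i \<notin> X" for X i unfolding c_def by (cases "q i \<in> X") simp_all
   have dis: "X \<inter> q ` {..<m} = {} \<longleftrightarrow> (\<forall>i\<in>{..<m}. c X i)" for X unfolding ci by blast
   have inC: "X \<in> Conf" if "X \<in> limit_event" for X using that unfolding limit_event_def by blast
   show ?thesis
   proof (rule Set.set_eqI)
    fix X
    show "X \<in> A \<longleftrightarrow> X \<in> limit_event \<inter> (\<Inter>i\<in>{..<m}. {X \<in> space conf_algebra. card (X \<inter> {q i}) = 0}) \<inter> space conf_algebra"
     unfolding A_def space_conf_algebra c_def[symmetric] Int_iff INT_iff mem_Collect_eq dis using inC[of X] by blast
   qed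
  qed
  have Am: "A \<in> sets conf_algebra"
  proof -
   have s: "{X \<in> space conf_algebra. card (X \<inter> {q i}) = 0} \<in> sets conf_algebra" if "i \<in> {..<m}" for i
   proof -
    have "{q i} \<in> relcompact_borel" by (rule relcompact_borel_annulus[of _ "\<bar>q i\<bar>" "\<bar>q i\<bar>"]) (use q0 that in auto)
    from measurable_sets[OF count_measurable[OF this], of "{0}"]
    have "(\<lambda>X. card (X \<inter> {q i})) -` {0} \<inter> space conf_algebra \<in> sets conf_algebra" by simp
    moreover have "(\<lambda>X. card (X \<inter> {q i})) -` {0} \<inter> space conf_algebra = {X \<in> space conf_algebra. card (X \<inter> {q i}) = 0}"
     by blast
    ultimately show ?thesis by (simp only:)
   qed
   have "0 \<in> {..<m}" using m by simp
   then have "{..<m} \<noteq> {}" by blast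
   then have "(\<Inter>i\<in>{..<m}. {X \<in> space conf_algebra. card (X \<inter> {q i}) = 0}) \<in> sets conf_algebra"
    by (intro sets.finite_INT finite_lessThan s)
   then show ?thesis unfolding Aeq by (intro sets.Int Lc sets.top)
  qed
  have "emeasure (Q' q) A = (\<integral>\<^sup>+X. indicator A X \<partial>Q' q)" using Am sQ by simp
  also have "\<dots> \<le> G q" unfolding G_def
  proof (rule nn_integral_mono)
   fix X :: "real set"
   show "indicator A X \<le> (indicator B (X \<union> q ` {..<m}) :: ennreal)"
   proof (cases "X \<in> A")
    case True
    then have X: "X \<in> limit_event" "X \<inter> q ` {..<m} = {}" by (simp_all add: A_def)
    have "X \<union> q ` {..<m} \<notin> limit_event" by (rule limit_event_insert_points[OF X(1) _ X(2) q0]) (use c in simp_all)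
    moreover have "X \<union> q ` {..<m} \<in> Conf" by (rule Conf_union) (use X(1) q0 in \<open>auto simp: limit_event_def\<close>)
    ultimately show ?thesis by (simp add: B_def indicator_def)
   qed simp
  qed
  finally have "emeasure (Palm q) A = 0" using G PQ by simp
  moreover have "emeasure P (space P - A) = 0"
  proof -
   have "AE X in P. \<forall>i\<in>{..<m}. q i \<notin> X" by (rule AE_finite_allI) (simp_all add: AE_avoids_point q0)
   with AE_limit_event have "AE X in P. X \<in> A"
    by eventually_elim (unfold A_def, blast)
   then have "AE X in P. \<not> (X \<notin> A)" by simp
   from emeasure_eq_0_AE[OF this] show ?thesis by (simp add: set_diff_eq)
  qed
  ultimately show "mutually_singular (Palm q) P"
   unfolding mutually_singular_def
   by (intro conjI bexI[of _ A]) (use Am in \<open>simp_all only: PQ sQ sets_P\<close>)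
 qed
qed

end

section \<open>Palm measures of the Whittaker process\<close>

context whittaker_pair
begin

lemma kd_measurable: "(\<lambda>z. kd (fst z) (snd z)) \<in> borel_measurable (borel \<Otimes>\<^sub>M borel)"
proof -
 have [measurable]: "(\<lambda>z. k (fst z) (snd z)) \<in> borel_measurable (borel \<Otimes>\<^sub>M borel)"
  using k_measurable2 by (simp add: case_prod_beta')
 show ?thesis unfolding kd_def by measurable
qed

text \<open>On the diagonal the bound follows by continuity.\<close>

lemma kd_bound:
 assumes x: "x \<noteq> 0" and y: "y \<noteq> 0"
 shows "\<bar>kd x y\<bar> \<le> C / max \<bar>x\<bar> \<bar>y\<bar>"
proof (cases "x = y")
 case False
 then show ?thesis using k_bound[OF x y] by (simp add: kd_def)
next
 case True
 have "\<forall>\<^sub>F t in at x. norm (k t x) \<le> C / \<bar>x\<bar>"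
 proof (rule eventually_mono[OF tendsto_imp_eventually_ne[OF tendsto_ident_at x]])
  fix t :: real assume t: "t \<noteq> 0"
  have "C / max \<bar>t\<bar> \<bar>x\<bar> \<le> C / \<bar>x\<bar>" by (rule frac_le) (use C_nonneg x in auto)
  then show "norm (k t x) \<le> C / \<bar>x\<bar>" using k_bound[OF t x] by simp
 qed
 from Lim_norm_ubound[OF _ k_tendsto_kd[OF x] this] show ?thesis using True by simp
qed

lemma kd_diagonal_gram:
 assumes x: "x \<noteq> 0"
 shows "integrable lborel (\<lambda>s. (kd x s)^2)" "lint (\<lambda>s. (kd x s)^2) = sgn x * kd x x"
proof -
 have "(\<lambda>s. (x, s)) \<in> measurable borel (borel \<Otimes>\<^sub>M borel)" by simp
 from measurable_compose[OF this kd_measurable] have m [measurable]: "(\<lambda>s. kd x s) \<in> borel_measurable borel" by simp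
 have eq: "AE s in lborel. (k x s)^2 = (kd x s)^2"
  using AE_lborel_singleton[of x] by (rule AE_mp) (rule AE_I2, simp add: kd_def)
 have mm: "(\<lambda>s. (k x s)^2) \<in> borel_measurable lborel" "(\<lambda>s. (kd x s)^2) \<in> borel_measurable lborel" by simp_all
 show "integrable lborel (\<lambda>s. (kd x s)^2)"
  using kernel_diagonal_gram(1)[OF x] integrable_cong_AE[OF mm eq] by (simp only:)
 show "lint (\<lambda>s. (kd x s)^2) = sgn x * kd x x"
  using kernel_diagonal_gram(2)[OF x] integral_cong_AE[OF mm eq] by (simp only:)
qed

lemma charge_kernel_whittaker: "charge_kernel kernel kd C"
proof
 show "kernel x y = of_real (sgn y * kd x y)" if "x \<noteq> 0" "y \<noteq> 0" for x y by (rule kernel_eq[OF that])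
 show "kd x y = kd y x" for x y by (rule kd_sym)
 show "(\<lambda>z. kd (fst z) (snd z)) \<in> borel_measurable (borel \<Otimes>\<^sub>M borel)" by (rule kd_measurable)
 show "\<bar>kd x y\<bar> \<le> C / max \<bar>x\<bar> \<bar>y\<bar>" if "x \<noteq> 0" "y \<noteq> 0" for x y by (rule kd_bound[OF that])
 show "integrable lborel (\<lambda>s. (kd x s)^2)" "lint (\<lambda>s. (kd x s)^2) = sgn x * kd x x" if "x \<noteq> 0" for x
  by (rule kd_diagonal_gram[OF that])+
qed

end

theorem corollary1p1:
  fixes z z' :: complex and n k :: nat
    and P :: "real set measure"
    and Palm :: "(nat \<Rightarrow> real) \<Rightarrow> real set measure"
  assumes "z \<notin> \<real>" and "z' = cnj z"
    and "determinantal P (whittaker_kernel z z')"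
    and "n \<noteq> k"
    and "reduced_palm P (n + k) Palm"
  shows "AE p in lebesgue_tuples (n + k).
           (\<forall>i<n. p i > 0) \<and> (\<forall>i\<in>{n..<n + k}. p i < 0) \<and> inj_on p {..<n + k} \<longrightarrow>
           mutually_singular (Palm p) P"
proof -
  interpret W: whittaker_pair z
    using assms(1) by unfold_locales (simp add: complex_is_Real_iff)
  have process: "charge_process W.kernel W.kd W.C P"
    by (intro charge_process.intro charge_process_axioms.intro W.charge_kernel_whittaker)
      (use assms(2,3) in simp)
  have m: "n + k \<ge> 1" using assms(4) by simp
  have "AE p in lebesgue_tuples (n + k). inj_on p {..<n + k} \<and> (\<Sum>i<n + k. sgn (p i)) \<noteq> 0 \<longrightarrow> mutually_singular (Palm p) P"
  proof (rule charge_process.palm_singular[OF process m assms(5)])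
    fix q :: "nat \<Rightarrow> real" assume "inj_on q {..<n + k}" "\<And>i. i < n + k \<Longrightarrow> q i \<noteq> 0"
    then show "kernel_det W.kernel (n + k) q \<noteq> 0" by (rule W.kernel_det_nonzero)
  qed
  then show ?thesis
  proof (rule AE_mp, intro AE_I2 impI)
    fix p :: "nat \<Rightarrow> real"
    assume sing: "inj_on p {..<n + k} \<and> (\<Sum>i<n + k. sgn (p i)) \<noteq> 0 \<longrightarrow> mutually_singular (Palm p) P"
      and p: "(\<forall>i<n. p i > 0) \<and> (\<forall>i\<in>{n..<n + k}. p i < 0) \<and> inj_on p {..<n + k}"
    have u: "{..<n + k} = {..<n} \<union> {n..<n + k}" by auto
    have "(\<Sum>i<n + k. sgn (p i)) = (\<Sum>i<n. sgn (p i)) + (\<Sum>i\<in>{n..<n + k}. sgn (p i))"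
      unfolding u by (rule sum.union_disjoint) auto
    also have "\<dots> = (\<Sum>i<n. 1) + (\<Sum>i\<in>{n..<n + k}. - 1)"
      by (intro arg_cong2[of _ _ _ _ "(+)"] sum.cong) (use p in auto)
    also have "\<dots> = real n - real k" by simp
    finally have "(\<Sum>i<n + k. sgn (p i)) \<noteq> 0" using assms(4) by simp
    then show "mutually_singular (Palm p) P" using sing p by blast
  qed
qed

end
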